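(* Let $k$ be a field of characteristic different from $2$, let $\varepsilon\in\{\pm1\}$, and let $\delta\in k$, with $\delta=0$ if $\varepsilon=-1$. Fix $0\le t\le r$ with $t=r-2u$ for some non-negative integer $u$. Let $V_t$ be the $k$-vector space with basis $E_{r,t}$. Then $\mathcal{I}_t/\mathcal{I}_{t-2}$ is isomorphic, as a $k$-algebra (possibly without unit), to the inflation $$V_t\otimes V_t\otimes k\Sigma_t$$ of $k\Sigma_t$ along $V_t$ with respect to the bilinear form $\langle-,-\rangle:V_t\otimes V_t\to k\Sigma_t$ defined in the context. (Convention: $k\Sigma_0=k$, and $\mathcal{I}_{t-2}=0$ if $t-2<0$.)
   Context: A Brauer diagram for $(r,s)$ is a partition of $\{1,\dots,r,1',\dots,s'\}$ into two-element subsets (edges), drawn with vertices $1,\dots,r$ in a top row and $1',\dots,s'$ in a bottom row. An edge joining two top vertices is a cup, an edge joining two bottom vertices is a cap, any other edge is a through string. A marked Brauer diagram is a Brauer diagram in which each cup carries one bead and each cap carries one arrow (pointing along the edge, toward its left or right endpoint), with no two markings (beads or arrows) at the same height. Up to equivalence it is the data of the Brauer diagram, the total order of all markings from top to bottom, and a direction for each arrow. Two markings are adjacent if no other marking has height strictly between them. $B_{r,s}(\delta,\varepsilon)$ is the $k$-vector space spanned by marked Brauer diagrams for $(r,s)$ modulo: (i) interchanging the heights of two adjacent markings multiplies the diagram by $\varepsilon$; (ii) reversing the direction of one arrow multiplies the diagram by $\varepsilon$. Composition $B_{r,s}\times B_{s,t}\to B_{r,t}$, $(D_1,D_2)\mapsto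 D_1\circ D_2$: stack $D_1$ above $D_2$, identifying the bottom vertices of $D_1$ with the top vertices of $D_2$ (markings of $D_1$ lie above those of $D_2$), then simplify: (1) if $m$ closed loops occur, delete them and multiply by $\delta^m$; (2) whenever a bead and an arrow are consecutive along the same edge and adjacent in height (which can be arranged using (i)), remove both and multiply by $1$ if the arrow is above the bead and points along the edge toward the bead, or the bead is above the arrow and the arrow points away from the bead, and by $\varepsilon$ otherwise; repeat until each cup carries one bead, each cap one arrow, and through strings carry no marking. The marked Brauer algebra is $B_r(\delta,\varepsilon)=B_{r,r}(\delta,\varepsilon)$ with product $\circ$. $\mathcal{I}_t\subseteq B_r(\delta,\varepsilon)$ is the two-sided ideal spanned by all marked Brauer diagrams with at most $t$ through strings. The group algebra $k\Sigma_t$ is identified with the subalgebra of $B_t(\delta,\varepsilon)$ spanned by diagrams with only through strings. Standard diagrams: order the cups and caps of a diagram by putting all cups before all caps, ordering cups in increasing order of left vertex (leftmost first), and caps in decreasing order of left vertex (rightmost first); this orders the markings. A marked Brauer diagram is standard if every arrow points right and every marking lies below all markings earlier in this order. The standard diagrams form a basis of $B_{r,s}(\delta,\varepsilon)$. $E_{r,t}$ is the set of graphs on vertices $1,\dots,r$ with exactly $u=(r-t)/2$ edges such that each vertex is incident to at most one edge. For a standard $D\in B_r(\delta,\varepsilon)$ with $t$ through strings, $t_D\in E_{r,t}$ is the graph formed by the cups of $D$ on the top vertices $1,\dots,r$; $b_D\in E_{r,t}$ is the graph formed by the caps of $D$ on the bottom vertices (with $i'$ relabelled $i$); and $\sigma_D\in\Sigma_t$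 is the diagram of through strings obtained by deleting all cups and caps and relabelling the remaining top vertices $1,\dots,t$ and bottom vertices $1',\dots,t'$ from left to right. The map $\psi:\mathcal{I}_t/\mathcal{I}_{t-2}\to V_t\otimes V_t\otimes k\Sigma_t$, $\psi(D)=t_D\otimes b_D\otimes\sigma_D$ for $D$ standard with exactly $t$ through strings, is a vector space isomorphism. Inflation: for an algebra $B$, a vector space $W$ and a bilinear form $\langle-,-\rangle:W\otimes W\to B$, the inflation of $B$ along $W$ is $W\otimes W\otimes B$ with multiplication $(x_1\otimes y_1\otimes b_1)(x_2\otimes y_2\otimes b_2)=x_1\otimes y_2\otimes b_1\langle y_1,x_2\rangle b_2$. (No compatible anti-involution is required.) The bilinear form: for $e,f\in E_{r,t}$, let $\Gamma$ be the graph obtained from $e$ and $f$ by identifying vertices with the same label. Its maximal paths are of three types: (first) closed loops; (second) non-closed paths whose beginning and ending edges are both in $e$ or both in $f$ (a path consisting of a single edge is of this type); (third) non-closed paths with one end edge in $e$ and the other end edge in $f$ (an isolated vertex counts as this type). If $\Gamma$ contains a path of the second type, $\langle e,f\rangle=0$. If $\Gamma$ contains only closed loops and paths of the third type, $\langle e,f\rangle=\omega_{e,f}\in k\Sigma_t$, where $\omega_{e,f}$ is defined by $$\psi\bigl(\psi^{-1}(e\otimes e\otimes 1)\,\psi^{-1}(f\otimes f\otimes 1)\bigr)=e\otimes f\otimes\omega_{e,f},$$ with $1$ the identity of $k\Sigma_t$. *)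

theory Defs
  imports
    "HOL-Algebra.Sym_Groups"
    "HOL-Library.Function_Algebras"
    "HOL-Library.Disjoint_Sets"
    "HOL-Computational_Algebra.Computational_Algebra"
begin

section \<open>Algebras without unit over a field\<close>

text \<open>
  The scalars are a type of class \<open>field\<close>; the algebra has an explicit carrier, so that subspaces
  and quotients of an algebra are again of this form.
\<close>

record ('k, 'a) nualg = "'a partial_object" +
  vzero :: 'a
  vadd :: "'a \<Rightarrow> 'a \<Rightarrow> 'a"
  vscale :: "'k \<Rightarrow> 'a \<Rightarrow> 'a"
  vmult :: "'a \<Rightarrow> 'a \<Rightarrow> 'a"

locale nonunital_algebra =
  fixes A :: "('k::field, 'a) nualg"
  assumes add_group: "comm_group \<lparr>carrier = carrier A, mult = vadd A, one = vzero A\<rparr>"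
    and scale_closed: "x \<in> carrier A \<Longrightarrow> vscale A c x \<in> carrier A"
    and scale_add_left: "x \<in> carrier A \<Longrightarrow> vscale A (c + d) x = vadd A (vscale A c x) (vscale A d x)"
    and scale_add_right: "\<lbrakk>x \<in> carrier A; y \<in> carrier A\<rbrakk> \<Longrightarrow>
      vscale A c (vadd A x y) = vadd A (vscale A c x) (vscale A c y)"
    and scale_scale: "x \<in> carrier A \<Longrightarrow> vscale A c (vscale A d x) = vscale A (c * d) x"
    and scale_one: "x \<in> carrier A \<Longrightarrow> vscale A 1 x = x"
    and mult_closed: "\<lbrakk>x \<in> carrier A; y \<in> carrier A\<rbrakk> \<Longrightarrow> vmult A x y \<in> carrier A"
    and mult_assoc: "\<lbrakk>x \<in> carrier A; y \<in> carrier A; z \<in> carrier A\<rbrakk> \<Longrightarrow>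
      vmult A (vmult A x y) z = vmult A x (vmult A y z)"
    and mult_add_left: "\<lbrakk>x \<in> carrier A; y \<in> carrier A; z \<in> carrier A\<rbrakk> \<Longrightarrow>
      vmult A (vadd A x y) z = vadd A (vmult A x z) (vmult A y z)"
    and mult_add_right: "\<lbrakk>x \<in> carrier A; y \<in> carrier A; z \<in> carrier A\<rbrakk> \<Longrightarrow>
      vmult A x (vadd A y z) = vadd A (vmult A x y) (vmult A x z)"
    and mult_scale_left: "\<lbrakk>x \<in> carrier A; y \<in> carrier A\<rbrakk> \<Longrightarrow>
      vmult A (vscale A c x) y = vscale A c (vmult A x y)"
    and mult_scale_right: "\<lbrakk>x \<in> carrier A; y \<in> carrier A\<rbrakk> \<Longrightarrow>
      vmult A x (vscale A c y) = vscale A c (vmult A x y)"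

definition linear_map :: "('k::field, 'a) nualg \<Rightarrow> ('k, 'b) nualg \<Rightarrow> ('a \<Rightarrow> 'b) \<Rightarrow> bool" where
  "linear_map A B \<phi> \<longleftrightarrow> \<phi> \<in> carrier A \<rightarrow> carrier B \<and>
     (\<forall>x\<in>carrier A. \<forall>y\<in>carrier A. \<phi> (vadd A x y) = vadd B (\<phi> x) (\<phi> y)) \<and>
     (\<forall>c. \<forall>x\<in>carrier A. \<phi> (vscale A c x) = vscale B c (\<phi> x))"

definition algebra_iso :: "('k::field, 'a) nualg \<Rightarrow> ('k, 'b) nualg \<Rightarrow> ('a \<Rightarrow> 'b) \<Rightarrow> bool" where
  "algebra_iso A B \<phi> \<longleftrightarrow> linear_map A B \<phi> \<and> bij_betw \<phi> (carrier A) (carrier B) \<and>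
     (\<forall>x\<in>carrier A. \<forall>y\<in>carrier A. \<phi> (vmult A x y) = vmult B (\<phi> x) (\<phi> y))"

definition isomorphic_algebras :: "('k::field, 'a) nualg \<Rightarrow> ('k, 'b) nualg \<Rightarrow> bool" where
  "isomorphic_algebras A B \<longleftrightarrow>
     nonunital_algebra A \<and> nonunital_algebra B \<and> (\<exists>\<phi>. algebra_iso A B \<phi>)"

text \<open>
  The operations on cosets are unions over all representatives; they return a coset exactly when the
  result does not depend on the representatives.
\<close>

definition vcoset :: "('k, 'a) nualg \<Rightarrow> 'a set \<Rightarrow> 'a \<Rightarrow> 'a set" where
  "vcoset A I x = (\<lambda>i. vadd A x i) ` I"

definition quotient_algebra :: "('k, 'a) nualg \<Rightarrow> 'a set \<Rightarrow> ('k, 'a set) nualg" where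
  "quotient_algebra A I =
     \<lparr>carrier = vcoset A I ` carrier A,
      vzero = I,
      vadd = (\<lambda>X Y. \<Union>x\<in>X. \<Union>y\<in>Y. vcoset A I (vadd A x y)),
      vscale = (\<lambda>c X. \<Union>x\<in>X. vcoset A I (vscale A c x)),
      vmult = (\<lambda>X Y. \<Union>x\<in>X. \<Union>y\<in>Y. vcoset A I (vmult A x y))\<rparr>"


section \<open>Vector spaces with a given basis\<close>

definition fun_scale :: "'k::field \<Rightarrow> ('a \<Rightarrow> 'k) \<Rightarrow> 'a \<Rightarrow> 'k" where
  "fun_scale c f = (\<lambda>x. c * f x)"

interpretation fun_vs: vector_space "fun_scale :: 'k::field \<Rightarrow> ('a \<Rightarrow> 'k) \<Rightarrow> 'a \<Rightarrow> 'k"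
  by unfold_locales (auto simp: fun_scale_def algebra_simps)

definition basis_vec :: "'a \<Rightarrow> 'a \<Rightarrow> 'k::field" where
  "basis_vec a = (\<lambda>x. if x = a then 1 else 0)"

definition free_space :: "'a set \<Rightarrow> ('a \<Rightarrow> 'k::field) set" where
  "free_space S = fun_vs.span (basis_vec ` S)"

text \<open>The bilinear extension of a map given on pairs of basis elements.\<close>

definition bilin :: "('a \<Rightarrow> 'b \<Rightarrow> 'c \<Rightarrow> 'k::field) \<Rightarrow> ('a \<Rightarrow> 'k) \<Rightarrow> ('b \<Rightarrow> 'k) \<Rightarrow> 'c \<Rightarrow> 'k" where
  "bilin b f g = (\<lambda>z. \<Sum>x | f x \<noteq> 0. \<Sum>y | g y \<noteq> 0. f x * g y * b x y z)"

definition free_algebra :: "'a set \<Rightarrow> ('a \<Rightarrow> 'a \<Rightarrow> 'a \<Rightarrow> 'k::field) \<Rightarrow> ('k, 'a \<Rightarrow> 'k) nualg" where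
  "free_algebra S b =
     \<lparr>carrier = free_space S, vzero = 0, vadd = (+), vscale = fun_scale, vmult = bilin b\<rparr>"

definition group_algebra :: "'g monoid \<Rightarrow> ('k::field, 'g \<Rightarrow> 'k) nualg" where
  "group_algebra G = free_algebra (carrier G) (\<lambda>g h. basis_vec (g \<otimes>\<^bsub>G\<^esub> h))"

text \<open>
  For spaces with bases \<open>E\<close>, \<open>F\<close>, \<open>S\<close> the tensor product is the space with basis \<open>E \<times> F \<times> S\<close>,
  and pure tensors are as follows.
\<close>

definition tensor :: "('e \<Rightarrow> 'k) \<Rightarrow> ('f \<Rightarrow> 'k) \<Rightarrow> ('s \<Rightarrow> 'k) \<Rightarrow> 'e \<times> 'f \<times> 's \<Rightarrow> 'k::field" where
  "tensor x y b = (\<lambda>(e, f, s). x e * y f * b s)"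

text \<open>
  The inflation of the algebra \<open>B\<close>, whose underlying space has basis \<open>S\<close>, along the space with basis
  \<open>E\<close>: the multiplication is the bilinear extension of
  \<open>(x1 \<otimes> y1 \<otimes> b1) (x2 \<otimes> y2 \<otimes> b2) = x1 \<otimes> y2 \<otimes> b1 form(y1, x2) b2\<close> on basis vectors.
  Lemma \<open>inflation_mult_tensor\<close> states this formula for all vectors.
\<close>

definition inflation ::
  "'e set \<Rightarrow> 's set \<Rightarrow> ('k::field, 's \<Rightarrow> 'k) nualg \<Rightarrow> (('e \<Rightarrow> 'k) \<Rightarrow> ('e \<Rightarrow> 'k) \<Rightarrow> 's \<Rightarrow> 'k) \<Rightarrow>
   ('k, 'e \<times> 'e \<times> 's \<Rightarrow> 'k) nualg" where
  "inflation E S B form = free_algebra (E \<times> E \<times> S)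
     (\<lambda>(x1, y1, b1) (x2, y2, b2).
        tensor (basis_vec x1) (basis_vec y2)
          (vmult B (vmult B (basis_vec b1) (form (basis_vec y1) (basis_vec x2))) (basis_vec b2)))"

lemma sum_fun_apply: "(\<Sum>a\<in>A. f a) z = (\<Sum>a\<in>A. f a z)"
  by (induction A rule: infinite_finite_induct) auto

lemma free_space_support:
  assumes "x \<in> free_space S"
  shows "finite {a. x a \<noteq> 0}" "{a. x a \<noteq> 0} \<subseteq> S"
proof -
  have "finite {a. x a \<noteq> 0} \<and> {a. x a \<noteq> 0} \<subseteq> S"
    using assms unfolding free_space_def
  proof (induction rule: fun_vs.span_induct_alt)
    case base
    show ?case by simp
  next
    case (step c b y)
    then obtain a where a: "a \<in> S" "b = basis_vec a" by auto
    have "{z. (fun_scale c b + y) z \<noteq> 0} \<subseteq> insert a {z. y z \<noteq> 0}"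
      by (auto simp: a basis_vec_def fun_scale_def)
    with step.IH a show ?case
      by (meson finite.insertI finite_subset insert_subset subset_trans)
  qed
  then show "finite {a. x a \<noteq> 0}" "{a. x a \<noteq> 0} \<subseteq> S" by auto
qed

lemma free_space_expand:
  assumes "finite {a. x a \<noteq> 0}"
  shows "x = (\<Sum>a | x a \<noteq> 0. fun_scale (x a) (basis_vec a))"
proof
  fix z
  have "(\<Sum>a | x a \<noteq> 0. fun_scale (x a) (basis_vec a)) z = (\<Sum>a | x a \<noteq> 0. if a = z then x a else 0)"
    by (subst sum_fun_apply) (auto simp: fun_scale_def basis_vec_def intro!: sum.cong)
  also have "\<dots> = x z" using assms by simp
  finally show "x z = (\<Sum>a | x a \<noteq> 0. fun_scale (x a) (basis_vec a)) z" by simp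
qed

lemma bilin_basis_vec: "bilin h (basis_vec a) (basis_vec b) = (h a b :: 'c \<Rightarrow> 'k::field)"
proof -
  have *: "{x. basis_vec a x \<noteq> (0::'k)} = {a}" "{x. basis_vec b x \<noteq> (0::'k)} = {b}"
    by (auto simp: basis_vec_def)
  show ?thesis
    unfolding bilin_def * by (simp add: basis_vec_def)
qed

lemma bilin_expand: "bilin h x y = (\<Sum>a | x a \<noteq> 0. \<Sum>b | y b \<noteq> 0. fun_scale (x a * y b) (h a b))"
  by (auto simp: bilin_def fun_scale_def sum_fun_apply)

lemma free_space_subspace: "fun_vs.subspace (free_space S)"
  by (simp add: free_space_def)

context
  fixes B :: "('k::field, 's \<Rightarrow> 'k) nualg" and S
  assumes B: "nonunital_algebra B"
    and carr: "carrier B = free_space S" and add: "vadd B = (+)" and scale: "vscale B = fun_scale"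
begin

lemma carr_sum: "(\<And>i. i \<in> I \<Longrightarrow> u i \<in> carrier B) \<Longrightarrow> (\<Sum>i\<in>I. fun_scale (c i) (u i)) \<in> carrier B"
  unfolding carr by (auto intro!: fun_vs.subspace_sum fun_vs.subspace_scale free_space_subspace)

lemma mult_zero_left: "y \<in> carrier B \<Longrightarrow> vmult B 0 y = 0"
  and mult_zero_right: "y \<in> carrier B \<Longrightarrow> vmult B y 0 = 0"
  using nonunital_algebra.mult_scale_left[OF B, of 0 y 0] nonunital_algebra.mult_scale_right[OF B, of y 0 0]
    fun_vs.subspace_0[OF free_space_subspace[of S]]
  by (auto simp: scale carr)

lemma mult_sum_left:
  assumes "y \<in> carrier B" "\<And>i. i \<in> I \<Longrightarrow> u i \<in> carrier B"
  shows "vmult B (\<Sum>i\<in>I. fun_scale (c i) (u i)) y = (\<Sum>i\<in>I. fun_scale (c i) (vmult B (u i) y))"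
  using assms(2)
proof (induction I rule: infinite_finite_induct)
  case (insert i I)
  have "fun_scale (c i) (u i) \<in> carrier B" "(\<Sum>i\<in>I. fun_scale (c i) (u i)) \<in> carrier B"
    using insert.prems nonunital_algebra.scale_closed[OF B] by (auto simp: scale intro!: carr_sum)
  with insert assms(1) show ?case
    using nonunital_algebra.mult_add_left[OF B, unfolded add]
      nonunital_algebra.mult_scale_left[OF B, unfolded scale]
    by (simp only: sum.insert[OF insert.hyps] insertI1 insertI2)
qed (use assms(1) in \<open>auto simp: mult_zero_left\<close>)

lemma mult_sum_right:
  assumes "y \<in> carrier B" "\<And>i. i \<in> I \<Longrightarrow> u i \<in> carrier B"
  shows "vmult B y (\<Sum>i\<in>I. fun_scale (c i) (u i)) = (\<Sum>i\<in>I. fun_scale (c i) (vmult B y (u i)))"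
  using assms(2)
proof (induction I rule: infinite_finite_induct)
  case (insert i I)
  have "fun_scale (c i) (u i) \<in> carrier B" "(\<Sum>i\<in>I. fun_scale (c i) (u i)) \<in> carrier B"
    using insert.prems nonunital_algebra.scale_closed[OF B] by (auto simp: scale intro!: carr_sum)
  with insert assms(1) show ?case
    using nonunital_algebra.mult_add_right[OF B, unfolded add]
      nonunital_algebra.mult_scale_right[OF B, unfolded scale]
    by (simp only: sum.insert[OF insert.hyps] insertI1 insertI2)
qed (use assms(1) in \<open>auto simp: mult_zero_right\<close>)

lemma inflation_mult_tensor:
  fixes E :: "'e set" and x1 y1 x2 y2 :: "'e \<Rightarrow> 'k"
  assumes h: "\<And>a b. \<lbrakk>a \<in> E; b \<in> E\<rbrakk> \<Longrightarrow> h a b \<in> carrier B"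
    and "x1 \<in> free_space E" "y1 \<in> free_space E" "x2 \<in> free_space E" "y2 \<in> free_space E"
    and "b1 \<in> carrier B" "b2 \<in> carrier B"
  shows "vmult (inflation E S B (bilin h)) (tensor x1 y1 b1) (tensor x2 y2 b2) =
    tensor x1 y2 (vmult B (vmult B b1 (bilin h y1 x2)) b2)"
proof
  fix z :: "'e \<times> 'e \<times> 's"
  obtain e f s where z: "z = (e, f, s)" by (cases z)
  note fs = free_space_support
  define X1 Y1 X2 Y2 B1 B2 where "X1 = {a. x1 a \<noteq> 0}" and "Y1 = {a. y1 a \<noteq> 0}"
    and "X2 = {a. x2 a \<noteq> 0}" and "Y2 = {a. y2 a \<noteq> 0}" and "B1 = {a. b1 a \<noteq> 0}" and "B2 = {a. b2 a \<noteq> 0}"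
  note defs = this
  have fin: "finite X1" "finite Y1" "finite X2" "finite Y2" "finite B1" "finite B2"
    and sub: "X1 \<subseteq> E" "Y1 \<subseteq> E" "X2 \<subseteq> E" "Y2 \<subseteq> E" "B1 \<subseteq> S" "B2 \<subseteq> S"
    using assms fs unfolding defs carr by blast+
  have bv: "basis_vec c \<in> carrier B" if "c \<in> S" for c
    using that by (auto simp: carr free_space_def intro: fun_vs.span_base)
  define P where "P c b a' c' = vmult B (vmult B (basis_vec c) (h b a')) (basis_vec c')" for c b a' c'
  have supp1: "{p. tensor x1 y1 b1 p \<noteq> 0} = X1 \<times> Y1 \<times> B1"
    and supp2: "{p. tensor x2 y2 b2 p \<noteq> 0} = X2 \<times> Y2 \<times> B2"
    by (auto simp: tensor_def defs)
  have pick: "(\<Sum>a\<in>X. x a * (if e = a then 1 else 0) * g) = x e * g"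
    if "finite X" "X = {a. x a \<noteq> 0}" for X and x :: "'e \<Rightarrow> 'k" and e g
  proof -
    have "(\<Sum>a\<in>X. x a * (if e = a then 1 else 0) * g) = (\<Sum>a\<in>X. if a = e then x a * g else 0)"
      by (rule sum.cong) auto
    also have "\<dots> = x e * g" using that by simp
    finally show ?thesis .
  qed
  have bvx: "basis_vec a x = (if x = a then 1 else (0::'k))" for a x :: 'e
    by (simp add: basis_vec_def)
  define T where "T = (\<Sum>b\<in>Y1. \<Sum>c\<in>B1. \<Sum>a'\<in>X2. \<Sum>c'\<in>B2. y1 b * b1 c * x2 a' * b2 c' * P c b a' c' s)"
  have "vmult (inflation E S B (bilin h)) (tensor x1 y1 b1) (tensor x2 y2 b2) z =
    (\<Sum>a\<in>X1. \<Sum>b\<in>Y1. \<Sum>c\<in>B1. \<Sum>a'\<in>X2. \<Sum>b'\<in>Y2. \<Sum>c'\<in>B2.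
      (x1 a * (if e = a then 1 else 0)) * ((y2 b' * (if f = b' then 1 else 0)) *
       (y1 b * b1 c * x2 a' * b2 c' * P c b a' c' s)))"
    unfolding inflation_def free_algebra_def nualg.simps
    unfolding bilin_def[of _ "tensor x1 y1 b1"] supp1 supp2 sum.cartesian_product'
    by (intro sum.cong refl)
       (simp add: tensor_def z bilin_basis_vec P_def bvx algebra_simps)
  also have "\<dots> = (\<Sum>a\<in>X1. (x1 a * (if e = a then 1 else 0)) * (\<Sum>b\<in>Y1. \<Sum>c\<in>B1. \<Sum>a'\<in>X2.
      \<Sum>b'\<in>Y2. (y2 b' * (if f = b' then 1 else 0)) * (\<Sum>c'\<in>B2. y1 b * b1 c * x2 a' * b2 c' * P c b a' c' s)))"
    by (simp add: sum_distrib_left)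
  also have "\<dots> = x1 e * (y2 f * T)"
    unfolding pick[OF fin(1) X1_def] pick[OF fin(4) Y2_def] T_def by (simp add: sum_distrib_left)
  finally have L: "vmult (inflation E S B (bilin h)) (tensor x1 y1 b1) (tensor x2 y2 b2) z = x1 e * (y2 f * T)" .

  have b1: "b1 = (\<Sum>c\<in>B1. fun_scale (b1 c) (basis_vec c))" and b2: "b2 = (\<Sum>c\<in>B2. fun_scale (b2 c) (basis_vec c))"
    using free_space_expand fin unfolding defs by blast+
  have bil: "bilin h y1 x2 = (\<Sum>p\<in>Y1\<times>X2. fun_scale (y1 (fst p) * x2 (snd p)) (h (fst p) (snd p)))"
    by (simp add: bilin_expand defs sum.cartesian_product case_prod_beta)
  have hin: "h (fst p) (snd p) \<in> carrier B" if "p \<in> Y1 \<times> X2" for p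
    using that sub by (auto intro!: h)
  have cl: "vmult B x y \<in> carrier B" if "x \<in> carrier B" "y \<in> carrier B" for x y
    using nonunital_algebra.mult_closed[OF B] that .
  have bilin_in: "bilin h y1 x2 \<in> carrier B"
    unfolding bil by (rule carr_sum) (rule hin)
  have bvin: "basis_vec c \<in> carrier B" if "c \<in> B1 \<union> B2" for c using that sub bv by auto
  have "vmult B b1 (bilin h y1 x2) = (\<Sum>c\<in>B1. fun_scale (b1 c) (vmult B (basis_vec c) (bilin h y1 x2)))"
    by (subst b1, subst mult_sum_left) (use bvin bilin_in in auto)
  then have "vmult B (vmult B b1 (bilin h y1 x2)) b2 =
     (\<Sum>c\<in>B1. fun_scale (b1 c) (vmult B (vmult B (basis_vec c) (bilin h y1 x2)) b2))"
    by (simp only:, intro mult_sum_left assms(7) cl bvin bilin_in) auto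
  also have "\<dots> = (\<Sum>c\<in>B1. fun_scale (b1 c) (\<Sum>p\<in>Y1\<times>X2. fun_scale (y1 (fst p) * x2 (snd p))
       (\<Sum>c'\<in>B2. fun_scale (b2 c') (P c (fst p) (snd p) c'))))"
  proof (intro sum.cong refl arg_cong[where f = "fun_scale _"])
    fix c assume c: "c \<in> B1"
    have "vmult B (basis_vec c) (bilin h y1 x2) =
      (\<Sum>p\<in>Y1\<times>X2. fun_scale (y1 (fst p) * x2 (snd p)) (vmult B (basis_vec c) (h (fst p) (snd p))))"
      unfolding bil by (rule mult_sum_right) (use bvin c hin in auto)
    then have "vmult B (vmult B (basis_vec c) (bilin h y1 x2)) b2 =
      (\<Sum>p\<in>Y1\<times>X2. fun_scale (y1 (fst p) * x2 (snd p)) (vmult B (vmult B (basis_vec c) (h (fst p) (snd p))) b2))"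
      by (simp only:, intro mult_sum_left assms(7) cl bvin hin) (use c in auto)
    also have "vmult B (vmult B (basis_vec c) (h (fst p) (snd p))) b2 =
        (\<Sum>c'\<in>B2. fun_scale (b2 c') (P c (fst p) (snd p) c'))" if "p \<in> Y1 \<times> X2" for p
      unfolding P_def by (subst b2, subst mult_sum_right) (use bvin c that hin cl in auto)
    ultimately show "vmult B (vmult B (basis_vec c) (bilin h y1 x2)) b2 =
      (\<Sum>p\<in>Y1\<times>X2. fun_scale (y1 (fst p) * x2 (snd p)) (\<Sum>c'\<in>B2. fun_scale (b2 c') (P c (fst p) (snd p) c')))"
      by simp
  qed
  finally have "vmult B (vmult B b1 (bilin h y1 x2)) b2 s =
    (\<Sum>c\<in>B1. \<Sum>b\<in>Y1. \<Sum>a'\<in>X2. \<Sum>c'\<in>B2. y1 b * b1 c * x2 a' * b2 c' * P c b a' c' s)"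
    by (simp add: sum_fun_apply fun_scale_def sum_distrib_left sum.cartesian_product' mult_ac)
  also have "\<dots> = T" unfolding T_def by (rule sum.swap)
  finally show "vmult (inflation E S B (bilin h)) (tensor x1 y1 b1) (tensor x2 y2 b2) z =
      tensor x1 y2 (vmult B (vmult B b1 (bilin h y1 x2)) b2) z"
    unfolding L by (simp add: z tensor_def)
qed

end


section \<open>Marked Brauer diagrams\<close>

text \<open>
  \<open>Top i\<close> and \<open>Bot i\<close> are the vertices \<open>i\<close> and \<open>i'\<close>. \<open>Mid i\<close> occurs only in stacked diagrams, where it
  is a bottom vertex of the upper diagram identified with a top vertex of the lower one.
\<close>

datatype vertex = Top nat | Mid nat | Bot nat

fun pos :: "vertex \<Rightarrow> nat" where
  "pos (Top i) = i"
| "pos (Mid i) = i"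
| "pos (Bot i) = i"

definition brauer_diagram :: "nat \<Rightarrow> nat \<Rightarrow> vertex set set \<Rightarrow> bool" where
  "brauer_diagram r s D \<longleftrightarrow>
     partition_on (Top ` {1..r} \<union> Bot ` {1..s}) D \<and> (\<forall>e\<in>D. card e = 2)"

definition cups :: "vertex set set \<Rightarrow> vertex set set" where
  "cups D = {e \<in> D. e \<subseteq> range Top}"

definition caps :: "vertex set set \<Rightarrow> vertex set set" where
  "caps D = {e \<in> D. e \<subseteq> range Bot}"

definition through_strings :: "vertex set set \<Rightarrow> vertex set set" where
  "through_strings D = D - cups D - caps D"

text \<open>\<open>Arrow e v\<close> is an arrow on the edge \<open>e\<close> pointing along \<open>e\<close> toward its endpoint \<open>v\<close>.\<close>

datatype 'e mark = Bead (mark_edge: 'e) | Arrow (mark_edge: 'e) vertex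

text \<open>A marked diagram consists of a Brauer diagram and the list of its markings from top to bottom.\<close>

type_synonym mdiagram = "vertex set set \<times> vertex set mark list"

definition marked_diagram :: "nat \<Rightarrow> nat \<Rightarrow> mdiagram \<Rightarrow> bool" where
  "marked_diagram r s = (\<lambda>(D, ms).
     brauer_diagram r s D \<and> distinct (map mark_edge ms) \<and>
     {e. Bead e \<in> set ms} = cups D \<and>
     {e. \<exists>v. Arrow e v \<in> set ms} = caps D \<and>
     (\<forall>e v. Arrow e v \<in> set ms \<longrightarrow> v \<in> e))"

abbreviation marked_diagrams :: "nat \<Rightarrow> nat \<Rightarrow> mdiagram set" where
  "marked_diagrams r s \<equiv> {M. marked_diagram r s M}"

text \<open>The subspace spanned by the relations (height interchange and arrow reversal).\<close>

definition relation_space :: "nat \<Rightarrow> nat \<Rightarrow> 'k::field \<Rightarrow> (mdiagram \<Rightarrow> 'k) set" where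
  "relation_space r s \<epsilon> = fun_vs.span
     ({basis_vec (D, xs @ [b, a] @ ys) - fun_scale \<epsilon> (basis_vec (D, xs @ [a, b] @ ys)) |D xs a b ys.
         marked_diagram r s (D, xs @ [a, b] @ ys)} \<union>
      {basis_vec (D, xs @ [Arrow e w] @ ys) - fun_scale \<epsilon> (basis_vec (D, xs @ [Arrow e v] @ ys))
         |D xs e v w ys. marked_diagram r s (D, xs @ [Arrow e v] @ ys) \<and> e = {v, w} \<and> v \<noteq> w})"


section \<open>Paths in multigraphs\<close>

text \<open>
  A multigraph is given by a set of edges and a function assigning to an edge its set of endpoints.
  A maximal path that is not closed is given by its vertices \<open>vs\<close> and edges \<open>es\<close> in order; the trivial
  path at an isolated vertex is left out.
\<close>

definition path_in :: "'e set \<Rightarrow> ('e \<Rightarrow> 'v set) \<Rightarrow> 'v list \<Rightarrow> 'e list \<Rightarrow> bool" where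
  "path_in G ends vs es \<longleftrightarrow>
     length vs = Suc (length es) \<and> distinct vs \<and> distinct es \<and> set es \<subseteq> G \<and>
     (\<forall>i<length es. ends (es ! i) = {vs ! i, vs ! Suc i})"

definition maximal_path :: "'e set \<Rightarrow> ('e \<Rightarrow> 'v set) \<Rightarrow> 'v list \<Rightarrow> 'e list \<Rightarrow> bool" where
  "maximal_path G ends vs es \<longleftrightarrow> path_in G ends vs es \<and> es \<noteq> [] \<and>
     (\<forall>e\<in>G - set es. hd vs \<notin> ends e \<and> last vs \<notin> ends e)"


section \<open>Composition of marked Brauer diagrams\<close>

text \<open>
  In a stacked diagram, \<open>Inl e\<close> is the edge \<open>e\<close> of the upper and \<open>Inr e\<close> the edge \<open>e\<close> of the lower
  diagram. The edges in the sense of the stacked picture are the maximal paths of this multigraph.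
\<close>

type_synonym stack_edge = "vertex set + vertex set"

fun upper :: "vertex \<Rightarrow> vertex" where
  "upper (Bot i) = Mid i"
| "upper v = v"

fun lower :: "vertex \<Rightarrow> vertex" where
  "lower (Top i) = Mid i"
| "lower v = v"

definition stack_ends :: "stack_edge \<Rightarrow> vertex set" where
  "stack_ends = case_sum ((`) upper) ((`) lower)"

definition stack :: "vertex set set \<Rightarrow> vertex set set \<Rightarrow> stack_edge set" where
  "stack D1 D2 = Inl ` D1 \<union> Inr ` D2"

definition strand :: "stack_edge set \<Rightarrow> vertex list \<Rightarrow> stack_edge list \<Rightarrow> bool" where
  "strand G = maximal_path G stack_ends"

text \<open>Closed loops are the connected components without top and bottom vertices.\<close>

definition loops :: "stack_edge set \<Rightarrow> vertex set set" where
  "loops G = {C. C \<subseteq> range Mid \<and>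
     (\<exists>v\<in>\<Union>(stack_ends ` G). C = {(x, y). \<exists>e\<in>G. stack_ends e = {x, y}}\<^sup>* `` {v})}"

definition stack_marks :: "vertex set mark list \<Rightarrow> vertex set mark list \<Rightarrow> stack_edge mark list" where
  "stack_marks ms1 ms2 =
     map (\<lambda>m. case m of Bead e \<Rightarrow> Bead (Inl e) | Arrow e v \<Rightarrow> Arrow (Inl e) (upper v)) ms1 @
     map (\<lambda>m. case m of Bead e \<Rightarrow> Bead (Inr e) | Arrow e v \<Rightarrow> Arrow (Inr e) (lower v)) ms2"

definition remove_loop_marks :: "stack_edge set \<Rightarrow> stack_edge mark list \<Rightarrow> stack_edge mark list" where
  "remove_loop_marks G ms = filter (\<lambda>m. \<forall>C\<in>loops G. \<not> stack_ends (mark_edge m) \<subseteq> C) ms"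

text \<open>
  Traversing a strand in a suitable direction, one passes an arrow on \<open>p\<close>, and then a bead on \<open>q\<close> as the
  next marking; \<open>v\<close> is the endpoint of \<open>p\<close> on the side of the bead.
\<close>

definition consecutive ::
  "stack_edge set \<Rightarrow> stack_edge mark list \<Rightarrow> stack_edge \<Rightarrow> stack_edge \<Rightarrow> vertex \<Rightarrow> bool" where
  "consecutive G ms p q v \<longleftrightarrow> (\<exists>vs es i j. strand G vs es \<and> i < j \<and> j < length es \<and>
     es ! i = p \<and> es ! j = q \<and> vs ! Suc i = v \<and>
     (\<forall>k. i < k \<and> k < j \<longrightarrow> es ! k \<notin> mark_edge ` set ms))"

text \<open>The scalar and the list of the remaining markings in the process of simplification.\<close>

inductive simp_step ::
  "stack_edge set \<Rightarrow> 'k::field \<Rightarrow> 'k \<times> stack_edge mark list \<Rightarrow> 'k \<times> stack_edge mark list \<Rightarrow> bool"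
  for G \<epsilon> where
  interchange: "simp_step G \<epsilon> (c, xs @ [a, b] @ ys) (\<epsilon> * c, xs @ [b, a] @ ys)"
| arrow_above_bead: "consecutive G (xs @ [Arrow p w, Bead q] @ ys) p q v \<Longrightarrow>
    simp_step G \<epsilon> (c, xs @ [Arrow p w, Bead q] @ ys) ((if w = v then 1 else \<epsilon>) * c, xs @ ys)"
| bead_above_arrow: "consecutive G (xs @ [Bead q, Arrow p w] @ ys) p q v \<Longrightarrow>
    simp_step G \<epsilon> (c, xs @ [Bead q, Arrow p w] @ ys) ((if w = v then \<epsilon> else 1) * c, xs @ ys)"

definition stacked_diagram :: "stack_edge set \<Rightarrow> vertex set set" where
  "stacked_diagram G = {{hd vs, last vs} |vs es. strand G vs es}"

inductive transfer_mark :: "stack_edge set \<Rightarrow> stack_edge mark \<Rightarrow> vertex set mark \<Rightarrow> bool" for G where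
  "\<lbrakk>strand G vs es; p \<in> set es\<rbrakk> \<Longrightarrow> transfer_mark G (Bead p) (Bead {hd vs, last vs})"
| "\<lbrakk>strand G vs es; i < length es\<rbrakk> \<Longrightarrow>
    transfer_mark G (Arrow (es ! i) (vs ! Suc i)) (Arrow {hd vs, last vs} (last vs))"

text \<open>
  The result \<open>x\<close> of simplification depends on the order of the steps. If \<open>\<epsilon>\<close> is \<open>1\<close> or \<open>-1\<close>, and \<open>\<delta> = 0\<close> in
  the latter case, then its class modulo the relations does not, so it does not matter which result is
  chosen in \<open>compose_diagrams\<close>.
\<close>

definition simplified_composite ::
  "nat \<Rightarrow> nat \<Rightarrow> 'k::field \<Rightarrow> 'k \<Rightarrow> mdiagram \<Rightarrow> mdiagram \<Rightarrow> (mdiagram \<Rightarrow> 'k) \<Rightarrow> bool" where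
  "simplified_composite r s \<delta> \<epsilon> = (\<lambda>(D1, ms1) (D2, ms2) x.
     let G = stack D1 D2; D = stacked_diagram G in
     \<exists>c ns ms. (simp_step G \<epsilon>)\<^sup>*\<^sup>* (1, remove_loop_marks G (stack_marks ms1 ms2)) (c, ns) \<and>
       list_all2 (transfer_mark G) ns ms \<and> marked_diagram r s (D, ms) \<and>
       x = fun_scale (\<delta> ^ card (loops G) * c) (basis_vec (D, ms)))"

definition compose_diagrams ::
  "nat \<Rightarrow> nat \<Rightarrow> 'k::field \<Rightarrow> 'k \<Rightarrow> mdiagram \<Rightarrow> mdiagram \<Rightarrow> mdiagram \<Rightarrow> 'k" where
  "compose_diagrams r s \<delta> \<epsilon> M1 M2 = (SOME x. simplified_composite r s \<delta> \<epsilon> M1 M2 x)"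


section \<open>The marked Brauer algebra and its ideals\<close>

definition marked_brauer_algebra :: "nat \<Rightarrow> 'k::field \<Rightarrow> 'k \<Rightarrow> ('k, (mdiagram \<Rightarrow> 'k) set) nualg" where
  "marked_brauer_algebra r \<delta> \<epsilon> =
     quotient_algebra (free_algebra (marked_diagrams r r) (compose_diagrams r r \<delta> \<epsilon>))
       (relation_space r r \<epsilon>)"

definition brauer_class :: "nat \<Rightarrow> 'k::field \<Rightarrow> (mdiagram \<Rightarrow> 'k) \<Rightarrow> (mdiagram \<Rightarrow> 'k) set" where
  "brauer_class r \<epsilon> x = (\<lambda>y. x + y) ` relation_space r r \<epsilon>"

text \<open>The index is an integer, so that the space is \<open>{0}\<close> for negative \<open>t\<close>.\<close>

definition brauer_ideal :: "nat \<Rightarrow> 'k::field \<Rightarrow> int \<Rightarrow> (mdiagram \<Rightarrow> 'k) set set" where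
  "brauer_ideal r \<epsilon> t = brauer_class r \<epsilon> `
     free_space {(D, ms). marked_diagram r r (D, ms) \<and> int (card (through_strings D)) \<le> t}"

definition ideal_quotient ::
  "nat \<Rightarrow> nat \<Rightarrow> 'k::field \<Rightarrow> 'k \<Rightarrow> ('k, (mdiagram \<Rightarrow> 'k) set set) nualg" where
  "ideal_quotient r t \<delta> \<epsilon> =
     quotient_algebra ((marked_brauer_algebra r \<delta> \<epsilon>)\<lparr>carrier := brauer_ideal r \<epsilon> (int t)\<rparr>)
       (brauer_ideal r \<epsilon> (int t - 2))"

definition ideal_quotient_class ::
  "nat \<Rightarrow> nat \<Rightarrow> 'k::field \<Rightarrow> 'k \<Rightarrow> mdiagram \<Rightarrow> (mdiagram \<Rightarrow> 'k) set set" where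
  "ideal_quotient_class r t \<delta> \<epsilon> M =
     vcoset (marked_brauer_algebra r \<delta> \<epsilon>) (brauer_ideal r \<epsilon> (int t - 2))
       (brauer_class r \<epsilon> (basis_vec M))"


section \<open>Standard diagrams\<close>

definition left_end :: "vertex set \<Rightarrow> nat" where
  "left_end e = Min (pos ` e)"

fun earlier :: "vertex set mark \<Rightarrow> vertex set mark \<Rightarrow> bool" where
  "earlier (Bead e) (Bead f) \<longleftrightarrow> left_end e < left_end f"
| "earlier (Bead e) (Arrow f v) \<longleftrightarrow> True"
| "earlier (Arrow e v) (Bead f) \<longleftrightarrow> False"
| "earlier (Arrow e v) (Arrow f w) \<longleftrightarrow> left_end f < left_end e"

definition standard :: "nat \<Rightarrow> nat \<Rightarrow> mdiagram \<Rightarrow> bool" where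
  "standard r s M \<longleftrightarrow> marked_diagram r s M \<and> sorted_wrt earlier (snd M) \<and>
     (\<forall>e v. Arrow e v \<in> set (snd M) \<longrightarrow> pos v = Max (pos ` e))"

definition partial_matchings :: "nat \<Rightarrow> nat \<Rightarrow> nat set set set" where
  "partial_matchings r t = {e. (\<forall>x\<in>e. x \<subseteq> {1..r} \<and> card x = 2) \<and> card e = (r - t) div 2 \<and>
     (\<forall>v\<in>{1..r}. card {x \<in> e. v \<in> x} \<le> 1)}"

definition top_graph :: "mdiagram \<Rightarrow> nat set set" where
  "top_graph M = (\<lambda>e. pos ` e) ` cups (fst M)"

definition bottom_graph :: "mdiagram \<Rightarrow> nat set set" where
  "bottom_graph M = (\<lambda>e. pos ` e) ` caps (fst M)"

text \<open>
  A permutation \<open>p\<close> of \<open>{1..t}\<close> is identified with the diagram joining \<open>p j\<close> in the top row to \<open>j'\<close> in the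
  bottom row. With this convention stacking the diagram of \<open>p\<close> above that of \<open>q\<close> gives the diagram of
  \<open>p \<circ> q\<close>, the product of \<open>p\<close> and \<open>q\<close> in \<open>sym_group t\<close>.
\<close>

definition perm_diagram :: "nat \<Rightarrow> (nat \<Rightarrow> nat) \<Rightarrow> vertex set set" where
  "perm_diagram t p = {{Top (p j), Bot j} |j. j \<in> {1..t}}"

definition relabelled_through_strings :: "vertex set set \<Rightarrow> vertex set set" where
  "relabelled_through_strings D =
     (let V = \<Union>(through_strings D) in
      {{Top (card {i'. i' \<le> i \<and> Top i' \<in> V}), Bot (card {j'. j' \<le> j \<and> Bot j' \<in> V})} |i j.
         {Top i, Bot j} \<in> through_strings D})"

definition through_perm :: "nat \<Rightarrow> mdiagram \<Rightarrow> nat \<Rightarrow> nat" where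
  "through_perm t M =
     (THE p. p permutes {1..t} \<and> perm_diagram t p = relabelled_through_strings (fst M))"


section \<open>The bilinear form\<close>

text \<open>
  The linear map from the quotient of ideals to the tensor product that is given on the classes of
  standard diagrams with exactly \<open>t\<close> through strings. It is \<open>undefined\<close> outside the quotient, which
  makes it unique as a function.
\<close>

definition psi :: "nat \<Rightarrow> nat \<Rightarrow> 'k::field \<Rightarrow> 'k \<Rightarrow> (mdiagram \<Rightarrow> 'k) set set \<Rightarrow>
    nat set set \<times> nat set set \<times> (nat \<Rightarrow> nat) \<Rightarrow> 'k" where
  "psi r t \<delta> \<epsilon> = (let Q = ideal_quotient r t \<delta> \<epsilon> in
     THE \<psi>. \<psi> \<in> carrier Q \<rightarrow>\<^sub>E
           free_space (partial_matchings r t \<times> partial_matchings r t \<times> carrier (sym_group t)) \<and>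
         (\<forall>x\<in>carrier Q. \<forall>y\<in>carrier Q. \<psi> (vadd Q x y) = \<psi> x + \<psi> y) \<and>
         (\<forall>c. \<forall>x\<in>carrier Q. \<psi> (vscale Q c x) = fun_scale c (\<psi> x)) \<and>
         (\<forall>M. standard r r M \<and> card (through_strings (fst M)) = t \<longrightarrow>
            \<psi> (ideal_quotient_class r t \<delta> \<epsilon> M) =
              tensor (basis_vec (top_graph M)) (basis_vec (bottom_graph M))
                (basis_vec (through_perm t M))))"

definition psi_inv :: "nat \<Rightarrow> nat \<Rightarrow> 'k::field \<Rightarrow> 'k \<Rightarrow>
    (nat set set \<times> nat set set \<times> (nat \<Rightarrow> nat) \<Rightarrow> 'k) \<Rightarrow> (mdiagram \<Rightarrow> 'k) set set" where
  "psi_inv r t \<delta> \<epsilon> = the_inv_into (carrier (ideal_quotient r t \<delta> \<epsilon>)) (psi r t \<delta> \<epsilon>)"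

text \<open>
  In the graph obtained from \<open>e\<close> and \<open>f\<close>, the edges of \<open>e\<close> are tagged by \<open>Inl\<close> and those of \<open>f\<close>
  by \<open>Inr\<close>, so that an edge common to both counts twice (and gives a closed loop).
\<close>

definition has_second_type_path :: "nat set set \<Rightarrow> nat set set \<Rightarrow> bool" where
  "has_second_type_path e f \<longleftrightarrow>
     (\<exists>vs es. maximal_path (Inl ` e \<union> Inr ` f) (case_sum id id) vs es \<and> isl (hd es) = isl (last es))"

definition omega :: "nat \<Rightarrow> nat \<Rightarrow> 'k::field \<Rightarrow> 'k \<Rightarrow>
    nat set set \<Rightarrow> nat set set \<Rightarrow> (nat \<Rightarrow> nat) \<Rightarrow> 'k" where
  "omega r t \<delta> \<epsilon> e f =
     (let d = (\<lambda>g. psi_inv r t \<delta> \<epsilon>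
            (tensor (basis_vec g) (basis_vec g) (basis_vec (\<one>\<^bsub>sym_group t\<^esub>)))) in
      THE w. w \<in> carrier (group_algebra (sym_group t)) \<and>
        psi r t \<delta> \<epsilon> (vmult (ideal_quotient r t \<delta> \<epsilon>) (d e) (d f)) =
          tensor (basis_vec e) (basis_vec f) w)"

definition brauer_form :: "nat \<Rightarrow> nat \<Rightarrow> 'k::field \<Rightarrow> 'k \<Rightarrow>
    (nat set set \<Rightarrow> 'k) \<Rightarrow> (nat set set \<Rightarrow> 'k) \<Rightarrow> (nat \<Rightarrow> nat) \<Rightarrow> 'k" where
  "brauer_form r t \<delta> \<epsilon> =
     bilin (\<lambda>e f. if has_second_type_path e f then 0 else omega r t \<delta> \<epsilon> e f)"

end

theory Submission
  imports Defs
begin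

text \<open>
  Sending a marked diagram to its underlying Brauer diagram, with the sign that sorts its markings into standard
  order, identifies the marked Brauer algebra with the span of Brauer diagrams. To find the product there, the
  strands of a stack of two diagrams are ordered and oriented by the rule that gives standard order on the simplified
  diagram. The sign of the markings with respect to this order and orientation changes under the interchange of
  adjacent markings and the reversal of arrows by \<open>\<epsilon>\<close>, and it changes under the removal of a bead-arrow pair exactly
  as prescribed; hence every simplification yields the sign of the initial stack.

  If no through strings are lost, the coefficient and the through strings of the composite depend, up to the
  permutations of the factors, only on the bottom graph of the first diagram and the top graph of the second. So the
  product in the top layer is the product of the inflation for a form with values in the group algebra, and the values
  of this form are recovered as \<open>\<omega>\<^bsub>e,f\<^esub>\<close>. A path of the second type forces the loss of a through string, so the form
  vanishes there. Associativity of the quotient is transported from the inflation.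
\<close>

section \<open>Linear algebra over a basis\<close>

text \<open>The composite is chosen by \<open>SOME\<close> among the results of a nondeterministic
  rewriting, so a result has to exist and its class must not depend on the steps. Existence rests on
  a charge: along a strand beads and arrows alternate, and their numbers differ by 1, 0 or -1 on a
  cup, a through string or a cap. Cancelling neighbours therefore leaves exactly the markings that a
  marked diagram needs. Markings on closed loops are deleted without any sign. Compatibility of the
  coefficient with the relations in the two factors is therefore shown for stacks without loops;
  with loops, either \<open>\<epsilon> = 1\<close> and signs are trivial, or the power of
  \<open>\<delta>\<close> is zero. This is the origin of the condition on \<open>\<delta>\<close>.
  Through strings carry no marking after simplification, so their place in the order of strands is a
  free choice. Ordering them by their first middle vertex makes the sign independent of the outer
  rows and of the permutations. Only then is the coefficient a function of a pair of graphs,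
  computable from representatives with identity permutation.\<close>

lemma free_space_iff: "x \<in> free_space S \<longleftrightarrow> finite {a. x a \<noteq> 0} \<and> {a. x a \<noteq> 0} \<subseteq> S"
proof
  assume *: "finite {a. x a \<noteq> 0} \<and> {a. x a \<noteq> 0} \<subseteq> S"
  have "(\<Sum>a | x a \<noteq> 0. fun_scale (x a) (basis_vec a)) \<in> free_space S"
    unfolding free_space_def by (intro fun_vs.span_sum fun_vs.span_scale fun_vs.span_base) (use * in auto)
  then show "x \<in> free_space S" using free_space_expand[of x] * by simp
qed (use free_space_support in blast)

lemma basis_vec_in_free_space: "a \<in> S \<Longrightarrow> basis_vec a \<in> free_space S"
  by (auto simp: free_space_def intro: fun_vs.span_base)

lemma free_space_zero: "0 \<in> free_space S"
  and free_space_add: "x \<in> free_space S \<Longrightarrow> y \<in> free_space S \<Longrightarrow> x + y \<in> free_space S"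
  and free_space_diff: "x \<in> free_space S \<Longrightarrow> y \<in> free_space S \<Longrightarrow> x - y \<in> free_space S"
  and free_space_scale: "x \<in> free_space S \<Longrightarrow> fun_scale c x \<in> free_space S"
  using free_space_subspace[of S]
  by (auto intro: fun_vs.subspace_0 fun_vs.subspace_add fun_vs.subspace_scale fun_vs.subspace_diff)

lemma free_space_mono: "S \<subseteq> T \<Longrightarrow> x \<in> free_space S \<Longrightarrow> x \<in> free_space T"
  by (auto simp: free_space_iff)

lemma fun_scale_zero [simp]: "fun_scale 0 x = 0" "fun_scale c 0 = 0"
  by (auto simp: fun_scale_def)

lemma fun_scale_one [simp]: "fun_scale 1 x = x"
  by (auto simp: fun_scale_def)

lemma fun_scale_scale: "fun_scale a (fun_scale b x) = fun_scale (a * b) x"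
  by (auto simp: fun_scale_def)

text \<open>The linear extension of \<open>f\<close>. A sum over an infinite support is 0 by
  convention, so additivity is stated on some \<open>free_space\<close>.\<close>

definition lin :: "('a \<Rightarrow> 'b \<Rightarrow> 'k::field) \<Rightarrow> ('a \<Rightarrow> 'k) \<Rightarrow> 'b \<Rightarrow> 'k" where
  "lin f x = (\<Sum>a | x a \<noteq> 0. fun_scale (x a) (f a))"

lemma lin_superset: "finite A \<Longrightarrow> {a. x a \<noteq> 0} \<subseteq> A \<Longrightarrow> lin f x = (\<Sum>a\<in>A. fun_scale (x a) (f a))"
  unfolding lin_def by (rule sum.mono_neutral_left) auto

lemma lin_add:
  assumes "x \<in> free_space S" "y \<in> free_space S"
  shows "lin f (x + y) = lin f x + lin f y"
proof -
  let ?A = "{a. x a \<noteq> 0} \<union> {a. y a \<noteq> 0}"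
  have "finite ?A" using assms by (simp add: free_space_iff)
  then have "lin f (x + y) = (\<Sum>a\<in>?A. fun_scale ((x + y) a) (f a))"
    "lin f x = (\<Sum>a\<in>?A. fun_scale (x a) (f a))" "lin f y = (\<Sum>a\<in>?A. fun_scale (y a) (f a))"
    by (rule lin_superset; auto)+
  then show ?thesis by (simp add: fun_vs.scale_left_distrib sum.distrib)
qed

lemma lin_zero [simp]: "lin f 0 = 0"
  by (simp add: lin_def)

lemma lin_scale: "lin f (fun_scale c x) = fun_scale c (lin f x)"
proof (cases "c = 0")
  case False
  then have "{a. fun_scale c x a \<noteq> 0} = {a. x a \<noteq> 0}" by (auto simp: fun_scale_def)
  then show ?thesis
    unfolding lin_def fun_vs.scale_sum_right
    by (auto simp: fun_scale_def mult.assoc intro!: sum.cong)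
qed auto

lemma lin_diff:
  assumes "x \<in> free_space S" "y \<in> free_space S"
  shows "lin f (x - y) = lin f x - lin f y"
  using lin_add[OF free_space_diff[OF assms] assms(2), of f] by (simp add: algebra_simps)

lemma lin_basis_vec [simp]: "lin f (basis_vec a) = f a"
proof -
  have "{x. basis_vec a x \<noteq> (0::'b)} = {a}" by (auto simp: basis_vec_def)
  then show ?thesis by (simp add: lin_def basis_vec_def)
qed

lemma lin_cong: "x \<in> free_space S \<Longrightarrow> (\<And>a. a \<in> S \<Longrightarrow> f a = g a) \<Longrightarrow> lin f x = lin g x"
  unfolding lin_def free_space_iff by (intro sum.cong) auto

lemma lin_in_free_space:
  "x \<in> free_space S \<Longrightarrow> (\<And>a. a \<in> S \<Longrightarrow> f a \<in> free_space T) \<Longrightarrow> lin f x \<in> free_space T"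
  unfolding lin_def
  by (intro fun_vs.subspace_sum[OF free_space_subspace] free_space_scale) (auto simp: free_space_iff)

lemma lin_id: "x \<in> free_space S \<Longrightarrow> lin basis_vec x = x"
  unfolding lin_def by (rule free_space_expand[symmetric]) (simp add: free_space_iff)

lemma free_space_induct [consumes 1, case_names zero step]:
  assumes "x \<in> free_space S" "P 0"
    and "\<And>c a y. a \<in> S \<Longrightarrow> y \<in> free_space S \<Longrightarrow> P y \<Longrightarrow> P (fun_scale c (basis_vec a) + y)"
  shows "P x"
proof -
  have "x \<in> free_space S \<and> P x"
    using assms(1) unfolding free_space_def
  proof (induction rule: fun_vs.span_induct_alt)
    case (step c b y)
    then obtain a where a: "a \<in> S" "b = basis_vec a" by auto
    have "fun_scale c b + y \<in> fun_vs.span (basis_vec ` S)"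
      using step a by (intro fun_vs.span_add fun_vs.span_scale) (auto intro: fun_vs.span_base)
    moreover have "P (fun_scale c b + y)"
      unfolding a(2) using step a(1) assms(3)[unfolded free_space_def] by blast
    ultimately show ?case by blast
  qed (use assms(2) fun_vs.span_zero in blast)
  then show ?thesis ..
qed

text \<open>Supplies the uniqueness half of the definite description in \<open>psi\<close>: a linear
  map is known once its values on basis vectors are.\<close>

lemma lin_unique:
  assumes "x \<in> free_space S"
    and add: "\<And>x y. x \<in> free_space S \<Longrightarrow> y \<in> free_space S \<Longrightarrow> F (x + y) = F x + F y"
    and scale: "\<And>c x. x \<in> free_space S \<Longrightarrow> F (fun_scale c x) = fun_scale c (F x)"
  shows "F x = lin (\<lambda>a. F (basis_vec a)) x"
  using assms(1)
proof (induction rule: free_space_induct)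
  case zero
  show ?case using scale[OF free_space_zero, of 0] by (simp only: fun_scale_zero lin_zero)
next
  case (step c a y)
  then show ?case
    by (simp only: lin_add[of _ S] add scale lin_scale basis_vec_in_free_space free_space_scale lin_basis_vec)
qed

lemma lin_lin:
  assumes "x \<in> free_space S" "\<And>a. a \<in> S \<Longrightarrow> f a \<in> free_space T"
  shows "lin g (lin f x) = lin (\<lambda>a. lin g (f a)) x"
  using assms(1)
proof (induction rule: free_space_induct)
  case (step c a y)
  have "lin f (fun_scale c (basis_vec a) + y) = fun_scale c (f a) + lin f y" for f :: "'a \<Rightarrow> 'c \<Rightarrow> 'b"
    using step by (subst lin_add[of _ S]) (auto simp: lin_scale basis_vec_in_free_space free_space_scale)
  moreover have "lin f (fun_scale c (basis_vec a) + y) = fun_scale c (f a) + lin f y" for f :: "'a \<Rightarrow> 'd \<Rightarrow> 'b"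
    using step by (subst lin_add[of _ S]) (auto simp: lin_scale basis_vec_in_free_space free_space_scale)
  moreover have "lin f y \<in> free_space T" using step assms(2) by (blast intro: lin_in_free_space)
  ultimately show ?case
    using step assms(2) by (simp only: lin_add[of _ T] lin_scale free_space_scale)
qed (simp only: lin_zero)

lemma bilin_lin: "bilin h x y = lin (\<lambda>a. lin (h a) y) x"
  by (simp add: bilin_expand lin_def fun_vs.scale_sum_right fun_scale_scale)

lemma bilin_lin_right: "bilin h x y = lin (\<lambda>b. lin (\<lambda>a. h a b) x) y"
  by (subst bilin_expand, subst sum.swap)
     (simp add: lin_def fun_vs.scale_sum_right fun_scale_scale mult.commute)

text \<open>Both sides are the double sum that defines \<open>bilin\<close>, read in the two orders
  of summation.\<close>

lemma lin_swap: "lin (\<lambda>a. lin (h a) y) x = lin (\<lambda>b. lin (\<lambda>a. h a b) x) y"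
  by (rule trans[OF bilin_lin[symmetric] bilin_lin_right])

lemma bilin_cong:
  "x \<in> free_space S \<Longrightarrow> y \<in> free_space T \<Longrightarrow> (\<And>a b. a \<in> S \<Longrightarrow> b \<in> T \<Longrightarrow> h a b = h' a b) \<Longrightarrow>
   bilin h x y = bilin h' x y"
  unfolding bilin_lin by (auto intro!: lin_cong)

lemma bilin_in_free_space:
  "x \<in> free_space S \<Longrightarrow> y \<in> free_space T \<Longrightarrow> (\<And>a b. a \<in> S \<Longrightarrow> b \<in> T \<Longrightarrow> h a b \<in> free_space U) \<Longrightarrow>
   bilin h x y \<in> free_space U"
  unfolding bilin_lin by (auto intro!: lin_in_free_space)

lemma lin_bilin:
  assumes "x \<in> free_space S" "y \<in> free_space T" "\<And>a b. a \<in> S \<Longrightarrow> b \<in> T \<Longrightarrow> h a b \<in> free_space U"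
  shows "lin f (bilin h x y) = bilin (\<lambda>a b. lin f (h a b)) x y"
proof -
  have "lin f (bilin h x y) = lin (\<lambda>a. lin f (lin (h a) y)) x"
    unfolding bilin_lin using assms by (intro lin_lin[of _ S]) (auto intro!: lin_in_free_space)
  also have "\<dots> = lin (\<lambda>a. lin (\<lambda>b. lin f (h a b)) y) x"
    using assms by (intro lin_cong[of _ S] lin_lin[of _ T]) auto
  finally show ?thesis by (simp add: bilin_lin)
qed

lemma bilin_lin_lin:
  assumes "x \<in> free_space S" "y \<in> free_space T"
    "\<And>a. a \<in> S \<Longrightarrow> f a \<in> free_space U" "\<And>a. a \<in> T \<Longrightarrow> g a \<in> free_space U'"
  shows "bilin h (lin f x) (lin g y) = bilin (\<lambda>a b. bilin h (f a) (g b)) x y"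
proof -
  have "bilin h (lin f x) (lin g y) = lin (\<lambda>a. lin (\<lambda>u. lin (h u) (lin g y)) (f a)) x"
    unfolding bilin_lin using assms by (intro lin_lin[of _ S]) auto
  also have "\<dots> = lin (\<lambda>a. lin (\<lambda>b. bilin h (f a) (g b)) y) x"
  proof (rule lin_cong[OF assms(1)])
    fix a assume "a \<in> S"
    have "lin (\<lambda>u. lin (h u) (lin g y)) (f a) = lin (\<lambda>w. lin (\<lambda>u. h u w) (f a)) (lin g y)"
      by (rule lin_swap)
    also have "\<dots> = lin (\<lambda>b. lin (\<lambda>w. lin (\<lambda>u. h u w) (f a)) (g b)) y"
      using assms by (intro lin_lin[of _ T]) auto
    finally show "lin (\<lambda>u. lin (h u) (lin g y)) (f a) = lin (\<lambda>b. bilin h (f a) (g b)) y"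
      by (simp only: bilin_lin_right)
  qed
  finally show ?thesis by (simp add: bilin_lin)
qed

lemma bilin_add_left:
  "x \<in> free_space S \<Longrightarrow> y \<in> free_space S \<Longrightarrow> bilin h (x + y) z = bilin h x z + bilin h y z"
  and bilin_add_right:
  "x \<in> free_space S \<Longrightarrow> y \<in> free_space S \<Longrightarrow> bilin h z (x + y) = bilin h z x + bilin h z y"
  and bilin_scale_left: "bilin h (fun_scale c x) z = fun_scale c (bilin h x z)"
  and bilin_scale_right: "bilin h z (fun_scale c x) = fun_scale c (bilin h z x)"
  by (simp_all only: bilin_lin[of h _ z] bilin_lin_right[of h z] lin_add lin_scale)

text \<open>The three arguments are expanded in basis vectors one at a time, until the assumption on
  basis triples applies under three nested linear extensions.\<close>

lemma bilin_assoc: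
  assumes cl: "\<And>a b. a \<in> S \<Longrightarrow> b \<in> S \<Longrightarrow> h a b \<in> free_space S"
    and assoc: "\<And>a b c. a \<in> S \<Longrightarrow> b \<in> S \<Longrightarrow> c \<in> S \<Longrightarrow>
      bilin h (h a b) (basis_vec c) = bilin h (basis_vec a) (h b c)"
    and xyz: "x \<in> free_space S" "y \<in> free_space S" "z \<in> free_space S"
  shows "bilin h (bilin h x y) z = bilin h x (bilin h y z)"
proof -
  have "bilin h (bilin h x y) z = bilin h (lin (\<lambda>a. lin (h a) y) x) (lin basis_vec z)"
    using xyz by (simp add: bilin_lin lin_id)
  also have "\<dots> = lin (\<lambda>a. lin (\<lambda>c. bilin h (lin (h a) y) (basis_vec c)) z) x"
    using xyz cl by (subst bilin_lin_lin[of _ S _ S])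
      (auto simp: bilin_lin[of _ x z] intro: lin_in_free_space basis_vec_in_free_space)
  also have "\<dots> = lin (\<lambda>a. lin (\<lambda>b. lin (\<lambda>c. bilin h (h a b) (basis_vec c)) z) y) x"
  proof (rule lin_cong[OF xyz(1)])
    fix a assume a: "a \<in> S"
    have "lin (\<lambda>c. bilin h (lin (h a) y) (basis_vec c)) z = bilin (\<lambda>b c. bilin h (h a b) (basis_vec c)) y z"
      unfolding bilin_lin_right[of _ y z]
    proof (rule lin_cong[OF xyz(3)])
      fix c
      show "bilin h (lin (h a) y) (basis_vec c) = lin (\<lambda>b. bilin h (h a b) (basis_vec c)) y"
        unfolding bilin_lin using a cl xyz by (auto intro: lin_lin)
    qed
    then show "lin (\<lambda>c. bilin h (lin (h a) y) (basis_vec c)) z =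
      lin (\<lambda>b. lin (\<lambda>c. bilin h (h a b) (basis_vec c)) z) y" by (simp add: bilin_lin)
  qed
  also have "\<dots> = lin (\<lambda>a. lin (\<lambda>b. lin (\<lambda>c. bilin h (basis_vec a) (h b c)) z) y) x"
    using xyz assoc by (intro lin_cong[of _ S]) auto
  also have "\<dots> = lin (\<lambda>a. bilin h (basis_vec a) (bilin h y z)) x"
  proof (rule lin_cong[OF xyz(1)])
    fix a
    have "bilin h (basis_vec a) (bilin h y z) = bilin (\<lambda>b c. lin (h a) (h b c)) y z"
      unfolding bilin_lin[of _ "basis_vec a"] lin_basis_vec by (rule lin_bilin[OF xyz(2,3) cl])
    then show "lin (\<lambda>b. lin (\<lambda>c. bilin h (basis_vec a) (h b c)) z) y = bilin h (basis_vec a) (bilin h y z)"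
      by (simp add: bilin_lin)
  qed
  also have "\<dots> = bilin h x (bilin h y z)"
    by (simp add: bilin_lin)
  finally show ?thesis .
qed

section \<open>Algebras given by a multiplication of basis vectors\<close>

lemma free_algebra_simps [simp]:
  "carrier (free_algebra S h) = free_space S" "vzero (free_algebra S h) = 0" "vadd (free_algebra S h) = (+)"
  "vscale (free_algebra S h) = fun_scale" "vmult (free_algebra S h) = bilin h"
  by (simp_all add: free_algebra_def)

lemma nonunital_free_algebra:
  assumes cl: "\<And>a b. a \<in> S \<Longrightarrow> b \<in> S \<Longrightarrow> h a b \<in> free_space S"
    and assoc: "\<And>a b c. a \<in> S \<Longrightarrow> b \<in> S \<Longrightarrow> c \<in> S \<Longrightarrow>
      bilin h (h a b) (basis_vec c) = bilin h (basis_vec a) (h b c)"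
  shows "nonunital_algebra (free_algebra S h)"
proof (rule nonunital_algebra.intro)
  show "comm_group \<lparr>carrier = carrier (free_algebra S h), mult = vadd (free_algebra S h), one = vzero (free_algebra S h)\<rparr>"
  proof (rule comm_groupI)
    fix x assume "x \<in> carrier \<lparr>carrier = carrier (free_algebra S h), mult = vadd (free_algebra S h), one = vzero (free_algebra S h)\<rparr>"
    then have "- x \<in> free_space S"
      using free_space_diff[OF free_space_zero, of x S] by (simp only: diff_0 free_algebra_simps partial_object.simps)
    then show "\<exists>y\<in>carrier \<lparr>carrier = carrier (free_algebra S h), mult = vadd (free_algebra S h), one = vzero (free_algebra S h)\<rparr>.
      y \<otimes>\<^bsub>\<lparr>carrier = carrier (free_algebra S h), mult = vadd (free_algebra S h), one = vzero (free_algebra S h)\<rparr>\<^esub> x =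
      \<one>\<^bsub>\<lparr>carrier = carrier (free_algebra S h), mult = vadd (free_algebra S h), one = vzero (free_algebra S h)\<rparr>\<^esub>"
      by (intro bexI[of _ "- x"]) auto
  qed (auto simp: free_space_zero free_space_add add.assoc add.commute)
qed (simp_all add: free_space_scale fun_scale_scale fun_vs.scale_left_distrib fun_vs.scale_right_distrib
  bilin_scale_left bilin_scale_right bilin_add_left[of _ S] bilin_add_right[of _ S] bilin_in_free_space[of _ S _ S] cl
  bilin_assoc[of S, OF cl assoc])

lemma nonunital_group_algebra:
  assumes "group G"
  shows "nonunital_algebra (group_algebra G :: ('k::field, 'g \<Rightarrow> 'k) nualg)"
  unfolding group_algebra_def
proof (rule nonunital_free_algebra)
  interpret group G by fact
  show "basis_vec (a \<otimes>\<^bsub>G\<^esub> b) \<in> free_space (carrier G)" if "a \<in> carrier G" "b \<in> carrier G" for a b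
    using that by (simp add: basis_vec_in_free_space)
  show "bilin (\<lambda>g h. basis_vec (g \<otimes>\<^bsub>G\<^esub> h)) (basis_vec (a \<otimes>\<^bsub>G\<^esub> b)) (basis_vec c) =
    bilin (\<lambda>g h. basis_vec (g \<otimes>\<^bsub>G\<^esub> h)) (basis_vec a) (basis_vec (b \<otimes>\<^bsub>G\<^esub> c))"
    if "a \<in> carrier G" "b \<in> carrier G" "c \<in> carrier G" for a b c
    using that by (simp add: bilin_basis_vec m_assoc)
qed

lemma tensor_basis_vec: "tensor (basis_vec x) (basis_vec y) (basis_vec b) = basis_vec (x, y, b)"
  by (auto simp: tensor_def basis_vec_def fun_eq_iff)

lemma tensor_zero [simp]: "tensor x y 0 = 0"
  by (auto simp: tensor_def fun_eq_iff)

lemma tensor_scale: "tensor x y (fun_scale c b) = fun_scale c (tensor x y b)"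
  by (auto simp: tensor_def fun_eq_iff fun_scale_def)

lemma tensor_in_free_space:
  assumes "x \<in> free_space X" "y \<in> free_space Y" "b \<in> free_space S"
  shows "tensor x y b \<in> free_space (X \<times> Y \<times> S)"
proof -
  have "{p. tensor x y b p \<noteq> 0} = {a. x a \<noteq> 0} \<times> {a. y a \<noteq> 0} \<times> {a. b a \<noteq> 0}"
    by (auto simp: tensor_def)
  then show ?thesis using assms by (auto simp: free_space_iff)
qed

lemma tensor_basis_vec_inject:
  assumes "tensor (basis_vec x) (basis_vec y) a = tensor (basis_vec x) (basis_vec y) b"
  shows "a = b"
proof
  fix s
  show "a s = b s" using fun_cong[OF assms, of "(x, y, s)"] by (simp add: tensor_def basis_vec_def)
qed

text \<open>Both bracketings of three pure tensors have the outer vectors \<open>x1\<close>,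
  \<open>y3\<close> and the coefficient \<open>b1 h(y1, x2) b2 h(y2, x3) b3\<close>, so
  associativity reduces to that of \<open>B\<close>. The form is arbitrary.\<close>

lemma nonunital_inflation:
  fixes B :: "('k::field, 's \<Rightarrow> 'k) nualg" and E :: "'e set"
  assumes B: "nonunital_algebra B"
    and carr: "carrier B = free_space S" and add: "vadd B = (+)" and scale: "vscale B = fun_scale"
    and h: "\<And>a b. \<lbrakk>a \<in> E; b \<in> E\<rbrakk> \<Longrightarrow> h a b \<in> carrier B"
  shows "nonunital_algebra (inflation E S B (bilin h))"
proof -
  interpret B: nonunital_algebra B by fact
  define H :: "'e \<times> 'e \<times> 's \<Rightarrow> 'e \<times> 'e \<times> 's \<Rightarrow> 'e \<times> 'e \<times> 's \<Rightarrow> 'k"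
    where "H = (\<lambda>(x1, y1, b1) (x2, y2, b2). tensor (basis_vec x1) (basis_vec y2)
    (vmult B (vmult B (basis_vec b1) (bilin h (basis_vec y1) (basis_vec x2))) (basis_vec b2)))"
  have I: "inflation E S B (bilin h) = free_algebra (E \<times> E \<times> S) H"
    by (simp add: inflation_def H_def)
  have tens: "bilin H (tensor x1 y1 b1) (tensor x2 y2 b2) = tensor x1 y2 (vmult B (vmult B b1 (bilin h y1 x2)) b2)"
    if "x1 \<in> free_space E" "y1 \<in> free_space E" "x2 \<in> free_space E" "y2 \<in> free_space E" "b1 \<in> carrier B" "b2 \<in> carrier B"
    for x1 y1 x2 y2 b1 b2
  proof -
    have "vmult (inflation E S B (bilin h)) (tensor x1 y1 b1) (tensor x2 y2 b2) =
        tensor x1 y2 (vmult B (vmult B b1 (bilin h y1 x2)) b2)"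
      by (rule inflation_mult_tensor[OF B carr add scale _ that]) (rule h)
    then show ?thesis by (simp add: I)
  qed
  show ?thesis unfolding I
  proof (rule nonunital_free_algebra, goal_cases)
    case (1 a b)
    then show ?case
      by (auto simp: H_def bilin_basis_vec carr[symmetric] basis_vec_in_free_space
          intro!: tensor_in_free_space B.mult_closed h) (auto simp: carr basis_vec_in_free_space)
  next
    case (2 a b c)
    obtain x1 y1 b1 where a: "a = (x1, y1, b1)" by (cases a)
    obtain x2 y2 b2 where b: "b = (x2, y2, b2)" by (cases b)
    obtain x3 y3 b3 where c: "c = (x3, y3, b3)" by (cases c)
    have mem: "basis_vec b1 \<in> carrier B" "basis_vec b2 \<in> carrier B" "basis_vec b3 \<in> carrier B"
      "x1 \<in> E" "x2 \<in> E" "x3 \<in> E" "y1 \<in> E" "y2 \<in> E" "y3 \<in> E"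
      using 2 by (auto simp: a b c carr basis_vec_in_free_space)
    have "bilin H (H a b) (basis_vec c) = tensor (basis_vec x1) (basis_vec y3)
      (vmult B (vmult B (vmult B (vmult B (basis_vec b1) (h y1 x2)) (basis_vec b2)) (h y2 x3)) (basis_vec b3))"
      unfolding a b c tensor_basis_vec[symmetric] H_def prod.case
      \<comment> \<open>Unfolding \<open>H\<close> has also expanded the outer multiplication; it is
        folded back so that \<open>tens\<close> applies.\<close>
      using mem by (subst H_def[symmetric], subst tens) (auto simp: bilin_basis_vec basis_vec_in_free_space h B.mult_closed)
    moreover have "bilin H (basis_vec a) (H b c) = tensor (basis_vec x1) (basis_vec y3)
      (vmult B (vmult B (basis_vec b1) (h y1 x2)) (vmult B (vmult B (basis_vec b2) (h y2 x3)) (basis_vec b3)))"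
      unfolding a b c tensor_basis_vec[symmetric] H_def prod.case
      using mem by (subst H_def[symmetric], subst tens) (auto simp: bilin_basis_vec basis_vec_in_free_space h B.mult_closed)
    ultimately show ?case using mem by (simp add: B.mult_assoc B.mult_closed h)
  qed
qed

section \<open>Quotients as images\<close>

text \<open>The axioms of a quotient are obtained from an algebra already known, along a bijection
  that respects the operations. In this way associativity of \<open>ideal_quotient\<close> follows
  without any geometric argument on triple stacks.\<close>

lemma nonunital_algebra_transfer:
  assumes C: "nonunital_algebra C" and bij: "bij_betw F (carrier C) (carrier Q)"
    and zero: "F (vzero C) = vzero Q"
    and add: "\<And>x y. x \<in> carrier C \<Longrightarrow> y \<in> carrier C \<Longrightarrow> vadd Q (F x) (F y) = F (vadd C x y)"
    and scale: "\<And>c x. x \<in> carrier C \<Longrightarrow> vscale Q c (F x) = F (vscale C c x)"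
    and mult: "\<And>x y. x \<in> carrier C \<Longrightarrow> y \<in> carrier C \<Longrightarrow> vmult Q (F x) (F y) = F (vmult C x y)"
  shows "nonunital_algebra Q"
proof -
  interpret C: nonunital_algebra C by fact
  interpret G: comm_group "\<lparr>carrier = carrier C, mult = vadd C, one = vzero C\<rparr>" by (rule C.add_group)
  have cQ: "carrier Q = F ` carrier C" using bij by (simp add: bij_betw_def)
  have cl: "x \<in> carrier C \<Longrightarrow> y \<in> carrier C \<Longrightarrow> vadd C x y \<in> carrier C" "vzero C \<in> carrier C" for x y
    using G.m_closed G.one_closed by auto
  have ex: "\<exists>y\<in>carrier C. vadd C y x = vzero C" if "x \<in> carrier C" for x
    using G.l_inv_ex that by auto
  show ?thesis
  proof (rule nonunital_algebra.intro)
    show "comm_group \<lparr>carrier = carrier Q, mult = vadd Q, one = vzero Q\<rparr>"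
    proof (rule comm_groupI)
      fix x assume "x \<in> carrier \<lparr>carrier = carrier Q, mult = vadd Q, one = vzero Q\<rparr>"
      then obtain x' where x': "x' \<in> carrier C" "x = F x'" by (auto simp: cQ)
      then obtain y where "y \<in> carrier C" "vadd C y x' = vzero C" using ex by blast
      then have "vadd Q (F y) x = vzero Q" "F y \<in> carrier Q" using x' by (auto simp: add zero[symmetric] cQ)
      then show "\<exists>y\<in>carrier \<lparr>carrier = carrier Q, mult = vadd Q, one = vzero Q\<rparr>.
        y \<otimes>\<^bsub>\<lparr>carrier = carrier Q, mult = vadd Q, one = vzero Q\<rparr>\<^esub> x = \<one>\<^bsub>\<lparr>carrier = carrier Q, mult = vadd Q, one = vzero Q\<rparr>\<^esub>"
        by auto
    qed (use G.m_assoc G.m_comm G.l_one in \<open>auto simp: cQ zero[symmetric] add cl\<close>)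
  qed (auto simp: cQ add scale mult cl C.scale_closed C.scale_add_left C.scale_add_right C.scale_scale C.scale_one
      C.mult_closed C.mult_assoc C.mult_add_left C.mult_add_right C.mult_scale_left C.mult_scale_right)
qed

text \<open>The natural bijection runs from the inflation to the quotient, sending a vector to its
  fibre, while an isomorphism out of the quotient is wanted.\<close>

lemma algebra_iso_inverse:
  assumes bij: "bij_betw F (carrier C) (carrier Q)"
    and add: "\<And>x y. x \<in> carrier C \<Longrightarrow> y \<in> carrier C \<Longrightarrow> vadd C x y \<in> carrier C \<and> vadd Q (F x) (F y) = F (vadd C x y)"
    and scale: "\<And>c x. x \<in> carrier C \<Longrightarrow> vscale C c x \<in> carrier C \<and> vscale Q c (F x) = F (vscale C c x)"
    and mult: "\<And>x y. x \<in> carrier C \<Longrightarrow> y \<in> carrier C \<Longrightarrow> vmult C x y \<in> carrier C \<and> vmult Q (F x) (F y) = F (vmult C x y)"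
  shows "algebra_iso Q C (the_inv_into (carrier C) F)"
proof -
  have inj: "inj_on F (carrier C)" and cQ: "carrier Q = F ` carrier C"
    using bij by (auto simp: bij_betw_def)
  have inv: "the_inv_into (carrier C) F (F x) = x" if "x \<in> carrier C" for x
    using the_inv_into_f_f[OF inj that] .
  show ?thesis
    unfolding algebra_iso_def linear_map_def
    using add scale mult bij_betw_the_inv_into[OF bij]
    by (auto simp: cQ inv)
qed

text \<open>If the cosets of \<open>I\<close> are the fibres of a map \<open>T\<close> that respects
  the operations, the quotient is the image of \<open>T\<close>. \<open>A\<close> and
  \<open>C\<close> are just carriers with operations here, so the locale applies before either is
  known to be an algebra. It is used twice: for the relation space in the free algebra, and for the
  smaller ideal in the larger one.\<close>

locale quotient_by_kernel =
  fixes A :: "('k::field, 'a) nualg" and I :: "'a set" and T :: "'a \<Rightarrow> 'b" and C :: "('k, 'b) nualg"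
  assumes add: "\<And>x y. x \<in> carrier A \<Longrightarrow> y \<in> carrier A \<Longrightarrow> vadd A x y \<in> carrier A \<and> T (vadd A x y) = vadd C (T x) (T y)"
    and scale: "\<And>c x. x \<in> carrier A \<Longrightarrow> vscale A c x \<in> carrier A \<and> T (vscale A c x) = vscale C c (T x)"
    and mult: "\<And>x y. x \<in> carrier A \<Longrightarrow> y \<in> carrier A \<Longrightarrow> vmult A x y \<in> carrier A \<and> T (vmult A x y) = vmult C (T x) (T y)"
    and vcoset: "\<And>x. x \<in> carrier A \<Longrightarrow> vcoset A I x = {y \<in> carrier A. T y = T x}"
    and zero: "I = {y \<in> carrier A. T y = vzero C}"
begin

definition fib :: "'b \<Rightarrow> 'a set" where
  "fib c = {y \<in> carrier A. T y = c}"

lemma vcoset_fib: "x \<in> carrier A \<Longrightarrow> vcoset A I x = fib (T x)"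
  by (simp add: vcoset fib_def)

lemma bij_fib: "bij_betw fib (T ` carrier A) (carrier (quotient_algebra A I))"
proof -
  have "carrier (quotient_algebra A I) = fib ` T ` carrier A"
    by (auto simp: quotient_algebra_def vcoset_fib)
  moreover have "inj_on fib (T ` carrier A)" by (rule inj_onI) (auto simp: fib_def)
  ultimately show ?thesis by (simp add: bij_betw_def)
qed

lemma zero_fib: "vzero (quotient_algebra A I) = fib (vzero C)"
  by (simp add: quotient_algebra_def fib_def) (rule zero)

lemma mem_fib: "x \<in> fib c \<longleftrightarrow> x \<in> carrier A \<and> T x = c"
  by (simp add: fib_def)

lemma fib_ex: "a \<in> T ` carrier A \<Longrightarrow> \<exists>x. x \<in> fib a"
  by (auto simp: fib_def)

text \<open>The operations of \<open>quotient_algebra\<close> are unions over representatives; such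
  a union collapses once all representatives give the same coset and at least one exists.\<close>

lemma UN_fib: "\<exists>x. x \<in> fib a \<Longrightarrow> (\<And>x. x \<in> fib a \<Longrightarrow> f x = Z) \<Longrightarrow> (\<Union>x\<in>fib a. f x) = Z"
  by auto

lemma add_fib:
  assumes "a \<in> T ` carrier A" "b \<in> T ` carrier A"
  shows "vadd (quotient_algebra A I) (fib a) (fib b) = fib (vadd C a b)"
proof -
  have "vcoset A I (vadd A x y) = fib (vadd C a b)" if "x \<in> fib a" "y \<in> fib b" for x y
    using that by (auto simp: mem_fib vcoset_fib add)
  then show ?thesis
    unfolding quotient_algebra_def nualg.simps by (intro UN_fib fib_ex assms)
qed

lemma scale_fib:
  assumes "a \<in> T ` carrier A"
  shows "vscale (quotient_algebra A I) c (fib a) = fib (vscale C c a)"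
proof -
  have "vcoset A I (vscale A c x) = fib (vscale C c a)" if "x \<in> fib a" for x
    using that by (auto simp: mem_fib vcoset_fib scale)
  then show ?thesis
    unfolding quotient_algebra_def nualg.simps by (intro UN_fib fib_ex assms)
qed

lemma mult_fib:
  assumes "a \<in> T ` carrier A" "b \<in> T ` carrier A"
  shows "vmult (quotient_algebra A I) (fib a) (fib b) = fib (vmult C a b)"
proof -
  have "vcoset A I (vmult A x y) = fib (vmult C a b)" if "x \<in> fib a" "y \<in> fib b" for x y
    using that by (auto simp: mem_fib vcoset_fib mult)
  then show ?thesis
    unfolding quotient_algebra_def nualg.simps by (intro UN_fib fib_ex assms)
qed

end

section \<open>Maximal paths in two-coloured graphs\<close>

text \<open>By maximality the edge lies on the path, and since the vertices of the path are
  distinct, its first vertex meets only the first edge. Stated for arbitrary multigraphs because it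
  serves both stacks and the graph of the bilinear form.\<close>

lemma maximal_path_hd_edge:
  assumes m: "maximal_path G ends vs es" and g: "g \<in> G" "hd vs \<in> ends g"
  shows "g = hd es"
proof -
  have p: "path_in G ends vs es" and ne: "es \<noteq> []" and "g \<in> set es"
    using m g by (auto simp: maximal_path_def)
  then obtain k where k: "k < length es" "g = es ! k" by (auto simp: in_set_conv_nth)
  have len: "length vs = Suc (length es)" "distinct vs" "ends (es ! k) = {vs ! k, vs ! Suc k}"
    using p k(1) by (auto simp: path_in_def)
  then have "hd vs = vs ! 0" by (cases vs) auto
  then have "vs ! 0 = vs ! k \<or> vs ! 0 = vs ! Suc k" using g(2) k(2) len(3) by auto
  then have "k = 0" using len(1,2) k(1) nth_eq_iff_index_eq[of vs 0 k] nth_eq_iff_index_eq[of vs 0 "Suc k"] by auto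
  then show ?thesis using k ne by (simp add: hd_conv_nth)
qed

lemma path_in_rev:
  assumes "path_in G ends vs es"
  shows "path_in G ends (rev vs) (rev es)"
proof -
  have "ends (rev es ! i) = {rev vs ! i, rev vs ! Suc i}" if "i < length es" for i
  proof -
    have "rev es ! i = es ! (length es - Suc i)" "rev vs ! i = vs ! Suc (length es - Suc i)"
      "rev vs ! Suc i = vs ! (length es - Suc i)"
      using assms that by (auto simp: path_in_def rev_nth Suc_diff_Suc)
    moreover have "length es - Suc i < length es" using that by simp
    ultimately show ?thesis using assms unfolding path_in_def by (metis insert_commute)
  qed
  then show ?thesis using assms by (simp add: path_in_def)
qed

lemma maximal_path_rev: "maximal_path G ends vs es \<Longrightarrow> maximal_path G ends (rev vs) (rev es)"
  unfolding maximal_path_def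
  by (auto simp: path_in_rev hd_rev last_rev)

lemma path_in_Cons:
  "path_in G ends (v # vs) (e # es) \<longleftrightarrow>
    path_in G ends vs es \<and> v \<notin> set vs \<and> e \<notin> set es \<and> e \<in> G \<and> ends e = {v, hd vs}"
proof -
  have "(\<forall>i<length (e # es). ends ((e # es) ! i) = {(v # vs) ! i, (v # vs) ! Suc i}) \<longleftrightarrow>
    ends e = {v, vs ! 0} \<and> (\<forall>i<length es. ends (es ! i) = {vs ! i, vs ! Suc i})"
    by (simp add: All_less_Suc2)
  then show ?thesis
    by (cases vs) (auto simp: path_in_def)
qed

lemma path_in_snoc:
  assumes "vs \<noteq> []"
  shows "path_in G ends (vs @ [v]) (es @ [e]) \<longleftrightarrow>
    path_in G ends vs es \<and> v \<notin> set vs \<and> e \<notin> set es \<and> e \<in> G \<and> ends e = {last vs, v}"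
proof -
  have "path_in G ends (vs @ [v]) (es @ [e]) \<longleftrightarrow> path_in G ends (v # rev vs) (e # rev es)"
    using path_in_rev[of G ends "vs @ [v]" "es @ [e]"] path_in_rev[of G ends "v # rev vs" "e # rev es"] by auto
  also have "\<dots> \<longleftrightarrow> path_in G ends vs es \<and> v \<notin> set vs \<and> e \<notin> set es \<and> e \<in> G \<and> ends e = {last vs, v}"
    using path_in_rev[of G ends vs es] path_in_rev[of G ends "rev vs" "rev es"] assms
    by (auto simp: path_in_Cons hd_rev)
  finally show ?thesis .
qed

text \<open>Every vertex meets at most one edge of each colour, hence has degree at most two, and
  the components are paths and cycles. In a stack the colour tells the upper from the lower
  diagram.\<close>

locale two_coloured_graph =
  fixes G :: "'e set" and ends :: "'e \<Rightarrow> 'v set" and col :: "'e \<Rightarrow> bool"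
  assumes finite_G: "finite G"
    and card_ends: "e \<in> G \<Longrightarrow> card (ends e) = 2"
    and col_unique: "\<lbrakk>e \<in> G; f \<in> G; v \<in> ends e; v \<in> ends f; col e = col f\<rbrakk> \<Longrightarrow> e = f"
begin

abbreviation path :: "'v list \<Rightarrow> 'e list \<Rightarrow> bool" where
  "path \<equiv> path_in G ends"

abbreviation mpath :: "'v list \<Rightarrow> 'e list \<Rightarrow> bool" where
  "mpath \<equiv> maximal_path G ends"

text \<open>The vertices of degree one, which are the possible ends of maximal paths.\<close>

definition outer :: "'v \<Rightarrow> bool" where
  "outer v \<longleftrightarrow> (\<exists>!e. e \<in> G \<and> v \<in> ends e)"

lemma ends_other:
  assumes "e \<in> G" "v \<in> ends e"
  shows "\<exists>w. ends e = {v, w} \<and> w \<noteq> v"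
  using card_ends[OF assms(1)] assms(2) unfolding card_2_iff by (metis insert_iff insert_commute singletonD)

lemma mpath_path: "mpath vs es \<Longrightarrow> path vs es"
  by (simp add: maximal_path_def)

lemma path_length: "path vs es \<Longrightarrow> length vs = Suc (length es)"
  by (simp add: path_in_def)

lemma path_ne: "path vs es \<Longrightarrow> vs \<noteq> []"
  by (auto simp: path_in_def)

lemma path_hd: "path vs es \<Longrightarrow> hd vs = vs ! 0" and path_last: "path vs es \<Longrightarrow> last vs = vs ! length es"
  using path_ne[of vs es] by (auto simp: path_in_def hd_conv_nth last_conv_nth)

lemma path_edge:
  assumes "path vs es" "i < length es"
  shows "es ! i \<in> G" "ends (es ! i) = {vs ! i, vs ! Suc i}" "vs ! i \<noteq> vs ! Suc i"
    "vs ! i \<in> set vs" "vs ! Suc i \<in> set vs" "es ! i \<in> set es"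
  using assms unfolding path_in_def by (auto simp: nth_eq_iff_index_eq)

lemma path_alternates:
  assumes "path vs es" "Suc i < length es"
  shows "col (es ! i) \<noteq> col (es ! Suc i)"
proof
  assume "col (es ! i) = col (es ! Suc i)"
  then have "es ! i = es ! Suc i"
    using path_edge[OF assms(1), of i] path_edge[OF assms(1), of "Suc i"] assms(2)
    by (intro col_unique[of _ _ "vs ! Suc i"]) auto
  then show False using assms by (auto simp: path_in_def nth_eq_iff_index_eq)
qed

text \<open>The two path edges at an interior vertex have different colours, so a further edge there
  shares its colour with one of them and coincides with it.\<close>

lemma path_interior:
  assumes "path vs es" "Suc i < length es" "e \<in> G" "vs ! Suc i \<in> ends e"
  shows "e = es ! i \<or> e = es ! Suc i"
proof -
  have "col e = col (es ! i) \<or> col e = col (es ! Suc i)"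
    using path_alternates[OF assms(1,2)] by auto
  then show ?thesis
    using assms path_edge[OF assms(1), of i] path_edge[OF assms(1), of "Suc i"]
    by (auto intro: col_unique[of _ _ "vs ! Suc i"])
qed

lemma mpath_closed:
  assumes m: "mpath vs es" and e: "e \<in> G" "v \<in> ends e" "v \<in> set vs"
  shows "e \<in> set es"
proof -
  have p: "path vs es" and l: "length vs = Suc (length es)" using m by (auto simp: maximal_path_def path_in_def)
  obtain i where i: "i \<le> length es" "v = vs ! i" using e(3) l by (auto simp: in_set_conv_nth less_Suc_eq_le)
  consider "i = 0" | "i = length es" | k where "i = Suc k" "Suc k < length es"
    using i by (cases i) (auto simp: order_le_less)
  then show ?thesis
  proof cases
    case 3
    then show ?thesis using path_interior[OF p, of k e] e i path_edge(6)[OF p] by auto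
  qed (use m e i path_hd[OF p] path_last[OF p] in \<open>auto simp: maximal_path_def\<close>)
qed

text \<open>The next edge \<open>es' ! i\<close> starts on the maximal path, hence lies on it, at
  position \<open>i\<close> or just before. The latter would repeat the previous edge of
  \<open>es'\<close>, so both paths continue in the same way.\<close>

lemma mpath_prefix:
  assumes m: "mpath vs es" and p: "path vs' es'" and hd: "hd vs' = hd vs" and i: "i < length es'"
  shows "i < length es \<and> es' ! i = es ! i \<and> vs' ! Suc i = vs ! Suc i \<and> vs' ! i = vs ! i"
  using i
proof (induction i)
  note p' = mpath_path[OF m]
  have step: "i < length es \<and> es' ! i = es ! i \<and> vs' ! Suc i = vs ! Suc i"
    if i: "i < length es'" and v: "vs' ! i = vs ! i" "i \<le> length es"
      and prev: "\<And>j. i = Suc j \<Longrightarrow> es' ! j = es ! j" for i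
  proof -
    have "es' ! i \<in> set es"
      using v path_length[OF p'] path_edge[OF p i] by (intro mpath_closed[OF m, of _ "vs ! i"]) auto
    then obtain k where k: "k < length es" "es' ! i = es ! k" by (auto simp: in_set_conv_nth)
    have "vs ! i \<in> {vs ! k, vs ! Suc k}" using path_edge(2)[OF p i] path_edge(2)[OF p' k(1)] k(2) v by auto
    then have "i = k \<or> i = Suc k"
      using p' v(2) k(1) unfolding path_in_def by (auto simp: nth_eq_iff_index_eq)
    moreover have "i \<noteq> Suc k"
    proof
      assume "i = Suc k"
      then have "es' ! k = es' ! i" using prev k by simp
      then show False using p i \<open>i = Suc k\<close> unfolding path_in_def by (auto simp: nth_eq_iff_index_eq)
    qed
    ultimately have "k = i" by simp
    then have "{vs ! i, vs' ! Suc i} = {vs ! i, vs ! Suc i}"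
      using path_edge(2)[OF p i] path_edge(2)[OF p' k(1)] k(2) v by simp
    then show ?thesis using k \<open>k = i\<close> by (auto simp: doubleton_eq_iff)
  qed
  {
    case 0
    then show ?case using step[of 0] hd path_hd[OF p] path_hd[OF p'] by auto
  next
    case (Suc i)
    then show ?case using step[of "Suc i"] by auto
  }
qed

lemma mpath_unique:
  assumes "mpath vs es" "mpath vs' es'" "hd vs' = hd vs"
  shows "vs' = vs \<and> es' = es"
proof -
  note pre = mpath_prefix[OF assms(1) mpath_path[OF assms(2)] assms(3)]
  note pre' = mpath_prefix[OF assms(2) mpath_path[OF assms(1)] assms(3)[symmetric]]
  have "length es' = length es"
    using pre[of "length es' - 1"] pre'[of "length es - 1"] assms(1,2)
    by (cases "length es'"; cases "length es"; force simp: maximal_path_def)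
  note len = this path_length[OF mpath_path[OF assms(1)]] path_length[OF mpath_path[OF assms(2)]]
  have "es' = es" using pre len by (auto intro: nth_equalityI)
  moreover have "vs' ! i = vs ! i" if "i < length vs'" for i
    using that pre[of "i - 1"] len assms(3) path_hd[OF mpath_path[OF assms(1)]] path_hd[OF mpath_path[OF assms(2)]]
    by (cases i) auto
  ultimately show ?thesis using len by (auto intro: nth_equalityI)
qed

lemma mpath_hd_edge:
  assumes m: "mpath vs es" and e: "e \<in> G" "hd vs \<in> ends e"
  shows "e = es ! 0"
  using maximal_path_hd_edge[OF assms] m by (simp add: maximal_path_def hd_conv_nth)

lemma mpath_outer:
  assumes m: "mpath vs es"
  shows "outer (hd vs)" "outer (last vs)" "hd vs \<noteq> last vs"
proof -
  have *: "outer (hd vs)" if "mpath vs es" for vs es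
  proof -
    note p = mpath_path[OF that]
    have "0 < length es" using that by (auto simp: maximal_path_def)
    then have "es ! 0 \<in> G" "hd vs \<in> ends (es ! 0)"
      using path_edge[OF p, of 0] path_hd[OF p] by auto
    then show ?thesis
      unfolding outer_def using mpath_hd_edge[OF that] by blast
  qed
  show "outer (hd vs)" using *[OF m] .
  show "outer (last vs)" using *[OF maximal_path_rev[OF m]] m by (simp add: hd_rev)
  show "hd vs \<noteq> last vs"
    using m path_hd[OF mpath_path[OF m]] path_last[OF mpath_path[OF m]]
    by (auto simp: maximal_path_def path_in_def nth_eq_iff_index_eq)
qed

lemma path_outer_edge:
  assumes "path vs es" "outer (hd vs)" "es \<noteq> []" "e \<in> G" "hd vs \<in> ends e"
  shows "e \<in> set es"
proof -
  have "es ! 0 \<in> G" "hd vs \<in> ends (es ! 0)" "es ! 0 \<in> set es"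
    using path_edge[OF assms(1), of 0] path_hd[OF assms(1)] assms(3) by auto
  then show ?thesis using assms(2,4,5) unfolding outer_def by blast
qed

lemma mpathI:
  assumes "path vs es" "es \<noteq> []" "outer (hd vs)" "outer (last vs)"
  shows "mpath vs es"
proof -
  have "e \<in> set es" if "e \<in> G" "last vs \<in> ends e" for e
    using path_outer_edge[OF path_in_rev[OF assms(1)], of e] assms that by (auto simp: hd_rev)
  then show ?thesis using path_outer_edge[OF assms(1,3,2)] assms(1,2) by (auto simp: maximal_path_def)
qed

lemma path_length_le: "path vs es \<Longrightarrow> length es \<le> card G"
  unfolding path_in_def using finite_G by (metis card_mono distinct_card)

text \<open>A longest path from \<open>v\<close> is maximal; one exists because the number of edges
  bounds the length.\<close>

lemma mpath_exists:
  assumes "outer v"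
  shows "\<exists>vs es. mpath vs es \<and> hd vs = v"
proof -
  define L where "L = {n. \<exists>vs es. path vs es \<and> hd vs = v \<and> length es = n}"
  have "finite L"
    by (rule finite_subset[of _ "{..card G}"]) (auto simp: L_def path_length_le)
  obtain e where e: "e \<in> G" "v \<in> ends e" using assms by (auto simp: outer_def)
  then obtain w where w: "ends e = {v, w}" "w \<noteq> v"
    using ends_other by blast
  have "path [v, w] [e]" using e w by (auto simp: path_in_def)
  then have "1 \<in> L" unfolding L_def by force
  define n where "n = Max L"
  have "n \<in> L" "1 \<le> n" "\<And>m. m \<in> L \<Longrightarrow> m \<le> n"
    using Max_in[of L] Max_ge[OF \<open>finite L\<close>] \<open>finite L\<close> \<open>1 \<in> L\<close> unfolding n_def by blast+
  then obtain vs es where p: "path vs es" "hd vs = v" "length es = n" by (auto simp: L_def)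
  have ne: "es \<noteq> []" using p \<open>1 \<le> n\<close> by auto
  note hd = path_outer_edge[OF p(1) _ ne, unfolded p(2), OF assms]
  have "e \<in> set es" if e: "e \<in> G" "last vs \<in> ends e" for e
  proof (rule ccontr)
    assume ne': "e \<notin> set es"
    obtain w where w: "ends e = {last vs, w}" "w \<noteq> last vs"
      using ends_other[OF e] by blast
    \<comment> \<open>An extension cannot run back into the path: an interior vertex has both its
      edges on the path, and the start, being outer, has its only edge there.\<close>
    have "w \<notin> set vs"
    proof
      assume "w \<in> set vs"
      then obtain i where i: "i \<le> length es" "w = vs ! i"
        using path_length[OF p(1)] by (auto simp: in_set_conv_nth less_Suc_eq_le)
      moreover have "i \<noteq> length es" using i w path_last[OF p(1)] by auto
      moreover have "i \<noteq> 0"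
      proof
        assume "i = 0"
        then have "v \<in> ends e" using i(2) w(1) path_hd[OF p(1)] p(2) by simp
        then show False using hd[OF e(1)] ne' by blast
      qed
      ultimately obtain k where k: "i = Suc k" "Suc k < length es" by (cases i) auto
      then show False using path_interior[OF p(1), of k e] e w i ne' by auto
    qed
    then have "path (vs @ [w]) (es @ [e])"
      using p(1) ne' e w path_length[OF p(1)] by (subst path_in_snoc) auto
    moreover have "hd (vs @ [w]) = v" using p path_length[OF p(1)] by (cases vs) auto
    ultimately have "Suc n \<in> L" unfolding L_def using p(3) by force
    then show False using \<open>\<And>m. m \<in> L \<Longrightarrow> m \<le> n\<close>[of "Suc n"] by simp
  qed
  then have "mpath vs es" using p ne hd by (auto simp: maximal_path_def)
  then show ?thesis using p by blast
qed

text \<open>The vertices of a maximal path are closed under adjacency, so a path meeting it is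
  followed upwards and downwards from the common vertex without leaving it.\<close>

lemma path_subset_mpath:
  assumes m: "mpath vs es" and p: "path vs' es'" and v: "v \<in> set vs" "v \<in> set vs'"
  shows "set vs' \<subseteq> set vs"
proof -
  note p' = mpath_path[OF m]
  have step: "ends e \<subseteq> set vs" if "e \<in> G" "w \<in> ends e" "w \<in> set vs" for e w
  proof -
    have "e \<in> set es" by (rule mpath_closed[OF m that])
    then show ?thesis using path_edge[OF p'] by (auto simp: in_set_conv_nth)
  qed
  obtain j where j: "j \<le> length es'" "v = vs' ! j"
    using v(2) path_length[OF p] by (auto simp: in_set_conv_nth less_Suc_eq_le)
  have up: "vs' ! (j + n) \<in> set vs" if "j + n \<le> length es'" for n
    using that
  proof (induction n)
    case (Suc n)
    then show ?case
      using step[of "es' ! (j + n)" "vs' ! (j + n)"] path_edge[OF p, of "j + n"] by auto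
  qed (use j v in auto)
  have down: "vs' ! (j - n) \<in> set vs" for n
  proof (induction n)
    case (Suc n)
    show ?case
    proof (cases "n < j")
      case True
      then have "Suc (j - Suc n) = j - n" by simp
      then show ?thesis
        using step[of "es' ! (j - Suc n)" "vs' ! (j - n)"] path_edge[OF p, of "j - Suc n"] j True Suc by auto
    qed (use Suc in auto)
  qed (use j v in auto)
  show ?thesis
  proof
    fix w assume "w \<in> set vs'"
    then obtain i where i: "i \<le> length es'" "w = vs' ! i"
      using path_length[OF p] by (auto simp: in_set_conv_nth less_Suc_eq_le)
    then show "w \<in> set vs" using up[of "i - j"] down[of "j - i"] by (cases "j \<le> i") auto
  qed
qed

text \<open>The start of the second path lies on the first and has degree one, so it is one of its
  two ends; a maximal path is determined by its start.\<close>

lemma mpath_share_vertex: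
  assumes m: "mpath vs es" and m': "mpath vs' es'" and v: "v \<in> set vs" "v \<in> set vs'"
  shows "vs' = vs \<and> es' = es \<or> vs' = rev vs \<and> es' = rev es"
proof -
  note p = mpath_path[OF m] and p' = mpath_path[OF m']
  have "hd vs' \<in> set vs"
    using path_subset_mpath[OF m p' v] path_length[OF p'] by (cases vs') auto
  then obtain i where i: "i \<le> length es" "hd vs' = vs ! i"
    using path_length[OF p] by (auto simp: in_set_conv_nth less_Suc_eq_le)
  have "i = 0 \<or> i = length es"
  proof (rule ccontr)
    assume "\<not> ?thesis"
    then obtain k where k: "i = Suc k" "Suc k < length es" using i by (cases i) auto
    then have "es ! k = es' ! 0" "es ! Suc k = es' ! 0"
      using i path_edge[OF p, of k] path_edge[OF p, of "Suc k"] by (auto intro!: mpath_hd_edge[OF m'])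
    then show False using path_alternates[OF p k(2)] by simp
  qed
  then show ?thesis
    using mpath_unique[OF m m'] mpath_unique[OF maximal_path_rev[OF m] m'] i path_hd[OF p] path_last[OF p]
    by (auto simp: hd_rev)
qed

lemma mpath_share_edge:
  assumes m: "mpath vs es" and m': "mpath vs' es'" and e: "e \<in> set es" "e \<in> set es'"
  shows "vs' = vs \<and> es' = es \<or> vs' = rev vs \<and> es' = rev es"
proof -
  obtain i j where "i < length es" "e = es ! i" "j < length es'" "e = es' ! j"
    using e by (auto simp: in_set_conv_nth)
  then have "vs ! i \<in> ends e" "vs ! i \<in> set vs" "ends e \<subseteq> set vs'"
    using path_edge[OF mpath_path[OF m], of i] path_edge[OF mpath_path[OF m'], of j] by auto
  then show ?thesis by (intro mpath_share_vertex[OF m m', of "vs ! i"]) auto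
qed

lemma mpath_share_end:
  assumes m: "mpath vs es" and m': "mpath vs' es'" and v: "v \<in> {hd vs, last vs}" "v \<in> {hd vs', last vs'}"
  shows "vs' = vs \<and> es' = es \<or> vs' = rev vs \<and> es' = rev es"
proof -
  have "v \<in> set vs" "v \<in> set vs'"
    using v path_ne[OF mpath_path[OF m]] path_ne[OF mpath_path[OF m']] by (metis insertE singletonD hd_in_set last_in_set)+
  then show ?thesis by (rule mpath_share_vertex[OF m m'])
qed

text \<open>This is what makes the composite of two Brauer diagrams a Brauer diagram: its edges are
  the pairs of ends of maximal paths.\<close>

lemma partition_on_ends: "partition_on {v. outer v} {{hd vs, last vs} |vs es. mpath vs es}"
proof (rule partition_onI)
  show "\<Union>{{hd vs, last vs} |vs es. mpath vs es} = {v. outer v}"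
  proof (intro equalityI subsetI)
    fix v assume "v \<in> {v. outer v}"
    then obtain vs es where "mpath vs es" "hd vs = v" using mpath_exists by blast
    then show "v \<in> \<Union>{{hd vs, last vs} |vs es. mpath vs es}" by (intro UnionI[of "{hd vs, last vs}"]) auto
  qed (use mpath_outer in auto)
next
  fix p q assume "p \<in> {{hd vs, last vs} |vs es. mpath vs es}" "q \<in> {{hd vs, last vs} |vs es. mpath vs es}" "p \<noteq> q"
  then obtain vs es vs' es' where *: "mpath vs es" "mpath vs' es'" "p = {hd vs, last vs}" "q = {hd vs', last vs'}" by blast
  show "disjnt p q"
  proof (rule ccontr)
    assume "\<not> disjnt p q"
    then obtain v where "v \<in> p" "v \<in> q" by (auto simp: disjnt_def)
    then have "vs' = vs \<or> vs' = rev vs" using mpath_share_end[OF *(1,2), of v] * by auto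
    then have "q = p" using *(3,4) by (auto simp: hd_rev last_rev)
    then show False using \<open>p \<noteq> q\<close> by simp
  qed
qed auto

end

section \<open>Signs of lists of markings\<close>

text \<open>\<open>\<epsilon>\<close> to the number of inversions with respect to \<open>lt\<close>
  plus the number of bad entries.\<close>

fun weight :: "'k::comm_ring_1 \<Rightarrow> ('m \<Rightarrow> 'm \<Rightarrow> bool) \<Rightarrow> ('m \<Rightarrow> bool) \<Rightarrow> 'm list \<Rightarrow> 'k" where
  "weight \<epsilon> lt bad [] = 1"
| "weight \<epsilon> lt bad (x # xs) =
    (if bad x then \<epsilon> else 1) * (\<Prod>y\<leftarrow>xs. if lt y x then \<epsilon> else 1) * weight \<epsilon> lt bad xs"

text \<open>\<open>\<epsilon>\<close> to the number of inversions between an entry of the first and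
  an entry of the second list; the defect of multiplicativity of \<open>weight\<close> under
  concatenation.\<close>

definition cross :: "'k::comm_ring_1 \<Rightarrow> ('m \<Rightarrow> 'm \<Rightarrow> bool) \<Rightarrow> 'm list \<Rightarrow> 'm list \<Rightarrow> 'k" where
  "cross \<epsilon> lt xs ys = (\<Prod>x\<leftarrow>xs. \<Prod>y\<leftarrow>ys. if lt y x then \<epsilon> else 1)"

lemma cross_rec:
  "cross \<epsilon> lt [] zs = 1"
  "cross \<epsilon> lt (x # xs) zs = (\<Prod>y\<leftarrow>zs. if lt y x then \<epsilon> else 1) * cross \<epsilon> lt xs zs"
  by (simp_all add: cross_def)

lemma cross_append [simp]:
  "cross \<epsilon> lt (xs @ ys) zs = cross \<epsilon> lt xs zs * cross \<epsilon> lt ys zs"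
  "cross \<epsilon> lt zs (xs @ ys) = cross \<epsilon> lt zs xs * cross \<epsilon> lt zs ys"
proof -
  show "cross \<epsilon> lt (xs @ ys) zs = cross \<epsilon> lt xs zs * cross \<epsilon> lt ys zs"
    by (simp add: cross_def)
  show "cross \<epsilon> lt zs (xs @ ys) = cross \<epsilon> lt zs xs * cross \<epsilon> lt zs ys"
    by (induction zs) (simp_all only: cross_rec map_append prod_list.append mult_ac mult_1)
qed

lemma cross_Cons:
  "cross \<epsilon> lt (x # xs) zs = cross \<epsilon> lt [x] zs * cross \<epsilon> lt xs zs"
  "cross \<epsilon> lt zs (x # xs) = cross \<epsilon> lt zs [x] * cross \<epsilon> lt zs xs"
  using cross_append(1)[of \<epsilon> lt "[x]" xs zs] cross_append(2)[of \<epsilon> lt zs "[x]" xs]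
  by (simp_all only: append_Cons append_Nil)

lemma cross_Nil [simp]: "cross \<epsilon> lt [] ys = 1" "cross \<epsilon> lt xs [] = 1"
  unfolding cross_def by (induction xs) auto

lemma cross_one: "(\<And>x y. x \<in> set xs \<Longrightarrow> y \<in> set ys \<Longrightarrow> \<not> lt y x) \<Longrightarrow> cross \<epsilon> lt xs ys = 1"
proof (induction xs)
  case (Cons a xs)
  have "(\<Prod>y\<leftarrow>ys. if lt y a then \<epsilon> else 1) = 1"
    using Cons.prems by (induction ys) auto
  with Cons show ?case by (simp add: cross_def)
qed simp

lemma cross_cong:
  "(\<And>x. x \<in> set xs \<Longrightarrow> lt x a = lt x b) \<Longrightarrow> cross \<epsilon> lt [a] xs = cross \<epsilon> lt [b] xs"
  "(\<And>x. x \<in> set xs \<Longrightarrow> lt a x = lt b x) \<Longrightarrow> cross \<epsilon> lt xs [a] = cross \<epsilon> lt xs [b]"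
  unfolding cross_def by (induction xs) auto

lemma cross_square: "\<epsilon> * \<epsilon> = 1 \<Longrightarrow> cross \<epsilon> lt xs ys * cross \<epsilon> lt xs ys = 1"
proof (induction xs)
  case (Cons a xs)
  have "(\<Prod>y\<leftarrow>ys. if lt y a then \<epsilon> else 1) * (\<Prod>y\<leftarrow>ys. if lt y a then \<epsilon> else 1) = 1"
    using Cons.prems by (induction ys) (auto simp: algebra_simps mult.left_commute[of \<epsilon> \<epsilon>] simp flip: mult.assoc)
  then show ?case
    using Cons by (simp add: cross_def) (metis (no_types, lifting) mult.assoc mult.left_commute mult_1)
qed simp

lemma weight_Cons: "weight \<epsilon> lt bad (x # xs) = weight \<epsilon> lt bad [x] * cross \<epsilon> lt [x] xs * weight \<epsilon> lt bad xs"
  by (simp add: cross_def)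

declare weight.simps(2) [simp del]

lemma weight_single: "weight \<epsilon> lt bad [x] = (if bad x then \<epsilon> else 1)"
  by (simp add: weight.simps(2))

lemma weight_append: "weight \<epsilon> lt bad (xs @ ys) = weight \<epsilon> lt bad xs * weight \<epsilon> lt bad ys * cross \<epsilon> lt xs ys"
proof (induction xs)
  case (Cons x xs)
  show ?case
    using Cons.IH weight_Cons[of \<epsilon> lt bad x "xs @ ys"] weight_Cons[of \<epsilon> lt bad x xs] cross_Cons(1)[of \<epsilon> lt x xs ys]
    by (simp only: append_Cons cross_append mult_ac)
qed simp

lemma weight_pair: "weight \<epsilon> lt bad [a, b] =
    (if bad a then \<epsilon> else 1) * (if bad b then \<epsilon> else 1) * (if lt b a then \<epsilon> else 1)"
  by (simp add: weight.simps(2))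

text \<open>Only the relative order of \<open>a\<close> and \<open>b\<close> changes; all inversions
  with the remaining entries stay.\<close>

lemma weight_swap:
  assumes "\<epsilon> * \<epsilon> = 1" "lt a b \<noteq> lt b a"
  shows "weight \<epsilon> lt bad (xs @ [b, a] @ ys) = \<epsilon> * weight \<epsilon> lt bad (xs @ [a, b] @ ys)"
proof -
  have "weight \<epsilon> lt bad [b, a] = \<epsilon> * weight \<epsilon> lt bad [a, b]"
    using assms by (auto simp: weight_pair algebra_simps)
  moreover have "cross \<epsilon> lt xs [b, a] = cross \<epsilon> lt xs [a, b]" "cross \<epsilon> lt [b, a] ys = cross \<epsilon> lt [a, b] ys"
    by (simp_all add: cross_Cons(1)[of _ _ _ "[_]"] cross_Cons(2)[of _ _ _ _ "[_]"] mult.commute)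
  ultimately show ?thesis unfolding weight_append cross_append by (simp add: mult_ac)
qed

text \<open>\<open>a\<close> and \<open>b\<close> compare alike with every other entry, so each
  inversion with the rest occurs twice and cancels because
  \<open>\<epsilon> * \<epsilon> = 1\<close>.\<close>

lemma weight_remove:
  assumes "\<epsilon> * \<epsilon> = 1" "\<And>c. c \<in> set xs \<union> set ys \<Longrightarrow> lt c a = lt c b \<and> lt a c = lt b c"
  shows "weight \<epsilon> lt bad (xs @ [a, b] @ ys) = weight \<epsilon> lt bad [a, b] * weight \<epsilon> lt bad (xs @ ys)"
proof -
  have "cross \<epsilon> lt xs [a] = cross \<epsilon> lt xs [b]" "cross \<epsilon> lt [a] ys = cross \<epsilon> lt [b] ys"
    using assms(2) by (auto intro!: cross_cong)
  then have "cross \<epsilon> lt xs [a, b] = 1" "cross \<epsilon> lt [a, b] ys = 1"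
    using cross_square[OF assms(1)]
    by (simp_all add: cross_Cons(1)[of _ _ _ "[_]"] cross_Cons(2)[of _ _ _ _ "[_]"])
  then show ?thesis unfolding weight_append cross_append by (simp add: mult_ac)
qed

lemma weight_replace:
  assumes "\<epsilon> * \<epsilon> = 1" "\<And>c. c \<in> set xs \<union> set ys \<Longrightarrow> lt c a = lt c b \<and> lt a c = lt b c" "bad a \<noteq> bad b"
  shows "weight \<epsilon> lt bad (xs @ [b] @ ys) = \<epsilon> * weight \<epsilon> lt bad (xs @ [a] @ ys)"
proof -
  have "cross \<epsilon> lt xs [a] = cross \<epsilon> lt xs [b]" "cross \<epsilon> lt [a] ys = cross \<epsilon> lt [b] ys"
    using assms(2) by (auto intro!: cross_cong)
  moreover have "weight \<epsilon> lt bad [b] = \<epsilon> * weight \<epsilon> lt bad [a]"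
    using assms by (auto simp: weight_single)
  ultimately show ?thesis unfolding weight_append cross_append by (simp add: mult_ac)
qed

lemma weight_sorted:
  "sorted_wrt (\<lambda>x y. \<not> lt y x) xs \<Longrightarrow> (\<And>x. x \<in> set xs \<Longrightarrow> \<not> bad x) \<Longrightarrow> weight \<epsilon> lt bad xs = 1"
proof (induction xs)
  case (Cons x xs)
  have "cross \<epsilon> lt [x] xs = 1" using Cons.prems by (intro cross_one) auto
  then show ?case using Cons by (simp add: weight_Cons[of _ _ _ x xs] weight_single)
qed simp

lemma weight_cases: "\<epsilon> \<in> {1, -1} \<Longrightarrow> weight \<epsilon> lt bad xs \<in> {1, -1}"
proof (induction xs)
  case (Cons x xs)
  have "(\<Prod>y\<leftarrow>ys. if lt y x then \<epsilon> else 1) \<in> {1, -1}" for ys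
    using Cons.prems by (induction ys) auto
  from this[of xs] Cons show ?case by (auto simp: weight.simps)
qed simp

lemma weight_square: "\<epsilon> \<in> {1, -1} \<Longrightarrow> weight \<epsilon> lt bad xs * weight \<epsilon> lt bad xs = 1"
  using weight_cases[of \<epsilon> lt bad xs] by auto

lemma weight_epsilon_one: "weight 1 lt bad xs = 1"
proof (induction xs)
  case (Cons x xs)
  have "(\<Prod>y\<leftarrow>ys. if lt y x then 1 else 1) = (1 :: 'a)" for ys by (induction ys) auto
  with Cons show ?case by (simp add: weight.simps)
qed simp

text \<open>The two lists may have different types. It compares the sign of a stack with that of the
  simplified diagram, and the signs of two stacks with the same middle part.\<close>

lemma weight_cong:
  assumes "length xs = length ys"
    and "\<And>i. i < length xs \<Longrightarrow> bad (xs ! i) = bad' (ys ! i)"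
    and "\<And>i j. i < j \<Longrightarrow> j < length xs \<Longrightarrow> lt (xs ! j) (xs ! i) = lt' (ys ! j) (ys ! i)"
  shows "weight \<epsilon> lt bad xs = weight \<epsilon> lt' bad' ys"
  using assms
proof (induction xs ys rule: list_induct2)
  case (Cons x xs y ys)
  have "weight \<epsilon> lt bad xs = weight \<epsilon> lt' bad' ys"
    using Cons.prems[of "Suc _"] Cons.prems(2)[of "Suc _" "Suc _"] by (intro Cons.IH) auto
  moreover have "map (\<lambda>z. if lt z x then \<epsilon> else 1) xs = map (\<lambda>z. if lt' z y then \<epsilon> else 1) ys"
    using Cons.hyps Cons.prems(2)[of 0 "Suc _"] by (intro nth_equalityI) auto
  moreover have "bad x = bad' y" using Cons.prems(1)[of 0] by simp
  ultimately show ?case by (simp add: weight.simps)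
qed simp

inductive adj_swap :: "'a list \<Rightarrow> 'a list \<Rightarrow> bool" where
  "adj_swap (xs @ [a, b] @ ys) (xs @ [b, a] @ ys)"

lemma adj_swap_Cons: "adj_swap xs ys \<Longrightarrow> adj_swap (a # xs) (a # ys)"
  by (erule adj_swap.cases) (metis adj_swap.intros append_Cons)

lemma adj_swaps_Cons: "adj_swap\<^sup>*\<^sup>* xs ys \<Longrightarrow> adj_swap\<^sup>*\<^sup>* (a # xs) (a # ys)"
  by (induction rule: rtranclp_induct) (auto intro: rtranclp.rtrancl_into_rtrancl adj_swap_Cons)

lemma adj_swap_move: "adj_swap\<^sup>*\<^sup>* (a # xs @ ys) (xs @ a # ys)"
proof (induction xs)
  case (Cons x xs)
  have "adj_swap (a # x # xs @ ys) (x # a # xs @ ys)"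
    using adj_swap.intros[of "[]" a x "xs @ ys"] by simp
  also have "adj_swap\<^sup>*\<^sup>* (x # a # xs @ ys) (x # xs @ a # ys)"
    by (rule adj_swaps_Cons[OF Cons.IH])
  finally show ?case by simp
qed simp

lemma adj_swaps_mset: "mset xs = mset ys \<Longrightarrow> adj_swap\<^sup>*\<^sup>* xs ys"
proof (induction xs arbitrary: ys)
  case (Cons a xs)
  then have "a \<in> set ys" by (metis list.set_intros(1) set_mset_mset)
  then obtain us vs where ys: "ys = us @ a # vs" by (auto simp: in_set_conv_decomp)
  then have "adj_swap\<^sup>*\<^sup>* xs (us @ vs)" using Cons by simp
  then have "adj_swap\<^sup>*\<^sup>* (a # xs) (a # us @ vs)" by (rule adj_swaps_Cons)
  also have "adj_swap\<^sup>*\<^sup>* (a # us @ vs) ys" unfolding ys by (rule adj_swap_move)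
  finally show ?case .
qed simp

section \<open>Brauer diagrams and their standard markings\<close>

lemma brauer_diagram_edge:
  assumes "brauer_diagram r s D" "e \<in> D"
  shows "card e = 2" "e \<subseteq> Top ` {1..r} \<union> Bot ` {1..s}" "finite e"
  using assms by (auto simp: brauer_diagram_def partition_on_def card_2_iff)

lemma brauer_diagram_unique:
  assumes "brauer_diagram r s D" "e \<in> D" "f \<in> D" "v \<in> e" "v \<in> f"
  shows "e = f"
  using assms by (auto simp: brauer_diagram_def partition_on_def disjoint_def)

lemma brauer_diagram_ex:
  assumes "brauer_diagram r s D" "v \<in> Top ` {1..r} \<union> Bot ` {1..s}"
  shows "\<exists>e\<in>D. v \<in> e"
  using assms by (auto simp: brauer_diagram_def partition_on_def)

lemma finite_brauer_diagram: "brauer_diagram r s D \<Longrightarrow> finite D"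
  unfolding brauer_diagram_def partition_on_def by (auto intro!: finite_UnionD)

lemma cupsE:
  assumes "brauer_diagram r s D" "e \<in> cups D"
  obtains a b where "e = {Top a, Top b}" "a < b" "1 \<le> a" "b \<le> r" "e \<in> D"
proof -
  have e: "e \<in> D" "e \<subseteq> range Top" using assms(2) by (auto simp: cups_def)
  obtain x y where xy: "e = {x, y}" "x \<noteq> y" using brauer_diagram_edge[OF assms(1) e(1)] by (auto simp: card_2_iff)
  obtain a b where "x = Top a" "y = Top b" using e xy by auto
  then show ?thesis
    using that[of a b] that[of b a] brauer_diagram_edge(2)[OF assms(1) e(1)] xy e
    by (cases "a < b") (auto simp: insert_commute)
qed

lemma capsE:
  assumes "brauer_diagram r s D" "e \<in> caps D"
  obtains a b where "e = {Bot a, Bot b}" "a < b" "1 \<le> a" "b \<le> s" "e \<in> D"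
proof -
  have e: "e \<in> D" "e \<subseteq> range Bot" using assms(2) by (auto simp: caps_def)
  obtain x y where xy: "e = {x, y}" "x \<noteq> y" using brauer_diagram_edge[OF assms(1) e(1)] by (auto simp: card_2_iff)
  obtain a b where "x = Bot a" "y = Bot b" using e xy by auto
  then show ?thesis
    using that[of a b] that[of b a] brauer_diagram_edge(2)[OF assms(1) e(1)] xy e
    by (cases "a < b") (auto simp: insert_commute)
qed

lemma throughE:
  assumes "brauer_diagram r s D" "e \<in> through_strings D"
  obtains a b where "e = {Top a, Bot b}" "1 \<le> a" "a \<le> r" "1 \<le> b" "b \<le> s" "e \<in> D"
proof -
  have e: "e \<in> D" "\<not> e \<subseteq> range Top" "\<not> e \<subseteq> range Bot"
    using assms(2) by (auto simp: through_strings_def cups_def caps_def)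
  obtain x y where xy: "e = {x, y}" "x \<noteq> y" using brauer_diagram_edge[OF assms(1) e(1)] by (auto simp: card_2_iff)
  then have "x \<in> Top ` {1..r} \<union> Bot ` {1..s}" "y \<in> Top ` {1..r} \<union> Bot ` {1..s}"
    using brauer_diagram_edge(2)[OF assms(1) e(1)] by auto
  then show ?thesis using that xy e by (auto simp: insert_commute)
qed

lemma through_strings_iff: "{Top a, Bot b} \<in> through_strings D \<longleftrightarrow> {Top a, Bot b} \<in> D"
  by (auto simp: through_strings_def cups_def caps_def)

lemma left_end_pair [simp]: "left_end {Top a, Top b} = min a b" "left_end {Bot a, Bot b} = min a b"
  by (simp_all add: left_end_def)

lemma left_end_cup: "brauer_diagram r s D \<Longrightarrow> e \<in> cups D \<Longrightarrow> Top (left_end e) \<in> e"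
  by (erule (1) cupsE) auto

lemma left_end_cap: "brauer_diagram r s D \<Longrightarrow> e \<in> caps D \<Longrightarrow> Bot (left_end e) \<in> e"
  by (erule (1) capsE) auto

lemma right_end_cap: "brauer_diagram r s D \<Longrightarrow> e \<in> caps D \<Longrightarrow> Bot (Max (pos ` e)) \<in> e"
  by (erule (1) capsE) (auto simp: max_def)

lemma cups_caps_subset: "cups D \<subseteq> D" "caps D \<subseteq> D"
  by (auto simp: cups_def caps_def)

lemma inj_left_end:
  assumes "brauer_diagram r s D"
  shows "inj_on left_end (cups D)" "inj_on left_end (caps D)"
proof -
  show "inj_on left_end (cups D)"
  proof (rule inj_onI)
    fix e f assume e: "e \<in> cups D" "f \<in> cups D" "left_end e = left_end f"
    then show "e = f"
      using left_end_cup[OF assms, of e] left_end_cup[OF assms, of f] cups_caps_subset(1)[of D]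
      by (intro brauer_diagram_unique[OF assms, of e f "Top (left_end e)"]) auto
  qed
  show "inj_on left_end (caps D)"
  proof (rule inj_onI)
    fix e f assume e: "e \<in> caps D" "f \<in> caps D" "left_end e = left_end f"
    then show "e = f"
      using left_end_cap[OF assms, of e] left_end_cap[OF assms, of f] cups_caps_subset(2)[of D]
      by (intro brauer_diagram_unique[OF assms, of e f "Bot (left_end e)"]) auto
  qed
qed

text \<open>Edges are sets of vertices without a linear order, so they are sorted through their left
  ends and recovered by the inverse of \<open>left_end\<close>.\<close>

definition sort_edges :: "vertex set set \<Rightarrow> vertex set list" where
  "sort_edges X = map (the_inv_into X left_end) (sorted_list_of_set (left_end ` X))"

lemma sort_edges:
  assumes "finite X" "inj_on left_end X"
  shows "set (sort_edges X) = X" "distinct (sort_edges X)" "sorted_wrt (\<lambda>e f. left_end e < left_end f) (sort_edges X)"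
proof -
  show "set (sort_edges X) = X"
    using assms by (auto simp: sort_edges_def image_image the_inv_into_f_f)
  have inv: "left_end (the_inv_into X left_end i) = i" if "i \<in> left_end ` X" for i
    using that assms by (rule_tac f_the_inv_into_f) auto
  have "inj_on (the_inv_into X left_end) (left_end ` X)"
    by (rule inj_on_the_inv_into[OF assms(2)])
  then show "distinct (sort_edges X)"
    using assms by (auto simp: sort_edges_def distinct_map)
  have "sorted_wrt (<) (map left_end (sort_edges X))"
    unfolding sort_edges_def map_map using assms inv by (subst map_idI) auto
  then show "sorted_wrt (\<lambda>e f. left_end e < left_end f) (sort_edges X)"
    by (simp add: sorted_wrt_map)
qed

definition right_arrow :: "vertex set \<Rightarrow> vertex set mark" where
  "right_arrow e = Arrow e (Bot (Max (pos ` e)))"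

definition std_marks :: "vertex set set \<Rightarrow> vertex set mark list" where
  "std_marks D = map Bead (sort_edges (cups D)) @ map right_arrow (rev (sort_edges (caps D)))"

text \<open>The bad entries in the sign of a marked diagram: arrows that differ from those of a
  standard diagram.\<close>

fun left_arrow :: "vertex set mark \<Rightarrow> bool" where
  "left_arrow (Bead e) = False"
| "left_arrow (Arrow e v) = (pos v \<noteq> Max (pos ` e))"

lemma standard_std_marks:
  assumes D: "brauer_diagram r s D"
  shows "standard r s (D, std_marks D)"
proof -
  have fin: "finite (cups D)" "finite (caps D)"
    by (rule finite_subset[OF _ finite_brauer_diagram[OF D]], rule cups_caps_subset)+
  note se = sort_edges[OF fin(1) inj_left_end(1)[OF D]] sort_edges[OF fin(2) inj_left_end(2)[OF D]]
  have disj: "cups D \<inter> caps D = {}"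
  proof -
    have "e \<notin> caps D" if "e \<in> cups D" for e
      by (rule cupsE[OF D that]) (auto simp: caps_def)
    then show ?thesis by blast
  qed
  have "map mark_edge (std_marks D) = sort_edges (cups D) @ rev (sort_edges (caps D))"
    by (simp add: std_marks_def comp_def right_arrow_def rev_map[symmetric])
  then have "distinct (map mark_edge (std_marks D))"
    using se disj by simp
  moreover have "v \<in> e" if "Arrow e v \<in> set (std_marks D)" for e v
    using that se right_end_cap[OF D] by (auto simp: std_marks_def right_arrow_def)
  moreover have "{e. Bead e \<in> set (std_marks D)} = cups D" "{e. \<exists>v. Arrow e v \<in> set (std_marks D)} = caps D"
    using se by (auto simp: std_marks_def right_arrow_def)
  ultimately have "marked_diagram r s (D, std_marks D)"
    using D by (simp add: marked_diagram_def)
  moreover have "sorted_wrt earlier (std_marks D)"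
    using se unfolding std_marks_def
    by (auto simp: sorted_wrt_append sorted_wrt_map sorted_wrt_rev right_arrow_def)
  moreover have "pos v = Max (pos ` e)" if "Arrow e v \<in> set (std_marks D)" for e v
    using that by (auto simp: std_marks_def right_arrow_def)
  ultimately show ?thesis by (simp add: standard_def)
qed

text \<open>The scalar relating a marked diagram to the standard one on the same Brauer diagram, see
  \<open>relation_std\<close>.\<close>

definition marks_sign :: "'k::field \<Rightarrow> vertex set mark list \<Rightarrow> 'k" where
  "marks_sign \<epsilon> ms = weight \<epsilon> earlier left_arrow ms"

lemma earlier_asym: "earlier m n \<Longrightarrow> \<not> earlier n m"
  by (cases m; cases n) auto

lemma marks_sign_standard: "standard r s M \<Longrightarrow> marks_sign \<epsilon> (snd M) = 1"
  unfolding marks_sign_def standard_def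
  by (intro weight_sorted) (auto elim!: sorted_wrt_mono_rel[rotated] dest: earlier_asym elim: left_arrow.elims)

lemma marked_diagramD:
  assumes "marked_diagram r s (D, ms)"
  shows "brauer_diagram r s D" "distinct (map mark_edge ms)" "Bead e \<in> set ms \<longleftrightarrow> e \<in> cups D"
    "Arrow e v \<in> set ms \<Longrightarrow> e \<in> caps D" "e \<in> caps D \<Longrightarrow> \<exists>v. Arrow e v \<in> set ms"
    "Arrow e v \<in> set ms \<Longrightarrow> v \<in> e"
  using assms unfolding marked_diagram_def by auto

lemma earlier_total:
  assumes "marked_diagram r s (D, ms)" "a \<in> set ms" "b \<in> set ms" "mark_edge a \<noteq> mark_edge b"
  shows "earlier a b \<noteq> earlier b a"
proof -
  note D = marked_diagramD[OF assms(1)]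
  have B: "left_end e \<noteq> left_end f" if "Bead e \<in> set ms" "Bead f \<in> set ms" "e \<noteq> f" for e f
    using that inj_on_eq_iff[OF inj_left_end(1)[OF D(1)], of e f] by (simp add: D(3))
  have A: "left_end e \<noteq> left_end f" if "Arrow e v \<in> set ms" "Arrow f w \<in> set ms" "e \<noteq> f" for e f v w
    using that inj_on_eq_iff[OF inj_left_end(2)[OF D(1)], of e f] D(4)[OF that(1)] D(4)[OF that(2)] by simp
  show ?thesis
  proof (cases a)
    case (Bead e)
    then show ?thesis using assms(2-) B[of e] by (cases b) (auto simp: neq_iff)
  next
    case (Arrow e v)
    then show ?thesis using assms(2-) A[of e v] by (cases b) (fastforce simp: neq_iff)+
  qed
qed

lemma cap_ends:
  assumes "brauer_diagram r s D" "{v, w} \<in> caps D" "v \<noteq> w"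
  shows "pos v \<noteq> pos w" "Max (pos ` {v, w}) \<in> {pos v, pos w}"
proof -
  obtain a b where "{v, w} = {Bot a, Bot b}" "a < b" using capsE[OF assms(1,2)] by metis
  then have "(v = Bot a \<and> w = Bot b \<or> v = Bot b \<and> w = Bot a) \<and> a < b" by (auto simp: doubleton_eq_iff)
  then show "pos v \<noteq> pos w" "Max (pos ` {v, w}) \<in> {pos v, pos w}" by (auto simp: max_def)
qed

lemma marks_sign_interchange:
  assumes "marked_diagram r s (D, xs @ [a, b] @ ys)" "\<epsilon> \<in> {1, -1}"
  shows "marks_sign \<epsilon> (xs @ [b, a] @ ys) = \<epsilon> * marks_sign \<epsilon> (xs @ [a, b] @ ys)"
  unfolding marks_sign_def
  using assms marked_diagramD(2)[OF assms(1)] by (intro weight_swap earlier_total[OF assms(1)]) auto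

lemma marks_sign_reverse:
  assumes "marked_diagram r s (D, xs @ [Arrow e v] @ ys)" "\<epsilon> \<in> {1, -1}" "e = {v, w}" "v \<noteq> w"
  shows "marks_sign \<epsilon> (xs @ [Arrow e w] @ ys) = \<epsilon> * marks_sign \<epsilon> (xs @ [Arrow e v] @ ys)"
  unfolding marks_sign_def
proof (rule weight_replace)
  note D = marked_diagramD[OF assms(1)]
  have "e \<in> caps D" using D(4)[of e v] by simp
  then show "left_arrow (Arrow e v) \<noteq> left_arrow (Arrow e w)"
    using cap_ends[OF D(1), of v w] assms(3,4) by auto
  show "earlier c (Arrow e v) = earlier c (Arrow e w) \<and> earlier (Arrow e v) c = earlier (Arrow e w) c" for c
    by (cases c) auto
qed (use assms in auto)

lemma marked_interchange:
  "marked_diagram r s (D, xs @ [a, b] @ ys) \<Longrightarrow> marked_diagram r s (D, xs @ [b, a] @ ys)"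
  unfolding marked_diagram_def by auto

lemma marked_reverse:
  assumes "marked_diagram r s (D, xs @ [Arrow e v] @ ys)" "w \<in> e"
  shows "marked_diagram r s (D, xs @ [Arrow e w] @ ys)"
proof -
  note D = marked_diagramD[OF assms(1)]
  have "Arrow e u \<notin> set xs \<union> set ys" for u
    using D(2) by (force simp: image_iff)
  then have "{f. \<exists>u. Arrow f u \<in> set (xs @ [Arrow e w] @ ys)} = {f. \<exists>u. Arrow f u \<in> set (xs @ [Arrow e v] @ ys)}"
    by auto
  then show ?thesis using assms unfolding marked_diagram_def by auto
qed

section \<open>The relation space\<close>

abbreviation signed_basis :: "'k::field \<Rightarrow> mdiagram \<Rightarrow> mdiagram \<Rightarrow> 'k" where
  "signed_basis \<epsilon> M \<equiv> fun_scale (marks_sign \<epsilon> (snd M)) (basis_vec M)"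

lemma relation_space_subspace: "fun_vs.subspace (relation_space r s \<epsilon>)"
  by (simp add: relation_space_def)

lemma fun_scale_diff: "fun_scale c (x - y) = fun_scale c x - fun_scale c y"
  by (rule fun_vs.scale_right_diff_distrib)

text \<open>Rescaled by its sign, the relation says that two signed basis vectors are congruent.
  Chains of relations then compose by transitivity, with no scalars to track.\<close>

lemma relation_interchange:
  assumes "\<epsilon> \<in> {1, -1}" "marked_diagram r s (D, xs @ [a, b] @ ys)"
  shows "signed_basis \<epsilon> (D, xs @ [b, a] @ ys) - signed_basis \<epsilon> (D, xs @ [a, b] @ ys) \<in> relation_space r s \<epsilon>"
proof -
  let ?M = "(D, xs @ [a, b] @ ys)" and ?M' = "(D, xs @ [b, a] @ ys)"
  have "basis_vec ?M' - fun_scale \<epsilon> (basis_vec ?M) \<in> relation_space r s \<epsilon>"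
    unfolding relation_space_def using assms(2) by (intro fun_vs.span_base) blast
  then have "fun_scale (marks_sign \<epsilon> (snd ?M')) (basis_vec ?M' - fun_scale \<epsilon> (basis_vec ?M)) \<in> relation_space r s \<epsilon>"
    by (rule fun_vs.subspace_scale[OF relation_space_subspace])
  also have "fun_scale (marks_sign \<epsilon> (snd ?M')) (basis_vec ?M' - fun_scale \<epsilon> (basis_vec ?M)) =
     signed_basis \<epsilon> ?M' - signed_basis \<epsilon> ?M"
    using marks_sign_interchange[OF assms(2,1)] assms(1)
    by (auto simp: fun_scale_diff fun_scale_scale)
  finally show ?thesis .
qed

lemma relation_reverse:
  assumes "\<epsilon> \<in> {1, -1}" "marked_diagram r s (D, xs @ [Arrow e v] @ ys)" "e = {v, w}" "v \<noteq> w"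
  shows "signed_basis \<epsilon> (D, xs @ [Arrow e w] @ ys) - signed_basis \<epsilon> (D, xs @ [Arrow e v] @ ys) \<in> relation_space r s \<epsilon>"
proof -
  let ?M = "(D, xs @ [Arrow e v] @ ys)" and ?M' = "(D, xs @ [Arrow e w] @ ys)"
  have "basis_vec ?M' - fun_scale \<epsilon> (basis_vec ?M) \<in> relation_space r s \<epsilon>"
    unfolding relation_space_def using assms(2-4) by (intro fun_vs.span_base) blast
  then have "fun_scale (marks_sign \<epsilon> (snd ?M')) (basis_vec ?M' - fun_scale \<epsilon> (basis_vec ?M)) \<in> relation_space r s \<epsilon>"
    by (rule fun_vs.subspace_scale[OF relation_space_subspace])
  also have "fun_scale (marks_sign \<epsilon> (snd ?M')) (basis_vec ?M' - fun_scale \<epsilon> (basis_vec ?M)) =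
     signed_basis \<epsilon> ?M' - signed_basis \<epsilon> ?M"
    using marks_sign_reverse[OF assms(2,1,3,4)] assms(1)
    by (auto simp: fun_scale_diff fun_scale_scale)
  finally show ?thesis .
qed

lemma relation_trans:
  "x - y \<in> relation_space r s \<epsilon> \<Longrightarrow> y - z \<in> relation_space r s \<epsilon> \<Longrightarrow> x - z \<in> relation_space r s \<epsilon>"
  using fun_vs.subspace_add[OF relation_space_subspace, of "x - y" r s \<epsilon> "y - z"] by simp

lemma relation_sym: "x - y \<in> relation_space r s \<epsilon> \<Longrightarrow> y - x \<in> relation_space r s \<epsilon>"
  using fun_vs.subspace_neg[OF relation_space_subspace, of "x - y" r s \<epsilon>] by simp

lemma relation_refl: "x - x \<in> relation_space r s \<epsilon>"
  using fun_vs.subspace_0[OF relation_space_subspace] by simp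

lemma relation_permute:
  assumes "\<epsilon> \<in> {1, -1}" "adj_swap\<^sup>*\<^sup>* ms ns" "marked_diagram r s (D, ms)"
  shows "marked_diagram r s (D, ns) \<and> signed_basis \<epsilon> (D, ns) - signed_basis \<epsilon> (D, ms) \<in> relation_space r s \<epsilon>"
  using assms(2)
proof (induction rule: rtranclp_induct)
  case (step ns ns')
  from step.hyps(2) obtain xs a b ys where ns: "ns = xs @ [a, b] @ ys" "ns' = xs @ [b, a] @ ys"
    by (auto elim: adj_swap.cases)
  have M: "marked_diagram r s (D, xs @ [a, b] @ ys)"
    and R: "signed_basis \<epsilon> (D, xs @ [a, b] @ ys) - signed_basis \<epsilon> (D, ms) \<in> relation_space r s \<epsilon>"
    using step.IH unfolding ns(1) by blast+
  show ?case
    using marked_interchange[OF M] relation_trans[OF relation_interchange[OF assms(1) M] R]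
    unfolding ns(2) by blast
qed (use assms relation_refl in blast)

text \<open>Induction on the number of arrows that point left; each reversal removes one and keeps
  the signed basis vector modulo relations.\<close>

lemma relation_straighten:
  assumes "\<epsilon> \<in> {1, -1}" "marked_diagram r s (D, ms)"
  shows "\<exists>ns. marked_diagram r s (D, ns) \<and> (\<forall>m\<in>set ns. \<not> left_arrow m) \<and>
    signed_basis \<epsilon> (D, ms) - signed_basis \<epsilon> (D, ns) \<in> relation_space r s \<epsilon>"
  using assms(2)
proof (induction "length (filter left_arrow ms)" arbitrary: ms rule: less_induct)
  case less
  show ?case
  proof (cases "\<exists>m\<in>set ms. left_arrow m")
    case True
    then obtain m where m: "m \<in> set ms" "left_arrow m" by blast
    from m(2) obtain e v where ev: "m = Arrow e v" by (cases m) auto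
    note D = marked_diagramD[OF less.prems]
    have cap: "e \<in> caps D" "v \<in> e" using D(4,6) m ev by auto
    then have "card e = 2" using D(1) brauer_diagram_edge cups_caps_subset by blast
    then obtain w where w: "e = {v, w}" "v \<noteq> w"
      using cap(2) unfolding card_2_iff by (metis insert_iff insert_commute singletonD)
    obtain xs ys where ms: "ms = xs @ [Arrow e v] @ ys"
      using m(1) ev by (auto simp: in_set_conv_decomp)
    let ?ns = "xs @ [Arrow e w] @ ys"
    have ns: "marked_diagram r s (D, ?ns)" using marked_reverse less.prems w unfolding ms by blast
    have "\<not> left_arrow (Arrow e w)"
      using m(2) ev cap_ends[OF D(1), of v w] cap w by auto
    then have "length (filter left_arrow ?ns) < length (filter left_arrow ms)"
      using m(2) unfolding ms ev by auto
    from less.hyps[OF this ns] show ?thesis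
      using relation_sym[OF relation_reverse[OF assms(1) less.prems[unfolded ms] w]] relation_trans
      unfolding ms by blast
  qed (use less.prems relation_refl in blast)
qed

text \<open>Once all arrows point right, the Brauer diagram determines which markings occur, and
  only their order is left free.\<close>

lemma straight_marks_mset:
  assumes "marked_diagram r s (D, ms)" "marked_diagram r s (D, ns)"
    and "\<forall>m\<in>set ms. \<not> left_arrow m" "\<forall>m\<in>set ns. \<not> left_arrow m"
  shows "mset ms = mset ns"
proof -
  have *: "set ms = Bead ` cups D \<union> right_arrow ` caps D \<and> distinct ms"
    if M: "marked_diagram r s (D, ms)" "\<forall>m\<in>set ms. \<not> left_arrow m" for ms
  proof -
    note D = marked_diagramD[OF M(1)]
    have arr: "v = Bot (Max (pos ` e))" if "Arrow e v \<in> set ms" for e v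
    proof -
      have "v \<in> e" "e \<subseteq> range Bot" using D(4,6)[OF that] by (auto simp: caps_def)
      then have "v = Bot (pos v)" by auto
      then show ?thesis using M(2) that by auto
    qed
    have "m \<in> set ms \<longleftrightarrow> m \<in> Bead ` cups D \<union> right_arrow ` caps D" for m
      using D(3,4,5) arr by (cases m) (auto simp: right_arrow_def, metis)
    moreover have "distinct ms" using D(2) by (simp add: distinct_map)
    ultimately show ?thesis by blast
  qed
  show ?thesis using *[OF assms(1,3)] *[OF assms(2,4)] by (metis set_eq_iff_mset_eq_distinct)
qed

lemma relation_std:
  assumes "\<epsilon> \<in> {1, -1}" "marked_diagram r s (D, ms)"
  shows "signed_basis \<epsilon> (D, ms) - basis_vec (D, std_marks D) \<in> relation_space r s \<epsilon>"
proof -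
  obtain ns where ns: "marked_diagram r s (D, ns)" "\<forall>m\<in>set ns. \<not> left_arrow m"
    "signed_basis \<epsilon> (D, ms) - signed_basis \<epsilon> (D, ns) \<in> relation_space r s \<epsilon>"
    using relation_straighten[OF assms] by blast
  have std: "standard r s (D, std_marks D)"
    using marked_diagramD(1)[OF assms(2)] by (rule standard_std_marks)
  then have M: "marked_diagram r s (D, std_marks D)" and "\<forall>m\<in>set (std_marks D). \<not> left_arrow m"
    by (auto simp: standard_def elim!: left_arrow.elims)
  then have "mset (std_marks D) = mset ns"
    using ns by (intro straight_marks_mset[of r s D])
  then have "signed_basis \<epsilon> (D, ns) - signed_basis \<epsilon> (D, std_marks D) \<in> relation_space r s \<epsilon>"
    using relation_permute[OF assms(1) adj_swaps_mset M] by blast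
  from relation_trans[OF ns(3) this] show ?thesis
    using marks_sign_standard[OF std, of \<epsilon>] by (simp only: snd_conv fun_scale_one)
qed

text \<open>On the free space the kernel of its linear extension is exactly the relation space, by
  \<open>relation_space_kernel\<close>.\<close>

definition signed_diagram :: "'k::field \<Rightarrow> mdiagram \<Rightarrow> vertex set set \<Rightarrow> 'k" where
  "signed_diagram \<epsilon> M = fun_scale (marks_sign \<epsilon> (snd M)) (basis_vec (fst M))"

lemma relation_space_induct:
  assumes "x \<in> relation_space r s \<epsilon>" "fun_vs.subspace U"
    and "\<And>D xs a b ys. marked_diagram r s (D, xs @ [a, b] @ ys) \<Longrightarrow>
      basis_vec (D, xs @ [b, a] @ ys) - fun_scale \<epsilon> (basis_vec (D, xs @ [a, b] @ ys)) \<in> U"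
    and "\<And>D xs e v w ys. marked_diagram r s (D, xs @ [Arrow e v] @ ys) \<Longrightarrow> e = {v, w} \<Longrightarrow> v \<noteq> w \<Longrightarrow>
      basis_vec (D, xs @ [Arrow e w] @ ys) - fun_scale \<epsilon> (basis_vec (D, xs @ [Arrow e v] @ ys)) \<in> U"
  shows "x \<in> U"
proof -
  have "relation_space r s \<epsilon> \<subseteq> U"
    unfolding relation_space_def by (rule fun_vs.span_minimal[OF _ assms(2)]) (use assms(3,4) in blast)
  then show ?thesis using assms(1) ..
qed

lemma relation_space_subset: "relation_space r s \<epsilon> \<subseteq> free_space (marked_diagrams r s)"
proof
  fix x assume "x \<in> relation_space r s \<epsilon>"
  then show "x \<in> free_space (marked_diagrams r s)"
  proof (rule relation_space_induct)
    fix D xs a b ys assume "marked_diagram r s (D, xs @ [a, b] @ ys)"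
    then show "basis_vec (D, xs @ [b, a] @ ys) - fun_scale \<epsilon> (basis_vec (D, xs @ [a, b] @ ys)) \<in> free_space (marked_diagrams r s)"
      using marked_interchange by (intro free_space_diff free_space_scale basis_vec_in_free_space CollectI)
  next
    fix D xs e v w ys assume "marked_diagram r s (D, xs @ [Arrow e v] @ ys)" "e = {v, w}"
    then show "basis_vec (D, xs @ [Arrow e w] @ ys) - fun_scale \<epsilon> (basis_vec (D, xs @ [Arrow e v] @ ys)) \<in> free_space (marked_diagrams r s)"
      using marked_reverse[of r s D xs e v ys w] by (intro free_space_diff free_space_scale basis_vec_in_free_space CollectI) blast+
  qed (rule free_space_subspace)
qed

lemma lin_relation_space:
  assumes x: "x \<in> relation_space r s \<epsilon>"
    and interchange: "\<And>D xs a b ys. marked_diagram r s (D, xs @ [a, b] @ ys) \<Longrightarrow>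
      F (D, xs @ [b, a] @ ys) = fun_scale \<epsilon> (F (D, xs @ [a, b] @ ys))"
    and reverse: "\<And>D xs e v w ys. marked_diagram r s (D, xs @ [Arrow e v] @ ys) \<Longrightarrow> e = {v, w} \<Longrightarrow> v \<noteq> w \<Longrightarrow>
      F (D, xs @ [Arrow e w] @ ys) = fun_scale \<epsilon> (F (D, xs @ [Arrow e v] @ ys))"
  shows "lin F x = 0"
proof -
  let ?U = "{x \<in> free_space (marked_diagrams r s). lin F x = 0}"
  have U: "fun_vs.subspace ?U"
    by (rule fun_vs.subspaceI) (auto simp only: mem_Collect_eq free_space_zero free_space_add free_space_scale
        lin_add[of _ "marked_diagrams r s"] lin_scale lin_zero add_0_left fun_scale_zero)
  have "x \<in> ?U"
    using x
  proof (rule relation_space_induct[OF _ U])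
    fix D xs a b ys assume M: "marked_diagram r s (D, xs @ [a, b] @ ys)"
    have F: "basis_vec (D, xs @ [b, a] @ ys) \<in> free_space (marked_diagrams r s)"
      "fun_scale \<epsilon> (basis_vec (D, xs @ [a, b] @ ys)) \<in> free_space (marked_diagrams r s)"
      by (rule basis_vec_in_free_space, use marked_interchange[OF M] in simp)
        (rule free_space_scale, rule basis_vec_in_free_space, use M in simp)
    have "lin F (basis_vec (D, xs @ [b, a] @ ys) - fun_scale \<epsilon> (basis_vec (D, xs @ [a, b] @ ys))) = 0"
      unfolding lin_diff[OF F] lin_scale lin_basis_vec interchange[OF M] by simp
    then show "basis_vec (D, xs @ [b, a] @ ys) - fun_scale \<epsilon> (basis_vec (D, xs @ [a, b] @ ys)) \<in> ?U"
      using free_space_diff[OF F] by blast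
  next
    fix D xs e v w ys assume M: "marked_diagram r s (D, xs @ [Arrow e v] @ ys)" "e = {v, w}" "v \<noteq> w"
    have F: "basis_vec (D, xs @ [Arrow e w] @ ys) \<in> free_space (marked_diagrams r s)"
      "fun_scale \<epsilon> (basis_vec (D, xs @ [Arrow e v] @ ys)) \<in> free_space (marked_diagrams r s)"
      by (rule basis_vec_in_free_space, use M marked_reverse[OF M(1), of w] in simp)
        (rule free_space_scale, rule basis_vec_in_free_space, use M in simp)
    have "lin F (basis_vec (D, xs @ [Arrow e w] @ ys) - fun_scale \<epsilon> (basis_vec (D, xs @ [Arrow e v] @ ys))) = 0"
      unfolding lin_diff[OF F] lin_scale lin_basis_vec reverse[OF M] by simp
    then show "basis_vec (D, xs @ [Arrow e w] @ ys) - fun_scale \<epsilon> (basis_vec (D, xs @ [Arrow e v] @ ys)) \<in> ?U"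
      using free_space_diff[OF F] by blast
  qed
  then show ?thesis by blast
qed

lemma signed_diagram_relation:
  assumes "\<epsilon> \<in> {1, -1}" "x \<in> relation_space r s \<epsilon>"
  shows "lin (signed_diagram \<epsilon>) x = 0"
  using assms(2)
proof (rule lin_relation_space)
  fix D xs e v w ys assume M: "marked_diagram r s (D, xs @ [Arrow e v] @ ys)" "e = {v, w}" "v \<noteq> w"
  show "signed_diagram \<epsilon> (D, xs @ [Arrow e w] @ ys) = fun_scale \<epsilon> (signed_diagram \<epsilon> (D, xs @ [Arrow e v] @ ys))"
    by (simp only: signed_diagram_def snd_conv fst_conv fun_scale_scale marks_sign_reverse[OF M(1) assms(1) M(2,3)])
qed (simp only: signed_diagram_def snd_conv fst_conv fun_scale_scale marks_sign_interchange[OF _ assms(1)])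

text \<open>A function that changes by \<open>\<epsilon>\<close> under both relations is determined
  by its value on the standard markings. It is applied to the sign of a stack as a function of the
  markings of one factor.\<close>

lemma alternating_marks:
  fixes g :: "vertex set mark list \<Rightarrow> 'k::field"
  assumes eps: "\<epsilon> \<in> {1, -1}" and M: "marked_diagram r s (D, ms)"
    and interchange: "\<And>xs a b ys. marked_diagram r s (D, xs @ [a, b] @ ys) \<Longrightarrow>
      g (xs @ [b, a] @ ys) = \<epsilon> * g (xs @ [a, b] @ ys)"
    and reverse: "\<And>xs e v w ys. marked_diagram r s (D, xs @ [Arrow e v] @ ys) \<Longrightarrow> e = {v, w} \<Longrightarrow> v \<noteq> w \<Longrightarrow>
      g (xs @ [Arrow e w] @ ys) = \<epsilon> * g (xs @ [Arrow e v] @ ys)"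
  shows "g ms = marks_sign \<epsilon> ms * g (std_marks D)"
proof -
  \<comment> \<open>\<open>lin\<close> needs values in a function space, hence the dummy argument of
    type \<open>unit\<close>; on all other diagrams the function is 0, which satisfies the relations
    trivially.\<close>
  define F :: "mdiagram \<Rightarrow> unit \<Rightarrow> 'k" where "F = (\<lambda>(D', ms) u. if D' = D then g ms else 0)"
  have std: "marked_diagram r s (D, std_marks D)"
    using standard_std_marks[OF marked_diagramD(1)[OF M]] by (simp add: standard_def)
  have "lin F (signed_basis \<epsilon> (D, ms) - basis_vec (D, std_marks D)) = 0"
  proof (rule lin_relation_space[OF relation_std[OF eps M]])
    fix D' xs a b ys assume "marked_diagram r s (D', xs @ [a, b] @ ys)"
    then show "F (D', xs @ [b, a] @ ys) = fun_scale \<epsilon> (F (D', xs @ [a, b] @ ys))"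
      using interchange[of xs a b ys] by (auto simp: F_def fun_scale_def fun_eq_iff)
  next
    fix D' xs e v w ys assume "marked_diagram r s (D', xs @ [Arrow e v] @ ys)" "e = {v, w}" "v \<noteq> w"
    then show "F (D', xs @ [Arrow e w] @ ys) = fun_scale \<epsilon> (F (D', xs @ [Arrow e v] @ ys))"
      using reverse[of xs e v ys w] by (auto simp: F_def fun_scale_def fun_eq_iff)
  qed
  moreover have "lin F (signed_basis \<epsilon> (D, ms) - basis_vec (D, std_marks D)) =
      fun_scale (marks_sign \<epsilon> ms) (F (D, ms)) - F (D, std_marks D)"
    by (subst lin_diff[of _ "marked_diagrams r s"])
      (simp_all add: lin_scale free_space_scale basis_vec_in_free_space M std)
  ultimately have "marks_sign \<epsilon> ms * g ms = g (std_marks D)"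
    by (auto simp: F_def fun_scale_def fun_eq_iff)
  then have "marks_sign \<epsilon> ms * g (std_marks D) = (marks_sign \<epsilon> ms * marks_sign \<epsilon> ms) * g ms"
    by (simp only: mult.assoc)
  then show ?thesis
    unfolding marks_sign_def weight_square[OF eps] by simp
qed

text \<open>Modulo relations every diagram is its sign times the standard diagram, so a combination
  whose signed underlying diagrams cancel is a relation. This contains the fact that the standard
  diagrams represent a basis.\<close>

lemma relation_space_kernel:
  assumes "\<epsilon> \<in> {1, -1}" "x \<in> free_space (marked_diagrams r s)"
  shows "x \<in> relation_space r s \<epsilon> \<longleftrightarrow> lin (signed_diagram \<epsilon>) x = 0"
proof
  assume z: "lin (signed_diagram \<epsilon>) x = 0"
  \<comment> \<open>The standard representative of a marked diagram, with its sign.\<close>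
  let ?f = "\<lambda>M. fun_scale (marks_sign \<epsilon> (snd M)) (basis_vec (fst M, std_marks (fst M)))"
  have "x - lin ?f x \<in> relation_space r s \<epsilon>"
    using assms(2)
  proof (induction rule: free_space_induct)
    case zero
    show ?case by (simp only: lin_zero relation_refl)
  next
    case (step c M y)
    have "signed_basis \<epsilon> M - basis_vec (fst M, std_marks (fst M)) \<in> relation_space r s \<epsilon>"
      using relation_std[OF assms(1), of r s "fst M" "snd M"] step(1) by simp
    then have "fun_scale (c * marks_sign \<epsilon> (snd M)) (signed_basis \<epsilon> M - basis_vec (fst M, std_marks (fst M))) \<in> relation_space r s \<epsilon>"
      by (rule fun_vs.subspace_scale[OF relation_space_subspace])
    also have "fun_scale (c * marks_sign \<epsilon> (snd M)) (signed_basis \<epsilon> M - basis_vec (fst M, std_marks (fst M))) =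
      fun_scale c (basis_vec M) - fun_scale c (?f M)"
      using weight_square[OF assms(1), of earlier left_arrow "snd M"] by (simp add: fun_scale_diff fun_scale_scale mult.assoc marks_sign_def)
    finally have "fun_scale c (basis_vec M) - fun_scale c (?f M) + (y - lin ?f y) \<in> relation_space r s \<epsilon>"
      using step.hyps step(3) by (intro fun_vs.subspace_add[OF relation_space_subspace])
    moreover have "lin ?f (fun_scale c (basis_vec M) + y) = fun_scale c (?f M) + lin ?f y"
      by (subst lin_add[of _ "marked_diagrams r s"])
        (use step in \<open>simp_all only: lin_scale lin_basis_vec basis_vec_in_free_space free_space_scale\<close>)
    ultimately show ?case by (simp only: add_diff_add)
  qed
  moreover have "lin ?f x = lin (\<lambda>D. basis_vec (D, std_marks D)) (lin (signed_diagram \<epsilon>) x)"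
    by (subst lin_lin[of _ "marked_diagrams r s" _ UNIV], rule assms(2))
      (simp_all only: signed_diagram_def lin_scale lin_basis_vec free_space_scale basis_vec_in_free_space UNIV_I)
  ultimately show "x \<in> relation_space r s \<epsilon>" using z by simp
qed (rule signed_diagram_relation[OF assms(1)])

section \<open>Stacked diagrams\<close>

fun vless :: "vertex \<Rightarrow> vertex \<Rightarrow> bool" where
  "vless (Top i) (Top j) = (i < j)"
| "vless (Bot i) (Bot j) = (i < j)"
| "vless (Top i) (Bot j) = True"
| "vless _ _ = False"

text \<open>
  Strands are oriented from top to bottom or from left to right. Cups come first, from left to right, then
  through strings, in the order of their first middle vertices, and then caps, from right to left; thus
  the order of cups and caps is that of standard diagrams, and the order and orientation of through strings
  depends only on the middle part of the stack.
\<close>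

definition canonical :: "stack_edge set \<Rightarrow> vertex list \<Rightarrow> stack_edge list \<Rightarrow> bool" where
  "canonical G vs es \<longleftrightarrow> strand G vs es \<and> vless (hd vs) (last vs)"

fun end_class :: "vertex \<Rightarrow> vertex \<Rightarrow> nat" where
  "end_class (Top i) (Top j) = 0"
| "end_class (Bot i) (Bot j) = 2"
| "end_class _ _ = 1"

definition strand_key :: "vertex list \<Rightarrow> int" where
  "strand_key vs = (let c = end_class (hd vs) (last vs) in
     if c = 0 then int (pos (hd vs)) else if c = 1 then int (pos (vs ! 1)) else - int (pos (hd vs)))"

definition strand_less :: "vertex list \<Rightarrow> vertex list \<Rightarrow> bool" where
  "strand_less vs vs' \<longleftrightarrow> (let c = end_class (hd vs) (last vs); c' = end_class (hd vs') (last vs') in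
     c < c' \<or> c = c' \<and> strand_key vs < strand_key vs')"

text \<open>Only edges on canonical strands have a place in this order; edges of closed loops are
  incomparable to all others.\<close>

definition edge_before :: "stack_edge set \<Rightarrow> stack_edge \<Rightarrow> stack_edge \<Rightarrow> bool" where
  "edge_before G p q \<longleftrightarrow> (\<exists>vs es vs' es' i j. canonical G vs es \<and> canonical G vs' es' \<and>
     i < length es \<and> j < length es' \<and> p = es ! i \<and> q = es' ! j \<and> (strand_less vs vs' \<or> vs = vs' \<and> i < j))"

definition mark_before :: "stack_edge set \<Rightarrow> stack_edge mark \<Rightarrow> stack_edge mark \<Rightarrow> bool" where
  "mark_before G m n = edge_before G (mark_edge m) (mark_edge n)"

text \<open>\<open>vs ! i\<close> is the vertex at which the canonical strand enters the edge, so an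
  arrow towards it runs against the strand.\<close>

fun mark_against :: "stack_edge set \<Rightarrow> stack_edge mark \<Rightarrow> bool" where
  "mark_against G (Bead p) = False"
| "mark_against G (Arrow p w) = (\<exists>vs es i. canonical G vs es \<and> i < length es \<and> es ! i = p \<and> vs ! i = w)"

text \<open>The counterpart of \<open>marks_sign\<close> before simplification. Multiplied by the
  current scalar it is the invariant of \<open>simp_step\<close>.\<close>

abbreviation stack_sign :: "'k::field \<Rightarrow> stack_edge set \<Rightarrow> stack_edge mark list \<Rightarrow> 'k" where
  "stack_sign \<epsilon> G \<equiv> weight \<epsilon> (mark_before G) (mark_against G)"

definition on_strand :: "stack_edge set \<Rightarrow> stack_edge \<Rightarrow> bool" where
  "on_strand G p \<longleftrightarrow> (\<exists>vs es. strand G vs es \<and> p \<in> set es)"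

definition strand_marks :: "stack_edge set \<Rightarrow> stack_edge mark list \<Rightarrow> bool" where
  "strand_marks G ns \<longleftrightarrow> distinct (map mark_edge ns) \<and> (\<forall>m\<in>set ns. on_strand G (mark_edge m)) \<and>
     (\<forall>p w. Arrow p w \<in> set ns \<longrightarrow> w \<in> stack_ends p)"

lemma strand_less_irrefl: "\<not> strand_less vs vs"
  by (simp add: strand_less_def Let_def)

lemma strand_less_asym: "strand_less vs vs' \<Longrightarrow> \<not> strand_less vs' vs"
  by (auto simp: strand_less_def Let_def)

lemma vless_asym: "vless v w \<Longrightarrow> \<not> vless w v"
  by (cases v; cases w) auto

lemma stack_ends_simps: "stack_ends (Inl e) = upper ` e" "stack_ends (Inr e) = lower ` e"
  by (simp_all add: stack_ends_def)

lemma Inl_in_stack [simp]: "Inl e \<in> stack D1 D2 \<longleftrightarrow> e \<in> D1"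
  and Inr_in_stack [simp]: "Inr e \<in> stack D1 D2 \<longleftrightarrow> e \<in> D2"
  by (auto simp: stack_def)

lemma upper_eq: "upper v = Top i \<longleftrightarrow> v = Top i" "upper v = Bot i \<longleftrightarrow> False"
    "v \<notin> range Mid \<Longrightarrow> upper v = Mid i \<longleftrightarrow> v = Bot i"
  by (cases v; auto)+

lemma lower_eq: "lower v = Bot i \<longleftrightarrow> v = Bot i" "lower v = Top i \<longleftrightarrow> False"
    "v \<notin> range Mid \<Longrightarrow> lower v = Mid i \<longleftrightarrow> v = Top i"
  by (cases v; auto)+

locale stacked =
  fixes r s t :: nat and D1 D2 :: "vertex set set"
  assumes D1: "brauer_diagram r s D1" and D2: "brauer_diagram s t D2"
begin

abbreviation "G \<equiv> stack D1 D2"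

lemma no_Mid: "e \<in> D1 \<Longrightarrow> v \<in> e \<Longrightarrow> v \<notin> range Mid" "e \<in> D2 \<Longrightarrow> v \<in> e \<Longrightarrow> v \<notin> range Mid"
  using brauer_diagram_edge(2)[OF D1, of e] brauer_diagram_edge(2)[OF D2, of e] by auto

lemma ends_Inl:
  assumes "e \<in> D1"
  shows "Top i \<in> stack_ends (Inl e) \<longleftrightarrow> Top i \<in> e" "Mid i \<in> stack_ends (Inl e) \<longleftrightarrow> Bot i \<in> e"
    "Bot i \<notin> stack_ends (Inl e)"
proof -
  show "Mid i \<in> stack_ends (Inl e) \<longleftrightarrow> Bot i \<in> e"
    using upper_eq(3)[OF no_Mid(1)[OF assms], of _ i] by (force simp: stack_ends_simps)
qed (auto simp: stack_ends_simps upper_eq image_iff eq_commute[of _ "upper _"])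

lemma ends_Inr:
  assumes "e \<in> D2"
  shows "Bot i \<in> stack_ends (Inr e) \<longleftrightarrow> Bot i \<in> e" "Mid i \<in> stack_ends (Inr e) \<longleftrightarrow> Top i \<in> e"
    "Top i \<notin> stack_ends (Inr e)"
proof -
  show "Mid i \<in> stack_ends (Inr e) \<longleftrightarrow> Top i \<in> e"
    using lower_eq(3)[OF no_Mid(2)[OF assms], of _ i] by (force simp: stack_ends_simps)
qed (auto simp: stack_ends_simps lower_eq image_iff eq_commute[of _ "lower _"])

lemma G_cases:
  assumes "p \<in> G"
  obtains e where "p = Inl e" "e \<in> D1" | e where "p = Inr e" "e \<in> D2"
  using assms by (auto simp: stack_def)

text \<open>The edges of a single Brauer diagram are disjoint, and identifying its vertices with
  those of the stack is injective, so a vertex meets at most one edge from each factor.\<close>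

sublocale two_coloured_graph G stack_ends isl
proof
  show "finite G" using finite_brauer_diagram[OF D1] finite_brauer_diagram[OF D2] by (simp add: stack_def)
next
  fix p assume "p \<in> G"
  then show "card (stack_ends p) = 2"
  proof (cases rule: G_cases)
    case (1 e)
    have "inj_on upper e" using no_Mid(1)[OF 1(2)] by (intro inj_onI) (metis upper.elims upper_eq rangeI)
    then show ?thesis using brauer_diagram_edge(1)[OF D1 1(2)] 1 by (simp add: stack_ends_simps card_image)
  next
    case (2 e)
    have "inj_on lower e" using no_Mid(2)[OF 2(2)] by (intro inj_onI) (metis lower.elims lower_eq rangeI)
    then show ?thesis using brauer_diagram_edge(1)[OF D2 2(2)] 2 by (simp add: stack_ends_simps card_image)
  qed
next
  fix p q v assume pq: "p \<in> G" "q \<in> G" "v \<in> stack_ends p" "v \<in> stack_ends q" "isl p = isl q"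
  show "p = q"
    using pq(1)
  proof (cases rule: G_cases)
    case (1 e)
    then obtain f where f: "q = Inl f" "f \<in> D1" using pq by (cases q) auto
    have "\<exists>w. w \<in> e \<and> w \<in> f" using pq(3,4) ends_Inl[OF 1(2)] ends_Inl[OF f(2)] unfolding 1 f by (cases v) blast+
    then show ?thesis using brauer_diagram_unique[OF D1 1(2) f(2)] 1 f by blast
  next
    case (2 e)
    then obtain f where f: "q = Inr f" "f \<in> D2" using pq by (cases q) auto
    have "\<exists>w. w \<in> e \<and> w \<in> f" using pq(3,4) ends_Inr[OF 2(2)] ends_Inr[OF f(2)] unfolding 2 f by (cases v) blast+
    then show ?thesis using brauer_diagram_unique[OF D2 2(2) f(2)] 2 f by blast
  qed
qed

lemma strand_iff: "strand G = mpath"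
  by (simp add: strand_def)

lemma Top_edge: "p \<in> G \<Longrightarrow> Top i \<in> stack_ends p \<Longrightarrow> isl p"
  by (erule G_cases) (auto simp: ends_Inr)

lemma Bot_edge: "p \<in> G \<Longrightarrow> Bot i \<in> stack_ends p \<Longrightarrow> \<not> isl p"
  by (erule G_cases) (auto simp: ends_Inl)

text \<open>A middle vertex is covered by both factors and so has degree two; a top or bottom vertex
  is covered by one factor only.\<close>

lemma outer_iff: "outer v \<longleftrightarrow> v \<in> Top ` {1..r} \<union> Bot ` {1..t}"
proof
  assume "outer v"
  then obtain p where p: "p \<in> G" "v \<in> stack_ends p" and u: "\<And>q. q \<in> G \<Longrightarrow> v \<in> stack_ends q \<Longrightarrow> q = p"
    unfolding outer_def by blast
  show "v \<in> Top ` {1..r} \<union> Bot ` {1..t}"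
  proof (cases v)
    case (Top i)
    then show ?thesis
      using p brauer_diagram_edge(2)[OF D1] by (cases rule: G_cases[OF p(1)]) (auto simp: ends_Inl ends_Inr)
  next
    case (Bot i)
    then show ?thesis
      using p brauer_diagram_edge(2)[OF D2] by (cases rule: G_cases[OF p(1)]) (auto simp: ends_Inl ends_Inr)
  next
    case (Mid i)
    have "Bot i \<in> Bot ` {1..s}"
      using p(1)
    proof (cases rule: G_cases)
      case (1 e)
      then show ?thesis using p(2) Mid brauer_diagram_edge(2)[OF D1 1(2)] by (auto simp: ends_Inl)
    next
      case (2 e)
      then show ?thesis using p(2) Mid brauer_diagram_edge(2)[OF D2 2(2)] by (auto simp: ends_Inr)
    qed
    then obtain e f where "e \<in> D1" "Bot i \<in> e" "f \<in> D2" "Top i \<in> f"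
      using brauer_diagram_ex[OF D1, of "Bot i"] brauer_diagram_ex[OF D2, of "Top i"] by blast
    then have "Inl e = p" "Inr f = p" using u[of "Inl e"] u[of "Inr f"] Mid by (auto simp: ends_Inl ends_Inr)
    then show ?thesis by (metis sum.distinct(1))
  qed
next
  assume v: "v \<in> Top ` {1..r} \<union> Bot ` {1..t}"
  show "outer v"
  proof (cases v)
    case (Top i)
    then obtain e where e: "e \<in> D1" "v \<in> e" using v brauer_diagram_ex[OF D1, of v] by blast
    then have "Inl e \<in> G" "v \<in> stack_ends (Inl e)" using Top by (auto simp: ends_Inl)
    moreover have "q = Inl e" if "q \<in> G" "v \<in> stack_ends q" for q
      using that calculation Top_edge[of q i] Top by (intro col_unique[of _ _ v]) auto
    ultimately show ?thesis unfolding outer_def by blast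
  next
    case (Bot i)
    then obtain e where e: "e \<in> D2" "v \<in> e" using v brauer_diagram_ex[OF D2, of v] by blast
    then have "Inr e \<in> G" "v \<in> stack_ends (Inr e)" using Bot by (auto simp: ends_Inr)
    moreover have "q = Inr e" if "q \<in> G" "v \<in> stack_ends q" for q
      using that calculation Bot_edge[of q i] Bot by (intro col_unique[of _ _ v]) auto
    ultimately show ?thesis unfolding outer_def by blast
  qed (use v in auto)
qed

lemma not_outer_Mid: "\<not> outer (Mid i)"
  by (auto simp: outer_iff)

lemma Mid_edges:
  assumes "p \<in> G" "Mid i \<in> stack_ends p"
  shows "i \<in> {1..s}" "\<exists>e\<in>D1. Bot i \<in> e" "\<exists>e\<in>D2. Top i \<in> e"
proof -
  show "i \<in> {1..s}"
    using assms(1)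
  proof (cases rule: G_cases)
    case (1 e)
    then show ?thesis using assms(2) brauer_diagram_edge(2)[OF D1 1(2)] by (auto simp: ends_Inl)
  next
    case (2 e)
    then show ?thesis using assms(2) brauer_diagram_edge(2)[OF D2 2(2)] by (auto simp: ends_Inr)
  qed
  then show "\<exists>e\<in>D1. Bot i \<in> e" "\<exists>e\<in>D2. Top i \<in> e"
    using brauer_diagram_ex[OF D1, of "Bot i"] brauer_diagram_ex[OF D2, of "Top i"] by auto
qed

text \<open>The colour changes at an interior vertex, while top vertices meet only upper edges and
  bottom vertices only lower ones.\<close>

lemma path_interior_Mid:
  assumes "path vs es" "Suc i < length es"
  shows "vs ! Suc i \<in> range Mid"
proof -
  have "isl (es ! i) \<noteq> isl (es ! Suc i)" by (rule path_alternates[OF assms])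
  moreover have "vs ! Suc i \<in> stack_ends (es ! i)" "vs ! Suc i \<in> stack_ends (es ! Suc i)" "es ! i \<in> G" "es ! Suc i \<in> G"
    using path_edge[OF assms(1), of i] path_edge[OF assms(1), of "Suc i"] assms(2) by auto
  ultimately show ?thesis using Top_edge Bot_edge by (cases "vs ! Suc i") auto
qed

lemma brauer_stacked_diagram: "brauer_diagram r t (stacked_diagram G)"
proof -
  have "Top ` {1..r} \<union> Bot ` {1..t} = {v. outer v}" using outer_iff by blast
  moreover have "card {hd vs, last vs} = 2" if "mpath vs es" for vs es
    using mpath_outer(3)[OF that] by simp
  ultimately show ?thesis
    using partition_on_ends unfolding brauer_diagram_def stacked_diagram_def strand_iff by auto
qed

lemma vless_total: "outer v \<Longrightarrow> outer w \<Longrightarrow> v \<noteq> w \<Longrightarrow> vless v w \<or> vless w v"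
  by (auto simp: outer_iff)

section \<open>Orientation and order of the strands\<close>

lemma canonical_or_rev:
  assumes "strand G vs es"
  shows "canonical G vs es \<noteq> canonical G (rev vs) (rev es)"
proof -
  note m = assms[unfolded strand_iff]
  have "hd (rev vs) = last vs" "last (rev vs) = hd vs" by (simp_all add: hd_rev last_rev)
  then show ?thesis
    using vless_total[OF mpath_outer[OF m]] vless_asym maximal_path_rev[OF m] m
    by (auto simp: canonical_def strand_iff)
qed

lemma canonical_share_edge:
  assumes "canonical G vs es" "canonical G vs' es'" "p \<in> set es" "p \<in> set es'"
  shows "vs' = vs" "es' = es"
proof -
  have "vs' = vs \<and> es' = es \<or> vs' = rev vs \<and> es' = rev es"
    using assms mpath_share_edge[of vs es vs' es' p] by (auto simp: canonical_def strand_iff)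
  then show "vs' = vs" "es' = es"
    using canonical_or_rev[of vs es] assms(1,2) by (auto simp: canonical_def)
qed

lemma canonical_share_hd:
  assumes "canonical G vs es" "canonical G vs' es'" "hd vs = hd vs'"
  shows "vs' = vs" "es' = es"
proof -
  have "mpath vs es" "mpath vs' es'" using assms(1,2) by (simp_all add: canonical_def strand_iff)
  from mpath_unique[OF this assms(3)[symmetric]] show "vs' = vs" "es' = es" by blast+
qed

lemma canonical_through_Mid:
  assumes "canonical G vs es" "end_class (hd vs) (last vs) = 1"
  shows "2 \<le> length es" "vs ! 1 \<in> range Mid" "\<exists>a b. hd vs = Top a \<and> last vs = Bot b"
proof -
  note m = assms(1)[unfolded canonical_def strand_iff, THEN conjunct1]
  note p = mpath_path[OF m]
  show ab: "\<exists>a b. hd vs = Top a \<and> last vs = Bot b"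
    using assms by (cases "hd vs"; cases "last vs") (auto simp: canonical_def)
  have "0 < length es" using m by (auto simp: maximal_path_def)
  moreover have "length es \<noteq> 1"
  proof
    assume "length es = 1"
    then have "hd vs \<in> stack_ends (es ! 0)" "last vs \<in> stack_ends (es ! 0)" "es ! 0 \<in> G"
      using path_edge[OF p, of 0] path_hd[OF p] path_last[OF p] by auto
    then show False using ab Top_edge Bot_edge by metis
  qed
  ultimately show "2 \<le> length es" by linarith
  then show "vs ! 1 \<in> range Mid" using path_interior_Mid[OF p, of 0] by simp
qed

text \<open>A first middle vertex lies on one strand only, and likewise a starting vertex, so within
  each class the key determines the strand.\<close>

lemma strand_less_total:
  assumes c: "canonical G vs es" "canonical G vs' es'" "vs \<noteq> vs'"
  shows "strand_less vs vs' \<noteq> strand_less vs' vs"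
proof -
  have "strand_less vs vs' \<or> strand_less vs' vs"
  proof (rule ccontr)
    assume "\<not> ?thesis"
    then have cl: "end_class (hd vs) (last vs) = end_class (hd vs') (last vs')" and key: "strand_key vs = strand_key vs'"
      by (auto simp: strand_less_def Let_def neq_iff)
    show False
    proof (cases "end_class (hd vs) (last vs) = 1")
      case True
      then have "vs ! 1 \<in> range Mid" "vs' ! 1 \<in> range Mid" "2 \<le> length es" "2 \<le> length es'"
        using canonical_through_Mid[OF c(1)] canonical_through_Mid[OF c(2)] cl by auto
      moreover have "pos (vs ! 1) = pos (vs' ! 1)" using key True cl by (simp add: strand_key_def)
      moreover have m: "mpath vs es" "mpath vs' es'" using c by (auto simp: canonical_def strand_iff)
      ultimately have eq: "vs ! 1 = vs' ! 1" and len: "2 \<le> length es" "2 \<le> length es'" by auto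
      have "vs ! 1 \<in> set vs" "vs' ! 1 \<in> set vs'"
        using path_length[OF mpath_path[OF m(1)]] path_length[OF mpath_path[OF m(2)]] len by (rule_tac nth_mem, linarith)+
      then have "vs' = vs \<or> vs' = rev vs \<and> es' = rev es" using mpath_share_vertex[OF m, of "vs ! 1"] eq by auto
      then show False using c canonical_or_rev[of vs es] by (auto simp: canonical_def)
    next
      case False
      then have "pos (hd vs) = pos (hd vs')" using key cl by (auto simp: strand_key_def Let_def split: if_splits)
      then have "hd vs = hd vs'"
        using cl False by (cases "hd vs"; cases "last vs"; cases "hd vs'"; cases "last vs'") auto
      then show False using canonical_share_hd[OF c(1,2)] c(3) by simp
    qed
  qed
  then show ?thesis using strand_less_asym by blast
qed

lemma edge_before_iff:
  assumes c: "canonical G vs es" "canonical G vs' es'" "i < length es" "j < length es'"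
  shows "edge_before G (es ! i) (es' ! j) \<longleftrightarrow> strand_less vs vs' \<or> vs = vs' \<and> i < j"
proof
  assume "edge_before G (es ! i) (es' ! j)"
  then obtain ws fs ws' fs' k l where *: "canonical G ws fs" "canonical G ws' fs'" "k < length fs" "l < length fs'"
    "es ! i = fs ! k" "es' ! j = fs' ! l" "strand_less ws ws' \<or> ws = ws' \<and> k < l"
    unfolding edge_before_def by blast
  have mem: "es ! i \<in> set es" "es ! i \<in> set fs" "es' ! j \<in> set es'" "es' ! j \<in> set fs'"
    using nth_mem[OF c(3)] nth_mem[OF c(4)] nth_mem[OF *(3)] nth_mem[OF *(4)] *(5,6) by auto
  have "ws = vs" "fs = es" using canonical_share_edge[OF c(1) *(1) mem(1,2)] by auto
  moreover have "ws' = vs'" "fs' = es'" using canonical_share_edge[OF c(2) *(2) mem(3,4)] by auto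
  moreover have "distinct es" "distinct es'" using c by (auto simp: canonical_def strand_iff maximal_path_def path_in_def)
  ultimately show "strand_less vs vs' \<or> vs = vs' \<and> i < j"
    using * c by (auto simp: nth_eq_iff_index_eq)
qed (use assms in \<open>unfold edge_before_def, blast\<close>)

lemma canonical_exists: "on_strand G p \<Longrightarrow> \<exists>vs es i. canonical G vs es \<and> i < length es \<and> p = es ! i"
  unfolding on_strand_def using canonical_or_rev by (metis in_set_conv_nth set_rev)

lemma edge_before_total:
  assumes "on_strand G p" "on_strand G q" "p \<noteq> q"
  shows "edge_before G p q \<noteq> edge_before G q p"
proof -
  obtain vs es i where p: "canonical G vs es" "i < length es" "p = es ! i" using canonical_exists[OF assms(1)] by blast
  obtain vs' es' j where q: "canonical G vs' es'" "j < length es'" "q = es' ! j" using canonical_exists[OF assms(2)] by blast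
  show ?thesis
  proof (cases "vs = vs'")
    case True
    then have "es = es'" using canonical_share_hd[OF p(1) q(1)] by simp
    then have "i \<noteq> j" using p q assms(3) by auto
    then show ?thesis
      using True strand_less_irrefl edge_before_iff[OF p(1) q(1) p(2) q(2)] edge_before_iff[OF q(1) p(1) q(2) p(2)]
      unfolding p(3) q(3) by auto
  next
    case False
    then show ?thesis
      using strand_less_total[OF p(1) q(1)] edge_before_iff[OF p(1) q(1) p(2) q(2)] edge_before_iff[OF q(1) p(1) q(2) p(2)]
      unfolding p(3) q(3) by auto
  qed
qed

lemma rev_index:
  assumes "strand G vs es" "i < length es"
  shows "rev es ! (length es - Suc i) = es ! i" "rev vs ! (length es - Suc i) = vs ! Suc i"
    "rev vs ! Suc (length es - Suc i) = vs ! i" "length es - Suc i < length es"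
proof -
  have "length vs = Suc (length es)" using assms by (simp add: strand_iff maximal_path_def path_in_def)
  then show "rev es ! (length es - Suc i) = es ! i" "rev vs ! (length es - Suc i) = vs ! Suc i"
    "rev vs ! Suc (length es - Suc i) = vs ! i" "length es - Suc i < length es"
    using assms(2) by (auto simp: rev_nth Suc_diff_Suc)
qed

lemma edge_before_strand:
  assumes "strand G vs es" "i < j" "j < length es"
  shows "edge_before G (es ! i) (es ! j) \<longleftrightarrow> canonical G vs es" "edge_before G (es ! j) (es ! i) \<longleftrightarrow> \<not> canonical G vs es"
proof -
  have "i < length es" using assms by simp
  note ri = rev_index[OF assms(1) this] and rj = rev_index[OF assms(1,3)]
  have "length es - Suc j < length es - Suc i" using assms by simp
  then have "edge_before G (es ! j) (es ! i) \<and> \<not> edge_before G (es ! i) (es ! j)" if "canonical G (rev vs) (rev es)"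
    using edge_before_iff[OF that that, of "length es - Suc i" "length es - Suc j"]
      edge_before_iff[OF that that, of "length es - Suc j" "length es - Suc i"] ri rj strand_less_irrefl by auto
  moreover have "edge_before G (es ! i) (es ! j) \<and> \<not> edge_before G (es ! j) (es ! i)" if "canonical G vs es"
    using edge_before_iff[OF that that, of i j] edge_before_iff[OF that that, of j i] assms strand_less_irrefl by auto
  ultimately show "edge_before G (es ! i) (es ! j) \<longleftrightarrow> canonical G vs es"
    "edge_before G (es ! j) (es ! i) \<longleftrightarrow> \<not> canonical G vs es"
    using canonical_or_rev[OF assms(1)] by blast+
qed

text \<open>An edge outside the segment from \<open>i\<close> to \<open>j\<close> lies on another
  strand or entirely before or after the segment. It thus sees both ends of the segment in the same
  way, which is why a cancellation disturbs no other inversion.\<close>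

lemma edge_before_other_canonical:
  assumes s: "canonical G vs es" "i < j" "j < length es" and q: "on_strand G q" "\<And>k. i \<le> k \<Longrightarrow> k \<le> j \<Longrightarrow> q \<noteq> es ! k"
  shows "edge_before G q (es ! i) = edge_before G q (es ! j) \<and> edge_before G (es ! i) q = edge_before G (es ! j) q"
proof -
  obtain ws fs k where k: "canonical G ws fs" "k < length fs" "q = fs ! k" using canonical_exists[OF q(1)] by blast
  have i: "i < length es" using s by simp
  have "vs = ws \<Longrightarrow> k < i \<or> j < k"
    using canonical_share_hd(2)[OF s(1) k(1)] q(2)[of k] k(3) by force
  then show ?thesis
    using edge_before_iff[OF k(1) s(1) k(2) i] edge_before_iff[OF k(1) s(1) k(2) s(3)]
      edge_before_iff[OF s(1) k(1) i k(2)] edge_before_iff[OF s(1) k(1) s(3) k(2)] s(2)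
    unfolding k(3) by auto
qed

lemma edge_before_other:
  assumes s: "strand G vs es" "i < j" "j < length es" and q: "on_strand G q" "\<And>k. i \<le> k \<Longrightarrow> k \<le> j \<Longrightarrow> q \<noteq> es ! k"
  shows "edge_before G q (es ! i) = edge_before G q (es ! j) \<and> edge_before G (es ! i) q = edge_before G (es ! j) q"
proof (cases "canonical G vs es")
  case False
  then have c: "canonical G (rev vs) (rev es)" using canonical_or_rev[OF s(1)] by simp
  have i: "i < length es" using s by simp
  have "q \<noteq> rev es ! k" if "length es - Suc j \<le> k" "k \<le> length es - Suc i" for k
    using that s q(2)[of "length es - Suc k"] i by (auto simp: rev_nth)
  moreover have "length es - Suc j < length es - Suc i" "length es - Suc i < length (rev es)" using s by auto
  ultimately show ?thesis
    using edge_before_other_canonical[OF c _ _ q(1), of "length es - Suc j" "length es - Suc i"]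
      rev_index[OF s(1) i] rev_index[OF s(1,3)] by auto
qed (use edge_before_other_canonical assms in blast)

section \<open>Invariance of the sign under simplification\<close>

lemma mark_against_strand:
  assumes "strand G vs es" "i < length es" "w \<in> stack_ends (es ! i)"
  shows "mark_against G (Arrow (es ! i) w) \<longleftrightarrow> (if canonical G vs es then w \<noteq> vs ! Suc i else w = vs ! Suc i)"
proof -
  have c: "mark_against G (Arrow (es ! i) w) \<longleftrightarrow> w = vs ! i" if "canonical G vs es" "i < length es" for vs es i
  proof
    assume "mark_against G (Arrow (es ! i) w)"
    then obtain ws fs k where *: "canonical G ws fs" "k < length fs" "fs ! k = es ! i" "ws ! k = w" by auto
    then have "ws = vs" "fs = es" using canonical_share_edge[OF that(1) *(1), of "es ! i"] that(2) nth_mem[OF *(2)] by auto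
    moreover have "distinct es" using that by (auto simp: canonical_def strand_iff maximal_path_def path_in_def)
    ultimately show "w = vs ! i" using * that by (auto simp: nth_eq_iff_index_eq)
  qed (use that in auto)
  note e = path_edge[OF mpath_path[OF assms(1)[unfolded strand_iff]] assms(2)]
  show ?thesis
  proof (cases "canonical G vs es")
    case True
    then show ?thesis using c[OF True assms(2)] e assms(3) by auto
  next
    case False
    then have "canonical G (rev vs) (rev es)" using canonical_or_rev[OF assms(1)] by simp
    from c[OF this, of "length es - Suc i"] show ?thesis
      using False rev_index[OF assms(1,2)] by auto
  qed
qed

text \<open>Reversing the strand changes both the order of the two edges and whether the arrow runs
  against it. The two changes cancel, so the sign does not depend on the direction of traversal and
  equals the scalar of the removal rule.\<close>

lemma mark_pair_sign:
  assumes s: "strand G vs es" "i < j" "j < length es" "w \<in> stack_ends (es ! i)" and eps: "\<epsilon> * \<epsilon> = 1"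
  shows "stack_sign \<epsilon> G [Arrow (es ! i) w, Bead (es ! j)] = (if w = vs ! Suc i then 1 else \<epsilon>)"
    "stack_sign \<epsilon> G [Bead (es ! j), Arrow (es ! i) w] = (if w = vs ! Suc i then \<epsilon> else 1)"
proof -
  have i: "i < length es" using s by simp
  show "stack_sign \<epsilon> G [Arrow (es ! i) w, Bead (es ! j)] = (if w = vs ! Suc i then 1 else \<epsilon>)"
    "stack_sign \<epsilon> G [Bead (es ! j), Arrow (es ! i) w] = (if w = vs ! Suc i then \<epsilon> else 1)"
    unfolding weight_pair mark_against_strand[OF s(1) i s(4)] mark_before_def
    using edge_before_strand[OF s(1-3)] eps by (auto simp del: mark_against.simps(2))
qed

lemma strand_marks_sub:
  "strand_marks G (xs @ [a, b] @ ys) \<Longrightarrow> strand_marks G (xs @ ys)"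
  by (auto simp: strand_marks_def)

text \<open>Since the two markings are consecutive, no other marked edge lies between theirs on the
  strand, and all remaining markings compare alike with both.\<close>

lemma cancel_sign:
  assumes "strand_marks G (xs @ [a, b] @ ys)" "consecutive G (xs @ [a, b] @ ys) p q v"
    "{mark_edge a, mark_edge b} = {p, q}" "\<epsilon> * \<epsilon> = 1"
  shows "stack_sign \<epsilon> G (xs @ [a, b] @ ys) = stack_sign \<epsilon> G [a, b] * stack_sign \<epsilon> G (xs @ ys)"
proof (rule weight_remove[OF assms(4)])
  obtain vs es i j where c: "strand G vs es" "i < j" "j < length es" "es ! i = p" "es ! j = q"
    "\<And>k. i < k \<Longrightarrow> k < j \<Longrightarrow> es ! k \<notin> mark_edge ` set (xs @ [a, b] @ ys)"
    using assms(2) unfolding consecutive_def by blast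
  fix m assume m: "m \<in> set xs \<union> set ys"
  have "on_strand G (mark_edge m)" "mark_edge m \<noteq> p" "mark_edge m \<noteq> q"
    using m assms(1,3) by (auto simp: strand_marks_def doubleton_eq_iff)
  moreover have "mark_edge m \<noteq> es ! k" if "i < k" "k < j" for k
  proof -
    have "mark_edge m \<in> mark_edge ` set (xs @ [a, b] @ ys)" using m by (intro imageI) auto
    then show ?thesis using c(6)[OF that] by metis
  qed
  ultimately have "mark_edge m \<noteq> es ! k" if "i \<le> k" "k \<le> j" for k
    using that c(4,5) by (cases "k = i"; cases "k = j") auto
  from edge_before_other[OF c(1-3) \<open>on_strand G (mark_edge m)\<close> this]
  have "edge_before G (mark_edge m) p = edge_before G (mark_edge m) q \<and> edge_before G p (mark_edge m) = edge_before G q (mark_edge m)"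
    unfolding c(4,5) .
  moreover have "mark_edge a = p \<and> mark_edge b = q \<or> mark_edge a = q \<and> mark_edge b = p"
    using assms(3) by (simp only: doubleton_eq_iff)
  ultimately show "mark_before G m a = mark_before G m b \<and> mark_before G a m = mark_before G b m"
    unfolding mark_before_def by (elim disjE conjE) (simp_all only:)
qed

text \<open>In each case the scalar of the step is compensated by the change of the sign: one
  inversion for an interchange, the sign of the pair for a removal.\<close>

lemma simp_step_sign:
  assumes "simp_step G \<epsilon> x y" "strand_marks G (snd x)" "\<epsilon> * \<epsilon> = 1"
  shows "strand_marks G (snd y) \<and> fst y * stack_sign \<epsilon> G (snd y) = fst x * stack_sign \<epsilon> G (snd x)"
  using assms
proof (cases rule: simp_step.cases)
  case (interchange c xs a b ys)
  have "mark_edge a \<noteq> mark_edge b" "on_strand G (mark_edge a)" "on_strand G (mark_edge b)"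
    using assms(2) unfolding interchange by (auto simp: strand_marks_def)
  then have "mark_before G a b \<noteq> mark_before G b a" unfolding mark_before_def by (intro edge_before_total)
  then have "stack_sign \<epsilon> G (xs @ [b, a] @ ys) = \<epsilon> * stack_sign \<epsilon> G (xs @ [a, b] @ ys)"
    by (rule weight_swap[OF assms(3)])
  moreover have "strand_marks G (xs @ [b, a] @ ys)" using assms(2) unfolding interchange by (auto simp: strand_marks_def)
  moreover have "\<epsilon> * c * (\<epsilon> * z) = c * z" for z using assms(3) by (metis mult.assoc mult.left_commute mult_1)
  ultimately show ?thesis unfolding interchange snd_conv fst_conv by simp
next
  case (arrow_above_bead xs p w q ys v c)
  note C = arrow_above_bead
  obtain vs es i j where s: "strand G vs es" "i < j" "j < length es" "es ! i = p" "es ! j = q" "vs ! Suc i = v"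
    using C(3) unfolding consecutive_def by blast
  have w: "w \<in> stack_ends (es ! i)" using assms(2) s(4) unfolding C by (auto simp: strand_marks_def)
  have "stack_sign \<epsilon> G (xs @ [Arrow p w, Bead q] @ ys) = (if w = v then 1 else \<epsilon>) * stack_sign \<epsilon> G (xs @ ys)"
    unfolding cancel_sign[OF assms(2)[unfolded C snd_conv] C(3) _ assms(3), simplified mark.sel, OF refl]
    using mark_pair_sign(1)[OF s(1-3) w assms(3)] s by simp
  moreover have "strand_marks G (xs @ ys)" using assms(2) unfolding C snd_conv by (rule strand_marks_sub)
  ultimately show ?thesis unfolding C snd_conv fst_conv by (simp only: mult_ac)
next
  case (bead_above_arrow xs q p w ys v c)
  note C = bead_above_arrow
  obtain vs es i j where s: "strand G vs es" "i < j" "j < length es" "es ! i = p" "es ! j = q" "vs ! Suc i = v"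
    using C(3) unfolding consecutive_def by blast
  have w: "w \<in> stack_ends (es ! i)" using assms(2) s(4) unfolding C by (auto simp: strand_marks_def)
  have "stack_sign \<epsilon> G (xs @ [Bead q, Arrow p w] @ ys) = (if w = v then \<epsilon> else 1) * stack_sign \<epsilon> G (xs @ ys)"
    unfolding cancel_sign[OF assms(2)[unfolded C snd_conv] C(3) _ assms(3), simplified mark.sel, OF insert_commute]
    using mark_pair_sign(2)[OF s(1-3) w assms(3)] s by simp
  moreover have "strand_marks G (xs @ ys)" using assms(2) unfolding C snd_conv by (rule strand_marks_sub)
  ultimately show ?thesis unfolding C snd_conv fst_conv by (simp only: mult_ac)
qed

lemma simp_steps_sign:
  assumes "(simp_step G \<epsilon>)\<^sup>*\<^sup>* x y" "strand_marks G (snd x)" "\<epsilon> * \<epsilon> = 1"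
  shows "strand_marks G (snd y) \<and> fst y * stack_sign \<epsilon> G (snd y) = fst x * stack_sign \<epsilon> G (snd x)"
  using assms(1)
proof (induction rule: rtranclp_induct)
  case (step y z)
  then show ?case using simp_step_sign[OF step.hyps(2) _ assms(3)] by auto
qed (use assms in auto)

end

section \<open>Simplification of stacked diagrams\<close>

text \<open>Neighbouring terms are opposite, so in twice the sum only the two ends survive.\<close>

lemma alternating_sum:
  fixes c :: "'a \<Rightarrow> bool"
  assumes "successively (\<lambda>x y. c x \<noteq> c y) xs" "xs \<noteq> []"
  shows "2 * (\<Sum>x\<leftarrow>xs. if c x then 1 else - 1) = (if c (hd xs) then 1 else - 1) + (if c (last xs) then 1 else - 1 :: int)"
  using assms
proof (induction xs)
  case (Cons x xs)
  then show ?case by (cases xs) auto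
qed simp

lemma successively_iff_nth: "successively P xs \<longleftrightarrow> (\<forall>i. Suc i < length xs \<longrightarrow> P (xs ! i) (xs ! Suc i))"
proof (induction xs)
  case (Cons x xs)
  then show ?case
    by (cases xs) (auto simp: nth_Cons split: nat.splits)
qed simp

definition adjacency :: "stack_edge set \<Rightarrow> (vertex \<times> vertex) set" where
  "adjacency G = {(x, y). \<exists>e\<in>G. stack_ends e = {x, y}}"

lemma loops_alt: "loops G = {C. C \<subseteq> range Mid \<and> (\<exists>v\<in>\<Union>(stack_ends ` G). C = (adjacency G)\<^sup>* `` {v})}"
  by (simp add: loops_def adjacency_def)

text \<open>On horizontal edges this says that the marking is a bead; on through strings, which
  carry no marking, the value is meaningless.\<close>

definition positive_edge :: "vertex set set \<Rightarrow> vertex set set \<Rightarrow> stack_edge \<Rightarrow> bool" where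
  "positive_edge D1 D2 p \<longleftrightarrow> (case p of Inl e \<Rightarrow> e \<in> cups D1 | Inr e \<Rightarrow> e \<in> cups D2)"

text \<open>The number of beads minus the number of arrows when \<open>es\<close> lists marked
  edges. A cancellation removes one of each, so this number is preserved on every strand.\<close>

definition charge :: "vertex set set \<Rightarrow> vertex set set \<Rightarrow> stack_edge list \<Rightarrow> int" where
  "charge D1 D2 es = (\<Sum>p\<leftarrow>es. if positive_edge D1 D2 p then 1 else - 1)"

definition marked_edges :: "stack_edge mark list \<Rightarrow> stack_edge list \<Rightarrow> stack_edge list" where
  "marked_edges ns es = filter (\<lambda>p. p \<in> mark_edge ` set ns) es"

definition is_bead :: "'e mark \<Rightarrow> bool" where
  "is_bead m \<longleftrightarrow> (\<exists>e. m = Bead e)"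

context stacked
begin

lemma adjacency_closed: "C = (adjacency G)\<^sup>* `` {v} \<Longrightarrow> x \<in> C \<Longrightarrow> (x, y) \<in> adjacency G \<Longrightarrow> y \<in> C"
  by (auto intro: rtrancl.rtrancl_into_rtrancl)

lemma adjacency_vertex: "(x, y) \<in> adjacency G \<Longrightarrow> \<exists>p\<in>G. stack_ends p = {x, y}"
  by (simp add: adjacency_def)

lemma vertex_outer:
  assumes "p \<in> G" "v \<in> stack_ends p" "v \<notin> range Mid"
  shows "outer v"
  using assms(1)
proof (cases rule: G_cases)
  case (1 e)
  then show ?thesis
    using assms(2,3) brauer_diagram_edge(2)[OF D1 1(2)] ends_Inl[OF 1(2)] unfolding outer_iff by (cases v) auto
next
  case (2 e)
  then show ?thesis
    using assms(2,3) brauer_diagram_edge(2)[OF D2 2(2)] ends_Inr[OF 2(2)] unfolding outer_iff by (cases v) auto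
qed

text \<open>A component containing an outer vertex is a strand, and one without is a closed loop.
  Hence the deletion of loop markings keeps exactly the markings on strands.\<close>

lemma on_strand_iff:
  assumes p: "p \<in> G"
  shows "on_strand G p \<longleftrightarrow> (\<forall>C\<in>loops G. \<not> stack_ends p \<subseteq> C)"
proof
  assume "on_strand G p"
  then obtain vs es i where s: "mpath vs es" "i < length es" "p = es ! i"
    by (auto simp: on_strand_def strand_iff in_set_conv_nth)
  show "\<forall>C\<in>loops G. \<not> stack_ends p \<subseteq> C"
  proof (intro ballI notI)
    fix C assume C: "C \<in> loops G" "stack_ends p \<subseteq> C"
    then obtain v where v: "C = (adjacency G)\<^sup>* `` {v}" "C \<subseteq> range Mid" by (auto simp: loops_alt)
    \<comment> \<open>Walking back along the strand never leaves the component, so its outer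
      starting vertex would belong to the loop.\<close>
    have "vs ! (i - n) \<in> C" for n
    proof (induction n)
      case 0
      then show ?case using C(2) path_edge(2)[OF mpath_path[OF s(1)] s(2)] s(3) by auto
    next
      case (Suc n)
      show ?case
      proof (cases "n < i")
        case True
        then have i: "i - Suc n < length es" "Suc (i - Suc n) = i - n" using s(2) by auto
        have "(vs ! (i - n), vs ! (i - Suc n)) \<in> adjacency G"
          using path_edge(1,2)[OF mpath_path[OF s(1)] i(1)] unfolding i(2) adjacency_def by (auto simp: insert_commute)
        then show ?thesis using adjacency_closed[OF v(1) Suc] by blast
      qed (use Suc in auto)
    qed
    from this[of i] have "hd vs \<in> C" using path_hd[OF mpath_path[OF s(1)]] by simp
    then show False using v(2) not_outer_Mid mpath_outer(1)[OF s(1)] by auto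
  qed
next
  assume L: "\<forall>C\<in>loops G. \<not> stack_ends p \<subseteq> C"
  show "on_strand G p"
  proof (rule ccontr)
    assume np: "\<not> on_strand G p"
    obtain v where v: "v \<in> stack_ends p" using card_ends[OF p] by fastforce
    \<comment> \<open>The component of an edge on no strand: if it contained an outer vertex, the
      strand from there would be closed under adjacency and contain \<open>p\<close>.\<close>
    define C where "C = (adjacency G)\<^sup>* `` {v}"
    have vx: "\<exists>q\<in>G. y \<in> stack_ends q" if "(v, y) \<in> (adjacency G)\<^sup>*" for y
      using that by (cases rule: rtranclE) (use p v in \<open>auto dest!: adjacency_vertex\<close>)
    have "C \<subseteq> range Mid"
    proof
      fix y assume y: "y \<in> C"
      show "y \<in> range Mid"
      proof (rule ccontr)
        assume "y \<notin> range Mid"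
        moreover have vy: "(v, y) \<in> (adjacency G)\<^sup>*" using y by (simp add: C_def)
        ultimately have "outer y" using vx[OF vy] vertex_outer by blast
        then obtain vs es where s: "mpath vs es" "hd vs = y" using mpath_exists by blast
        have "v \<in> set vs"
          using vy
        proof (induction rule: converse_rtrancl_induct)
          case base
          then show ?case using s path_ne[OF mpath_path[OF s(1)]] by auto
        next
          case (step x z)
          then obtain q where q: "q \<in> G" "stack_ends q = {x, z}" by (auto dest: adjacency_vertex)
          then have "q \<in> set es" using mpath_closed[OF s(1) q(1), of z] step by auto
          then obtain i where i: "i < length es" "q = es ! i" by (auto simp: in_set_conv_nth)
          have "{vs ! i, vs ! Suc i} = {x, z}" using path_edge(2)[OF mpath_path[OF s(1)] i(1)] i(2) q(2) by simp
          then show ?case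
            using path_edge(4,5)[OF mpath_path[OF s(1)] i(1)] by (auto simp: doubleton_eq_iff)
        qed
        then have "p \<in> set es" using mpath_closed[OF s(1) p v] by simp
        then show False using np s(1) by (auto simp: on_strand_def strand_iff)
      qed
    qed
    then have "C \<in> loops G" using p v unfolding loops_alt C_def by blast
    moreover obtain w where w: "stack_ends p = {v, w}" using ends_other[OF p v] by blast
    then have "(v, w) \<in> adjacency G" using p by (auto simp: adjacency_def)
    then have "stack_ends p \<subseteq> C" unfolding w C_def by auto
    ultimately show False using L by blast
  qed
qed

text \<open>An infinite set has cardinality 0 by convention, which would turn
  \<open>\<delta> ^ card (loops G)\<close> into 1 even for \<open>\<delta> = 0\<close>.\<close>

lemma finite_loops: "finite (loops G)"
proof -
  have "finite (\<Union>(stack_ends ` G))" using finite_G card_ends by (auto simp: card_2_iff dest!: card_ends)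
  then show ?thesis
    by (rule finite_subset[rotated, OF finite_imageI, of _ _ "\<lambda>v. (adjacency G)\<^sup>* `` {v}"]) (auto simp: loops_alt)
qed

abbreviation "pos_edge \<equiv> positive_edge D1 D2"

abbreviation "chrg \<equiv> charge D1 D2"

text \<open>The invariant behind the existence of a simplification. The value
  \<open>1 - end_class\<close> is 1, 0, -1 on cups, through strings and caps; alternation ensures
  that neighbouring markings can be cancelled as long as two are left on a strand.\<close>

definition good_marks :: "stack_edge mark list \<Rightarrow> bool" where
  "good_marks ns \<longleftrightarrow> strand_marks G ns \<and> (\<forall>m\<in>set ns. is_bead m \<longleftrightarrow> pos_edge (mark_edge m)) \<and>
     (\<forall>vs es. canonical G vs es \<longrightarrow>
       successively (\<lambda>p q. pos_edge p \<noteq> pos_edge q) (marked_edges ns es) \<and>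
       chrg (marked_edges ns es) = 1 - int (end_class (hd vs) (last vs)))"

lemma simp_permute: "adj_swap\<^sup>*\<^sup>* xs ys \<Longrightarrow> \<exists>c'. (simp_step G \<epsilon>)\<^sup>*\<^sup>* (c, xs) (c', ys)"
proof (induction rule: rtranclp_induct)
  case (step ys zs)
  then obtain c' where "(simp_step G \<epsilon>)\<^sup>*\<^sup>* (c, xs) (c', ys)" by blast
  moreover obtain us a b vs where "ys = us @ [a, b] @ vs" "zs = us @ [b, a] @ vs"
    using step(2) by (auto elim: adj_swap.cases)
  then have "simp_step G \<epsilon> (c', ys) (\<epsilon> * c', zs)" by (simp only: simp_step.interchange)
  ultimately show ?case by (meson rtranclp.rtrancl_into_rtrancl)
qed auto

lemma canonical_distinct: "canonical G vs es \<Longrightarrow> distinct es"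
  by (simp add: canonical_def strand_iff maximal_path_def path_in_def)

text \<open>By alternation the first two markings on the strand are a bead and an arrow.
  Interchanges bring the pair to the top of the list with the arrow first, so a single removal rule
  suffices.\<close>

lemma simp_cancel:
  assumes good: "good_marks ns" and c: "canonical G vs es" and two: "marked_edges ns es = p # q # l"
  shows "\<exists>c' ns'. (simp_step G \<epsilon>)\<^sup>*\<^sup>* (c, ns) (c', ns') \<and> good_marks ns' \<and> length ns' < length ns"
proof -
  let ?M = "\<lambda>p. p \<in> mark_edge ` set ns"
  have st: "strand G vs es" using c by (simp add: canonical_def)
  have sm: "strand_marks G ns" and bead_iff: "\<And>m. m \<in> set ns \<Longrightarrow> is_bead m \<longleftrightarrow> pos_edge (mark_edge m)"
    using good by (auto simp: good_marks_def)
  have alt: "pos_edge p \<noteq> pos_edge q"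
    using good c two unfolding good_marks_def by fastforce
  obtain us rest where us: "es = us @ p # rest" "\<forall>u\<in>set us. \<not> ?M u" "?M p" "q # l = filter ?M rest"
    using filter_eq_ConsD[OF two[unfolded marked_edges_def]] by blast
  obtain us' rest' where us': "rest = us' @ q # rest'" "\<forall>u\<in>set us'. \<not> ?M u" "?M q" "l = filter ?M rest'"
    using filter_eq_ConsD[OF us(4)[symmetric]] by blast
  define i j where "i = length us" and "j = Suc (length us + length us')"
  have ij: "i < j" "j < length es" "es ! i = p" "es ! j = q"
    unfolding us us' i_def j_def by (auto simp: nth_append)
  have between: "\<not> ?M (es ! k)" if "i < k" "k < j" for k
  proof -
    have "es ! k = us' ! (k - Suc i)" "k - Suc i < length us'"
      using that unfolding us us' i_def j_def by (auto simp: nth_append nth_Cons')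
    then show ?thesis using us'(2) by (metis nth_mem)
  qed
  obtain mp mq where m: "mp \<in> set ns" "mark_edge mp = p" "mq \<in> set ns" "mark_edge mq = q" using us(3) us'(3) by auto
  have "p \<noteq> q" using ij canonical_distinct[OF c] by (auto simp: nth_eq_iff_index_eq)
  then have mpq: "mp \<noteq> mq" using m by auto
  define ns' where "ns' = remove1 mp (remove1 mq ns)"
  have mset: "mset ns = mset ([mp, mq] @ ns')" "mset ns = mset ([mq, mp] @ ns')"
  proof -
    have "mp \<in> set (remove1 mq ns)" using m mpq by (simp add: in_set_remove1)
    then have "mset (remove1 mq ns) = add_mset mp (mset ns')"
      unfolding ns'_def by (metis insert_DiffM mset_remove1 set_mset_mset)
    moreover have "mset ns = add_mset mq (mset (remove1 mq ns))"
      using m(3) by (metis insert_DiffM mset_remove1 set_mset_mset)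
    ultimately have k: "mset ns = add_mset mq (add_mset mp (mset ns'))" by (simp only:)
    have e: "mset ([a, b] @ ns') = add_mset a (add_mset b (mset ns'))" for a b by simp
    show "mset ns = mset ([mp, mq] @ ns')" "mset ns = mset ([mq, mp] @ ns')"
      unfolding e k by (rule add_mset_commute, rule refl)
  qed
  have set_eq: "set ([mp, mq] @ ns') = set ns" "set ([mq, mp] @ ns') = set ns"
    using mset mset_eq_setD by metis+
  have cons: "consecutive G xs p q (vs ! Suc i)" if "set xs = set ns" for xs
    unfolding consecutive_def that using st ij between by blast
  \<comment> \<open>If the second marking is the arrow, the strand is read backwards; the bead then
    lies on the side of \<open>vs ! j\<close>.\<close>
  have cons': "consecutive G xs q p (vs ! j)" if "set xs = set ns" for xs
  proof -
    have i: "i < length es" using ij by simp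
    note ri = rev_index[OF st i] and rj = rev_index[OF st ij(2)]
    have "strand G (rev vs) (rev es)" using st by (simp add: strand_iff maximal_path_rev)
    moreover have "length es - Suc j < length es - Suc i" "length es - Suc i < length (rev es)" using ij by auto
    moreover have "\<not> ?M (rev es ! k)" if "length es - Suc j < k \<and> k < length es - Suc i" for k
    proof -
      have "k < length es" "i < length es - Suc k" "length es - Suc k < j" using that ij(1,2) by linarith+
      then show ?thesis using between[of "length es - Suc k"] by (simp only: rev_nth not_False_eq_True)
    qed
    ultimately show ?thesis
      unfolding consecutive_def that using ri rj ij by blast
  qed
  \<comment> \<open>The arrow is placed above the bead in both cases; only the direction of
    traversal differs.\<close>
  have "\<exists>a b. mset ns = mset ([a, b] @ ns') \<and> (\<forall>c. \<exists>c'. simp_step G \<epsilon> (c, [a, b] @ ns') (c', ns'))"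
  proof (cases "pos_edge q")
    case True
    then obtain w where "mp = Arrow p w" "mq = Bead q"
      using bead_iff[OF m(1)] bead_iff[OF m(3)] alt m by (cases mp; cases mq) (auto simp: is_bead_def)
    then have "simp_step G \<epsilon> (c, [mp, mq] @ ns') ((if w = vs ! Suc i then 1 else \<epsilon>) * c, ns')" for c
      using simp_step.arrow_above_bead[of G "[]" p w q ns' "vs ! Suc i" \<epsilon> c] cons[OF set_eq(1)] by simp
    then show ?thesis using mset by blast
  next
    case False
    then obtain w where "mp = Bead p" "mq = Arrow q w"
      using bead_iff[OF m(1)] bead_iff[OF m(3)] alt m by (cases mp; cases mq) (auto simp: is_bead_def)
    then have "simp_step G \<epsilon> (c, [mq, mp] @ ns') ((if w = vs ! j then 1 else \<epsilon>) * c, ns')" for c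
      using simp_step.arrow_above_bead[of G "[]" q w p ns' "vs ! j" \<epsilon> c] cons'[OF set_eq(2)] by simp
    then show ?thesis using mset by blast
  qed
  then obtain a b where ab: "mset ns = mset ([a, b] @ ns')" "\<And>c. \<exists>c'. simp_step G \<epsilon> (c, [a, b] @ ns') (c', ns')"
    by blast
  obtain c1 where "(simp_step G \<epsilon>)\<^sup>*\<^sup>* (c, ns) (c1, [a, b] @ ns')"
    using simp_permute[OF adj_swaps_mset[OF ab(1)]] by blast
  moreover obtain c2 where "simp_step G \<epsilon> (c1, [a, b] @ ns') (c2, ns')" using ab(2) by blast
  ultimately have steps: "(simp_step G \<epsilon>)\<^sup>*\<^sup>* (c, ns) (c2, ns')" by (rule rtranclp.rtrancl_into_rtrancl)
  have dist: "distinct (map mark_edge ns)" using sm by (simp add: strand_marks_def)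
  have sub: "set ns' \<subseteq> set ns" unfolding ns'_def by (meson notin_set_remove1 subsetI)
  have dn: "distinct ns" "inj_on mark_edge (set ns)" using dist by (auto simp: distinct_map)
  then have set': "set ns' = set ns - {mp, mq}" unfolding ns'_def by (auto simp: set_remove1_eq distinct_remove1)
  have M': "mark_edge ` set ns' = mark_edge ` set ns - {p, q}"
    unfolding set' using dn(2) m by (auto dest: inj_onD)
  have filt: "marked_edges ns' es' = filter (\<lambda>x. x \<notin> {p, q}) (marked_edges ns es')" for es'
    unfolding marked_edges_def M' filter_filter by (rule filter_cong) auto
  have "good_marks ns'"
    unfolding good_marks_def
  proof (intro conjI allI impI ballI)
    have "distinct (map mark_edge ns')"
      using dn inj_on_subset[OF dn(2) sub] by (auto simp: distinct_map ns'_def distinct_remove1)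
    then show "strand_marks G ns'" using sm sub by (auto simp: strand_marks_def)
    show "is_bead m = pos_edge (mark_edge m)" if "m \<in> set ns'" for m using bead_iff that sub by blast
    fix vs' es' assume c': "canonical G vs' es'"
    have old: "successively (\<lambda>p q. pos_edge p \<noteq> pos_edge q) (marked_edges ns es')"
      "chrg (marked_edges ns es') = 1 - int (end_class (hd vs') (last vs'))"
      using good c' unfolding good_marks_def by blast+
    \<comment> \<open>The strand of the removed pair loses its first two entries, which have
      opposite charges; all other strands keep their markings.\<close>
    have "successively (\<lambda>p q. pos_edge p \<noteq> pos_edge q) (marked_edges ns' es') \<and>
      chrg (marked_edges ns' es') = chrg (marked_edges ns es')"
    proof (cases "es' = es")
      case True
      have "distinct (p # q # l)" using canonical_distinct[OF c] unfolding two[symmetric] marked_edges_def by simp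
      then have "marked_edges ns' es' = l" unfolding filt True two by (auto simp: filter_id_conv)
      moreover have "successively (\<lambda>p q. pos_edge p \<noteq> pos_edge q) l"
        using old(1) unfolding True two by (cases l) auto
      ultimately show ?thesis using alt unfolding True two by (auto simp: charge_def)
    next
      case False
      have "p \<in> set es" "q \<in> set es" using us us' by auto
      then have "p \<notin> set es'" "q \<notin> set es'" using canonical_share_edge[OF c c'] False by auto
      then have "marked_edges ns' es' = marked_edges ns es'"
        unfolding filt by (intro filter_True) (auto simp: marked_edges_def)
      then show ?thesis using old(1) by simp
    qed
    then show "successively (\<lambda>p q. pos_edge p \<noteq> pos_edge q) (marked_edges ns' es')"
      "chrg (marked_edges ns' es') = 1 - int (end_class (hd vs') (last vs'))"
      using old(2) by simp_all
  qed
  moreover have "length ns' < length ns" using mset_eq_length[OF ab(1)] by simp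
  ultimately show ?thesis using steps by blast
qed

lemma simp_exists:
  assumes "good_marks ns"
  shows "\<exists>c' ns'. (simp_step G \<epsilon>)\<^sup>*\<^sup>* (c, ns) (c', ns') \<and> good_marks ns' \<and>
    (\<forall>vs es. canonical G vs es \<longrightarrow> length (marked_edges ns' es) \<le> 1)"
  using assms
proof (induction "length ns" arbitrary: c ns rule: less_induct)
  case less
  show ?case
  proof (cases "\<forall>vs es. canonical G vs es \<longrightarrow> length (marked_edges ns es) \<le> 1")
    case False
    then obtain vs es where c: "canonical G vs es" "\<not> length (marked_edges ns es) \<le> 1" by blast
    then obtain p q l where "marked_edges ns es = p # q # l"
      by (cases "marked_edges ns es" rule: remdups_adj.cases) auto
    from simp_cancel[OF less.prems c(1) this] obtain c1 ns1 where 1: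
      "(simp_step G \<epsilon>)\<^sup>*\<^sup>* (c, ns) (c1, ns1)" "good_marks ns1" "length ns1 < length ns" by blast
    from less.hyps[OF 1(3,2)] obtain c2 ns2 where 2: "(simp_step G \<epsilon>)\<^sup>*\<^sup>* (c1, ns1) (c2, ns2)" "good_marks ns2"
      "\<forall>vs es. canonical G vs es \<longrightarrow> length (marked_edges ns2 es) \<le> 1" by blast
    show ?thesis using rtranclp_trans[OF 1(1) 2(1)] 2(2,3) by blast
  qed (use less.prems in blast)
qed

text \<open>\<open>transfer_mark\<close> asks for a traversal in the direction of the arrow. If the
  arrow points to \<open>vs ! i\<close> instead of \<open>vs ! Suc i\<close>, the reversed strand
  provides it.\<close>

lemma transfer_exists:
  assumes "good_marks ns" "m \<in> set ns" "canonical G vs es" "mark_edge m \<in> set es"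
  shows "\<exists>n. transfer_mark G m n \<and> mark_edge n = {hd vs, last vs} \<and> is_bead n = is_bead m \<and>
    (\<forall>e v. n = Arrow e v \<longrightarrow> v \<in> e)"
proof (cases m)
  case (Bead p)
  then have "transfer_mark G m (Bead {hd vs, last vs})"
    using assms by (auto simp: canonical_def intro!: transfer_mark.intros)
  then show ?thesis using Bead by (intro exI[of _ "Bead {hd vs, last vs}"]) (auto simp: is_bead_def)
next
  case (Arrow p w)
  have st: "strand G vs es" using assms by (simp add: canonical_def)
  obtain i where i: "i < length es" "p = es ! i" using assms(4) Arrow by (auto simp: in_set_conv_nth)
  have "w \<in> {vs ! i, vs ! Suc i}"
    using assms(1,2) Arrow path_edge(2)[OF mpath_path[OF st[unfolded strand_iff]] i(1)] i(2)
    by (auto simp: good_marks_def strand_marks_def)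
  then consider "w = vs ! Suc i" | "w = vs ! i" by blast
  then show ?thesis
  proof cases
    case 1
    then have "transfer_mark G m (Arrow {hd vs, last vs} (last vs))"
      unfolding Arrow i(2) 1 by (intro transfer_mark.intros st i)
    then show ?thesis using Arrow by (intro exI[of _ "Arrow {hd vs, last vs} (last vs)"]) (auto simp: is_bead_def)
  next
    case 2
    note ri = rev_index[OF st i(1)]
    have "strand G (rev vs) (rev es)" using st by (simp add: strand_iff maximal_path_rev)
    from transfer_mark.intros(2)[OF this, of "length es - Suc i"]
    have "transfer_mark G m (Arrow {last vs, hd vs} (hd vs))"
      unfolding Arrow i(2) 2 using ri by (simp add: hd_rev last_rev)
    then show ?thesis using Arrow
      by (intro exI[of _ "Arrow {last vs, hd vs} (hd vs)"]) (auto simp: is_bead_def insert_commute)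
  qed
qed

lemma end_class_cases:
  assumes "canonical G vs es"
  shows "end_class (hd vs) (last vs) = 0 \<longleftrightarrow> {hd vs, last vs} \<in> cups (stacked_diagram G)"
    "end_class (hd vs) (last vs) = 2 \<longleftrightarrow> {hd vs, last vs} \<in> caps (stacked_diagram G)"
    "end_class (hd vs) (last vs) \<in> {0, 1, 2}"
proof -
  have "{hd vs, last vs} \<in> stacked_diagram G" using assms by (auto simp: stacked_diagram_def canonical_def)
  moreover have "outer (hd vs)" "outer (last vs)" using assms mpath_outer by (auto simp: canonical_def strand_iff)
  ultimately show "end_class (hd vs) (last vs) = 0 \<longleftrightarrow> {hd vs, last vs} \<in> cups (stacked_diagram G)"
    "end_class (hd vs) (last vs) = 2 \<longleftrightarrow> {hd vs, last vs} \<in> caps (stacked_diagram G)"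
    "end_class (hd vs) (last vs) \<in> {0, 1, 2}"
    by (cases "hd vs"; cases "last vs"; auto simp: cups_def caps_def)+
qed

lemma stacked_diagram_canonical:
  assumes "e \<in> stacked_diagram G"
  shows "\<exists>vs es. canonical G vs es \<and> e = {hd vs, last vs}"
proof -
  obtain vs es where s: "strand G vs es" "e = {hd vs, last vs}" using assms by (auto simp: stacked_diagram_def)
  then show ?thesis
    using canonical_or_rev[OF s(1)] by (metis hd_rev last_rev insert_commute)
qed

text \<open>With at most one marking per strand, the charge decides everything: 1 is a single bead
  on a cup, -1 a single arrow on a cap, and 0 no marking on a through string.\<close>

lemma transfer_marks_exist:
  assumes good: "good_marks ns" and one: "\<And>vs es. canonical G vs es \<Longrightarrow> length (marked_edges ns es) \<le> 1"
  shows "\<exists>ms. list_all2 (transfer_mark G) ns ms \<and> marked_diagram r t (stacked_diagram G, ms)"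
proof -
  let ?D = "stacked_diagram G"
  have sm: "strand_marks G ns" and bead_iff: "\<And>m. m \<in> set ns \<Longrightarrow> is_bead m \<longleftrightarrow> pos_edge (mark_edge m)"
    using good by (auto simp: good_marks_def)
  have "\<forall>m\<in>set ns. \<exists>vs es n. canonical G vs es \<and> mark_edge m \<in> set es \<and> transfer_mark G m n \<and>
    mark_edge n = {hd vs, last vs} \<and> is_bead n = is_bead m \<and> (\<forall>e v. n = Arrow e v \<longrightarrow> v \<in> e)"
  proof
    fix m assume m: "m \<in> set ns"
    then have "on_strand G (mark_edge m)" using sm by (simp add: strand_marks_def)
    then obtain vs es where c: "canonical G vs es" "mark_edge m \<in> set es"
      using canonical_exists nth_mem by metis
    then show "\<exists>vs es n. canonical G vs es \<and> mark_edge m \<in> set es \<and> transfer_mark G m n \<and>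
      mark_edge n = {hd vs, last vs} \<and> is_bead n = is_bead m \<and> (\<forall>e v. n = Arrow e v \<longrightarrow> v \<in> e)"
      using transfer_exists[OF good m c] by blast
  qed
  from bchoice[OF this] obtain V where "\<forall>m\<in>set ns. \<exists>es n. canonical G (V m) es \<and> mark_edge m \<in> set es \<and>
    transfer_mark G m n \<and> mark_edge n = {hd (V m), last (V m)} \<and> is_bead n = is_bead m \<and> (\<forall>e v. n = Arrow e v \<longrightarrow> v \<in> e)" ..
  from bchoice[OF this] obtain E where "\<forall>m\<in>set ns. \<exists>n. canonical G (V m) (E m) \<and> mark_edge m \<in> set (E m) \<and>
    transfer_mark G m n \<and> mark_edge n = {hd (V m), last (V m)} \<and> is_bead n = is_bead m \<and> (\<forall>e v. n = Arrow e v \<longrightarrow> v \<in> e)" ..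
  from bchoice[OF this] obtain f where f_all: "\<forall>m\<in>set ns. canonical G (V m) (E m) \<and> mark_edge m \<in> set (E m) \<and>
    transfer_mark G m (f m) \<and> mark_edge (f m) = {hd (V m), last (V m)} \<and> is_bead (f m) = is_bead m \<and>
    (\<forall>e v. f m = Arrow e v \<longrightarrow> v \<in> e)" ..
  have f: "\<And>m. m \<in> set ns \<Longrightarrow> canonical G (V m) (E m)" "\<And>m. m \<in> set ns \<Longrightarrow> mark_edge m \<in> set (E m)"
    "\<And>m. m \<in> set ns \<Longrightarrow> transfer_mark G m (f m)" "\<And>m. m \<in> set ns \<Longrightarrow> mark_edge (f m) = {hd (V m), last (V m)}"
    "\<And>m. m \<in> set ns \<Longrightarrow> is_bead (f m) = is_bead m" "\<And>m e v. m \<in> set ns \<Longrightarrow> f m = Arrow e v \<Longrightarrow> v \<in> e"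
    using f_all by blast+
  have share: "vs = vs' \<and> es = es'" if "canonical G vs es" "canonical G vs' es'" "{hd vs, last vs} = {hd vs', last vs'}" for vs es vs' es'
  proof -
    have "vs' = vs \<and> es' = es \<or> vs' = rev vs \<and> es' = rev es"
      using that by (intro mpath_share_end[of _ _ _ _ "hd vs"]) (auto simp: canonical_def strand_iff)
    then show ?thesis using canonical_or_rev[of vs es] that by (auto simp: canonical_def)
  qed
  have single: "marked_edges ns es = [mark_edge m]" if "canonical G vs es" "m \<in> set ns" "mark_edge m \<in> set es" for vs es m
  proof -
    have "mark_edge m \<in> set (marked_edges ns es)" using that by (auto simp: marked_edges_def)
    then show ?thesis using one[OF that(1)] by (cases "marked_edges ns es") auto
  qed
  have charge: "chrg (marked_edges ns es) = 1 - int (end_class (hd vs) (last vs))" if "canonical G vs es" for vs es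
    using good that by (auto simp: good_marks_def)
  have kind: "is_bead m \<longleftrightarrow> mark_edge (f m) \<in> cups ?D" "\<not> is_bead m \<longleftrightarrow> mark_edge (f m) \<in> caps ?D" if m: "m \<in> set ns" for m
  proof -
    \<comment> \<open>The charge of a one-element list, compared with the prescribed charge of its
      strand.\<close>
    have "(if is_bead m then 1 else -1) = 1 - int (end_class (hd (V m)) (last (V m)))"
      using charge[OF f(1)[OF m]] bead_iff[OF m] unfolding single[OF f(1)[OF m] m f(2)[OF m]] by (simp add: charge_def)
    then have "is_bead m \<longleftrightarrow> end_class (hd (V m)) (last (V m)) = 0" "\<not> is_bead m \<longleftrightarrow> end_class (hd (V m)) (last (V m)) = 2"
      by (auto split: if_splits)
    then show "is_bead m \<longleftrightarrow> mark_edge (f m) \<in> cups ?D" "\<not> is_bead m \<longleftrightarrow> mark_edge (f m) \<in> caps ?D"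
      using end_class_cases[OF f(1)[OF m]] f(4)[OF m] by auto
  qed
  have onto: "\<exists>m\<in>set ns. mark_edge (f m) = e" if "e \<in> cups ?D \<union> caps ?D" for e
  proof -
    have "e \<in> ?D" using that by (auto simp: cups_def caps_def)
    then obtain vs es where c: "canonical G vs es" "e = {hd vs, last vs}" using stacked_diagram_canonical by blast
    then have "end_class (hd vs) (last vs) = 0 \<or> end_class (hd vs) (last vs) = 2"
      using end_class_cases[OF c(1)] that by auto
    \<comment> \<open>A nonzero charge forces a marking, so no cup or cap is left bare.\<close>
    then have "chrg (marked_edges ns es) \<noteq> 0" using charge[OF c(1)] by auto
    then obtain p where "p \<in> set (marked_edges ns es)" by (cases "marked_edges ns es") (auto simp: charge_def)
    then obtain m where m: "m \<in> set ns" "mark_edge m \<in> set es" by (auto simp: marked_edges_def)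
    then have "vs = V m" using canonical_share_edge[OF c(1) f(1)[OF m(1)] m(2) f(2)[OF m(1)]] by simp
    then show ?thesis using m(1) f(4)[OF m(1)] c(2) by blast
  qed
  define ms where "ms = map f ns"
  have "list_all2 (transfer_mark G) ns ms" using f(3) by (auto simp: ms_def list.rel_map intro: list.rel_refl_strong)
  moreover have "distinct (map mark_edge ms)"
  proof -
    have "m = m'" if m: "m \<in> set ns" "m' \<in> set ns" "mark_edge (f m) = mark_edge (f m')" for m m'
    proof -
      have "E m = E m'" using share[OF f(1)[OF m(1)] f(1)[OF m(2)]] f(4)[OF m(1)] f(4)[OF m(2)] m(3) by auto
      then have "[mark_edge m] = [mark_edge m']"
        using single[OF f(1)[OF m(1)] m(1) f(2)[OF m(1)]] single[OF f(1)[OF m(2)] m(2) f(2)[OF m(2)]] by simp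
      then show ?thesis using sm m(1,2) by (auto simp: strand_marks_def distinct_map dest: inj_onD)
    qed
    moreover have "distinct ns" using sm by (auto simp: strand_marks_def distinct_map)
    ultimately show ?thesis by (auto simp: ms_def distinct_map inj_on_def)
  qed
  moreover have "{e. Bead e \<in> set ms} = cups ?D"
  proof (intro equalityI subsetI)
    fix e assume "e \<in> {e. Bead e \<in> set ms}"
    then obtain m where m': "m \<in> set ns" "Bead e = f m" by (auto simp: ms_def)
    note m = m'(1) m'(2)[symmetric]
    have "is_bead (f m)" unfolding m(2) by (simp add: is_bead_def)
    then show "e \<in> cups ?D" using kind(1)[OF m(1)] f(5)[OF m(1)] m(2) by simp
  next
    fix e assume e: "e \<in> cups ?D"
    then obtain m where m: "m \<in> set ns" "mark_edge (f m) = e" using onto by blast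
    then have "is_bead (f m)" using kind(1)[OF m(1)] f(5)[OF m(1)] e by simp
    then have "f m = Bead e" using m(2) by (auto simp: is_bead_def)
    then show "e \<in> {e. Bead e \<in> set ms}" using m(1) by (force simp: ms_def)
  qed
  moreover have "{e. \<exists>v. Arrow e v \<in> set ms} = caps ?D"
  proof (intro equalityI subsetI)
    fix e assume "e \<in> {e. \<exists>v. Arrow e v \<in> set ms}"
    then obtain m v where m': "m \<in> set ns" "Arrow e v = f m" by (auto simp: ms_def)
    note m = m'(1) m'(2)[symmetric]
    have "\<not> is_bead (f m)" unfolding m(2) by (simp add: is_bead_def)
    then show "e \<in> caps ?D" using kind(2)[OF m(1)] f(5)[OF m(1)] m(2) by simp
  next
    fix e assume e: "e \<in> caps ?D"
    then obtain m where m: "m \<in> set ns" "mark_edge (f m) = e" using onto by blast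
    then have "\<not> is_bead (f m)" using kind(2)[OF m(1)] f(5)[OF m(1)] e by simp
    then obtain v where "f m = Arrow e v" using m(2) by (cases "f m") (auto simp: is_bead_def)
    then show "e \<in> {e. \<exists>v. Arrow e v \<in> set ms}" using m(1) by (force simp: ms_def)
  qed
  moreover have "\<forall>e v. Arrow e v \<in> set ms \<longrightarrow> v \<in> e" using f(6) by (auto simp: ms_def)
  ultimately have "marked_diagram r t (?D, ms)" using brauer_stacked_diagram by (simp add: marked_diagram_def)
  then show ?thesis using \<open>list_all2 (transfer_mark G) ns ms\<close> by blast
qed

end

section \<open>The composite of two marked diagrams\<close>

text \<open>The edges of the stack that carry a marking.\<close>

definition horizontal_edge :: "vertex set set \<Rightarrow> vertex set set \<Rightarrow> stack_edge \<Rightarrow> bool" where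
  "horizontal_edge D1 D2 p \<longleftrightarrow> (case p of Inl e \<Rightarrow> e \<in> cups D1 \<union> caps D1 | Inr e \<Rightarrow> e \<in> cups D2 \<union> caps D2)"

definition lift_upper :: "vertex set mark \<Rightarrow> stack_edge mark" where
  "lift_upper m = (case m of Bead e \<Rightarrow> Bead (Inl e) | Arrow e v \<Rightarrow> Arrow (Inl e) (upper v))"

definition lift_lower :: "vertex set mark \<Rightarrow> stack_edge mark" where
  "lift_lower m = (case m of Bead e \<Rightarrow> Bead (Inr e) | Arrow e v \<Rightarrow> Arrow (Inr e) (lower v))"

lemma stack_marks_lift: "stack_marks ms1 ms2 = map lift_upper ms1 @ map lift_lower ms2"
  by (simp add: stack_marks_def lift_upper_def lift_lower_def)

lemma lift_simps [simp]:
  "lift_upper (Bead e) = Bead (Inl e)" "lift_upper (Arrow e v) = Arrow (Inl e) (upper v)"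
  "lift_lower (Bead e) = Bead (Inr e)" "lift_lower (Arrow e v) = Arrow (Inr e) (lower v)"
  "mark_edge (lift_upper m) = Inl (mark_edge m)" "mark_edge (lift_lower m) = Inr (mark_edge m)"
  "is_bead (lift_upper m) = is_bead m" "is_bead (lift_lower m) = is_bead m"
  by (simp_all add: lift_upper_def lift_lower_def is_bead_def split: mark.split)

lemma marked_diagram_edges:
  assumes "marked_diagram r s (D, ms)"
  shows "mark_edge ` set ms = cups D \<union> caps D" "m \<in> set ms \<Longrightarrow> is_bead m \<longleftrightarrow> mark_edge m \<in> cups D"
proof -
  note M = marked_diagramD[OF assms]
  show "mark_edge ` set ms = cups D \<union> caps D"
  proof (intro equalityI subsetI)
    fix e assume "e \<in> mark_edge ` set ms"
    then obtain m where m: "m \<in> set ms" "e = mark_edge m" by blast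
    show "e \<in> cups D \<union> caps D"
    proof (cases m)
      case (Bead f)
      then show ?thesis using m M(3)[of f] by auto
    next
      case (Arrow f v)
      then show ?thesis using m M(4)[of f v] by auto
    qed
  next
    fix e assume "e \<in> cups D \<union> caps D"
    then show "e \<in> mark_edge ` set ms" using M(3)[of e] M(5)[of e] by force
  qed
  have "cups D \<inter> caps D = {}"
  proof -
    have "e \<notin> caps D" if "e \<in> cups D" for e
      by (rule cupsE[OF M(1) that]) (auto simp: caps_def)
    then show ?thesis by blast
  qed
  then show "m \<in> set ms \<Longrightarrow> is_bead m \<longleftrightarrow> mark_edge m \<in> cups D"
    using M(3,4) by (cases m) (auto simp: is_bead_def)
qed

text \<open>The set-theoretic part common to both factors in \<open>edge_kinds\<close>:
  \<open>M\<close> is the middle row, \<open>A\<close> the row that is mapped into it,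
  \<open>B\<close> the other row.\<close>

lemma image_in_complement:
  assumes "\<And>x. x \<in> e \<Longrightarrow> f x \<in> M \<longleftrightarrow> x \<in> A" "\<And>x. x \<in> e \<Longrightarrow> x \<in> A \<longleftrightarrow> x \<notin> B" "x \<in> e"
  shows "f ` e \<subseteq> M \<longleftrightarrow> e \<subseteq> A" "f ` e \<inter> M = {} \<longleftrightarrow> e \<subseteq> B"
    "v \<in> f ` e \<Longrightarrow> v \<notin> M \<Longrightarrow> \<not> e \<subseteq> A" "w \<in> f ` e \<Longrightarrow> w \<in> M \<Longrightarrow> \<not> e \<subseteq> B"
    "\<not> (e \<subseteq> A \<and> e \<subseteq> B)"
  using assms by blast+

context stacked
begin

abbreviation "hor_edge \<equiv> horizontal_edge D1 D2"

text \<open>Edges within the middle row are caps of the upper factor, with arrows, or cups of the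
  lower one, with beads. For edges avoiding the middle row the roles are exchanged, and an edge with
  one end in the middle is a through string of its factor.\<close>

lemma edge_kinds:
  assumes "p \<in> G"
  shows "stack_ends p \<subseteq> range Mid \<Longrightarrow> hor_edge p \<and> (pos_edge p \<longleftrightarrow> \<not> isl p)"
    "v \<in> stack_ends p \<Longrightarrow> v \<notin> range Mid \<Longrightarrow> w \<in> stack_ends p \<Longrightarrow> w \<in> range Mid \<Longrightarrow> \<not> hor_edge p"
    "stack_ends p \<inter> range Mid = {} \<Longrightarrow> hor_edge p \<and> (pos_edge p \<longleftrightarrow> isl p)"
proof -
  have ne: "e \<noteq> {}" if "e \<in> D1 \<union> D2" for e
    using that brauer_diagram_edge(1)[OF D1, of e] brauer_diagram_edge(1)[OF D2, of e] by auto
  have *: "(stack_ends p \<subseteq> range Mid \<longrightarrow> hor_edge p \<and> (pos_edge p \<longleftrightarrow> \<not> isl p)) \<and>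
    (v \<in> stack_ends p \<longrightarrow> v \<notin> range Mid \<longrightarrow> w \<in> stack_ends p \<longrightarrow> w \<in> range Mid \<longrightarrow> \<not> hor_edge p) \<and>
    (stack_ends p \<inter> range Mid = {} \<longrightarrow> hor_edge p \<and> (pos_edge p \<longleftrightarrow> isl p))"
    using assms
  proof (cases rule: G_cases)
    case (1 e)
    have r: "upper x \<in> range Mid \<longleftrightarrow> x \<in> range Bot" "x \<in> range Bot \<longleftrightarrow> x \<notin> range Top" if "x \<in> e" for x
      using no_Mid(1)[OF 1(2) that] by (cases x; auto)+
    obtain x where x: "x \<in> e" using ne 1(2) by auto
    have h: "hor_edge p \<longleftrightarrow> e \<subseteq> range Top \<or> e \<subseteq> range Bot" "pos_edge p \<longleftrightarrow> e \<subseteq> range Top"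
      using 1 by (auto simp: horizontal_edge_def positive_edge_def cups_def caps_def)
    have "upper y \<in> range Mid \<longleftrightarrow> y \<in> range Bot" "y \<in> range Bot \<longleftrightarrow> y \<notin> range Top" if "y \<in> e" for y
      using r[OF that] by simp_all
    note im = image_in_complement[of e upper "range Mid" "range Bot" "range Top", OF this x]
    have "stack_ends p = upper ` e" "isl p = True" unfolding 1 by (simp_all add: stack_ends_simps)
    then show ?thesis unfolding h using im by auto
  next
    case (2 e)
    have r: "lower x \<in> range Mid \<longleftrightarrow> x \<in> range Top" "x \<in> range Bot \<longleftrightarrow> x \<notin> range Top" if "x \<in> e" for x
      using no_Mid(2)[OF 2(2) that] by (cases x; auto)+
    obtain x where x: "x \<in> e" using ne 2(2) by auto
    have h: "hor_edge p \<longleftrightarrow> e \<subseteq> range Top \<or> e \<subseteq> range Bot" "pos_edge p \<longleftrightarrow> e \<subseteq> range Top"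
      using 2 by (auto simp: horizontal_edge_def positive_edge_def cups_def caps_def)
    have "lower y \<in> range Mid \<longleftrightarrow> y \<in> range Top" "y \<in> range Top \<longleftrightarrow> y \<notin> range Bot" if "y \<in> e" for y
      using r[OF that] by simp_all
    note im = image_in_complement[of e lower "range Mid" "range Top" "range Bot", OF this x]
    have "stack_ends p = lower ` e" "isl p = False" unfolding 2 by (simp_all add: stack_ends_simps)
    then show ?thesis unfolding h using im by auto
  qed
  then show "stack_ends p \<subseteq> range Mid \<Longrightarrow> hor_edge p \<and> (pos_edge p \<longleftrightarrow> \<not> isl p)"
    "v \<in> stack_ends p \<Longrightarrow> v \<notin> range Mid \<Longrightarrow> w \<in> stack_ends p \<Longrightarrow> w \<in> range Mid \<Longrightarrow> \<not> hor_edge p"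
    "stack_ends p \<inter> range Mid = {} \<Longrightarrow> hor_edge p \<and> (pos_edge p \<longleftrightarrow> isl p)" by blast+
qed

lemma hd_Top_iff:
  assumes "mpath vs es"
  shows "isl (hd es) \<longleftrightarrow> hd vs \<in> range Top" "isl (last es) \<longleftrightarrow> last vs \<in> range Top"
proof -
  have *: "isl (hd es) \<longleftrightarrow> hd vs \<in> range Top" if m: "mpath vs es" for vs es
  proof -
    have "hd vs \<in> stack_ends (hd es)" "hd es \<in> G"
      using path_edge[OF mpath_path[OF m], of 0] path_hd[OF mpath_path[OF m]] m
      by (auto simp: maximal_path_def hd_conv_nth)
    then show ?thesis
      using Top_edge Bot_edge mpath_outer(1)[OF m] unfolding outer_iff by (cases "hd vs") auto
  qed
  show "isl (hd es) \<longleftrightarrow> hd vs \<in> range Top" using *[OF assms] .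
  show "isl (last es) \<longleftrightarrow> last vs \<in> range Top" using *[OF maximal_path_rev[OF assms]] by (simp add: hd_rev)
qed

text \<open>Brings the prescribed charge into the form of \<open>alternating_sum\<close>: an end in
  the top row contributes 1 and an end in the bottom row -1.\<close>

lemma end_class_isl:
  assumes "canonical G vs es"
  shows "2 * (1 - int (end_class (hd vs) (last vs))) = (if isl (hd es) then 1 else - 1) + (if isl (last es) then 1 else - 1)"
proof -
  have m: "mpath vs es" using assms by (simp add: canonical_def strand_iff)
  show ?thesis
    using hd_Top_iff[OF m] mpath_outer(1,2)[OF m] unfolding outer_iff by (cases "hd vs"; cases "last vs") auto
qed

text \<open>On a strand with at least two edges the first and last are through strings of their
  factors and unmarked, and on all others the charge is opposite to the colour. As colours
  alternate, the charges do so too, and their sum follows from the colours of the two end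
  edges.\<close>

lemma horizontal_canonical:
  assumes c: "canonical G vs es"
  shows "successively (\<lambda>p q. pos_edge p \<noteq> pos_edge q) (filter hor_edge es)"
    "chrg (filter hor_edge es) = 1 - int (end_class (hd vs) (last vs))"
proof -
  have m: "mpath vs es" using c by (simp add: canonical_def strand_iff)
  note p = mpath_path[OF m]
  have ne: "es \<noteq> []" using m by (simp add: maximal_path_def)
  have oh: "hd vs \<notin> range Mid" "last vs \<notin> range Mid" using mpath_outer[OF m] not_outer_Mid by auto
  have "successively (\<lambda>p q. pos_edge p \<noteq> pos_edge q) (filter hor_edge es) \<and>
    chrg (filter hor_edge es) = 1 - int (end_class (hd vs) (last vs))"
  proof (cases "length es = 1")
    case True
    then obtain q where q: "es = [q]" by (auto simp: length_Suc_conv)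
    have "stack_ends q = {hd vs, last vs}" "q \<in> G"
      using path_edge[OF p, of 0] path_hd[OF p] path_last[OF p] q by auto
    then have "hor_edge q" "pos_edge q \<longleftrightarrow> isl q" using edge_kinds(3)[of q] oh by auto
    then show ?thesis using end_class_isl[OF c] unfolding q by (auto simp: charge_def)
  next
    case False
    then have two: "2 \<le> length es" using ne by (cases es rule: remdups_adj.cases) auto
    define a z l where "a = hd es" and "z = last es" and "l = butlast (tl es)"
    have es: "es = a # l @ [z]" using two unfolding a_def z_def l_def by (cases es rule: remdups_adj.cases) auto
    have len: "length es = Suc (Suc (length l))" unfolding es by simp
    \<comment> \<open>The first edge joins an outer to a middle vertex; the last one is treated in
      the same way.\<close>
    have "\<not> hor_edge a"
    proof (rule edge_kinds(2)[OF _ _ oh(1)])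
      show "a \<in> G" "hd vs \<in> stack_ends a" "vs ! 1 \<in> stack_ends a"
        using path_edge[OF p, of 0] path_hd[OF p] two by (auto simp: es)
      show "vs ! 1 \<in> range Mid" using path_interior_Mid[OF p, of 0] two by simp
    qed
    moreover have "\<not> hor_edge z"
    proof (rule edge_kinds(2)[OF _ _ oh(2)])
      have "es ! Suc (length l) = z" unfolding es by simp
      then show "z \<in> G" "last vs \<in> stack_ends z" "vs ! Suc (length l) \<in> stack_ends z"
        using path_edge[OF p, of "Suc (length l)"] path_last[OF p] len by auto
      show "vs ! Suc (length l) \<in> range Mid" using path_interior_Mid[OF p, of "length l"] len by simp
    qed
    moreover have mid: "hor_edge q \<and> (pos_edge q \<longleftrightarrow> \<not> isl q)" if ql: "q \<in> set l" for q
    proof -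
      obtain i where i: "i < length l" "q = l ! i" using ql by (auto simp: in_set_conv_nth)
      then have q: "q = es ! Suc i" unfolding es by (simp add: nth_append)
      have "stack_ends q = {vs ! Suc i, vs ! Suc (Suc i)}" "q \<in> G"
        using path_edge[OF p, of "Suc i"] i len q by auto
      moreover have "vs ! Suc i \<in> range Mid" "vs ! Suc (Suc i) \<in> range Mid"
        using path_interior_Mid[OF p, of i] path_interior_Mid[OF p, of "Suc i"] i len by auto
      ultimately show ?thesis using edge_kinds(1)[of q] by auto
    qed
    ultimately have f: "filter hor_edge es = l" unfolding es by (auto simp: filter_id_conv)
    have alt: "successively (\<lambda>p q. isl p \<noteq> isl q) es"
      unfolding successively_iff_nth using path_alternates[OF p] by blast
    then have "successively (\<lambda>p q. isl p \<noteq> isl q) l"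
      unfolding es by (auto simp: successively_Cons successively_append_iff)
    then have 1: "successively (\<lambda>p q. pos_edge p \<noteq> pos_edge q) l"
      by (rule successively_mono) (use mid in auto)
    have "(\<Sum>q\<leftarrow>l. if pos_edge q then 1 else - 1) = (\<Sum>q\<leftarrow>l. - (if isl q then 1 else - 1 :: int))"
      using mid by (intro arg_cong[of _ _ sum_list] map_cong) auto
    also have "\<dots> = - (\<Sum>q\<leftarrow>l. if isl q then 1 else - 1)" by (simp add: uminus_sum_list_map o_def)
    finally have "2 * chrg l = - (2 * (\<Sum>q\<leftarrow>l. if isl q then 1 else - 1))" by (simp add: charge_def)
    moreover have "2 * (\<Sum>q\<leftarrow>es. if isl q then 1 else - 1 :: int) = 2 * (1 - int (end_class (hd vs) (last vs)))"
      using alternating_sum[OF alt ne] end_class_isl[OF c] by simp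
    moreover have "(\<Sum>q\<leftarrow>es. if isl q then 1 else - 1 :: int) =
      (if isl a then 1 else - 1) + (\<Sum>q\<leftarrow>l. if isl q then 1 else - 1) + (if isl z then 1 else - 1)"
      unfolding es by simp
    moreover have "2 * (1 - int (end_class (hd vs) (last vs))) = (if isl a then 1 else - 1) + (if isl z then 1 else - 1)"
      using end_class_isl[OF c] unfolding a_def z_def by simp
    \<comment> \<open>\<open>A\<close> and \<open>Z\<close> are the colour signs of the end edges
      and \<open>S\<close> is the inner sum: \<open>2 * (A + S + Z) = A + Z\<close> gives
      \<open>- 2 * S = A + Z\<close>, which is twice the charge.\<close>
    moreover have "x = y" if "2 * x = - (2 * S)" "2 * T = 2 * y" "T = A + S + Z" "2 * y = A + Z" for x y S T A Z :: int
      using that by linarith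
    ultimately have "chrg l = 1 - int (end_class (hd vs) (last vs))" by blast
    then show ?thesis using 1 f by simp
  qed
  then show "successively (\<lambda>p q. pos_edge p \<noteq> pos_edge q) (filter hor_edge es)"
    "chrg (filter hor_edge es) = 1 - int (end_class (hd vs) (last vs))" by blast+
qed

lemma remove_loop_marks_iff:
  "mark_edge ` set ms \<subseteq> G \<Longrightarrow> remove_loop_marks G ms = filter (\<lambda>m. on_strand G (mark_edge m)) ms"
  unfolding remove_loop_marks_def by (rule filter_cong) (auto simp: on_strand_iff)

lemma stack_marks_props:
  assumes M1: "marked_diagram r s (D1, ms1)" and M2: "marked_diagram s t (D2, ms2)"
  shows "distinct (map mark_edge (stack_marks ms1 ms2))"
    "mark_edge ` set (stack_marks ms1 ms2) = {p \<in> G. hor_edge p}"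
    "m \<in> set (stack_marks ms1 ms2) \<Longrightarrow> is_bead m \<longleftrightarrow> pos_edge (mark_edge m)"
    "Arrow p w \<in> set (stack_marks ms1 ms2) \<Longrightarrow> w \<in> stack_ends p"
proof -
  have "map mark_edge (stack_marks ms1 ms2) = map Inl (map mark_edge ms1) @ map Inr (map mark_edge ms2)"
    by (simp add: stack_marks_lift)
  then show "distinct (map mark_edge (stack_marks ms1 ms2))"
    using marked_diagramD(2)[OF M1] marked_diagramD(2)[OF M2]
    by (simp only: distinct_append) (auto simp: distinct_map inj_on_def)
  have "mark_edge ` set (stack_marks ms1 ms2) = Inl ` (mark_edge ` set ms1) \<union> Inr ` (mark_edge ` set ms2)"
    by (simp add: stack_marks_lift image_Un image_image)
  also have "\<dots> = {p \<in> G. hor_edge p}"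
    unfolding marked_diagram_edges(1)[OF M1] marked_diagram_edges(1)[OF M2]
  proof (rule Set.set_eqI)
    fix p
    show "p \<in> Inl ` (cups D1 \<union> caps D1) \<union> Inr ` (cups D2 \<union> caps D2) \<longleftrightarrow> p \<in> {p \<in> G. hor_edge p}"
      using cups_caps_subset[of D1] cups_caps_subset[of D2] by (cases p) (auto simp: horizontal_edge_def)
  qed
  finally show "mark_edge ` set (stack_marks ms1 ms2) = {p \<in> G. hor_edge p}" .
  show "is_bead m \<longleftrightarrow> pos_edge (mark_edge m)" if "m \<in> set (stack_marks ms1 ms2)"
    using that marked_diagram_edges(2)[OF M1] marked_diagram_edges(2)[OF M2]
    by (auto simp: stack_marks_lift positive_edge_def)
  show "w \<in> stack_ends p" if a: "Arrow p w \<in> set (stack_marks ms1 ms2)"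
  proof -
    consider m where "m \<in> set ms1" "Arrow p w = lift_upper m" | m where "m \<in> set ms2" "Arrow p w = lift_lower m"
      using a unfolding stack_marks_lift by auto
    then show ?thesis
    proof cases
      case 1
      show ?thesis
      proof (cases m)
        case (Arrow e v)
        then show ?thesis using 1 marked_diagramD(6)[OF M1, of e v] by (auto simp: stack_ends_simps)
      qed (use 1 in simp)
    next
      case 2
      show ?thesis
      proof (cases m)
        case (Arrow e v)
        then show ?thesis using 2 marked_diagramD(6)[OF M2, of e v] by (auto simp: stack_ends_simps)
      qed (use 2 in simp)
    qed
  qed
qed

lemma good_marks_initial:
  assumes M1: "marked_diagram r s (D1, ms1)" and M2: "marked_diagram s t (D2, ms2)"
  shows "good_marks (remove_loop_marks G (stack_marks ms1 ms2))"
proof -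
  note P = stack_marks_props[OF M1 M2]
  let ?ns = "filter (\<lambda>m. on_strand G (mark_edge m)) (stack_marks ms1 ms2)"
  have ns: "remove_loop_marks G (stack_marks ms1 ms2) = ?ns"
    by (rule remove_loop_marks_iff) (use P(2) in blast)
  have edges: "mark_edge ` set ?ns = {p \<in> G. hor_edge p \<and> on_strand G p}"
    using P(2) by auto
  have "marked_edges ?ns es = filter hor_edge es" if "canonical G vs es" for vs es
  proof -
    have "p \<in> G" "on_strand G p" if "p \<in> set es" for p
      using that \<open>canonical G vs es\<close> by (auto simp: canonical_def on_strand_def strand_iff maximal_path_def path_in_def)
    then show ?thesis unfolding marked_edges_def edges by (auto intro!: filter_cong)
  qed
  then have "\<forall>vs es. canonical G vs es \<longrightarrow> successively (\<lambda>p q. pos_edge p \<noteq> pos_edge q) (marked_edges ?ns es) \<and>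
       chrg (marked_edges ?ns es) = 1 - int (end_class (hd vs) (last vs))"
    using horizontal_canonical by simp
  moreover have "strand_marks G ?ns"
    using P(1,4) by (auto simp: strand_marks_def distinct_map_filter)
  ultimately show ?thesis unfolding ns good_marks_def using P(3) by auto
qed

text \<open>The canonical orientation of a cap runs from left to right, so an arrow against the
  strand is exactly one that points left on the resulting cap.\<close>

lemma transfer_canonical:
  assumes "transfer_mark G m n" "strand_marks G [m]" "mark_edge n \<in> cups (stacked_diagram G) \<union> caps (stacked_diagram G)"
  shows "\<exists>vs es. canonical G vs es \<and> mark_edge m \<in> set es \<and> mark_edge n = {hd vs, last vs} \<and> is_bead n = is_bead m \<and>
    (mark_edge n \<in> caps (stacked_diagram G) \<longrightarrow> left_arrow n = mark_against G m)"
  using assms(1)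
proof cases
  case (1 vs es p)
  define ws fs where "ws = (if canonical G vs es then vs else rev vs)" and "fs = (if canonical G vs es then es else rev es)"
  have "canonical G ws fs" "set fs = set es" "{hd ws, last ws} = {hd vs, last vs}"
    using canonical_or_rev[OF 1(3)] by (auto simp: ws_def fs_def hd_rev last_rev)
  then show ?thesis using 1 by (intro exI[of _ ws] exI[of _ fs]) (auto simp: is_bead_def)
next
  case (2 vs es i)
  define ws fs where "ws = (if canonical G vs es then vs else rev vs)" and "fs = (if canonical G vs es then es else rev es)"
  have c: "canonical G ws fs" "set fs = set es" "{hd ws, last ws} = {hd vs, last vs}"
    using canonical_or_rev[OF 2(3)] by (auto simp: ws_def fs_def hd_rev last_rev)
  have "left_arrow n = mark_against G m" if cap: "mark_edge n \<in> caps (stacked_diagram G)"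
  proof -
    have "vs ! Suc i \<in> stack_ends (es ! i)"
      using path_edge(2)[OF mpath_path[OF 2(3)[unfolded strand_iff]] 2(4)] by simp
    then have "mark_against G m \<longleftrightarrow> \<not> canonical G vs es"
      unfolding 2(1) using mark_against_strand[OF 2(3,4)] by simp
    moreover have "{hd vs, last vs} \<in> caps (stacked_diagram G)" using cap 2(2) by simp
    then obtain a b where ab: "{hd vs, last vs} = {Bot a, Bot b}" "a < b"
      using capsE[OF brauer_stacked_diagram] by metis
    then have "hd vs = Bot a \<and> last vs = Bot b \<or> hd vs = Bot b \<and> last vs = Bot a" by (auto simp: doubleton_eq_iff)
    then have "left_arrow n \<longleftrightarrow> \<not> canonical G vs es"
      using 2(3) ab(2) unfolding 2(2) by (auto simp: canonical_def)
    ultimately show ?thesis by simp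
  qed
  then show ?thesis using 2 c by (intro exI[of _ ws] exI[of _ fs]) (auto simp: is_bead_def)
qed

text \<open>Distinct markings that remain lie on distinct strands, which are cups or caps; the keys
  of strands were chosen so that their order is the order \<open>earlier\<close> of standard
  diagrams.\<close>

lemma transfer_sign:
  assumes sm: "strand_marks G ns" and tr: "list_all2 (transfer_mark G) ns ms"
    and M: "marked_diagram r t (stacked_diagram G, ms)"
  shows "marks_sign \<epsilon> ms = stack_sign \<epsilon> G ns"
proof -
  let ?D = "stacked_diagram G"
  have len: "length ns = length ms" using tr by (rule list_all2_lengthD)
  have T: "\<exists>vs es. canonical G vs es \<and> mark_edge (ns ! i) \<in> set es \<and> mark_edge (ms ! i) = {hd vs, last vs} \<and>
    is_bead (ms ! i) = is_bead (ns ! i) \<and> (mark_edge (ms ! i) \<in> caps ?D \<longrightarrow> left_arrow (ms ! i) = mark_against G (ns ! i)) \<and>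
    (is_bead (ms ! i) \<longleftrightarrow> mark_edge (ms ! i) \<in> cups ?D) \<and> (\<not> is_bead (ms ! i) \<longleftrightarrow> mark_edge (ms ! i) \<in> caps ?D)"
    if i: "i < length ms" for i
  proof -
    have mi: "ms ! i \<in> set ms" "ns ! i \<in> set ns" using i len by auto
    have e: "mark_edge (ms ! i) \<in> cups ?D \<union> caps ?D" using marked_diagram_edges(1)[OF M] mi by blast
    have d: "cups ?D \<inter> caps ?D = {}"
    proof -
      have "e \<notin> caps ?D" if "e \<in> cups ?D" for e
        by (rule cupsE[OF brauer_stacked_diagram that]) (auto simp: caps_def)
      then show ?thesis by blast
    qed
    have "strand_marks G [ns ! i]" using sm mi by (auto simp: strand_marks_def)
    moreover have "transfer_mark G (ns ! i) (ms ! i)" using list_all2_nthD2[OF tr i] .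
    ultimately obtain vs es where "canonical G vs es" "mark_edge (ns ! i) \<in> set es" "mark_edge (ms ! i) = {hd vs, last vs}"
      "is_bead (ms ! i) = is_bead (ns ! i)" "mark_edge (ms ! i) \<in> caps ?D \<longrightarrow> left_arrow (ms ! i) = mark_against G (ns ! i)"
      using transfer_canonical[OF _ _ e] by blast
    then show ?thesis using marked_diagram_edges(2)[OF M mi(1)] e d by blast
  qed
  show ?thesis
    unfolding marks_sign_def
  proof (rule weight_cong)
    fix i assume i: "i < length ms"
    show "left_arrow (ms ! i) = mark_against G (ns ! i)"
    proof (cases "is_bead (ms ! i)")
      case True
      then show ?thesis using T[OF i] by (auto simp: is_bead_def)
    qed (use T[OF i] in blast)
  next
    fix i j assume ij: "i < j" "j < length ms"
    then have i: "i < length ms" by simp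
    obtain vs es where v: "canonical G vs es" "mark_edge (ns ! i) \<in> set es" "mark_edge (ms ! i) = {hd vs, last vs}"
      "is_bead (ms ! i) \<longleftrightarrow> mark_edge (ms ! i) \<in> cups ?D" "\<not> is_bead (ms ! i) \<longleftrightarrow> mark_edge (ms ! i) \<in> caps ?D"
      using T[OF i] by blast
    obtain ws fs where w: "canonical G ws fs" "mark_edge (ns ! j) \<in> set fs" "mark_edge (ms ! j) = {hd ws, last ws}"
      "is_bead (ms ! j) \<longleftrightarrow> mark_edge (ms ! j) \<in> cups ?D" "\<not> is_bead (ms ! j) \<longleftrightarrow> mark_edge (ms ! j) \<in> caps ?D"
      using T[OF ij(2)] by blast
    have "mark_edge (ms ! i) \<noteq> mark_edge (ms ! j)"
      using marked_diagramD(2)[OF M] ij i by (auto simp: distinct_conv_nth)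
    then have "vs \<noteq> ws" using v(3) w(3) by auto
    moreover obtain k where k: "k < length es" "mark_edge (ns ! i) = es ! k" using v(2) by (metis in_set_conv_nth)
    moreover obtain l where l: "l < length fs" "mark_edge (ns ! j) = fs ! l" using w(2) by (metis in_set_conv_nth)
    ultimately have "mark_before G (ns ! j) (ns ! i) \<longleftrightarrow> strand_less ws vs"
      using edge_before_iff[OF w(1) v(1) l(1) k(1)] unfolding mark_before_def k(2) l(2) by auto
    also have "\<dots> \<longleftrightarrow> earlier (ms ! j) (ms ! i)"
    proof -
      \<comment> \<open>A canonical cup or cap starts at its left end, so its key is the left end,
        negated for caps, which are ordered from right to left.\<close>
      have key: "strand_key us = (if is_bead m then int (left_end (mark_edge m)) else - int (left_end (mark_edge m))) \<and>
          end_class (hd us) (last us) = (if is_bead m then 0 else 2)"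
        if u: "canonical G us gs" "mark_edge m = {hd us, last us}" "is_bead m \<longleftrightarrow> mark_edge m \<in> cups ?D"
          "\<not> is_bead m \<longleftrightarrow> mark_edge m \<in> caps ?D" for us gs and m :: "vertex set mark"
      proof -
        have "end_class (hd us) (last us) = (if is_bead m then 0 else 2)"
          using end_class_cases[OF u(1)] u(2-4) by auto
        moreover have "vless (hd us) (last us)" using u(1) by (simp add: canonical_def)
        ultimately show ?thesis
          unfolding strand_key_def u(2) by (cases "hd us"; cases "last us") (auto split: if_splits)
      qed
      show ?thesis
        using key[OF v(1,3,4,5)] key[OF w(1,3,4,5)]
        unfolding strand_less_def Let_def by (cases "ms ! i"; cases "ms ! j") (auto simp: is_bead_def)
    qed
    finally show "earlier (ms ! j) (ms ! i) = mark_before G (ns ! j) (ns ! i)" ..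
  qed (use len in auto)
qed

text \<open>Existence of a simplification gives meaning to \<open>SOME\<close>; the invariant then
  evaluates whichever result was chosen in terms of the initial stack.\<close>

lemma signed_composite:
  fixes \<delta> \<epsilon> :: "'k::field"
  assumes M1: "marked_diagram r s (D1, ms1)" and M2: "marked_diagram s t (D2, ms2)" and eps: "\<epsilon> \<in> {1, -1}"
  defines "x \<equiv> compose_diagrams r t \<delta> \<epsilon> (D1, ms1) (D2, ms2)"
  shows "lin (signed_diagram \<epsilon>) x = fun_scale (\<delta> ^ card (loops G) *
      stack_sign \<epsilon> G (remove_loop_marks G (stack_marks ms1 ms2))) (basis_vec (stacked_diagram G))"
    "x \<in> free_space {(D, ms). D = stacked_diagram G \<and> marked_diagram r t (D, ms)}"
proof -
  let ?n0 = "remove_loop_marks G (stack_marks ms1 ms2)"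
  have eps2: "\<epsilon> * \<epsilon> = 1" using eps by auto
  have good: "good_marks ?n0" by (rule good_marks_initial[OF M1 M2])
  obtain c' ns' where s: "(simp_step G \<epsilon>)\<^sup>*\<^sup>* (1, ?n0) (c', ns')" "good_marks ns'"
    "\<forall>vs es. canonical G vs es \<longrightarrow> length (marked_edges ns' es) \<le> 1"
    using simp_exists[OF good] by blast
  obtain ms' where "list_all2 (transfer_mark G) ns' ms'" "marked_diagram r t (stacked_diagram G, ms')"
    using transfer_marks_exist[OF s(2)] s(3) by blast
  then have "\<exists>x. simplified_composite r t \<delta> \<epsilon> (D1, ms1) (D2, ms2) x"
    using s(1) unfolding simplified_composite_def Let_def prod.case by blast
  then have "simplified_composite r t \<delta> \<epsilon> (D1, ms1) (D2, ms2) x"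
    unfolding x_def compose_diagrams_def by (rule someI_ex)
  then obtain c ns ms where c: "(simp_step G \<epsilon>)\<^sup>*\<^sup>* (1, ?n0) (c, ns)" "list_all2 (transfer_mark G) ns ms"
    "marked_diagram r t (stacked_diagram G, ms)"
    "x = fun_scale (\<delta> ^ card (loops G) * c) (basis_vec (stacked_diagram G, ms))"
    unfolding simplified_composite_def Let_def prod.case by blast
  have "strand_marks G (snd (1 :: 'k, ?n0))" using good by (simp add: good_marks_def)
  from simp_steps_sign[OF c(1) this eps2] have i: "strand_marks G ns" "c * stack_sign \<epsilon> G ns = stack_sign \<epsilon> G ?n0"
    by simp_all
  have "lin (signed_diagram \<epsilon>) x = fun_scale (\<delta> ^ card (loops G) * c * marks_sign \<epsilon> ms) (basis_vec (stacked_diagram G))"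
    unfolding c(4) lin_scale by (simp add: signed_diagram_def fun_scale_scale)
  also have "\<delta> ^ card (loops G) * c * marks_sign \<epsilon> ms = \<delta> ^ card (loops G) * stack_sign \<epsilon> G ?n0"
    unfolding transfer_sign[OF i(1) c(2,3)] i(2)[symmetric] by (simp add: mult.assoc)
  finally show "lin (signed_diagram \<epsilon>) x = fun_scale (\<delta> ^ card (loops G) *
      stack_sign \<epsilon> G (remove_loop_marks G (stack_marks ms1 ms2))) (basis_vec (stacked_diagram G))" .
  show "x \<in> free_space {(D, ms). D = stacked_diagram G \<and> marked_diagram r t (D, ms)}"
    unfolding c(4) using c(3) by (intro free_space_scale basis_vec_in_free_space) simp
qed

end

section \<open>The coefficient of a composite\<close>

text \<open>The coefficient of the composite for standard markings of both factors.\<close>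

definition comp_coeff :: "'k::field \<Rightarrow> 'k \<Rightarrow> vertex set set \<Rightarrow> vertex set set \<Rightarrow> 'k" where
  "comp_coeff \<delta> \<epsilon> D1 D2 = \<delta> ^ card (loops (stack D1 D2)) *
     stack_sign \<epsilon> (stack D1 D2) (remove_loop_marks (stack D1 D2) (stack_marks (std_marks D1) (std_marks D2)))"

context stacked
begin

lemma on_strand_no_loops: "loops G = {} \<Longrightarrow> p \<in> G \<Longrightarrow> on_strand G p"
  by (simp add: on_strand_iff)

lemma mark_before_total:
  assumes "loops G = {}" "mark_edge m \<in> G" "mark_edge n \<in> G" "mark_edge m \<noteq> mark_edge n"
  shows "mark_before G m n \<noteq> mark_before G n m"
  unfolding mark_before_def using assms on_strand_no_loops by (intro edge_before_total) auto

lemma mark_against_flip: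
  assumes "loops G = {}" "p \<in> G" "stack_ends p = {v, w}" "v \<noteq> w"
  shows "mark_against G (Arrow p v) \<noteq> mark_against G (Arrow p w)"
proof -
  obtain vs es i where c: "canonical G vs es" "i < length es" "p = es ! i"
    using canonical_exists on_strand_no_loops assms(1,2) by blast
  then have s: "strand G vs es" by (simp add: canonical_def)
  have "vs ! Suc i \<in> {v, w}"
    using path_edge(2)[OF mpath_path[OF s[unfolded strand_iff]] c(2)] assms(3) c(3) by auto
  then show ?thesis
    using mark_against_strand[OF s c(2), of v] mark_against_strand[OF s c(2), of w] assms(3,4) c(1,3) by auto
qed

text \<open>In the absence of loops every marking lies on a strand and is counted by the sign, so
  the sign is alternating in the markings of one factor, and \<open>alternating_marks\<close>
  applies.\<close>

lemma sign_upper: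
  assumes L: "loops G = {}" and M: "marked_diagram r s (D1, ms1)" and eps: "\<epsilon> \<in> {1, -1}"
  shows "stack_sign \<epsilon> G (stack_marks ms1 ms2) = marks_sign \<epsilon> ms1 * stack_sign \<epsilon> G (stack_marks (std_marks D1) ms2)"
proof (rule alternating_marks[OF eps M])
  have eps2: "\<epsilon> * \<epsilon> = 1" using eps by auto
  fix xs a b ys assume M: "marked_diagram r s (D1, xs @ [a, b] @ ys)"
  have "mark_edge a \<in> D1" "mark_edge b \<in> D1" "mark_edge a \<noteq> mark_edge b"
    using marked_diagram_edges(1)[OF M] cups_caps_subset[of D1] marked_diagramD(2)[OF M] by auto
  then have "mark_before G (lift_upper a) (lift_upper b) \<noteq> mark_before G (lift_upper b) (lift_upper a)"
    by (intro mark_before_total L) auto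
  then show "stack_sign \<epsilon> G (stack_marks (xs @ [b, a] @ ys) ms2) = \<epsilon> * stack_sign \<epsilon> G (stack_marks (xs @ [a, b] @ ys) ms2)"
    using weight_swap[OF eps2, of "mark_before G" "lift_upper a" "lift_upper b" "mark_against G" "map lift_upper xs"
      "map lift_upper ys @ map lift_lower ms2"] by (simp add: stack_marks_lift)
next
  have eps2: "\<epsilon> * \<epsilon> = 1" using eps by auto
  fix xs e v w ys assume M: "marked_diagram r s (D1, xs @ [Arrow e v] @ ys)" "e = {v, w}" "v \<noteq> w"
  have e: "e \<in> caps D1" using marked_diagramD(4)[OF M(1), of e v] by simp
  then have "v \<in> range Bot" "w \<in> range Bot" using M(2) by (auto simp: caps_def)
  then have "upper v \<noteq> upper w" using M(3) by auto
  moreover have "Inl e \<in> G" "stack_ends (Inl e) = {upper v, upper w}"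
    using e cups_caps_subset[of D1] M(2) by (auto simp: stack_ends_simps)
  ultimately have "mark_against G (Arrow (Inl e) (upper v)) \<noteq> mark_against G (Arrow (Inl e) (upper w))"
    by (intro mark_against_flip L)
  then show "stack_sign \<epsilon> G (stack_marks (xs @ [Arrow e w] @ ys) ms2) = \<epsilon> * stack_sign \<epsilon> G (stack_marks (xs @ [Arrow e v] @ ys) ms2)"
    using weight_replace[OF eps2, of "map lift_upper xs" "map lift_upper ys @ map lift_lower ms2" "mark_before G"
      "Arrow (Inl e) (upper v)" "Arrow (Inl e) (upper w)" "mark_against G"]
    by (simp add: stack_marks_lift mark_before_def del: mark_against.simps)
qed

lemma sign_lower:
  assumes L: "loops G = {}" and M: "marked_diagram s t (D2, ms2)" and eps: "\<epsilon> \<in> {1, -1}"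
  shows "stack_sign \<epsilon> G (stack_marks ms1 ms2) = marks_sign \<epsilon> ms2 * stack_sign \<epsilon> G (stack_marks ms1 (std_marks D2))"
proof (rule alternating_marks[OF eps M])
  have eps2: "\<epsilon> * \<epsilon> = 1" using eps by auto
  fix xs a b ys assume M: "marked_diagram s t (D2, xs @ [a, b] @ ys)"
  have "mark_edge a \<in> D2" "mark_edge b \<in> D2" "mark_edge a \<noteq> mark_edge b"
    using marked_diagram_edges(1)[OF M] cups_caps_subset[of D2] marked_diagramD(2)[OF M] by auto
  then have "mark_before G (lift_lower a) (lift_lower b) \<noteq> mark_before G (lift_lower b) (lift_lower a)"
    by (intro mark_before_total L) auto
  then show "stack_sign \<epsilon> G (stack_marks ms1 (xs @ [b, a] @ ys)) = \<epsilon> * stack_sign \<epsilon> G (stack_marks ms1 (xs @ [a, b] @ ys))"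
    using weight_swap[OF eps2, of "mark_before G" "lift_lower a" "lift_lower b" "mark_against G"
      "map lift_upper ms1 @ map lift_lower xs" "map lift_lower ys"] by (simp add: stack_marks_lift)
next
  have eps2: "\<epsilon> * \<epsilon> = 1" using eps by auto
  fix xs e v w ys assume M: "marked_diagram s t (D2, xs @ [Arrow e v] @ ys)" "e = {v, w}" "v \<noteq> w"
  have e: "e \<in> caps D2" using marked_diagramD(4)[OF M(1), of e v] by simp
  then have "v \<in> range Bot" "w \<in> range Bot" using M(2) by (auto simp: caps_def)
  then have "lower v \<noteq> lower w" using M(3) by auto
  moreover have "Inr e \<in> G" "stack_ends (Inr e) = {lower v, lower w}"
    using e cups_caps_subset[of D2] M(2) by (auto simp: stack_ends_simps)
  ultimately have "mark_against G (Arrow (Inr e) (lower v)) \<noteq> mark_against G (Arrow (Inr e) (lower w))"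
    by (intro mark_against_flip L)
  then show "stack_sign \<epsilon> G (stack_marks ms1 (xs @ [Arrow e w] @ ys)) = \<epsilon> * stack_sign \<epsilon> G (stack_marks ms1 (xs @ [Arrow e v] @ ys))"
    using weight_replace[OF eps2, of "map lift_upper ms1 @ map lift_lower xs" "map lift_lower ys" "mark_before G"
      "Arrow (Inr e) (lower v)" "Arrow (Inr e) (lower w)" "mark_against G"]
    by (simp add: stack_marks_lift mark_before_def del: mark_against.simps)
qed

text \<open>If there are loops, then \<open>\<epsilon> = 1\<close> and all signs are trivial, or \<open>\<delta> = 0\<close> and both sides vanish.\<close>

lemma signed_composite_std:
  fixes \<delta> \<epsilon> :: "'k::field"
  assumes M1: "marked_diagram r s (D1, ms1)" and M2: "marked_diagram s t (D2, ms2)"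
    and eps: "\<epsilon> \<in> {1, -1}" and del: "\<epsilon> = -1 \<Longrightarrow> \<delta> = 0"
  shows "lin (signed_diagram \<epsilon>) (compose_diagrams r t \<delta> \<epsilon> (D1, ms1) (D2, ms2)) =
    fun_scale (marks_sign \<epsilon> ms1 * marks_sign \<epsilon> ms2 * comp_coeff \<delta> \<epsilon> D1 D2) (basis_vec (stacked_diagram G))"
proof -
  let ?n0 = "remove_loop_marks G (stack_marks ms1 ms2)"
  consider "\<epsilon> = 1" | "loops G = {}" | "\<epsilon> = -1" "loops G \<noteq> {}" using eps by auto
  then have "\<delta> ^ card (loops G) * stack_sign \<epsilon> G ?n0 = marks_sign \<epsilon> ms1 * marks_sign \<epsilon> ms2 * comp_coeff \<delta> \<epsilon> D1 D2"
  proof cases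
    case 1
    then show ?thesis by (simp add: comp_coeff_def marks_sign_def weight_epsilon_one)
  next
    case 2
    then have "remove_loop_marks G ms = ms" for ms by (simp add: remove_loop_marks_def)
    then show ?thesis
      using sign_upper[OF 2 M1 eps, of ms2] sign_lower[OF 2 M2 eps, of "std_marks D1"] 2
      by (simp add: comp_coeff_def mult_ac)
  next
    case 3
    then have "0 < card (loops G)" using finite_loops by (simp add: card_gt_0_iff)
    then show ?thesis using del[OF 3(1)] by (simp add: comp_coeff_def)
  qed
  then show ?thesis using signed_composite(1)[OF M1 M2 eps, of \<delta>] by simp
qed

end

section \<open>Through strings\<close>

text \<open>Counts the vertices of each row: a through string has one in either row, a cup two in
  the top row, a cap two in the bottom row.\<close>

lemma brauer_diagram_card:
  assumes D: "brauer_diagram r s D"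
  shows "r = card (through_strings D) + 2 * card (cups D)" "s = card (through_strings D) + 2 * card (caps D)"
proof -
  have fin: "finite D" by (rule finite_brauer_diagram[OF D])
  have part: "D = through_strings D \<union> (cups D \<union> caps D)" using cups_caps_subset by (auto simp: through_strings_def)
  have disj: "cups D \<inter> caps D = {}" "through_strings D \<inter> (cups D \<union> caps D) = {}"
  proof -
    have "e \<notin> caps D" if "e \<in> cups D" for e
      by (rule cupsE[OF D that]) (auto simp: caps_def)
    then show "cups D \<inter> caps D = {}" by blast
  qed (auto simp: through_strings_def)
  have fins: "finite (through_strings D)" "finite (cups D)" "finite (caps D)" using fin part by (metis finite_Un)+
  have *: "card (range K \<inter> \<Union>D) = (\<Sum>e\<in>through_strings D. card (range K \<inter> e)) + ((\<Sum>e\<in>cups D. card (range K \<inter> e)) + (\<Sum>e\<in>caps D. card (range K \<inter> e)))"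
    for K :: "nat \<Rightarrow> vertex"
  proof -
    have "range K \<inter> \<Union>D = (\<Union>e\<in>D. range K \<inter> e)" by blast
    also have "card \<dots> = (\<Sum>e\<in>D. card (range K \<inter> e))"
      using fin brauer_diagram_edge(3)[OF D] brauer_diagram_unique[OF D] by (intro card_UN_disjoint) blast+
    also have "\<dots> = (\<Sum>e\<in>through_strings D \<union> (cups D \<union> caps D). card (range K \<inter> e))" using part by simp
    finally show ?thesis using disj fins by (simp add: sum.union_disjoint)
  qed
  have U: "\<Union>D = Top ` {1..r} \<union> Bot ` {1..s}" using D by (auto simp: brauer_diagram_def partition_on_def)
  have "range Top \<inter> \<Union>D = Top ` {1..r}" "range Bot \<inter> \<Union>D = Bot ` {1..s}" unfolding U by auto
  then have c: "card (range Top \<inter> \<Union>D) = r" "card (range Bot \<inter> \<Union>D) = s" by (simp_all add: card_image inj_on_def)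
  have th: "card (range Top \<inter> e) = 1 \<and> card (range Bot \<inter> e) = 1" if e: "e \<in> through_strings D" for e
  proof -
    obtain a b where "e = {Top a, Bot b}" by (rule throughE[OF D e])
    then have "range Top \<inter> e = {Top a}" "range Bot \<inter> e = {Bot b}" by auto
    then show ?thesis by simp
  qed
  have cu: "card (range Top \<inter> e) = 2 \<and> card (range Bot \<inter> e) = 0" if e: "e \<in> cups D" for e
  proof -
    obtain a b where "e = {Top a, Top b}" "a < b" by (rule cupsE[OF D e])
    then have "range Top \<inter> e = {Top a, Top b}" "range Bot \<inter> e = {}" "a \<noteq> b" by auto
    then show ?thesis by simp
  qed
  have ca: "card (range Top \<inter> e) = 0 \<and> card (range Bot \<inter> e) = 2" if e: "e \<in> caps D" for e
  proof -
    obtain a b where "e = {Bot a, Bot b}" "a < b" by (rule capsE[OF D e])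
    then have "range Bot \<inter> e = {Bot a, Bot b}" "range Top \<inter> e = {}" "a \<noteq> b" by auto
    then show ?thesis by simp
  qed
  show "r = card (through_strings D) + 2 * card (cups D)" "s = card (through_strings D) + 2 * card (caps D)"
    using *[of Top] *[of Bot] unfolding c by (simp_all add: th cu ca)
qed

lemma pair_in_edge:
  assumes "brauer_diagram r s D" "e \<in> D" "v \<in> e" "w \<in> e" "v \<noteq> w"
  shows "e = {v, w}"
proof -
  have "card {v, w} = card e" "{v, w} \<subseteq> e" "finite e" using brauer_diagram_edge[OF assms(1,2)] assms by auto
  then show ?thesis using card_subset_eq by metis
qed

context stacked
begin

lemma cup_strand:
  assumes "e \<in> cups D1"
  obtains a b where "e = {Top a, Top b}" "a < b" "canonical G [Top a, Top b] [Inl e]"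
proof -
  obtain a b where ab: "e = {Top a, Top b}" "a < b" "1 \<le> a" "b \<le> r" "e \<in> D1" by (rule cupsE[OF D1 assms])
  have "path [Top a, Top b] [Inl e]" using ab by (auto simp: path_in_def stack_ends_simps)
  then have "mpath [Top a, Top b] [Inl e]" using ab by (intro mpathI) (auto simp: outer_iff)
  then show thesis using that[of a b] ab by (simp add: canonical_def strand_iff)
qed

lemma cap_strand:
  assumes "e \<in> caps D2"
  obtains a b where "e = {Bot a, Bot b}" "a < b" "canonical G [Bot a, Bot b] [Inr e]"
proof -
  obtain a b where ab: "e = {Bot a, Bot b}" "a < b" "1 \<le> a" "b \<le> t" "e \<in> D2" by (rule capsE[OF D2 assms])
  have "path [Bot a, Bot b] [Inr e]" using ab by (auto simp: path_in_def stack_ends_simps)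
  then have "mpath [Bot a, Bot b] [Inr e]" using ab by (intro mpathI) (auto simp: outer_iff)
  then show thesis using that[of a b] ab by (simp add: canonical_def strand_iff)
qed

lemma cups_subset: "cups D1 \<subseteq> cups (stacked_diagram G)"
proof
  fix e assume e: "e \<in> cups D1"
  obtain a b where ab: "e = {Top a, Top b}" "canonical G [Top a, Top b] [Inl e]" by (rule cup_strand[OF e])
  then have "e \<in> stacked_diagram G" unfolding stacked_diagram_def canonical_def ab(1) by force
  then show "e \<in> cups (stacked_diagram G)" using e by (simp add: cups_def)
qed

lemma caps_subset: "caps D2 \<subseteq> caps (stacked_diagram G)"
proof
  fix e assume e: "e \<in> caps D2"
  obtain a b where ab: "e = {Bot a, Bot b}" "canonical G [Bot a, Bot b] [Inr e]" by (rule cap_strand[OF e])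
  then have "e \<in> stacked_diagram G" unfolding stacked_diagram_def canonical_def ab(1) by force
  then show "e \<in> caps (stacked_diagram G)" using e by (simp add: caps_def)
qed

lemma finite_cups_caps: "finite (cups (stacked_diagram G))" "finite (caps (stacked_diagram G))"
  using finite_brauer_diagram[OF brauer_stacked_diagram] cups_caps_subset[of "stacked_diagram G"] by (auto intro: finite_subset)

text \<open>Cups of the upper and caps of the lower factor are strands of length one and survive in
  the composite; counting the vertices of the outer rows gives the bounds.\<close>

lemma through_le:
  "card (through_strings (stacked_diagram G)) \<le> card (through_strings D1)"
  "card (through_strings (stacked_diagram G)) \<le> card (through_strings D2)"
  using brauer_diagram_card[OF D1] brauer_diagram_card[OF D2] brauer_diagram_card[OF brauer_stacked_diagram]
    card_mono[OF finite_cups_caps(1) cups_subset] card_mono[OF finite_cups_caps(2) caps_subset] by linarith+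

lemma cups_eq:
  assumes "card (through_strings (stacked_diagram G)) = card (through_strings D1)"
  shows "cups (stacked_diagram G) = cups D1"
proof -
  have "card (cups D1) = card (cups (stacked_diagram G))"
    using brauer_diagram_card(1)[OF D1] brauer_diagram_card(1)[OF brauer_stacked_diagram] assms by linarith
  then show ?thesis using card_subset_eq[OF finite_cups_caps(1) cups_subset] by simp
qed

lemma caps_eq:
  assumes "card (through_strings (stacked_diagram G)) = card (through_strings D2)"
  shows "caps (stacked_diagram G) = caps D2"
proof -
  have "card (caps D2) = card (caps (stacked_diagram G))"
    using brauer_diagram_card(2)[OF D2] brauer_diagram_card(2)[OF brauer_stacked_diagram] assms by linarith
  then show ?thesis using card_subset_eq[OF finite_cups_caps(2) caps_subset] by simp
qed

lemma list_split_ends: "2 \<le> length xs \<Longrightarrow> xs = hd xs # butlast (tl xs) @ [last xs]"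
  by (cases xs) auto

text \<open>A path in the middle row becomes a strand when edges leaving the row are attached at
  both ends. This completes the same middle path in different stacks.\<close>

lemma strand_extend:
  assumes "path us mes" "set us \<subseteq> range Mid" "a \<in> G" "b \<in> G" "stack_ends a = {v, hd us}" "stack_ends b = {last us, w}"
    and "v \<notin> range Mid" "w \<notin> range Mid" "v \<noteq> w"
  shows "mpath (v # us @ [w]) (a # mes @ [b])"
proof -
  have ne: "us \<noteq> []" by (rule path_ne[OF assms(1)])
  have mes: "stack_ends p \<subseteq> range Mid" if "p \<in> set mes" for p
  proof -
    obtain i where i: "i < length mes" "p = mes ! i" using \<open>p \<in> set mes\<close> by (auto simp: in_set_conv_nth)
    then show ?thesis using path_edge(2,4,5)[OF assms(1) i(1)] assms(2) by auto
  qed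
  have "a \<notin> set mes" "b \<notin> set mes" using mes[of a] mes[of b] assms(5-8) by auto
  moreover have "a \<noteq> b"
  proof
    assume "a = b"
    then have "v \<in> {last us, w}" using assms(5,6) by auto
    moreover have "last us \<in> range Mid" using ne assms(2) by auto
    ultimately show False using assms(7,9) by auto
  qed
  moreover have "v \<notin> set us" "w \<notin> set us" using assms(2,7,8) by auto
  ultimately have "path (v # us @ [w]) (a # mes @ [b])"
    using assms ne unfolding path_in_Cons path_in_snoc[OF ne] by (simp add: path_in_snoc)
  moreover have "outer v" "outer w" using vertex_outer[OF assms(3), of v] vertex_outer[OF assms(4), of w] assms(5-8) by auto
  ultimately show ?thesis by (intro mpathI) auto
qed

lemma through_decompose:
  assumes c: "canonical G vs es" "end_class (hd vs) (last vs) = 1"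
  shows "\<exists>x us w p mes q. vs = Top x # us @ [Bot w] \<and> es = p # mes @ [q] \<and> path us mes \<and> set us \<subseteq> range Mid \<and>
    p \<in> G \<and> q \<in> G \<and> stack_ends p = {Top x, hd us} \<and> stack_ends q = {last us, Bot w} \<and> us \<noteq> []"
proof -
  have m: "mpath vs es" using c(1) by (simp add: canonical_def strand_iff)
  note p = mpath_path[OF m]
  obtain x w where xw: "hd vs = Top x" "last vs = Bot w" using canonical_through_Mid(3)[OF c] by blast
  have two: "2 \<le> length es" by (rule canonical_through_Mid(1)[OF c])
  define us mes a b where "us = butlast (tl vs)" and "mes = butlast (tl es)" and "a = hd es" and "b = last es"
  have vs: "vs = Top x # us @ [Bot w]"
    using list_split_ends[of vs] two path_length[OF p] xw unfolding us_def by simp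
  have es: "es = a # mes @ [b]"
    using list_split_ends[of es] two unfolding a_def b_def mes_def by simp
  have ne: "us \<noteq> []" using path_length[OF p] two unfolding vs es by auto
  have "path (us @ [Bot w]) (mes @ [b])" "a \<in> G" "stack_ends a = {Top x, hd us}"
    using p ne unfolding vs es path_in_Cons by auto
  then have "path us mes" "b \<in> G" "stack_ends b = {last us, Bot w}"
    unfolding path_in_snoc[OF ne] by auto
  moreover have "set us \<subseteq> range Mid"
  proof
    fix y assume "y \<in> set us"
    then obtain i where i: "i < length us" "y = us ! i" by (auto simp: in_set_conv_nth)
    then have "vs ! Suc i = y" unfolding vs by (simp add: nth_append)
    moreover have "Suc i < length es" using i path_length[OF p] unfolding vs by simp
    ultimately show "y \<in> range Mid" using path_interior_Mid[OF p, of i] by simp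
  qed
  ultimately show ?thesis using vs es ne \<open>a \<in> G\<close> \<open>stack_ends a = {Top x, hd us}\<close> by blast
qed

lemma through_edges:
  assumes "p \<in> G" "stack_ends p = {Top x, Mid y}"
  shows "p = Inl {Top x, Bot y}" "{Top x, Bot y} \<in> D1"
proof -
  have "p = Inl {Top x, Bot y} \<and> {Top x, Bot y} \<in> D1"
    using assms(1)
  proof (cases rule: G_cases)
    case (1 e)
    then have "Top x \<in> e" "Bot y \<in> e" using assms(2) ends_Inl[OF 1(2)] by auto
    then show ?thesis using pair_in_edge[OF D1 1(2)] 1 by auto
  next
    case (2 e)
    then show ?thesis using assms(2) ends_Inr(3)[OF 2(2), of x] by auto
  qed
  then show "p = Inl {Top x, Bot y}" "{Top x, Bot y} \<in> D1" by blast+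
qed

lemma through_edges_lower:
  assumes "p \<in> G" "stack_ends p = {Mid y, Bot x}"
  shows "p = Inr {Top y, Bot x}" "{Top y, Bot x} \<in> D2"
proof -
  have "p = Inr {Top y, Bot x} \<and> {Top y, Bot x} \<in> D2"
    using assms(1)
  proof (cases rule: G_cases)
    case (2 e)
    then have "Bot x \<in> e" "Top y \<in> e" using assms(2) ends_Inr[OF 2(2)] by auto
    then show ?thesis using pair_in_edge[OF D2 2(2)] 2 by auto
  next
    case (1 e)
    then show ?thesis using assms(2) ends_Inl(3)[OF 1(2), of x] by auto
  qed
  then show "p = Inr {Top y, Bot x}" "{Top y, Bot x} \<in> D2" by blast+
qed

lemma canonical_share_vertex:
  assumes "canonical G vs es" "canonical G vs' es'" "v \<in> set vs" "v \<in> set vs'"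
  shows "vs' = vs \<and> es' = es"
proof -
  have "vs' = vs \<and> es' = es \<or> vs' = rev vs \<and> es' = rev es"
    using assms mpath_share_vertex[of vs es vs' es' v] by (auto simp: canonical_def strand_iff)
  then show ?thesis
    using canonical_or_rev[of vs es] assms(1,2) by (auto simp: canonical_def)
qed

end

section \<open>Dependence on the middle part of a stack\<close>

text \<open>The standard markings on edges with both ends in the middle row; they depend only on
  \<open>caps D1\<close> and \<open>cups D2\<close>.\<close>

definition middle_marks :: "vertex set set \<Rightarrow> vertex set set \<Rightarrow> stack_edge mark list" where
  "middle_marks D1 D2 = map lift_upper (map right_arrow (rev (sort_edges (caps D1)))) @
     map lift_lower (map Bead (sort_edges (cups D2)))"

context stacked
begin

text \<open>No new cups or caps arise. It is stated by sets of edges instead of by numbers of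
  through strings, because it is used to recognise individual strands.\<close>

definition full_rank :: bool where
  "full_rank \<longleftrightarrow> cups (stacked_diagram G) = cups D1 \<and> caps (stacked_diagram G) = caps D2"

lemma class_not_before:
  assumes "canonical G vs es" "canonical G ws fs" "p \<in> set es" "q \<in> set fs"
    and "end_class (hd vs) (last vs) < end_class (hd ws) (last ws)"
  shows "\<not> edge_before G q p"
proof -
  obtain i where i: "i < length es" "p = es ! i" using assms(3) by (auto simp: in_set_conv_nth)
  obtain j where j: "j < length fs" "q = fs ! j" using assms(4) by (auto simp: in_set_conv_nth)
  show ?thesis
    unfolding i(2) j(2) edge_before_iff[OF assms(2,1) j(1) i(1)]
    using assms(5) by (auto simp: strand_less_def Let_def)
qed

text \<open>With full rank a cup or cap of the composite is an edge of a factor, hence a strand of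
  length one that does not touch the middle row.\<close>

lemma mid_edge_through:
  assumes full: full_rank and c: "canonical G vs es" "p \<in> set es" and p: "stack_ends p \<subseteq> range Mid"
  shows "end_class (hd vs) (last vs) = 1"
proof (rule ccontr)
  assume "end_class (hd vs) (last vs) \<noteq> 1"
  then consider "{hd vs, last vs} \<in> cups D1" | "{hd vs, last vs} \<in> caps D2"
    using end_class_cases[OF c(1)] full unfolding full_rank_def by auto
  then show False
  proof cases
    case 1
    obtain a b where ab: "{hd vs, last vs} = {Top a, Top b}" "canonical G [Top a, Top b] [Inl {hd vs, last vs}]"
      by (rule cup_strand[OF 1])
    have "hd vs \<in> set vs" using c(1) path_ne by (auto simp: canonical_def strand_iff dest: mpath_path)
    moreover have "hd vs \<in> set [Top a, Top b]" using ab(1) by (auto simp: doubleton_eq_iff)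
    ultimately have "es = [Inl {hd vs, last vs}]" using canonical_share_vertex[OF ab(2) c(1)] by blast
    then have "stack_ends p = {Top a, Top b}" using c(2) ab(1) by (simp add: stack_ends_simps)
    then show False using p by auto
  next
    case 2
    obtain a b where ab: "{hd vs, last vs} = {Bot a, Bot b}" "canonical G [Bot a, Bot b] [Inr {hd vs, last vs}]"
      by (rule cap_strand[OF 2])
    have "hd vs \<in> set vs" using c(1) path_ne by (auto simp: canonical_def strand_iff dest: mpath_path)
    moreover have "hd vs \<in> set [Bot a, Bot b]" using ab(1) by (auto simp: doubleton_eq_iff)
    ultimately have "es = [Inr {hd vs, last vs}]" using canonical_share_vertex[OF ab(2) c(1)] by blast
    then have "stack_ends p = {Bot a, Bot b}" using c(2) ab(1) by (simp add: stack_ends_simps)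
    then show False using p by auto
  qed
qed

lemma mid_index:
  assumes c: "canonical G vs es" "end_class (hd vs) (last vs) = 1" and i: "i < length es" "stack_ends (es ! i) \<subseteq> range Mid"
  shows "0 < i" "Suc i < length es"
proof -
  have m: "mpath vs es" using c(1) by (simp add: canonical_def strand_iff)
  note p = mpath_path[OF m]
  obtain x w where xw: "hd vs = Top x" "last vs = Bot w" using canonical_through_Mid(3)[OF c] by blast
  have e: "vs ! i \<in> range Mid" "vs ! Suc i \<in> range Mid" using path_edge(2)[OF p i(1)] i(2) by auto
  show "0 < i" using e(1) xw path_hd[OF p] by (cases i) auto
  show "Suc i < length es" using e(2) xw path_last[OF p] i(1) by (cases "Suc i = length es") auto
qed

lemma sort_edges_sets:
  "set (sort_edges (cups D1)) = cups D1" "set (sort_edges (caps D1)) = caps D1"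
  "set (sort_edges (cups D2)) = cups D2" "set (sort_edges (caps D2)) = caps D2"
  using sort_edges(1) inj_left_end[OF D1] inj_left_end[OF D2]
    finite_subset[OF cups_caps_subset(1) finite_brauer_diagram[OF D1]] finite_subset[OF cups_caps_subset(2) finite_brauer_diagram[OF D1]]
    finite_subset[OF cups_caps_subset(1) finite_brauer_diagram[OF D2]] finite_subset[OF cups_caps_subset(2) finite_brauer_diagram[OF D2]]
  by blast+

lemma middle_marks_edges:
  assumes "m \<in> set (middle_marks D1 D2)"
  shows "mark_edge m \<in> G" "stack_ends (mark_edge m) \<subseteq> range Mid" "Arrow p w = m \<Longrightarrow> w \<in> stack_ends p"
proof -
  consider e where "e \<in> caps D1" "m = lift_upper (right_arrow e)" | e where "e \<in> cups D2" "m = lift_lower (Bead e)"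
    using assms by (auto simp: middle_marks_def sort_edges_sets)
  then have "mark_edge m \<in> G \<and> stack_ends (mark_edge m) \<subseteq> range Mid \<and> (Arrow p w = m \<longrightarrow> w \<in> stack_ends p)"
  proof cases
    case (1 e)
    have "e \<subseteq> range Bot" "e \<in> D1" using 1(1) by (auto simp: caps_def)
    moreover have "upper (Bot (Max (pos ` e))) \<in> upper ` e" by (rule imageI[OF right_end_cap[OF D1 1(1)]])
    ultimately show ?thesis unfolding 1(2) right_arrow_def by (auto simp: stack_ends_simps)
  next
    case (2 e)
    have "e \<subseteq> range Top" "e \<in> D2" using 2(1) by (auto simp: cups_def)
    then show ?thesis unfolding 2(2) by (auto simp: stack_ends_simps)
  qed
  then show "mark_edge m \<in> G" "stack_ends (mark_edge m) \<subseteq> range Mid" "Arrow p w = m \<Longrightarrow> w \<in> stack_ends p" by blast+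
qed

text \<open>Beads of upper cups come first and arrows of lower caps last in the order of strands, so they contribute no signs.\<close>

lemma sign_middle:
  assumes full: full_rank
  shows "stack_sign \<epsilon> G (remove_loop_marks G (stack_marks (std_marks D1) (std_marks D2))) =
    stack_sign \<epsilon> G (filter (\<lambda>m. on_strand G (mark_edge m)) (middle_marks D1 D2))"
proof -
  let ?F = "filter (\<lambda>m. on_strand G (mark_edge m))"
  define A B where "A = map lift_upper (map Bead (sort_edges (cups D1)))"
    and "B = map lift_lower (map right_arrow (rev (sort_edges (caps D2))))"
  have fin: "finite (cups D1)" "finite (caps D2)"
    using finite_subset[OF cups_caps_subset(1) finite_brauer_diagram[OF D1]] finite_subset[OF cups_caps_subset(2) finite_brauer_diagram[OF D2]]
    by blast+
  have split: "stack_marks (std_marks D1) (std_marks D2) = A @ middle_marks D1 D2 @ B"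
    by (simp add: stack_marks_lift std_marks_def middle_marks_def A_def B_def)
  have std: "marked_diagram r s (D1, std_marks D1)" "marked_diagram s t (D2, std_marks D2)"
    using standard_std_marks[OF D1] standard_std_marks[OF D2] by (auto simp: standard_def)
  have "mark_edge ` set (stack_marks (std_marks D1) (std_marks D2)) \<subseteq> G"
    using stack_marks_props(2)[OF std] by blast
  then have F: "remove_loop_marks G (stack_marks (std_marks D1) (std_marks D2)) = ?F A @ ?F (middle_marks D1 D2) @ ?F B"
    using remove_loop_marks_iff split by simp
  have A: "\<exists>e\<in>cups D1. m = Bead (Inl e)" if "m \<in> set A" for m
    using that by (auto simp: A_def sort_edges_sets)
  have B: "\<exists>e\<in>caps D2. m = lift_lower (right_arrow e)" if "m \<in> set B" for m
    using that by (auto simp: B_def sort_edges_sets)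
  have cA: "\<exists>vs es. canonical G vs es \<and> mark_edge m \<in> set es \<and> end_class (hd vs) (last vs) = 0" if "m \<in> set A" for m
  proof -
    obtain e where e: "e \<in> cups D1" "m = Bead (Inl e)" using A[OF \<open>m \<in> set A\<close>] by blast
    obtain a b where "e = {Top a, Top b}" "canonical G [Top a, Top b] [Inl e]" by (rule cup_strand[OF e(1)])
    then show ?thesis unfolding e(2) by (intro exI[of _ "[Top a, Top b]"] exI[of _ "[Inl e]"]) simp
  qed
  have cB: "\<exists>vs es. canonical G vs es \<and> mark_edge m \<in> set es \<and> end_class (hd vs) (last vs) = 2" if "m \<in> set B" for m
  proof -
    obtain e where e: "e \<in> caps D2" "m = lift_lower (right_arrow e)" using B[OF \<open>m \<in> set B\<close>] by blast
    obtain a b where "e = {Bot a, Bot b}" "canonical G [Bot a, Bot b] [Inr e]" by (rule cap_strand[OF e(1)])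
    then show ?thesis unfolding e(2)
      by (intro exI[of _ "[Bot a, Bot b]"] exI[of _ "[Inr e]"]) (simp add: right_arrow_def)
  qed
  \<comment> \<open>Here full rank enters: middle markings lie on through strings, of class 1,
    between the upper beads of class 0 and the lower arrows of class 2.\<close>
  have cM: "\<exists>vs es. canonical G vs es \<and> mark_edge m \<in> set es \<and> end_class (hd vs) (last vs) = 1"
    if m: "m \<in> set (?F (middle_marks D1 D2))" for m
  proof -
    obtain vs es i where c: "canonical G vs es" "i < length es" "mark_edge m = es ! i"
      using m canonical_exists[of "mark_edge m"] by auto
    then have "mark_edge m \<in> set es" by simp
    then show ?thesis using mid_edge_through[OF full c(1)] middle_marks_edges(2)[of m] m c(1) by auto
  qed
  have "cross \<epsilon> (mark_before G) (?F A) (?F (middle_marks D1 D2) @ ?F B) = 1"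
  proof (rule cross_one)
    fix m n assume m: "m \<in> set (?F A)" and n: "n \<in> set (?F (middle_marks D1 D2) @ ?F B)"
    obtain vs es where v: "canonical G vs es" "mark_edge m \<in> set es" "end_class (hd vs) (last vs) = 0"
      using cA[of m] m unfolding set_filter by blast
    obtain ws fs where w: "canonical G ws fs" "mark_edge n \<in> set fs" "end_class (hd ws) (last ws) > 0"
    proof -
      have "n \<in> set (?F (middle_marks D1 D2)) \<or> n \<in> set B" using n by auto
      then show ?thesis
      proof
        assume "n \<in> set (?F (middle_marks D1 D2))"
        from cM[OF this] obtain ws fs where "canonical G ws fs" "mark_edge n \<in> set fs" "end_class (hd ws) (last ws) = 1" by blast
        then show ?thesis by (intro that[of ws fs]) simp_all
      next
        assume "n \<in> set B"
        from cB[OF this] obtain ws fs where "canonical G ws fs" "mark_edge n \<in> set fs" "end_class (hd ws) (last ws) = 2" by blast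
        then show ?thesis by (intro that[of ws fs]) simp_all
      qed
    qed
    show "\<not> mark_before G n m" unfolding mark_before_def using class_not_before[OF v(1) w(1) v(2) w(2)] v(3) w(3) by simp
  qed
  moreover have "cross \<epsilon> (mark_before G) (?F (middle_marks D1 D2)) (?F B) = 1"
  proof (rule cross_one)
    fix m n assume m: "m \<in> set (?F (middle_marks D1 D2))" and n: "n \<in> set (?F B)"
    obtain vs es where v: "canonical G vs es" "mark_edge m \<in> set es" "end_class (hd vs) (last vs) = 1"
      using cM[OF m] by blast
    obtain ws fs where w: "canonical G ws fs" "mark_edge n \<in> set fs" "end_class (hd ws) (last ws) = 2"
      using cB[of n] n unfolding set_filter by blast
    show "\<not> mark_before G n m" unfolding mark_before_def using class_not_before[OF v(1) w(1) v(2) w(2)] v(3) w(3) by simp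
  qed
  moreover have "stack_sign \<epsilon> G (?F A) = 1"
  proof (rule weight_sorted)
    have "sorted_wrt (\<lambda>x y. \<not> mark_before G y x) A"
      unfolding A_def sorted_wrt_map
    proof (rule sorted_wrt_mono_rel[OF _ sort_edges(3)[OF fin(1) inj_left_end(1)[OF D1]]])
      fix e f assume ef: "e \<in> set (sort_edges (cups D1))" "f \<in> set (sort_edges (cups D1))" "left_end e < left_end f"
      obtain a b where ab: "e = {Top a, Top b}" "a < b" "canonical G [Top a, Top b] [Inl e]"
        using cup_strand[of e] ef(1) unfolding sort_edges_sets by blast
      obtain a' b' where ab': "f = {Top a', Top b'}" "a' < b'" "canonical G [Top a', Top b'] [Inl f]"
        using cup_strand[of f] ef(2) unfolding sort_edges_sets by blast
      show "\<not> mark_before G (lift_upper (Bead f)) (lift_upper (Bead e))"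
        using edge_before_iff[OF ab'(3) ab(3), of 0 0] ef(3) ab(1,2) ab'(1,2)
        by (auto simp: mark_before_def strand_less_def strand_key_def)
    qed
    then show "sorted_wrt (\<lambda>x y. \<not> mark_before G y x) (?F A)" by (rule sorted_wrt_filter)
    show "\<not> mark_against G m" if "m \<in> set (?F A)" for m using A[of m] that by auto
  qed
  moreover have "stack_sign \<epsilon> G (?F B) = 1"
  proof (rule weight_sorted)
    have "sorted_wrt (\<lambda>x y. \<not> mark_before G y x) B"
      unfolding B_def sorted_wrt_map sorted_wrt_rev
    proof (rule sorted_wrt_mono_rel[OF _ sort_edges(3)[OF fin(2) inj_left_end(2)[OF D2]]])
      fix e f assume ef: "e \<in> set (sort_edges (caps D2))" "f \<in> set (sort_edges (caps D2))" "left_end e < left_end f"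
      obtain a b where ab: "e = {Bot a, Bot b}" "a < b" "canonical G [Bot a, Bot b] [Inr e]"
        using cap_strand[of e] ef(1) unfolding sort_edges_sets by blast
      obtain a' b' where ab': "f = {Bot a', Bot b'}" "a' < b'" "canonical G [Bot a', Bot b'] [Inr f]"
        using cap_strand[of f] ef(2) unfolding sort_edges_sets by blast
      show "\<not> mark_before G (lift_lower (right_arrow e)) (lift_lower (right_arrow f))"
        using edge_before_iff[OF ab(3) ab'(3), of 0 0] ef(3) ab(1,2) ab'(1,2)
        by (auto simp: mark_before_def strand_less_def strand_key_def right_arrow_def)
    qed
    then show "sorted_wrt (\<lambda>x y. \<not> mark_before G y x) (?F B)" by (rule sorted_wrt_filter)
    show "\<not> mark_against G m" if "m \<in> set (?F B)" for m
    proof -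
      obtain e where e: "e \<in> caps D2" "m = lift_lower (right_arrow e)" using B[of m] \<open>m \<in> set (?F B)\<close> by auto
      obtain a b where ab: "e = {Bot a, Bot b}" "a < b" "canonical G [Bot a, Bot b] [Inr e]" by (rule cap_strand[OF e(1)])
      have "m = Arrow ([Inr e] ! 0) (Bot b)" unfolding e(2) right_arrow_def using ab(1,2) by (simp add: max_def)
      then show ?thesis
        using mark_against_strand[of "[Bot a, Bot b]" "[Inr e]" 0 "Bot b"] ab
        by (simp add: canonical_def stack_ends_simps del: mark_against.simps)
    qed
  qed
  ultimately show ?thesis unfolding F weight_append[of _ _ _ "?F A"] weight_append[of _ _ _ "?F (middle_marks D1 D2)"] by simp
qed

end

text \<open>Two stacks with the same edges inside the middle row; the outer rows, even their sizes,
  and the through strings of the factors may differ.\<close>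

locale stacked_pair = stacked r s t D1 D2 + B: stacked r' s t' D1' D2'
  for r s t D1 D2 r' t' D1' D2' +
  assumes caps_middle: "caps D1' = caps D1" and cups_middle: "cups D2' = cups D2"
begin

text \<open>Allows each comparison to be proved in one direction only.\<close>

lemma pair_sym: "stacked_pair r' s t' D1' D2' r t D1 D2"
  by unfold_locales (simp_all add: caps_middle cups_middle)

text \<open>An edge inside the middle row is a cap of the upper or a cup of the lower factor, and
  these are shared.\<close>

lemma mid_edge_transfer:
  assumes "p \<in> G" "stack_ends p \<subseteq> range Mid"
  shows "p \<in> B.G"
proof -
  have k: "hor_edge p" "pos_edge p \<longleftrightarrow> \<not> isl p" using edge_kinds(1)[OF assms] by auto
  show ?thesis
  proof (cases p)
    case (Inl e)
    then have "e \<in> caps D1" using k by (auto simp: horizontal_edge_def positive_edge_def)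
    then show ?thesis using Inl caps_middle cups_caps_subset(2)[of D1'] by auto
  next
    case (Inr e)
    then have "e \<in> cups D2" using k by (auto simp: horizontal_edge_def positive_edge_def)
    then show ?thesis using Inr cups_middle cups_caps_subset(1)[of D2'] by auto
  qed
qed

end

context stacked_pair
begin

text \<open>A closed loop consists of middle edges only, so it is present in the other stack; it
  remains to see that it is still a whole component there.\<close>

lemma loops_transfer: "loops G \<subseteq> loops B.G"
proof
  fix C assume C: "C \<in> loops G"
  obtain v p0 where v: "C \<subseteq> range Mid" "p0 \<in> G" "v \<in> stack_ends p0" "C = (adjacency G)\<^sup>* `` {v}"
    using C by (auto simp: loops_alt)
  have ends: "stack_ends p \<subseteq> C" if py: "p \<in> G" "y \<in> stack_ends p" "y \<in> C" for p y
  proof -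
    obtain z where z: "stack_ends p = {y, z}" using ends_other[OF py(1,2)] by blast
    then have "(y, z) \<in> adjacency G" using py(1) by (auto simp: adjacency_def)
    then show ?thesis using adjacency_closed[OF v(4) py(3)] z py(3) by auto
  qed
  have vC: "v \<in> C" using v(4) by auto
  have "(v, y) \<in> (adjacency B.G)\<^sup>*" if "(v, y) \<in> (adjacency G)\<^sup>*" for y
    using that
  proof (induction rule: rtrancl_induct)
    case (step y z)
    then obtain p where p: "p \<in> G" "stack_ends p = {y, z}" by (auto simp: adjacency_def)
    have "y \<in> C" using step(1) v(4) by auto
    then have "stack_ends p \<subseteq> range Mid" using ends[OF p(1), of y] p(2) v(1) by auto
    then have "p \<in> B.G" by (rule mid_edge_transfer[OF p(1)])
    then have "(y, z) \<in> adjacency B.G" using p(2) by (auto simp: adjacency_def)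
    then show ?case using step.IH by (rule rtrancl.rtrancl_into_rtrancl[rotated])
  qed simp
  moreover have "y \<in> C" if "(v, y) \<in> (adjacency B.G)\<^sup>*" for y
    using that
  proof (induction rule: rtrancl_induct)
    case (step y z)
    then obtain q where q: "q \<in> B.G" "stack_ends q = {y, z}" by (auto simp: adjacency_def)
    obtain i where i: "y = Mid i" using step.IH v(1) by auto
    have "\<exists>p'\<in>G. y \<in> stack_ends p'"
    proof -
      have "(v, y) \<in> (adjacency G)\<^sup>*" using step.IH v(4) by auto
      then show ?thesis by (cases rule: rtranclE) (use v in \<open>auto simp: adjacency_def\<close>)
    qed
    then obtain p' where p': "p' \<in> G" "Mid i \<in> stack_ends p'" using i by auto
    obtain e f where "e \<in> D1" "Bot i \<in> e" "f \<in> D2" "Top i \<in> f" using Mid_edges[OF p'] by blast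
    then have ef: "Inl e \<in> G" "Mid i \<in> stack_ends (Inl e)" "Inr f \<in> G" "Mid i \<in> stack_ends (Inr f)"
      by (auto simp: ends_Inl ends_Inr)
    \<comment> \<open>At a vertex of the loop both colours are already taken by edges of the loop,
      so an edge of the other stack at this vertex is one of them.\<close>
    define p where "p = (if isl q then Inl e else Inr f)"
    have p: "p \<in> G" "y \<in> stack_ends p" "isl p = isl q" using ef i by (auto simp: p_def)
    have "stack_ends p \<subseteq> C" by (rule ends[OF p(1,2) step.IH])
    moreover from this have "p \<in> B.G" using mid_edge_transfer[OF p(1)] v(1) by blast
    then have "p = q" using B.col_unique[of p q y] q p by auto
    ultimately show ?case using q(2) by auto
  qed (rule vC)
  ultimately have "C = (adjacency B.G)\<^sup>* `` {v}" using v(4) by blast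
  moreover have "p0 \<in> B.G" using mid_edge_transfer[OF v(2)] ends[OF v(2,3) vC] v(1) by blast
  ultimately show "C \<in> loops B.G" using v(1,3) unfolding loops_alt by blast
qed

text \<open>Where one stack leaves the middle row in a given colour, so does the other: an edge
  within the row would be shared.\<close>

lemma mid_partner:
  assumes "p \<in> G" "Mid i \<in> stack_ends p" "\<not> stack_ends p \<subseteq> range Mid"
    and q: "q \<in> B.G" "Mid i \<in> stack_ends q" "isl q = isl p"
  shows "\<not> stack_ends q \<subseteq> range Mid"
proof
  assume "stack_ends q \<subseteq> range Mid"
  then have "q \<in> G" using stacked_pair.mid_edge_transfer[OF pair_sym q(1)] by simp
  then have "q = p" using col_unique[of q p "Mid i"] assms by auto
  then show False using assms(3) \<open>stack_ends q \<subseteq> range Mid\<close> by simp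
qed

text \<open>The middle part of a through string is a path in both stacks. Its two end edges are
  replaced by the edges of the same colour in the other stack, which leave the middle row as well
  and complete it to a through string.\<close>

lemma through_transport:
  assumes c: "canonical G vs es" "end_class (hd vs) (last vs) = 1"
  shows "\<exists>x us w p mes q x' w' p' q'. vs = Top x # us @ [Bot w] \<and> es = p # mes @ [q] \<and>
    stack_ends p = {Top x, hd us} \<and> stack_ends q = {last us, Bot w} \<and> us \<noteq> [] \<and> set us \<subseteq> range Mid \<and>
    p \<in> G \<and> q \<in> G \<and> p' \<in> B.G \<and> q' \<in> B.G \<and>
    stack_ends p' = {Top x', hd us} \<and> stack_ends q' = {last us, Bot w'} \<and>
    canonical B.G (Top x' # us @ [Bot w']) (p' # mes @ [q'])"
proof -
  obtain x us w p mes q where *: "vs = Top x # us @ [Bot w]" "es = p # mes @ [q]" "path us mes" "set us \<subseteq> range Mid"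
    "p \<in> G" "q \<in> G" "stack_ends p = {Top x, hd us}" "stack_ends q = {last us, Bot w}" "us \<noteq> []"
    using through_decompose[OF c] by blast
  obtain y z where yz: "hd us = Mid y" "last us = Mid z" using *(4,9) by (meson hd_in_set last_in_set rangeE subsetD)
  have "set mes \<subseteq> B.G"
  proof
    fix g assume g: "g \<in> set mes"
    then obtain i where i: "i < length mes" "g = mes ! i" by (auto simp: in_set_conv_nth)
    then show "g \<in> B.G" using path_edge(1,2,4,5)[OF *(3) i(1)] *(4) by (intro mid_edge_transfer) auto
  qed
  then have path: "B.path us mes" using *(3) by (auto simp: path_in_def)
  have "isl p" "\<not> isl q" using Top_edge[OF *(5), of x] Bot_edge[OF *(6), of w] *(7,8) by auto
  have "y \<in> {1..s}" "z \<in> {1..s}" using Mid_edges(1)[OF *(5), of y] Mid_edges(1)[OF *(6), of z] *(7,8) yz by auto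
  then obtain e f where ef: "e \<in> D1'" "Bot y \<in> e" "f \<in> D2'" "Top z \<in> f"
    using brauer_diagram_ex[OF B.D1, of "Bot y"] brauer_diagram_ex[OF B.D2, of "Top z"] by blast
  then have p': "Inl e \<in> B.G" "Mid y \<in> stack_ends (Inl e)" and q': "Inr f \<in> B.G" "Mid z \<in> stack_ends (Inr f)"
    by (auto simp: B.ends_Inl B.ends_Inr)
  \<comment> \<open>The replacing edge leaves the middle row, so its other end lies in the top
    row.\<close>
  have "\<not> stack_ends (Inl e) \<subseteq> range Mid"
    using mid_partner[OF *(5), of y "Inl e"] *(7) yz(1) p' \<open>isl p\<close> by auto
  moreover obtain v where v: "stack_ends (Inl e) = {Mid y, v}" using B.ends_other[OF p'] by blast
  ultimately obtain x' where x': "v = Top x'" using ends_Inl(3) B.ends_Inl(3)[OF ef(1)] by (cases v) auto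
  have "\<not> stack_ends (Inr f) \<subseteq> range Mid"
    using mid_partner[OF *(6), of z "Inr f"] *(8) yz(2) q' \<open>\<not> isl q\<close> by auto
  moreover obtain v' where v': "stack_ends (Inr f) = {Mid z, v'}" using B.ends_other[OF q'] by blast
  ultimately obtain w' where w': "v' = Bot w'" using B.ends_Inr(3)[OF ef(3)] by (cases v') auto
  have "B.mpath (Top x' # us @ [Bot w']) (Inl e # mes @ [Inr f])"
    using B.strand_extend[OF path *(4) p'(1) q'(1)] v v' x' w' yz by (auto simp: insert_commute)
  then have "canonical B.G (Top x' # us @ [Bot w']) (Inl e # mes @ [Inr f])"
    by (simp add: canonical_def B.strand_iff)
  moreover have "stack_ends (Inl e) = {Top x', hd us}" "stack_ends (Inr f) = {last us, Bot w'}"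
    using v v' x' w' yz by auto
  ultimately show ?thesis using * p'(1) q'(1) by blast
qed

lemma through_transport_index:
  assumes c: "canonical G vs es" "end_class (hd vs) (last vs) = 1"
  shows "\<exists>vs' es'. canonical B.G vs' es' \<and> end_class (hd vs') (last vs') = 1 \<and> length es' = length es \<and>
    (\<forall>i. 0 < i \<longrightarrow> i < length es \<longrightarrow> vs' ! i = vs ! i) \<and> (\<forall>i. 0 < i \<longrightarrow> Suc i < length es \<longrightarrow> es' ! i = es ! i)"
proof -
  obtain x us w p mes q x' w' p' q' where *: "vs = Top x # us @ [Bot w]" "es = p # mes @ [q]"
    "canonical B.G (Top x' # us @ [Bot w']) (p' # mes @ [q'])"
    using through_transport[OF c] by blast
  have "length vs = Suc (length es)" using c(1) by (simp add: canonical_def strand_iff maximal_path_def path_in_def)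
  then have len: "length us = Suc (length mes)" unfolding * by simp
  show ?thesis
    by (intro exI[of _ "Top x' # us @ [Bot w']"] exI[of _ "p' # mes @ [q']"])
      (use *(3) len in \<open>auto simp: *(1,2) nth_Cons nth_append split: nat.splits\<close>)
qed

text \<open>Through strings are compared by their first middle vertices and edges on one strand by
  their positions; both are unchanged by the transport. A key taken from the outer rows would not
  have this property.\<close>

lemma edge_before_transfer:
  assumes full: full_rank and p: "on_strand G p" "stack_ends p \<subseteq> range Mid" and q: "on_strand G q" "stack_ends q \<subseteq> range Mid"
  shows "edge_before G p q \<longleftrightarrow> edge_before B.G p q"
proof -
  obtain vs es i where v: "canonical G vs es" "i < length es" "p = es ! i" using canonical_exists[OF p(1)] by blast
  obtain ws fs j where w: "canonical G ws fs" "j < length fs" "q = fs ! j" using canonical_exists[OF q(1)] by blast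
  have cl: "end_class (hd vs) (last vs) = 1" "end_class (hd ws) (last ws) = 1"
    using mid_edge_through[OF full v(1) _ p(2)] mid_edge_through[OF full w(1) _ q(2)] v w by auto
  have i: "0 < i" "Suc i < length es" using mid_index[OF v(1) cl(1) v(2)] p(2) v(3) by auto
  have j: "0 < j" "Suc j < length fs" using mid_index[OF w(1) cl(2) w(2)] q(2) w(3) by auto
  obtain vs' es' where v': "canonical B.G vs' es'" "end_class (hd vs') (last vs') = 1" "length es' = length es"
    "\<And>i. 0 < i \<Longrightarrow> i < length es \<Longrightarrow> vs' ! i = vs ! i" "\<And>i. 0 < i \<Longrightarrow> Suc i < length es \<Longrightarrow> es' ! i = es ! i"
    using through_transport_index[OF v(1) cl(1)] by blast
  obtain ws' fs' where w': "canonical B.G ws' fs'" "end_class (hd ws') (last ws') = 1" "length fs' = length fs"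
    "\<And>i. 0 < i \<Longrightarrow> i < length fs \<Longrightarrow> ws' ! i = ws ! i" "\<And>i. 0 < i \<Longrightarrow> Suc i < length fs \<Longrightarrow> fs' ! i = fs ! i"
    using through_transport_index[OF w(1) cl(2)] by blast
  have one: "vs' ! 1 = vs ! 1" "ws' ! 1 = ws ! 1" using v'(4)[of 1] w'(4)[of 1] i j by auto
  have len: "length vs = Suc (length es)" "length ws = Suc (length fs)" "length vs' = Suc (length es')" "length ws' = Suc (length fs')"
    using v(1) w(1) v'(1) w'(1) by (simp_all add: canonical_def strand_iff B.strand_iff maximal_path_def path_in_def)
  have len2: "1 < length vs" "1 < length ws" "1 < length vs'" "1 < length ws'" using len i j v'(3) w'(3) by linarith+
  have eq: "vs = ws \<longleftrightarrow> vs ! 1 = ws ! 1"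
    using canonical_share_vertex[OF v(1) w(1) nth_mem[OF len2(1)]] nth_mem[OF len2(2)] by metis
  have eq': "vs' = ws' \<longleftrightarrow> vs' ! 1 = ws' ! 1"
    using B.canonical_share_vertex[OF v'(1) w'(1) nth_mem[OF len2(3)]] nth_mem[OF len2(4)] by metis
  have "strand_less vs ws \<longleftrightarrow> strand_less vs' ws'"
    unfolding strand_less_def strand_key_def Let_def cl v'(2) w'(2) one by simp
  moreover have "vs = ws \<longleftrightarrow> vs' = ws'" unfolding eq eq' one ..
  moreover have "p = es' ! i" "q = fs' ! j" using v'(5) w'(5) i j v(3) w(3) by auto
  ultimately show ?thesis
    using edge_before_iff[OF v(1) w(1) v(2) w(2)] B.edge_before_iff[OF v'(1) w'(1), of i j] v'(3) w'(3) v(2,3) w(2,3) by simp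
qed

lemma mark_against_transfer:
  assumes full: full_rank and p: "on_strand G p" "stack_ends p \<subseteq> range Mid" and w: "w \<in> stack_ends p"
  shows "mark_against G (Arrow p w) \<longleftrightarrow> mark_against B.G (Arrow p w)"
proof -
  obtain vs es i where v: "canonical G vs es" "i < length es" "p = es ! i" using canonical_exists[OF p(1)] by blast
  have cl: "end_class (hd vs) (last vs) = 1"
    using mid_edge_through[OF full v(1) _ p(2)] v by auto
  have i: "0 < i" "Suc i < length es" using mid_index[OF v(1) cl(1) v(2)] p(2) v(3) by auto
  obtain vs' es' where v': "canonical B.G vs' es'" "length es' = length es"
    "\<And>i. 0 < i \<Longrightarrow> i < length es \<Longrightarrow> vs' ! i = vs ! i" "\<And>i. 0 < i \<Longrightarrow> Suc i < length es \<Longrightarrow> es' ! i = es ! i"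
    using through_transport_index[OF v(1) cl(1)] by blast
  have e: "p = es' ! i" "vs' ! Suc i = vs ! Suc i" using v' i v(3) by auto
  have "strand G vs es" "strand B.G vs' es'" using v(1) v'(1) by (auto simp: canonical_def)
  then show ?thesis
    using mark_against_strand[of vs es i w] B.mark_against_strand[of vs' es' i w] v v' e w by (simp del: mark_against.simps)
qed

text \<open>The transport is injective because a through string is recognised by its part in the
  middle row.\<close>

lemma through_count_le:
  "card (through_strings (stacked_diagram G)) \<le> card (through_strings (stacked_diagram B.G))"
proof -
  let ?D = "stacked_diagram G" and ?D' = "stacked_diagram B.G"
  \<comment> \<open>\<open>butlast (tl vs)\<close> is the part of the strand in the middle row; it
    is nonempty and the same for both strands.\<close>
  have "\<forall>e\<in>through_strings ?D. \<exists>vs'. \<exists>vs es es'. canonical G vs es \<and> e = {hd vs, last vs} \<and> butlast (tl vs) \<noteq> [] \<and>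
      butlast (tl vs) = butlast (tl vs') \<and> canonical B.G vs' es' \<and> {hd vs', last vs'} \<in> through_strings ?D'"
  proof
    fix e assume e: "e \<in> through_strings ?D"
    have "e \<in> ?D" using e by (simp add: through_strings_def)
    then obtain vs es where c: "canonical G vs es" "e = {hd vs, last vs}"
      using stacked_diagram_canonical by blast
    have "end_class (hd vs) (last vs) = 1"
      using end_class_cases[OF c(1)] e c(2) by (auto simp: through_strings_def)
    from through_transport[OF c(1) this] obtain x us w p mes q x' w' p' q'
      where *: "vs = Top x # us @ [Bot w]" "us \<noteq> []" "canonical B.G (Top x' # us @ [Bot w']) (p' # mes @ [q'])" by blast
    have "{Top x', Bot w'} \<in> ?D'" using *(3) unfolding stacked_diagram_def canonical_def by force
    then have "{Top x', Bot w'} \<in> through_strings ?D'" by (simp add: through_strings_iff)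
    then show "\<exists>vs' vs es es'. canonical G vs es \<and> e = {hd vs, last vs} \<and> butlast (tl vs) \<noteq> [] \<and>
      butlast (tl vs) = butlast (tl vs') \<and> canonical B.G vs' es' \<and> {hd vs', last vs'} \<in> through_strings ?D'"
      using * c by (intro exI[of _ "Top x' # us @ [Bot w']"] exI[of _ vs] exI[of _ es] exI[of _ "p' # mes @ [q']"]) simp
  qed
  from bchoice[OF this] obtain F where F: "\<forall>e\<in>through_strings ?D. \<exists>vs es es'. canonical G vs es \<and> e = {hd vs, last vs} \<and>
      butlast (tl vs) \<noteq> [] \<and> butlast (tl vs) = butlast (tl (F e)) \<and> canonical B.G (F e) es' \<and>
      {hd (F e), last (F e)} \<in> through_strings ?D'" ..
  show ?thesis
  proof (rule card_inj_on_le)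
    show "(\<lambda>e. {hd (F e), last (F e)}) ` through_strings ?D \<subseteq> through_strings ?D'"
    proof (rule image_subsetI)
      fix e assume "e \<in> through_strings ?D"
      from bspec[OF F this] show "{hd (F e), last (F e)} \<in> through_strings ?D'" by (elim exE conjE)
    qed
    show "finite (through_strings ?D')"
      using finite_brauer_diagram[OF B.brauer_stacked_diagram] by (simp add: through_strings_def)
    show "inj_on (\<lambda>e. {hd (F e), last (F e)}) (through_strings ?D)"
    proof (rule inj_onI)
      fix e f assume ef: "e \<in> through_strings ?D" "f \<in> through_strings ?D" "{hd (F e), last (F e)} = {hd (F f), last (F f)}"
      obtain vs es es' where 1: "canonical G vs es" "e = {hd vs, last vs}" "butlast (tl vs) \<noteq> []"
        "butlast (tl vs) = butlast (tl (F e))" "canonical B.G (F e) es'"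
        using bspec[OF F ef(1)] by blast
      obtain ws fs fs' where 2: "canonical G ws fs" "f = {hd ws, last ws}" "butlast (tl ws) \<noteq> []"
        "butlast (tl ws) = butlast (tl (F f))" "canonical B.G (F f) fs'"
        using bspec[OF F ef(2)] by blast
      have ne: "F e \<noteq> []" "F f \<noteq> []" using 1 2 by auto
      have "hd (F e) \<in> {hd (F f), last (F f)}" using ef(3) by auto
      then have "hd (F e) \<in> set (F e)" "hd (F e) \<in> set (F f)" using ne by auto
      then have "F f = F e" using B.canonical_share_vertex[OF 1(5) 2(5)] by blast
      then have eq: "butlast (tl vs) = butlast (tl ws)" using 1(4) 2(4) by simp
      have "hd (butlast (tl vs)) \<in> set (butlast (tl vs))" using 1(3) by simp
      then have "hd (butlast (tl vs)) \<in> set vs" "hd (butlast (tl vs)) \<in> set ws"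
        using eq by (metis in_set_butlastD list.sel(2) list.set_sel(2))+
      then have "ws = vs" using canonical_share_vertex[OF 1(1) 2(1)] by blast
      then show "e = f" using 1(2) 2(2) by simp
    qed
  qed
qed

end

context stacked_pair
begin

lemma loops_middle: "loops G = loops B.G"
  using loops_transfer stacked_pair.loops_transfer[OF pair_sym] by blast

lemma through_count: "card (through_strings (stacked_diagram G)) = card (through_strings (stacked_diagram B.G))"
  using through_count_le stacked_pair.through_count_le[OF pair_sym] by linarith

lemma on_strand_middle: "p \<in> G \<Longrightarrow> stack_ends p \<subseteq> range Mid \<Longrightarrow> on_strand G p \<longleftrightarrow> on_strand B.G p"
  using on_strand_iff[of p] B.on_strand_iff[of p] mid_edge_transfer[of p] loops_middle by simp

lemma comp_coeff_middle:
  assumes full: full_rank B.full_rank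
  shows "comp_coeff \<delta> \<epsilon> D1 D2 = comp_coeff \<delta> \<epsilon> D1' D2'"
proof -
  have mm: "middle_marks D1' D2' = middle_marks D1 D2"
    by (simp add: middle_marks_def caps_middle cups_middle)
  let ?ms = "filter (\<lambda>m. on_strand G (mark_edge m)) (middle_marks D1 D2)"
  have "filter (\<lambda>m. on_strand B.G (mark_edge m)) (middle_marks D1' D2') = ?ms"
    unfolding mm by (rule filter_cong) (use on_strand_middle middle_marks_edges in auto)
  moreover have "stack_sign \<epsilon> G ?ms = stack_sign \<epsilon> B.G ?ms"
  proof (rule weight_cong)
    fix i assume "i < length ?ms"
    then have "?ms ! i \<in> set ?ms" by (rule nth_mem)
    then have m: "on_strand G (mark_edge (?ms ! i))" "?ms ! i \<in> set (middle_marks D1 D2)" by auto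
    show "mark_against G (?ms ! i) = mark_against B.G (?ms ! i)"
    proof (cases "?ms ! i")
      case (Arrow p w)
      then show ?thesis
        using mark_against_transfer[OF full(1), of p w] middle_marks_edges[OF m(2)] m(1) by simp
    qed simp
  next
    fix i j assume "i < j" "j < length ?ms"
    then have "?ms ! i \<in> set ?ms" "?ms ! j \<in> set ?ms" by (auto intro!: nth_mem simp del: set_filter)
    then show "mark_before G (?ms ! j) (?ms ! i) = mark_before B.G (?ms ! j) (?ms ! i)"
      unfolding mark_before_def using middle_marks_edges(2) by (intro edge_before_transfer[OF full(1)]) auto
  qed simp
  ultimately show ?thesis
    unfolding comp_coeff_def sign_middle[OF full(1)] B.sign_middle[OF full(2)] loops_middle by simp
qed

end

section \<open>Diagrams with a given number of through strings\<close>

lemma bij_betw_ex: "bij_betw f A B \<Longrightarrow> y \<in> B \<Longrightarrow> \<exists>x\<in>A. y = f x"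
  unfolding bij_betw_def by blast

lemma bij_betw_inj_onD: "bij_betw f A B \<Longrightarrow> f x = f y \<Longrightarrow> x \<in> A \<Longrightarrow> y \<in> A \<Longrightarrow> x = y"
  unfolding bij_betw_def by (blast dest: inj_onD)

text \<open>On \<open>S\<close> this is the order-preserving relabelling by
  \<open>1, ..., card S\<close>, in the form in which it occurs in
  \<open>relabelled_through_strings\<close>.\<close>

definition rank :: "nat set \<Rightarrow> nat \<Rightarrow> nat" where
  "rank S i = card {j. j \<le> i \<and> j \<in> S}"

lemma bij_rank:
  assumes "finite S"
  shows "bij_betw (rank S) S {1..card S}"
proof -
  have less: "rank S i < rank S j" if "i < j" "j \<in> S" for i j
  proof -
    have "{k. k \<le> i \<and> k \<in> S} \<subseteq> {k. k \<le> j \<and> k \<in> S}" "j \<in> {k. k \<le> j \<and> k \<in> S}" "j \<notin> {k. k \<le> i \<and> k \<in> S}"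
      using that by auto
    then have "{k. k \<le> i \<and> k \<in> S} \<subset> {k. k \<le> j \<and> k \<in> S}" by blast
    then show ?thesis unfolding rank_def by (rule psubset_card_mono[rotated]) simp
  qed
  have inj: "inj_on (rank S) S"
  proof (rule inj_onI)
    fix i j assume "i \<in> S" "j \<in> S" "rank S i = rank S j"
    then show "i = j" using less[of i j] less[of j i] by (cases i j rule: linorder_cases) auto
  qed
  have "rank S i \<in> {1..card S}" if "i \<in> S" for i
  proof -
    have "{j. j \<le> i \<and> j \<in> S} \<noteq> {}" using that by auto
    moreover have "finite {j. j \<le> i \<and> j \<in> S}" by simp
    ultimately have "0 < rank S i" unfolding rank_def by (metis card_gt_0_iff)
    moreover have "rank S i \<le> card S" unfolding rank_def by (rule card_mono[OF assms]) auto
    ultimately show ?thesis by simp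
  qed
  then have "rank S ` S \<subseteq> {1..card S}" by blast
  moreover have "card (rank S ` S) = card {1..card S}" using card_image[OF inj] by simp
  ultimately have "rank S ` S = {1..card S}" by (intro card_subset_eq) auto
  then show ?thesis using inj by (simp add: bij_betw_def)
qed

definition free_top :: "vertex set set \<Rightarrow> nat set" where
  "free_top D = {i. Top i \<in> \<Union>(through_strings D)}"

definition free_bot :: "vertex set set \<Rightarrow> nat set" where
  "free_bot D = {j. Bot j \<in> \<Union>(through_strings D)}"

lemma relabelled_alt: "relabelled_through_strings D =
    {{Top (rank (free_top D) i), Bot (rank (free_bot D) j)} |i j. {Top i, Bot j} \<in> D}"
  by (simp add: relabelled_through_strings_def Let_def rank_def free_top_def free_bot_def through_strings_iff)

lemma free_top_iff: "brauer_diagram r s D \<Longrightarrow> i \<in> free_top D \<longleftrightarrow> (\<exists>j. {Top i, Bot j} \<in> D)"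
proof
  assume D: "brauer_diagram r s D" and "i \<in> free_top D"
  then obtain e where e: "e \<in> through_strings D" "Top i \<in> e" by (auto simp: free_top_def)
  obtain a b where "e = {Top a, Bot b}" "e \<in> D" by (rule throughE[OF D e(1)])
  then show "\<exists>j. {Top i, Bot j} \<in> D" using e(2) by auto
next
  assume "\<exists>j. {Top i, Bot j} \<in> D"
  then obtain j where "{Top i, Bot j} \<in> through_strings D" by (auto simp: through_strings_iff)
  then show "i \<in> free_top D" by (auto simp: free_top_def)
qed

lemma free_bot_iff: "brauer_diagram r s D \<Longrightarrow> j \<in> free_bot D \<longleftrightarrow> (\<exists>i. {Top i, Bot j} \<in> D)"
proof
  assume D: "brauer_diagram r s D" and "j \<in> free_bot D"
  then obtain e where e: "e \<in> through_strings D" "Bot j \<in> e" by (auto simp: free_bot_def)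
  obtain a b where "e = {Top a, Bot b}" "e \<in> D" by (rule throughE[OF D e(1)])
  then show "\<exists>i. {Top i, Bot j} \<in> D" using e(2) by auto
next
  assume "\<exists>i. {Top i, Bot j} \<in> D"
  then obtain i where "{Top i, Bot j} \<in> through_strings D" by (auto simp: through_strings_iff)
  then show "j \<in> free_bot D" by (auto simp: free_bot_def)
qed

lemma through_unique:
  assumes "brauer_diagram r s D" "{Top i, Bot j} \<in> D" "{Top i', Bot j'} \<in> D"
  shows "i = i' \<longleftrightarrow> j = j'"
  using brauer_diagram_unique[OF assms(1-3), of "Top i"] brauer_diagram_unique[OF assms(1-3), of "Bot j"]
  by (auto simp: doubleton_eq_iff)

lemma free_subset:
  assumes "brauer_diagram r s D"
  shows "free_top D \<subseteq> {1..r}" "free_bot D \<subseteq> {1..s}"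
proof -
  have "i \<in> {1..r} \<and> j \<in> {1..s}" if "{Top i, Bot j} \<in> D" for i j
    using brauer_diagram_edge(2)[OF assms that] by auto
  then show "free_top D \<subseteq> {1..r}" "free_bot D \<subseteq> {1..s}"
    using free_top_iff[OF assms] free_bot_iff[OF assms] by blast+
qed

lemma finite_free:
  assumes "brauer_diagram r s D"
  shows "finite (free_top D)" "finite (free_bot D)"
  using free_subset[OF assms] finite_subset by blast+

definition partner :: "vertex set set \<Rightarrow> nat \<Rightarrow> nat" where
  "partner D j = (THE i. {Top i, Bot j} \<in> D)"

lemma partner_eq: "brauer_diagram r s D \<Longrightarrow> {Top i, Bot j} \<in> D \<Longrightarrow> partner D j = i"
  unfolding partner_def by (rule the_equality) (auto dest: through_unique)

lemma bij_partner:
  assumes D: "brauer_diagram r s D"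
  shows "bij_betw (partner D) (free_bot D) (free_top D)"
proof (rule bij_betwI')
  fix j j' assume "j \<in> free_bot D" "j' \<in> free_bot D"
  then obtain i i' where "{Top i, Bot j} \<in> D" "{Top i', Bot j'} \<in> D" using free_bot_iff[OF D] by blast
  then show "partner D j = partner D j' \<longleftrightarrow> j = j'" using partner_eq[OF D] through_unique[OF D] by metis
next
  fix j assume "j \<in> free_bot D"
  then show "partner D j \<in> free_top D" using free_bot_iff[OF D] free_top_iff[OF D] partner_eq[OF D] by metis
next
  fix i assume "i \<in> free_top D"
  then show "\<exists>j\<in>free_bot D. i = partner D j" using free_bot_iff[OF D] free_top_iff[OF D] partner_eq[OF D] by metis
qed

lemma card_free:
  assumes D: "brauer_diagram r s D"
  shows "card (free_bot D) = card (through_strings D)" "card (free_top D) = card (through_strings D)"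
proof -
  have "bij_betw (\<lambda>j. {Top (partner D j), Bot j}) (free_bot D) (through_strings D)"
  proof (rule bij_betwI')
    fix j j'
    show "({Top (partner D j), Bot j} = {Top (partner D j'), Bot j'}) = (j = j')" by (auto simp: doubleton_eq_iff)
  next
    fix j assume "j \<in> free_bot D"
    then show "{Top (partner D j), Bot j} \<in> through_strings D"
      using free_bot_iff[OF D] partner_eq[OF D] by (metis through_strings_iff)
  next
    fix e assume e: "e \<in> through_strings D"
    obtain a b where "e = {Top a, Bot b}" "e \<in> D" by (rule throughE[OF D e])
    then show "\<exists>j\<in>free_bot D. e = {Top (partner D j), Bot j}"
      using partner_eq[OF D] free_bot_iff[OF D] by metis
  qed
  then show "card (free_bot D) = card (through_strings D)" by (rule bij_betw_same_card)
  then show "card (free_top D) = card (through_strings D)" using bij_betw_same_card[OF bij_partner[OF D]] by simp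
qed

text \<open>Turns the equation of diagrams in the definition of \<open>through_perm\<close> into
  pointwise equations between ranks, with which composites can be computed.\<close>

lemma perm_diagram_iff:
  assumes D: "brauer_diagram r s D" and t: "card (through_strings D) = t"
  shows "perm_diagram t p = relabelled_through_strings D \<longleftrightarrow>
    (\<forall>i j. {Top i, Bot j} \<in> D \<longrightarrow> rank (free_top D) i = p (rank (free_bot D) j))"
proof
  assume eq: "perm_diagram t p = relabelled_through_strings D"
  show "\<forall>i j. {Top i, Bot j} \<in> D \<longrightarrow> rank (free_top D) i = p (rank (free_bot D) j)"
  proof (intro allI impI)
    fix i j assume "{Top i, Bot j} \<in> D"
    then have "{Top (rank (free_top D) i), Bot (rank (free_bot D) j)} \<in> perm_diagram t p"
      unfolding eq relabelled_alt by blast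
    then show "rank (free_top D) i = p (rank (free_bot D) j)" by (auto simp: perm_diagram_def doubleton_eq_iff)
  qed
next
  have rb: "bij_betw (rank (free_bot D)) (free_bot D) {1..t}"
    using bij_rank[OF finite_free(2)[OF D]] card_free[OF D] t by simp
  assume *: "\<forall>i j. {Top i, Bot j} \<in> D \<longrightarrow> rank (free_top D) i = p (rank (free_bot D) j)"
  show "perm_diagram t p = relabelled_through_strings D"
  proof (intro equalityI subsetI)
    fix e assume "e \<in> perm_diagram t p"
    then obtain k where k: "k \<in> {1..t}" "e = {Top (p k), Bot k}" by (auto simp: perm_diagram_def)
    obtain j where j: "j \<in> free_bot D" "k = rank (free_bot D) j" using bij_betw_ex[OF rb k(1)] by blast
    then obtain i where "{Top i, Bot j} \<in> D" using free_bot_iff[OF D] by blast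
    then show "e \<in> relabelled_through_strings D" unfolding relabelled_alt k(2) j(2) using * by force
  next
    fix e assume "e \<in> relabelled_through_strings D"
    then obtain i j where ij: "{Top i, Bot j} \<in> D" "e = {Top (rank (free_top D) i), Bot (rank (free_bot D) j)}"
      unfolding relabelled_alt by blast
    then have "j \<in> free_bot D" using free_bot_iff[OF D] by blast
    then have "rank (free_bot D) j \<in> {1..t}" using rb by (auto simp: bij_betw_def)
    moreover have "rank (free_top D) i = p (rank (free_bot D) j)" using * ij(1) by blast
    ultimately show "e \<in> perm_diagram t p" unfolding perm_diagram_def ij(2) by auto
  qed
qed

lemma perm_unique:
  assumes D: "brauer_diagram r s D" and t: "card (through_strings D) = t"
    and "p permutes {1..t}" "q permutes {1..t}"
    and "\<And>i j. {Top i, Bot j} \<in> D \<Longrightarrow> rank (free_top D) i = p (rank (free_bot D) j)"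
    and "\<And>i j. {Top i, Bot j} \<in> D \<Longrightarrow> rank (free_top D) i = q (rank (free_bot D) j)"
  shows "p = q"
proof
  have rb: "bij_betw (rank (free_bot D)) (free_bot D) {1..t}"
    using bij_rank[OF finite_free(2)[OF D]] card_free[OF D] t by simp
  fix k
  show "p k = q k"
  proof (cases "k \<in> {1..t}")
    case True
    then obtain j where j: "j \<in> free_bot D" "k = rank (free_bot D) j" using bij_betw_ex[OF rb] by blast
    then obtain i where "{Top i, Bot j} \<in> D" using free_bot_iff[OF D] by blast
    then show ?thesis using assms(5,6) j(2) by metis
  qed (use assms(3,4) in \<open>simp add: permutes_def\<close>)
qed

lemma perm_exists:
  assumes D: "brauer_diagram r s D" and t: "card (through_strings D) = t"
  shows "\<exists>p. p permutes {1..t} \<and> (\<forall>i j. {Top i, Bot j} \<in> D \<longrightarrow> rank (free_top D) i = p (rank (free_bot D) j))"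
proof -
  have rb: "bij_betw (rank (free_bot D)) (free_bot D) {1..t}" and rt: "bij_betw (rank (free_top D)) (free_top D) {1..t}"
    using bij_rank[OF finite_free(2)[OF D]] bij_rank[OF finite_free(1)[OF D]] card_free[OF D] t by simp_all
  \<comment> \<open>From the label of a bottom vertex to the vertex, to its partner in the top row,
    to the label of that; the direction is the one fixed by \<open>perm_diagram\<close>.\<close>
  define q where "q = rank (free_top D) \<circ> (partner D \<circ> the_inv_into (free_bot D) (rank (free_bot D)))"
  have q: "bij_betw q {1..t} {1..t}"
    unfolding q_def by (rule bij_betw_trans[OF bij_betw_trans[OF bij_betw_the_inv_into[OF rb] bij_partner[OF D]] rt])
  \<comment> \<open>\<open>permutes\<close> requires the identity outside
    \<open>{1..t}\<close>.\<close>
  define p where "p k = (if k \<in> {1..t} then q k else k)" for k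
  have "bij_betw p {1..t} {1..t}" using q by (subst bij_betw_cong[of _ p q]) (simp_all add: p_def)
  then have "p permutes {1..t}" by (rule bij_imp_permutes) (auto simp: p_def)
  moreover have "rank (free_top D) i = p (rank (free_bot D) j)" if ij: "{Top i, Bot j} \<in> D" for i j
  proof -
    have j: "j \<in> free_bot D" using ij free_bot_iff[OF D] by blast
    then have "rank (free_bot D) j \<in> {1..t}" using rb by (auto simp: bij_betw_def)
    moreover have "the_inv_into (free_bot D) (rank (free_bot D)) (rank (free_bot D) j) = j"
      using rb j by (intro the_inv_into_f_f) (auto simp: bij_betw_def)
    ultimately show ?thesis using partner_eq[OF D ij] by (simp add: p_def q_def)
  qed
  ultimately show ?thesis by blast
qed

lemma through_perm_eqI:
  assumes D: "brauer_diagram r s (fst M)" and t: "card (through_strings (fst M)) = t" and p: "p permutes {1..t}"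
    and "\<And>i j. {Top i, Bot j} \<in> fst M \<Longrightarrow> rank (free_top (fst M)) i = p (rank (free_bot (fst M)) j)"
  shows "through_perm t M = p"
  unfolding through_perm_def
proof (rule the_equality)
  show "p permutes {1..t} \<and> perm_diagram t p = relabelled_through_strings (fst M)"
    using assms by (simp add: perm_diagram_iff[OF D t])
  show "q = p" if "q permutes {1..t} \<and> perm_diagram t q = relabelled_through_strings (fst M)" for q
    using that assms by (intro perm_unique[OF D t]) (auto simp: perm_diagram_iff[OF D t])
qed

lemma through_perm:
  assumes D: "brauer_diagram r s (fst M)" and t: "card (through_strings (fst M)) = t"
  shows "through_perm t M permutes {1..t}"
    "{Top i, Bot j} \<in> fst M \<Longrightarrow> rank (free_top (fst M)) i = through_perm t M (rank (free_bot (fst M)) j)"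
proof -
  obtain p where p: "p permutes {1..t}" "\<And>i j. {Top i, Bot j} \<in> fst M \<Longrightarrow> rank (free_top (fst M)) i = p (rank (free_bot (fst M)) j)"
    using perm_exists[OF D t] by blast
  have "through_perm t M = p" by (rule through_perm_eqI[OF D t p])
  then show "through_perm t M permutes {1..t}"
    "{Top i, Bot j} \<in> fst M \<Longrightarrow> rank (free_top (fst M)) i = through_perm t M (rank (free_bot (fst M)) j)"
    using p by simp_all
qed

section \<open>Diagrams and triples\<close>

lemma pos_image: "pos ` Top ` x = x" "pos ` Bot ` x = x"
  by (simp_all add: image_image)

lemma cups_top_graph: "brauer_diagram r s D \<Longrightarrow> cups D = (`) Top ` top_graph (D, ms)"
proof -
  assume D: "brauer_diagram r s D"
  have "Top ` pos ` e = e" if "e \<in> cups D" for e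
    using that by (auto simp: cups_def image_image subset_iff image_iff) (metis pos.simps(1) rangeE)+
  then show ?thesis by (simp add: top_graph_def image_image)
qed

lemma caps_bottom_graph: "brauer_diagram r s D \<Longrightarrow> caps D = (`) Bot ` bottom_graph (D, ms)"
proof -
  assume D: "brauer_diagram r s D"
  have "Bot ` pos ` e = e" if "e \<in> caps D" for e
    using that by (auto simp: caps_def image_image subset_iff image_iff) (metis pos.simps(3) rangeE)+
  then show ?thesis by (simp add: bottom_graph_def image_image)
qed

lemma inj_image_Top: "inj ((`) Top)" "inj ((`) Bot)"
  by (auto intro!: inj_on_image simp: inj_on_def)

lemma free_top_alt:
  assumes D: "brauer_diagram r s D"
  shows "free_top D = {1..r} - \<Union>(top_graph (D, ms))"
proof (intro equalityI subsetI)
  fix i assume i: "i \<in> free_top D"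
  then obtain j where ij: "{Top i, Bot j} \<in> D" using free_top_iff[OF D] by blast
  have "i \<notin> x" if "x \<in> top_graph (D, ms)" for x
  proof
    assume "i \<in> x"
    moreover have "Top ` x \<in> cups D" using that cups_top_graph[OF D, of ms] by blast
    ultimately have "Top ` x = {Top i, Bot j}"
      using brauer_diagram_unique[OF D _ ij, of "Top ` x" "Top i"] cups_caps_subset(1)[of D] by auto
    then show False by (auto simp: set_eq_iff)
  qed
  then show "i \<in> {1..r} - \<Union>(top_graph (D, ms))" using i free_subset(1)[OF D] by blast
next
  fix i assume i: "i \<in> {1..r} - \<Union>(top_graph (D, ms))"
  then obtain e where e: "e \<in> D" "Top i \<in> e" using brauer_diagram_ex[OF D, of "Top i"] by auto
  have "e \<notin> cups D"
  proof
    assume "e \<in> cups D"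
    then obtain x where "x \<in> top_graph (D, ms)" "e = Top ` x" using cups_top_graph[OF D, of ms] by blast
    then show False using i e(2) by auto
  qed
  moreover have "e \<notin> caps D" using e(2) by (auto simp: caps_def)
  ultimately have "e \<in> through_strings D" using e(1) by (simp add: through_strings_def)
  then show "i \<in> free_top D" using e(2) by (auto simp: free_top_def)
qed

lemma free_bot_alt:
  assumes D: "brauer_diagram r s D"
  shows "free_bot D = {1..s} - \<Union>(bottom_graph (D, ms))"
proof (intro equalityI subsetI)
  fix j assume j: "j \<in> free_bot D"
  then obtain i where ij: "{Top i, Bot j} \<in> D" using free_bot_iff[OF D] by blast
  have "j \<notin> x" if "x \<in> bottom_graph (D, ms)" for x
  proof
    assume "j \<in> x"
    moreover have "Bot ` x \<in> caps D" using that caps_bottom_graph[OF D, of ms] by blast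
    ultimately have "Bot ` x = {Top i, Bot j}"
      using brauer_diagram_unique[OF D _ ij, of "Bot ` x" "Bot j"] cups_caps_subset(2)[of D] by auto
    then show False by (auto simp: set_eq_iff)
  qed
  then show "j \<in> {1..s} - \<Union>(bottom_graph (D, ms))" using j free_subset(2)[OF D] by blast
next
  fix j assume j: "j \<in> {1..s} - \<Union>(bottom_graph (D, ms))"
  then obtain e where e: "e \<in> D" "Bot j \<in> e" using brauer_diagram_ex[OF D, of "Bot j"] by auto
  have "e \<notin> caps D"
  proof
    assume "e \<in> caps D"
    then obtain x where "x \<in> bottom_graph (D, ms)" "e = Bot ` x" using caps_bottom_graph[OF D, of ms] by blast
    then show False using j e(2) by auto
  qed
  moreover have "e \<notin> cups D" using e(2) by (auto simp: cups_def)
  ultimately have "e \<in> through_strings D" using e(1) by (simp add: through_strings_def)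
  then show "j \<in> free_bot D" using e(2) by (auto simp: free_bot_def)
qed

text \<open>The inverse of taking top graph, bottom graph and permutation.\<close>

definition diagram_of :: "nat \<Rightarrow> nat set set \<Rightarrow> nat set set \<Rightarrow> (nat \<Rightarrow> nat) \<Rightarrow> vertex set set" where
  "diagram_of r e f p = (`) Top ` e \<union> (`) Bot ` f \<union>
     {{Top a, Bot b} |a b. a \<in> {1..r} - \<Union>e \<and> b \<in> {1..r} - \<Union>f \<and> rank ({1..r} - \<Union>e) a = p (rank ({1..r} - \<Union>f) b)}"

lemma diagram_of_eq:
  assumes D: "brauer_diagram r r (fst M)" and t: "card (through_strings (fst M)) = t"
  shows "diagram_of r (top_graph M) (bottom_graph M) (through_perm t M) = fst M"
proof -
  obtain D' ms where M: "M = (D', ms)" by (cases M)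
  note D = D[unfolded M fst_conv] and t = t[unfolded M fst_conv]
  have ft: "{1..r} - \<Union>(top_graph M) = free_top D'" "{1..r} - \<Union>(bottom_graph M) = free_bot D'"
    using free_top_alt[OF D] free_bot_alt[OF D] unfolding M by simp_all
  have "{{Top a, Bot b} |a b. a \<in> free_top D' \<and> b \<in> free_bot D' \<and> rank (free_top D') a = through_perm t M (rank (free_bot D') b)}
    = through_strings D'" (is "?L = _")
  proof (intro equalityI subsetI)
    fix e assume "e \<in> ?L"
    then obtain a b where ab: "e = {Top a, Bot b}" "a \<in> free_top D'" "b \<in> free_bot D'"
      "rank (free_top D') a = through_perm t M (rank (free_bot D') b)" by blast
    obtain a' where a': "{Top a', Bot b} \<in> D'" using ab(3) free_bot_iff[OF D] by blast
    then have "rank (free_top D') a' = rank (free_top D') a"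
      using through_perm(2)[of r r M t a' b] D t M ab(4) by simp
    moreover have "a' \<in> free_top D'" using a' free_top_iff[OF D] by blast
    ultimately have "a' = a" using bij_betw_inj_onD[OF bij_rank[OF finite_free(1)[OF D]]] ab(2) by blast
    then show "e \<in> through_strings D'" using a' ab(1) by (simp add: through_strings_iff)
  next
    fix e assume e: "e \<in> through_strings D'"
    obtain a b where "e = {Top a, Bot b}" "e \<in> D'" by (rule throughE[OF D e])
    then show "e \<in> ?L"
      using through_perm(2)[of r r M t a b] D t M free_top_iff[OF D, of a] free_bot_iff[OF D, of b] by auto
  qed
  then have "diagram_of r (top_graph M) (bottom_graph M) (through_perm t M) = cups D' \<union> caps D' \<union> through_strings D'"
    unfolding diagram_of_def ft using cups_top_graph[OF D, of ms] caps_bottom_graph[OF D, of ms] M by simp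
  also have "\<dots> = D'" using cups_caps_subset[of D'] by (auto simp: through_strings_def)
  finally show ?thesis using M by simp
qed

lemma partial_matchings_disjoint:
  assumes "e \<in> partial_matchings r t" "x \<in> e" "y \<in> e" "v \<in> x" "v \<in> y"
  shows "x = y"
proof -
  have fin: "finite e"
    by (rule finite_subset[of _ "Pow {1..r}"]) (use assms(1) in \<open>auto simp: partial_matchings_def\<close>)
  have "x \<subseteq> {1..r}" using assms(1,2) by (auto simp: partial_matchings_def)
  then have "v \<in> {1..r}" using assms(4) by blast
  then have "card {x \<in> e. v \<in> x} \<le> 1" using assms(1) by (auto simp: partial_matchings_def)
  then show ?thesis using assms(2-5) fin by (auto simp: card_le_Suc0_iff_eq)
qed

lemma card_free_vertices:
  assumes e: "e \<in> partial_matchings r t" and r: "t + 2 * u = r"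
  shows "card ({1..r} - \<Union>e) = t"
proof -
  have fin: "finite e"
    by (rule finite_subset[of _ "Pow {1..r}"]) (use e in \<open>auto simp: partial_matchings_def\<close>)
  have two: "x \<subseteq> {1..r} \<and> card x = 2" if "x \<in> e" for x using e that by (auto simp: partial_matchings_def)
  have "card (\<Union>x\<in>e. x) = (\<Sum>x\<in>e. card x)"
  proof (rule card_UN_disjoint[OF fin])
    show "\<forall>x\<in>e. finite x" using two finite_subset by blast
    show "\<forall>x\<in>e. \<forall>y\<in>e. x \<noteq> y \<longrightarrow> x \<inter> y = {}" using partial_matchings_disjoint[OF e] by blast
  qed
  also have "\<dots> = 2 * card e" using two by simp
  also have "card e = u" using e r by (auto simp: partial_matchings_def)
  finally have "card (\<Union>e) = 2 * u" by simp
  moreover have "\<Union>e \<subseteq> {1..r}" using two by blast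
  ultimately show ?thesis using r by (subst card_Diff_subset) (auto intro: finite_subset)
qed

text \<open>Together with \<open>diagram_of_eq\<close> this identifies the diagrams with
  \<open>t\<close> through strings with the triples that index the basis of the inflation.\<close>

lemma diagram_of:
  assumes e: "e \<in> partial_matchings r t" and f: "f \<in> partial_matchings r t" and p: "p permutes {1..t}"
    and r: "t + 2 * u = r"
  defines "D \<equiv> diagram_of r e f p"
  shows "brauer_diagram r r D" "card (through_strings D) = t" "top_graph (D, ms) = e" "bottom_graph (D, ms) = f"
    "through_perm t (D, ms) = p"
proof -
  let ?E = "{1..r} - \<Union>e" and ?F = "{1..r} - \<Union>f"
  define Th where "Th = {{Top a, Bot b} |a b. a \<in> ?E \<and> b \<in> ?F \<and> rank ?E a = p (rank ?F b)}"
  have D_def': "D = (`) Top ` e \<union> (`) Bot ` f \<union> Th" by (simp add: D_def diagram_of_def Th_def)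
  have rE: "bij_betw (rank ?E) ?E {1..t}" and rF: "bij_betw (rank ?F) ?F {1..t}"
    using bij_rank[of ?E] bij_rank[of ?F] card_free_vertices[OF e r] card_free_vertices[OF f r] by auto
  have two: "x \<subseteq> {1..r} \<and> card x = 2" if "x \<in> e \<union> f" for x using e f that by (auto simp: partial_matchings_def)
  \<comment> \<open>\<open>p\<close> and both ranks are injective on the free vertices, so each free
    vertex has a single partner.\<close>
  have uniqF: "b = b'" if "b \<in> ?F" "b' \<in> ?F" "p (rank ?F b) = p (rank ?F b')" for b b'
    using bij_betw_inj_onD[OF rF] injD[OF permutes_inj[OF p] that(3)] that by blast
  have uniqE: "a = a'" if "a \<in> ?E" "a' \<in> ?E" "rank ?E a = rank ?E a'" for a a'
    using bij_betw_inj_onD[OF rE] that by blast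
  have exE: "\<exists>b\<in>?F. rank ?E a = p (rank ?F b)" if a: "a \<in> ?E" for a
  proof -
    have "rank ?E a \<in> {1..t}" using bij_betwE[OF rE] a by blast
    then obtain k where k: "k \<in> {1..t}" "rank ?E a = p k" using permutes_image[OF p] by (metis imageE)
    then obtain b where "b \<in> ?F" "k = rank ?F b" using bij_betw_ex[OF rF] by blast
    then show ?thesis using k(2) by blast
  qed
  have exF: "\<exists>a\<in>?E. rank ?E a = p (rank ?F b)" if b: "b \<in> ?F" for b
  proof -
    have "rank ?F b \<in> {1..t}" using bij_betwE[OF rF] b by blast
    then have "p (rank ?F b) \<in> {1..t}" using permutes_in_image[OF p] by blast
    then obtain a where "a \<in> ?E" "p (rank ?F b) = rank ?E a" using bij_betw_ex[OF rE] by blast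
    then have "a \<in> ?E" "rank ?E a = p (rank ?F b)" by simp_all
    then show ?thesis by blast
  qed
  have D_cases: "(\<exists>y\<in>e. x = Top ` y) \<or> (\<exists>y\<in>f. x = Bot ` y) \<or>
    (\<exists>a b. a \<in> ?E \<and> b \<in> ?F \<and> x = {Top a, Bot b} \<and> rank ?E a = p (rank ?F b))" if "x \<in> D" for x
    using that unfolding D_def' Th_def by blast
  have Top_in: "a \<in> \<Union>e \<and> (\<exists>y\<in>e. x = Top ` y) \<or> a \<in> ?E \<and> (\<exists>b\<in>?F. x = {Top a, Bot b} \<and> rank ?E a = p (rank ?F b))"
    if "x \<in> D" "Top a \<in> x" for x a
    using D_cases[OF that(1)] that(2) by (elim disjE exE bexE conjE) (auto simp del: Diff_iff)
  have Bot_in: "b \<in> \<Union>f \<and> (\<exists>y\<in>f. x = Bot ` y) \<or> b \<in> ?F \<and> (\<exists>a\<in>?E. x = {Top a, Bot b} \<and> rank ?E a = p (rank ?F b))"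
    if "x \<in> D" "Bot b \<in> x" for x b
    using D_cases[OF that(1)] that(2) by (elim disjE exE bexE conjE) (auto simp del: Diff_iff)
  have Th_in: "{Top a, Bot b} \<in> D" if "a \<in> ?E" "b \<in> ?F" "rank ?E a = p (rank ?F b)" for a b
    unfolding D_def' Th_def by (rule UnI2, rule CollectI, rule exI[of _ a], rule exI[of _ b]) (intro conjI refl that)
  have no_Mid: "Mid i \<notin> x" if "x \<in> D" for x i
    using D_cases[OF that] by (elim disjE exE bexE conjE) auto
  have c2: "card x = 2" if xD: "x \<in> D" for x
  proof -
    consider y where "y \<in> e" "x = Top ` y" | y where "y \<in> f" "x = Bot ` y" | a b where "x = {Top a, Bot b}"
      using D_cases[OF xD] by blast
    then show ?thesis using two by cases (auto simp: card_image inj_on_def)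
  qed
  show D: "brauer_diagram r r D"
    unfolding brauer_diagram_def
  proof (intro conjI ballI c2)
    show "partition_on (Top ` {1..r} \<union> Bot ` {1..r}) D"
    proof (rule partition_onI)
      show "\<Union>D = Top ` {1..r} \<union> Bot ` {1..r}"
      proof (intro equalityI subsetI)
        fix v assume "v \<in> \<Union>D"
        then obtain x where x: "x \<in> D" "v \<in> x" by blast
        show "v \<in> Top ` {1..r} \<union> Bot ` {1..r}"
        proof (cases v)
          case (Top a)
          then have "a \<in> \<Union>e \<or> a \<in> ?E" using Top_in[OF x(1)] x(2) by blast
          then show ?thesis using two Top by blast
        next
          case (Bot b)
          then have "b \<in> \<Union>f \<or> b \<in> ?F" using Bot_in[OF x(1)] x(2) by blast
          then show ?thesis using two Bot by blast
        qed (use no_Mid x in blast)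
      next
        fix v assume "v \<in> Top ` {1..r} \<union> Bot ` {1..r}"
        then consider a where "v = Top a" "a \<in> {1..r}" | b where "v = Bot b" "b \<in> {1..r}" by blast
        then show "v \<in> \<Union>D"
        proof cases
          case 1
          show ?thesis
          proof (cases "a \<in> \<Union>e")
            case True
            then obtain y where "y \<in> e" "a \<in> y" by blast
            then have "Top ` y \<in> D" "v \<in> Top ` y" using 1 by (auto simp: D_def')
            then show ?thesis by blast
          next
            case False
            then have "a \<in> ?E" using 1 by blast
            then obtain b where "b \<in> ?F" "rank ?E a = p (rank ?F b)" using exE by blast
            then have "{Top a, Bot b} \<in> D" using Th_in \<open>a \<in> ?E\<close> by blast
            then show ?thesis using 1 by blast
          qed
        next
          case 2
          show ?thesis
          proof (cases "b \<in> \<Union>f")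
            case True
            then obtain y where "y \<in> f" "b \<in> y" by blast
            then have "Bot ` y \<in> D" "v \<in> Bot ` y" using 2 by (auto simp: D_def')
            then show ?thesis by blast
          next
            case False
            then have "b \<in> ?F" using 2 by blast
            then obtain a where "a \<in> ?E" "rank ?E a = p (rank ?F b)" using exF by blast
            then have "{Top a, Bot b} \<in> D" using Th_in \<open>b \<in> ?F\<close> by blast
            then show ?thesis using 2 by blast
          qed
        qed
      qed
    next
      fix x y assume xy: "x \<in> D" "y \<in> D" "x \<noteq> y"
      have "x = y" if v: "v \<in> x" "v \<in> y" for v
      proof (cases v)
        case (Top a)
        have X: "a \<in> \<Union>e \<and> (\<exists>z\<in>e. x = Top ` z) \<or> a \<in> ?E \<and> (\<exists>b\<in>?F. x = {Top a, Bot b} \<and> rank ?E a = p (rank ?F b))"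
          and Y: "a \<in> \<Union>e \<and> (\<exists>z\<in>e. y = Top ` z) \<or> a \<in> ?E \<and> (\<exists>b\<in>?F. y = {Top a, Bot b} \<and> rank ?E a = p (rank ?F b))"
          by (rule Top_in[OF xy(1)], use v Top in simp, rule Top_in[OF xy(2)], use v Top in simp)
        show ?thesis
        proof (cases "a \<in> \<Union>e")
          case True
          then have "\<exists>z\<in>e. x = Top ` z" "\<exists>z\<in>e. y = Top ` z" using X Y by (simp_all only: Diff_iff simp_thms)
          then obtain z z' where "z \<in> e" "x = Top ` z" "z' \<in> e" "y = Top ` z'" by blast
          then show ?thesis using partial_matchings_disjoint[OF e, of z z' a] v Top by auto
        next
          case False
          then have "\<exists>b\<in>?F. x = {Top a, Bot b} \<and> rank ?E a = p (rank ?F b)" "\<exists>b\<in>?F. y = {Top a, Bot b} \<and> rank ?E a = p (rank ?F b)"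
            using X Y by (simp_all only: simp_thms)
          then obtain b b' where bb: "b \<in> ?F" "x = {Top a, Bot b}" "rank ?E a = p (rank ?F b)"
            "b' \<in> ?F" "y = {Top a, Bot b'}" "rank ?E a = p (rank ?F b')" by blast
          have "b = b'" by (rule uniqF[OF bb(1,4) trans[OF bb(3)[symmetric] bb(6)]])
          then show ?thesis using bb(2,5) by simp
        qed
      next
        case (Bot b)
        have X: "b \<in> \<Union>f \<and> (\<exists>z\<in>f. x = Bot ` z) \<or> b \<in> ?F \<and> (\<exists>a\<in>?E. x = {Top a, Bot b} \<and> rank ?E a = p (rank ?F b))"
          and Y: "b \<in> \<Union>f \<and> (\<exists>z\<in>f. y = Bot ` z) \<or> b \<in> ?F \<and> (\<exists>a\<in>?E. y = {Top a, Bot b} \<and> rank ?E a = p (rank ?F b))"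
          by (rule Bot_in[OF xy(1)], use v Bot in simp, rule Bot_in[OF xy(2)], use v Bot in simp)
        show ?thesis
        proof (cases "b \<in> \<Union>f")
          case True
          then have "\<exists>z\<in>f. x = Bot ` z" "\<exists>z\<in>f. y = Bot ` z" using X Y by (simp_all only: Diff_iff simp_thms)
          then obtain z z' where "z \<in> f" "x = Bot ` z" "z' \<in> f" "y = Bot ` z'" by blast
          then show ?thesis using partial_matchings_disjoint[OF f, of z z' b] v Bot by auto
        next
          case False
          then have "\<exists>a\<in>?E. x = {Top a, Bot b} \<and> rank ?E a = p (rank ?F b)" "\<exists>a\<in>?E. y = {Top a, Bot b} \<and> rank ?E a = p (rank ?F b)"
            using X Y by (simp_all only: simp_thms)
          then obtain a a' where aa: "a \<in> ?E" "x = {Top a, Bot b}" "rank ?E a = p (rank ?F b)"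
            "a' \<in> ?E" "y = {Top a', Bot b}" "rank ?E a' = p (rank ?F b)" by blast
          have "a = a'" by (rule uniqE[OF aa(1,4) trans[OF aa(3) aa(6)[symmetric]]])
          then show ?thesis using aa(2,5) by simp
        qed
      qed (use no_Mid xy v in blast)
      then show "disjnt x y" using xy(3) by (auto simp: disjnt_def)
    next
      show "{} \<notin> D" using c2[of "{}"] by auto
    qed
  qed
  have ne: "x \<noteq> {}" if "x \<in> e \<union> f" for x using two[OF that] by auto
  have "cups D = (`) Top ` e"
  proof (intro equalityI subsetI)
    fix x assume x: "x \<in> cups D"
    then have xD: "x \<in> D" "x \<subseteq> range Top" by (auto simp: cups_def)
    from D_cases[OF xD(1)] consider "x \<in> (`) Top ` e" | y where "y \<in> f" "x = Bot ` y" | a b where "x = {Top a, Bot b}"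
      by blast
    then show "x \<in> (`) Top ` e"
    proof cases
      case 2
      then show ?thesis using ne[of y] \<open>x \<subseteq> range Top\<close> by auto
    qed (use \<open>x \<subseteq> range Top\<close> in auto)
  qed (auto simp: cups_def D_def')
  moreover have "caps D = (`) Bot ` f"
  proof (intro equalityI subsetI)
    fix x assume x: "x \<in> caps D"
    then have xD: "x \<in> D" "x \<subseteq> range Bot" by (auto simp: caps_def)
    from D_cases[OF xD(1)] consider "x \<in> (`) Bot ` f" | y where "y \<in> e" "x = Top ` y" | a b where "x = {Top a, Bot b}"
      by blast
    then show "x \<in> (`) Bot ` f"
    proof cases
      case 2
      then show ?thesis using ne[of y] \<open>x \<subseteq> range Bot\<close> by auto
    qed (use \<open>x \<subseteq> range Bot\<close> in auto)
  qed (auto simp: caps_def D_def')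
  ultimately show tg: "top_graph (D, ms) = e" and bg: "bottom_graph (D, ms) = f"
    by (simp_all add: top_graph_def bottom_graph_def image_image)
  have free: "free_top D = ?E" "free_bot D = ?F"
    using free_top_alt[OF D, of ms] free_bot_alt[OF D, of ms] tg bg by simp_all
  show t: "card (through_strings D) = t"
    using card_free(2)[OF D] card_free_vertices[OF e r] free by simp
  show "through_perm t (D, ms) = p"
  proof (rule through_perm_eqI[of r r])
    fix i j assume "{Top i, Bot j} \<in> fst (D, ms)"
    then have ij: "{Top i, Bot j} \<in> D" by simp
    have "i \<in> ?E" using ij free free_top_iff[OF D] by blast
    then obtain b where "{Top i, Bot j} = {Top i, Bot b}" "rank ?E i = p (rank ?F b)" using Top_in[OF ij, of i] by auto
    then show "rank (free_top (fst (D, ms))) i = p (rank (free_bot (fst (D, ms))) j)"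
      using free by (auto simp: doubleton_eq_iff)
  qed (use D t p in simp_all)
qed

lemma graphs_partial_matchings:
  assumes D: "brauer_diagram r r (fst M)" and t: "card (through_strings (fst M)) = t"
  shows "top_graph M \<in> partial_matchings r t" "bottom_graph M \<in> partial_matchings r t"
proof -
  obtain D' ms where M: "M = (D', ms)" by (cases M)
  note D = D[unfolded M fst_conv] and t = t[unfolded M fst_conv]
  note c = brauer_diagram_card[OF D]
  have fin: "finite (top_graph M)" "finite (bottom_graph M)"
    using finite_brauer_diagram[OF D] unfolding M top_graph_def bottom_graph_def cups_def caps_def by auto
  have tg: "Top ` x \<in> cups D'" if "x \<in> top_graph M" for x using that cups_top_graph[OF D, of ms] M by blast
  have bg: "Bot ` x \<in> caps D'" if "x \<in> bottom_graph M" for x using that caps_bottom_graph[OF D, of ms] M by blast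
  have "card (top_graph M) = card (cups D')"
    unfolding cups_top_graph[OF D, of ms] M using inj_image_Top(1) by (simp add: card_image inj_on_subset)
  then have ct: "card (top_graph M) = (r - t) div 2" using c t by simp
  have "card (bottom_graph M) = card (caps D')"
    unfolding caps_bottom_graph[OF D, of ms] M using inj_image_Top(2) by (simp add: card_image inj_on_subset)
  then have cb: "card (bottom_graph M) = (r - t) div 2" using c t by simp
  have et: "x \<subseteq> {1..r} \<and> card x = 2" if xM: "x \<in> top_graph M" for x
  proof -
    obtain a b where "Top ` x = {Top a, Top b}" "a < b" "1 \<le> a" "b \<le> r" by (rule cupsE[OF D tg[OF xM]])
    then have "pos ` Top ` x = {a, b}" "a \<noteq> b" "1 \<le> a" "b \<le> r" "a < b" by auto
    then show ?thesis unfolding pos_image by auto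
  qed
  have eb: "x \<subseteq> {1..r} \<and> card x = 2" if xM: "x \<in> bottom_graph M" for x
  proof -
    obtain a b where "Bot ` x = {Bot a, Bot b}" "a < b" "1 \<le> a" "b \<le> r" by (rule capsE[OF D bg[OF xM]])
    then have "pos ` Bot ` x = {a, b}" "a \<noteq> b" "1 \<le> a" "b \<le> r" "a < b" by auto
    then show ?thesis unfolding pos_image by auto
  qed
  have dt: "x = y" if "x \<in> top_graph M" "y \<in> top_graph M" "v \<in> x" "v \<in> y" for x y v
  proof -
    have "Top ` x = Top ` y"
      using tg[OF that(1)] tg[OF that(2)] that(3,4) cups_caps_subset(1)[of D']
      by (intro brauer_diagram_unique[OF D, of _ _ "Top v"]) auto
    then show ?thesis by (metis pos_image(1))
  qed
  have db: "x = y" if "x \<in> bottom_graph M" "y \<in> bottom_graph M" "v \<in> x" "v \<in> y" for x y v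
  proof -
    have "Bot ` x = Bot ` y"
      using bg[OF that(1)] bg[OF that(2)] that(3,4) cups_caps_subset(2)[of D']
      by (intro brauer_diagram_unique[OF D, of _ _ "Bot v"]) auto
    then show ?thesis by (metis pos_image(2))
  qed
  show "top_graph M \<in> partial_matchings r t" "bottom_graph M \<in> partial_matchings r t"
  proof -
    have "card {x \<in> top_graph M. v \<in> x} \<le> Suc 0" for v using fin dt by (subst card_le_Suc0_iff_eq) auto
    moreover have "card {x \<in> bottom_graph M. v \<in> x} \<le> Suc 0" for v using fin db by (subst card_le_Suc0_iff_eq) auto
    ultimately show "top_graph M \<in> partial_matchings r t" "bottom_graph M \<in> partial_matchings r t"
      unfolding partial_matchings_def using et eb ct cb by simp_all
  qed
qed

section \<open>Composites with the maximal number of through strings\<close>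

context stacked
begin

text \<open>A middle path entered and left on the same side would give a cup or cap that passes
  through the middle row, whereas with full rank all cups and caps are edges of a factor.\<close>

lemma full_rank_no_returning_strand:
  assumes full: full_rank and path: "path us mes" "set us \<subseteq> range Mid" "hd us \<noteq> last us"
    and a: "a \<in> G" "hd us \<in> stack_ends a" "\<not> stack_ends a \<subseteq> range Mid"
    and b: "b \<in> G" "last us \<in> stack_ends b" "\<not> stack_ends b \<subseteq> range Mid"
    and ab: "isl a = isl b"
  shows False
proof -
  have ne: "us \<noteq> []" by (rule path_ne[OF path(1)])
  have Mid: "hd us \<in> range Mid" "last us \<in> range Mid" using ne path(2) by auto
  obtain v where v: "stack_ends a = {hd us, v}" using ends_other[OF a(1,2)] by blast
  obtain w where w: "stack_ends b = {last us, w}" using ends_other[OF b(1,2)] by blast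
  have vw: "v \<notin> range Mid" "w \<notin> range Mid" using v w a(3) b(3) Mid by auto
  \<comment> \<open>If both outer ends coincided, the two edges would be the same edge by colour,
    and it would have three ends.\<close>
  have "v \<noteq> w"
  proof
    assume "v = w"
    then have "a = b" using col_unique[OF a(1) b(1), of v] v w ab by auto
    then have "{hd us, v} = {last us, v}" using v w \<open>v = w\<close> by simp
    then show False using path(3) Mid vw(1) by (auto simp: doubleton_eq_iff)
  qed
  have sa: "stack_ends a = {v, hd us}" using v by auto
  have m: "mpath (v # us @ [w]) (a # mes @ [b])"
    by (rule strand_extend[OF path(1,2) a(1) b(1) sa w vw \<open>v \<noteq> w\<close>])
  have "\<exists>vs es. strand G vs es \<and> {v, w} = {hd vs, last vs}"
    using m unfolding strand_iff by (intro exI[of _ "v # us @ [w]"] exI[of _ "a # mes @ [b]"]) simp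
  then have D: "{v, w} \<in> stacked_diagram G" unfolding stacked_diagram_def by blast
  show False
  proof (cases "isl a")
    case True
    have "v \<in> range Top" using vw(1) Bot_edge[OF a(1)] True v by (cases v) auto
    moreover have "w \<in> range Top" using vw(2) Bot_edge[OF b(1)] True ab w by (cases w) auto
    \<comment> \<open>The cup is an edge of the upper factor, so by colour it is the edge
      \<open>a\<close> at \<open>v\<close>; but \<open>a\<close> ends in the middle row.\<close>
    ultimately have "{v, w} \<in> cups D1" using D full unfolding full_rank_def by (auto simp: cups_def)
    then have "Inl {v, w} \<in> G" using cups_caps_subset by auto
    moreover have "upper v = v" "upper w = w" using \<open>v \<in> range Top\<close> \<open>w \<in> range Top\<close> by auto
    then have "stack_ends (Inl {v, w}) = {v, w}" by (simp add: stack_ends_simps)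
    ultimately have "a = Inl {v, w}" using col_unique[OF a(1), of "Inl {v, w}" v] v True by auto
    then have "hd us \<in> {v, w}" using a(2) \<open>stack_ends (Inl {v, w}) = {v, w}\<close> by auto
    then show False using Mid(1) vw by auto
  next
    case False
    have "v \<in> range Bot" using vw(1) Top_edge[OF a(1)] False v by (cases v) auto
    moreover have "w \<in> range Bot" using vw(2) Top_edge[OF b(1)] False ab w by (cases w) auto
    ultimately have "{v, w} \<in> caps D2" using D full unfolding full_rank_def by (auto simp: caps_def)
    then have "Inr {v, w} \<in> G" using cups_caps_subset by auto
    moreover have "lower v = v" "lower w = w" using \<open>v \<in> range Bot\<close> \<open>w \<in> range Bot\<close> by auto
    then have "stack_ends (Inr {v, w}) = {v, w}" by (simp add: stack_ends_simps)
    ultimately have "a = Inr {v, w}" using col_unique[OF a(1), of "Inr {v, w}" v] v False by auto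
    then have "hd us \<in> {v, w}" using a(2) \<open>stack_ends (Inr {v, w}) = {v, w}\<close> by auto
    then show False using Mid(1) vw by auto
  qed
qed

text \<open>The path becomes a path in the middle row of the stack. As both its end edges come from
  the same factor, at both ends it continues in the other factor by an edge leaving the row, so it
  returns to the side it came from.\<close>

lemma second_type_not_full_rank:
  assumes "has_second_type_path (bottom_graph (D1, ms1)) (top_graph (D2, ms2))"
  shows "\<not> full_rank"
proof
  assume full: full_rank
  let ?e = "bottom_graph (D1, ms1)" and ?f = "top_graph (D2, ms2)"
  have ce: "caps D1 = (`) Bot ` ?e" and cf: "cups D2 = (`) Top ` ?f"
    by (rule caps_bottom_graph[OF D1], rule cups_top_graph[OF D2])
  let ?\<Gamma> = "Inl ` ?e \<union> Inr ` ?f" and ?ends = "case_sum id id :: nat set + nat set \<Rightarrow> nat set"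
  \<comment> \<open>Edges of the graph of the form are sent to the corresponding middle edges; ends
    and colours are preserved.\<close>
  define conv :: "nat set + nat set \<Rightarrow> stack_edge" where
    "conv = case_sum (\<lambda>x. Inl (Bot ` x)) (\<lambda>x. Inr (Top ` x))"
  obtain vs es where m: "maximal_path ?\<Gamma> ?ends vs es" and same: "isl (hd es) = isl (last es)"
    using assms unfolding has_second_type_path_def by blast
  have p: "path_in ?\<Gamma> ?ends vs es" and ne: "es \<noteq> []" using m by (auto simp: maximal_path_def)
  have len: "length vs = Suc (length es)" "distinct vs" "distinct es" "set es \<subseteq> ?\<Gamma>"
    "\<And>i. i < length es \<Longrightarrow> ?ends (es ! i) = {vs ! i, vs ! Suc i}"
    using p by (auto simp: path_in_def)
  have conv_ends: "stack_ends (conv g) = Mid ` ?ends g" for g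
    by (cases g) (simp_all add: conv_def stack_ends_simps image_image)
  have conv_G: "conv g \<in> G" if "g \<in> ?\<Gamma>" for g
    using that ce cf cups_caps_subset(1)[of D2] cups_caps_subset(2)[of D1] unfolding conv_def by auto
  have conv_isl: "isl (conv g) = isl g" for g by (cases g) (simp_all add: conv_def)
  have inj: "inj conv"
  proof (rule injI)
    fix g h assume "conv g = conv h"
    then show "g = h"
      using injD[OF inj_image_Top(1)] injD[OF inj_image_Top(2)] by (cases g; cases h) (auto simp: conv_def)
  qed
  have path: "path (map Mid vs) (map conv es)"
    unfolding path_in_def
  proof (intro conjI allI impI)
    show "distinct (map Mid vs)" using len(2) by (simp add: distinct_map inj_on_def)
    show "distinct (map conv es)" using len(3) inj_on_subset[OF inj subset_UNIV] by (simp add: distinct_map)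
    show "set (map conv es) \<subseteq> G" using len(4) conv_G by auto
    show "stack_ends (map conv es ! i) = {map Mid vs ! i, map Mid vs ! Suc i}" if "i < length (map conv es)" for i
      using that len(1) len(5)[of i] conv_ends[of "es ! i"] by simp
  qed (use len(1) in simp)
  have vne: "vs \<noteq> []" using len(1) by auto
  have hl: "hd (map Mid vs) = Mid (hd vs)" "last (map Mid vs) = Mid (last vs)"
    using vne by (simp_all add: hd_map last_map)
  have "hd vs = vs ! 0" "last vs = vs ! length es" using len(1) vne by (simp_all add: hd_conv_nth last_conv_nth)
  then have neq: "hd vs \<noteq> last vs" using len(1,2) ne nth_eq_iff_index_eq[of vs 0 "length es"] by auto
  have ends: "hd vs \<in> ?ends (hd es)" "last vs \<in> ?ends (last es)" "hd es \<in> ?\<Gamma>" "last es \<in> ?\<Gamma>"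
  proof -
    have "es ! 0 = hd es" using ne by (simp add: hd_conv_nth)
    then show "hd vs \<in> ?ends (hd es)" using len(5)[of 0] \<open>hd vs = vs ! 0\<close> ne by auto
    have "es ! (length es - 1) = last es" using ne by (simp add: last_conv_nth)
    moreover have "Suc (length es - 1) = length es" using ne by (cases es) auto
    ultimately show "last vs \<in> ?ends (last es)" using len(5)[of "length es - 1"] \<open>last vs = vs ! length es\<close> ne by auto
    show "hd es \<in> ?\<Gamma>" "last es \<in> ?\<Gamma>" by (rule subsetD[OF len(4) hd_in_set[OF ne]], rule subsetD[OF len(4) last_in_set[OF ne]])
  qed
  have u1: "g = hd es" if "g \<in> ?\<Gamma>" "hd vs \<in> ?ends g" for g by (rule maximal_path_hd_edge[OF m that])
  have u2: "g = last es" if "g \<in> ?\<Gamma>" "last vs \<in> ?ends g" for g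
    using maximal_path_hd_edge[OF maximal_path_rev[OF m] that(1)] that(2) by (simp add: hd_rev)
  \<comment> \<open>If \<open>g0\<close> is the only edge of the graph at \<open>y\<close>, the
    stack still has an edge of the other colour at \<open>Mid y\<close>. It cannot lie within the
    middle row, as it would then come from the graph.\<close>
  have other: "\<exists>a\<in>G. isl a \<noteq> isl g0 \<and> Mid y \<in> stack_ends a \<and> \<not> stack_ends a \<subseteq> range Mid"
    if g0: "g0 \<in> ?\<Gamma>" "y \<in> ?ends g0" and u: "\<And>g. g \<in> ?\<Gamma> \<Longrightarrow> y \<in> ?ends g \<Longrightarrow> g = g0" for g0 y
  proof -
    have "Mid y \<in> stack_ends (conv g0)" using g0(2) conv_ends by auto
    then obtain h k where h: "h \<in> D1" "Bot y \<in> h" and k: "k \<in> D2" "Top y \<in> k"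
      using Mid_edges(2,3)[OF conv_G[OF g0(1)]] by blast
    define a where "a = (if isl g0 then Inr k else Inl h)"
    have a: "a \<in> G" "Mid y \<in> stack_ends a" "isl a \<noteq> isl g0"
      using h k by (auto simp: a_def ends_Inl ends_Inr)
    have "\<not> stack_ends a \<subseteq> range Mid"
    proof
      assume "stack_ends a \<subseteq> range Mid"
      then have hor: "hor_edge a" "pos_edge a \<longleftrightarrow> \<not> isl a" using edge_kinds(1)[OF a(1)] by auto
      show False
      proof (cases "isl g0")
        case True
        then have "k \<in> cups D2" using hor by (auto simp: a_def horizontal_edge_def positive_edge_def)
        then obtain x where "x \<in> ?f" "k = Top ` x" using cf by blast
        then have "Inr x = g0" using u[of "Inr x"] k(2) by auto
        then show False using True by auto
      next
        case False
        then have "h \<in> caps D1" using hor by (auto simp: a_def horizontal_edge_def positive_edge_def)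
        then obtain x where "x \<in> ?e" "h = Bot ` x" using ce by blast
        then have "Inl x = g0" using u[of "Inl x"] h(2) by auto
        then show False using False by auto
      qed
    qed
    then show ?thesis using a by blast
  qed
  obtain a where a: "a \<in> G" "isl a \<noteq> isl (hd es)" "Mid (hd vs) \<in> stack_ends a" "\<not> stack_ends a \<subseteq> range Mid"
    using other[OF ends(3,1) u1] by blast
  obtain b where b: "b \<in> G" "isl b \<noteq> isl (last es)" "Mid (last vs) \<in> stack_ends b" "\<not> stack_ends b \<subseteq> range Mid"
    using other[OF ends(4,2) u2] by blast
  show False
  proof (rule full_rank_no_returning_strand[OF full path])
    show "isl a = isl b" using a(2) b(2) same by simp
  qed (use a b hl neq in auto)
qed

lemma full_rankI:
  assumes "card (through_strings (stacked_diagram G)) = card (through_strings D1)"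
    "card (through_strings (stacked_diagram G)) = card (through_strings D2)"
  shows full_rank
  using cups_eq[OF assms(1)] caps_eq[OF assms(2)] by (simp add: full_rank_def)

end

lemma free_top_cong: "brauer_diagram r s D \<Longrightarrow> brauer_diagram r s' D' \<Longrightarrow> cups D = cups D' \<Longrightarrow> free_top D = free_top D'"
  using free_top_alt[of r s D "[]"] free_top_alt[of r s' D' "[]"] by (simp add: top_graph_def)

lemma free_bot_cong: "brauer_diagram r s D \<Longrightarrow> brauer_diagram r' s D' \<Longrightarrow> caps D = caps D' \<Longrightarrow> free_bot D = free_bot D'"
  using free_bot_alt[of r s D "[]"] free_bot_alt[of r' s D' "[]"] by (simp add: bottom_graph_def)

lemma through_perm_fst: "through_perm t (D, ms) = through_perm t (D, ns)"
  by (simp add: through_perm_def)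

text \<open>The primed diagrams carry no permutation, so their composite gives the contribution of the middle part.\<close>

lemma (in stacked_pair) through_perm_stacked:
  assumes full: full_rank B.full_rank
    and k: "card (through_strings D1) = k" "card (through_strings D2) = k" "card (through_strings (stacked_diagram G)) = k"
    and id1: "\<And>i j. {Top i, Bot j} \<in> D1' \<Longrightarrow> rank (free_top D1') i = rank (free_bot D1') j"
    and id2: "\<And>i j. {Top i, Bot j} \<in> D2' \<Longrightarrow> rank (free_top D2') i = rank (free_bot D2') j"
  shows "through_perm k (stacked_diagram G, ms) =
    through_perm k (D1, ms1) \<circ> through_perm k (stacked_diagram B.G, ms') \<circ> through_perm k (D2, ms2)"
proof (rule through_perm_eqI[of r t])
  let ?D = "stacked_diagram G" and ?D' = "stacked_diagram B.G"
  note D = brauer_stacked_diagram and D' = B.brauer_stacked_diagram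
  have k': "card (through_strings ?D') = k" using through_count k(3) by simp
  show "brauer_diagram r t (fst (?D, ms))" "card (through_strings (fst (?D, ms))) = k" using D k(3) by simp_all
  show "through_perm k (D1, ms1) \<circ> through_perm k (?D', ms') \<circ> through_perm k (D2, ms2) permutes {1..k}"
    using through_perm(1)[of r s "(D1, ms1)" k] through_perm(1)[of r' t' "(?D', ms')" k] through_perm(1)[of s t "(D2, ms2)" k]
      D1 D2 D' k k' by (intro permutes_compose) simp_all
  have f: "free_top ?D = free_top D1" "free_bot ?D = free_bot D2" "free_top ?D' = free_top D1'" "free_bot ?D' = free_bot D2'"
    "free_bot D1 = free_bot D1'" "free_top D2 = free_top D2'"
    using full caps_middle cups_middle
      free_top_cong[OF D D1] free_bot_cong[OF D D2] free_top_cong[OF D' B.D1] free_bot_cong[OF D' B.D2]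
      free_bot_cong[OF D1 B.D1] free_top_cong[OF D2 B.D2] by (simp_all add: full_rank_def B.full_rank_def)
  fix i j assume "{Top i, Bot j} \<in> fst (?D, ms)"
  then have ij: "{Top i, Bot j} \<in> ?D" by simp
  then obtain vs es where c: "canonical G vs es" "{Top i, Bot j} = {hd vs, last vs}"
    using stacked_diagram_canonical by blast
  have "hd vs = Top i \<and> last vs = Bot j \<or> hd vs = Bot j \<and> last vs = Top i" using c(2) by (auto simp: doubleton_eq_iff)
  then have hl: "hd vs = Top i" "last vs = Bot j" using c(1) by (auto simp: canonical_def)
  then have "end_class (hd vs) (last vs) = 1" by simp
  from through_transport[OF c(1) this] obtain x us w p mes q x' w' p' q'
    where *: "vs = Top x # us @ [Bot w]" "stack_ends p = {Top x, hd us}" "stack_ends q = {last us, Bot w}"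
      "us \<noteq> []" "set us \<subseteq> range Mid" "p \<in> G" "q \<in> G" "p' \<in> B.G" "q' \<in> B.G"
      "stack_ends p' = {Top x', hd us}" "stack_ends q' = {last us, Bot w'}"
      "canonical B.G (Top x' # us @ [Bot w']) (p' # mes @ [q'])" by blast
  obtain y z where yz: "hd us = Mid y" "last us = Mid z" using *(4,5) by (meson hd_in_set last_in_set rangeE subsetD)
  have xw: "x = i" "w = j" using hl unfolding *(1) by auto
  have e: "{Top i, Bot y} \<in> D1" "{Top z, Bot j} \<in> D2" "{Top x', Bot y} \<in> D1'" "{Top z, Bot w'} \<in> D2'"
    using through_edges(2)[OF *(6), of x y] through_edges_lower(2)[OF *(7), of z w]
      B.through_edges(2)[OF *(8), of x' y] B.through_edges_lower(2)[OF *(9), of z w'] * yz xw by auto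
  have "\<exists>vs es. strand B.G vs es \<and> {Top x', Bot w'} = {hd vs, last vs}"
    using *(12) unfolding canonical_def
    by (intro exI[of _ "Top x' # us @ [Bot w']"] exI[of _ "p' # mes @ [q']"]) simp
  then have e': "{Top x', Bot w'} \<in> ?D'" unfolding stacked_diagram_def by blast
  have "rank (free_top D1) i = through_perm k (D1, ms1) (rank (free_bot D1) y)"
    using through_perm(2)[of r s "(D1, ms1)" k i y] D1 k(1) e(1) by simp
  moreover have "rank (free_top D2) z = through_perm k (D2, ms2) (rank (free_bot D2) j)"
    using through_perm(2)[of s t "(D2, ms2)" k z j] D2 k(2) e(2) by simp
  moreover have "rank (free_top ?D') x' = through_perm k (?D', ms') (rank (free_bot ?D') w')"
    using through_perm(2)[of r' t' "(?D', ms')" k x' w'] D' k' e' by simp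
  ultimately show "rank (free_top (fst (?D, ms))) i =
    (through_perm k (D1, ms1) \<circ> through_perm k (?D', ms') \<circ> through_perm k (D2, ms2)) (rank (free_bot (fst (?D, ms))) j)"
    using id1[OF e(3)] id2[OF e(4)] f by simp
qed

section \<open>The quotient of ideals and the inflation\<close>

lemma group_algebra_simps [simp]:
  "carrier (group_algebra G) = free_space (carrier G)" "vzero (group_algebra G) = 0" "vadd (group_algebra G) = (+)"
  "vscale (group_algebra G) = fun_scale" "vmult (group_algebra G) = bilin (\<lambda>g h. basis_vec (g \<otimes>\<^bsub>G\<^esub> h))"
  by (simp_all add: group_algebra_def)

lemma inflation_simps [simp]:
  "carrier (inflation E S B form) = free_space (E \<times> E \<times> S)" "vzero (inflation E S B form) = 0"
  "vadd (inflation E S B form) = (+)" "vscale (inflation E S B form) = fun_scale"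
  by (simp_all add: inflation_def)

lemma bilin_zero: "bilin h 0 y = 0" "bilin h x 0 = 0"
  by (simp_all add: bilin_def fun_eq_iff)

text \<open>The product on Brauer diagrams for which the linear extension of
  \<open>signed_diagram\<close> is multiplicative.\<close>

definition diagram_mult :: "'k::field \<Rightarrow> 'k \<Rightarrow> vertex set set \<Rightarrow> vertex set set \<Rightarrow> vertex set set \<Rightarrow> 'k" where
  "diagram_mult \<delta> \<epsilon> D1 D2 = fun_scale (comp_coeff \<delta> \<epsilon> D1 D2) (basis_vec (stacked_diagram (stack D1 D2)))"

text \<open>The bound is an integer, so that \<open>int t - 2\<close> may be negative and the set is
  then empty.\<close>

definition diagrams_le :: "nat \<Rightarrow> int \<Rightarrow> vertex set set set" where
  "diagrams_le r k = {D. brauer_diagram r r D \<and> int (card (through_strings D)) \<le> k}"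

text \<open>Diagrams with another number of through strings are sent to 0. The empty list of
  markings is a placeholder: graphs and permutation depend on the Brauer diagram only.\<close>

definition triple_vec :: "nat \<Rightarrow> vertex set set \<Rightarrow> nat set set \<times> nat set set \<times> (nat \<Rightarrow> nat) \<Rightarrow> 'k::field" where
  "triple_vec t D = (if card (through_strings D) = t
     then basis_vec (top_graph (D, []), bottom_graph (D, []), through_perm t (D, [])) else 0)"

text \<open>The product is evaluated on representatives with bottom graph \<open>f\<close> and top
  graph \<open>e\<close>. Their other halves repeat the same graphs and their permutations are the
  identity, so the permutation of the composite is the contribution of the middle part
  alone.\<close>

definition middle_form :: "nat \<Rightarrow> nat \<Rightarrow> 'k::field \<Rightarrow> 'k \<Rightarrow> nat set set \<Rightarrow> nat set set \<Rightarrow> (nat \<Rightarrow> nat) \<Rightarrow> 'k" where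
  "middle_form r t \<delta> \<epsilon> f e = (let D1 = diagram_of r f f id; D2 = diagram_of r e e id; D = stacked_diagram (stack D1 D2) in
     if card (through_strings D) = t then fun_scale (comp_coeff \<delta> \<epsilon> D1 D2) (basis_vec (through_perm t (D, []))) else 0)"

locale ideal_setup =
  fixes r t u :: nat and \<delta> \<epsilon> :: "'k::field"
  assumes eps: "\<epsilon> \<in> {1, -1}" and del: "\<epsilon> = -1 \<Longrightarrow> \<delta> = 0" and tr: "t + 2 * u = r"
begin

abbreviation "E \<equiv> partial_matchings r t"
abbreviation "S \<equiv> carrier (sym_group t)"
abbreviation "GA \<equiv> group_algebra (sym_group t) :: ('k, (nat \<Rightarrow> nat) \<Rightarrow> 'k) nualg"
abbreviation "A0 \<equiv> free_algebra (marked_diagrams r r) (compose_diagrams r r \<delta> \<epsilon>)"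
abbreviation "C0 \<equiv> free_algebra {D. brauer_diagram r r D} (diagram_mult \<delta> \<epsilon>)"

section \<open>The marked Brauer algebra as a span of Brauer diagrams\<close>

abbreviation "\<Theta> \<equiv> lin (signed_diagram \<epsilon>) :: (mdiagram \<Rightarrow> 'k) \<Rightarrow> _"

lemma compose_in:
  assumes "M1 \<in> marked_diagrams r r" "M2 \<in> marked_diagrams r r"
  shows "compose_diagrams r r \<delta> \<epsilon> M1 M2 \<in> free_space (marked_diagrams r r)"
    "\<Theta> (compose_diagrams r r \<delta> \<epsilon> M1 M2) = bilin (diagram_mult \<delta> \<epsilon>) (signed_diagram \<epsilon> M1) (signed_diagram \<epsilon> M2)"
proof -
  obtain D1 ms1 D2 ms2 where M: "M1 = (D1, ms1)" "M2 = (D2, ms2)" by (cases M1; cases M2)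
  then have m: "marked_diagram r r (D1, ms1)" "marked_diagram r r (D2, ms2)" using assms by auto
  interpret stacked r r r D1 D2
    by unfold_locales (use m in \<open>auto dest: marked_diagramD(1)\<close>)
  show "compose_diagrams r r \<delta> \<epsilon> M1 M2 \<in> free_space (marked_diagrams r r)"
    unfolding M by (rule free_space_mono[OF _ signed_composite(2)[OF m eps]]) auto
  show "\<Theta> (compose_diagrams r r \<delta> \<epsilon> M1 M2) = bilin (diagram_mult \<delta> \<epsilon>) (signed_diagram \<epsilon> M1) (signed_diagram \<epsilon> M2)"
    using signed_composite_std[OF m eps del] unfolding M
    by (simp only:) (simp add: diagram_mult_def signed_diagram_def bilin_scale_left bilin_scale_right bilin_basis_vec fun_scale_scale mult_ac)
qed

lemma signed_diagram_in: "M \<in> marked_diagrams r r \<Longrightarrow> signed_diagram \<epsilon> M \<in> free_space {D. brauer_diagram r r D}"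
  unfolding signed_diagram_def by (cases M) (auto intro!: free_space_scale basis_vec_in_free_space dest: marked_diagramD(1))

text \<open>The first quotient: the relation space is the kernel of \<open>\<Theta>\<close>. The
  target \<open>C0\<close> is only a table of products, no associativity is claimed for it.\<close>

sublocale L1: quotient_by_kernel A0 "relation_space r r \<epsilon>" \<Theta> C0
proof
  show "vadd A0 x y \<in> carrier A0 \<and> \<Theta> (vadd A0 x y) = vadd C0 (\<Theta> x) (\<Theta> y)"
    if "x \<in> carrier A0" "y \<in> carrier A0" for x y
    using that by (simp add: free_space_add lin_add)
  show "vscale A0 c x \<in> carrier A0 \<and> \<Theta> (vscale A0 c x) = vscale C0 c (\<Theta> x)" if "x \<in> carrier A0" for c x
    using that by (simp add: free_space_scale lin_scale)
  show "vmult A0 x y \<in> carrier A0 \<and> \<Theta> (vmult A0 x y) = vmult C0 (\<Theta> x) (\<Theta> y)"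
    if "x \<in> carrier A0" "y \<in> carrier A0" for x y
  proof -
    have xy: "x \<in> free_space (marked_diagrams r r)" "y \<in> free_space (marked_diagrams r r)" using that by simp_all
    have "bilin (compose_diagrams r r \<delta> \<epsilon>) x y \<in> free_space (marked_diagrams r r)"
      by (rule bilin_in_free_space[OF xy compose_in(1)])
    moreover have "\<Theta> (bilin (compose_diagrams r r \<delta> \<epsilon>) x y) = bilin (\<lambda>M N. \<Theta> (compose_diagrams r r \<delta> \<epsilon> M N)) x y"
      by (rule lin_bilin[OF xy compose_in(1)])
    moreover have "\<dots> = bilin (\<lambda>M N. bilin (diagram_mult \<delta> \<epsilon>) (signed_diagram \<epsilon> M) (signed_diagram \<epsilon> N)) x y"
      by (rule bilin_cong[OF xy compose_in(2)])
    moreover have "\<dots> = bilin (diagram_mult \<delta> \<epsilon>) (\<Theta> x) (\<Theta> y)"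
      by (rule bilin_lin_lin[OF xy signed_diagram_in signed_diagram_in, symmetric])
    ultimately show ?thesis by simp
  qed
  show "vcoset A0 (relation_space r r \<epsilon>) x = {y \<in> carrier A0. \<Theta> y = \<Theta> x}" if "x \<in> carrier A0" for x
  proof -
    have x: "x \<in> free_space (marked_diagrams r r)" using that by simp
    show ?thesis
    proof (intro equalityI subsetI)
      fix y assume "y \<in> vcoset A0 (relation_space r r \<epsilon>) x"
      then obtain z where z: "z \<in> relation_space r r \<epsilon>" "y = x + z" by (auto simp: vcoset_def)
      have "z \<in> free_space (marked_diagrams r r)" "\<Theta> z = 0"
        using z(1) relation_space_subset signed_diagram_relation[OF eps] by blast+
      then show "y \<in> {y \<in> carrier A0. \<Theta> y = \<Theta> x}" using x z(2) by (simp add: free_space_add lin_add)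
    next
      fix y assume "y \<in> {y \<in> carrier A0. \<Theta> y = \<Theta> x}"
      then have y: "y \<in> free_space (marked_diagrams r r)" "\<Theta> y = \<Theta> x" by simp_all
      then have "\<Theta> (y - x) = 0" using x by (subst lin_diff) auto
      then have "y - x \<in> relation_space r r \<epsilon>"
        using relation_space_kernel[OF eps free_space_diff[OF y(1) x]] by simp
      moreover have "y = x + (y - x)" by simp
      ultimately show "y \<in> vcoset A0 (relation_space r r \<epsilon>) x" unfolding vcoset_def by (simp only: free_algebra_simps) blast
    qed
  qed
  show "relation_space r r \<epsilon> = {y \<in> carrier A0. \<Theta> y = vzero C0}"
  proof (intro equalityI subsetI)
    fix y assume y: "y \<in> relation_space r r \<epsilon>"
    then have "y \<in> free_space (marked_diagrams r r)" by (rule subsetD[OF relation_space_subset])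
    then show "y \<in> {y \<in> carrier A0. \<Theta> y = vzero C0}" using signed_diagram_relation[OF eps y] by simp
  next
    fix y assume "y \<in> {y \<in> carrier A0. \<Theta> y = vzero C0}"
    then show "y \<in> relation_space r r \<epsilon>" using relation_space_kernel[OF eps, of y r r] by simp
  qed
qed

lemma marked_brauer_algebra_eq: "marked_brauer_algebra r \<delta> \<epsilon> = quotient_algebra A0 (relation_space r r \<epsilon>)"
  by (simp add: marked_brauer_algebra_def)

abbreviation "BA \<equiv> marked_brauer_algebra r \<delta> \<epsilon>"

lemma \<Theta>_std: "brauer_diagram r r D \<Longrightarrow> \<Theta> (basis_vec (D, std_marks D)) = basis_vec D"
  using marks_sign_standard[OF standard_std_marks, of r r D \<epsilon>] by (simp add: signed_diagram_def)

text \<open>Standard markings give preimages. The predicate \<open>P\<close> makes the statement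
  cover the whole algebra and all of the ideals at once.\<close>

lemma \<Theta>_image:
  "\<Theta> ` free_space {(D, ms). marked_diagram r r (D, ms) \<and> P D} = free_space {D. brauer_diagram r r D \<and> P D}"
proof (intro equalityI subsetI)
  fix c assume "c \<in> \<Theta> ` free_space {(D, ms). marked_diagram r r (D, ms) \<and> P D}"
  then obtain x where x: "x \<in> free_space {(D, ms). marked_diagram r r (D, ms) \<and> P D}" "c = \<Theta> x" by blast
  show "c \<in> free_space {D. brauer_diagram r r D \<and> P D}"
    unfolding x(2) by (rule lin_in_free_space[OF x(1)])
      (auto simp: signed_diagram_def intro!: free_space_scale basis_vec_in_free_space dest: marked_diagramD(1))
next
  fix c :: "_ \<Rightarrow> 'k" assume c: "c \<in> free_space {D. brauer_diagram r r D \<and> P D}"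
  let ?x = "lin (\<lambda>D. basis_vec (D, std_marks D)) c"
  have std: "basis_vec (D, std_marks D) \<in> free_space {(D, ms). marked_diagram r r (D, ms) \<and> P D}"
    if "D \<in> {D. brauer_diagram r r D \<and> P D}" for D
    using that standard_std_marks by (intro basis_vec_in_free_space) (auto simp: standard_def)
  have "\<Theta> ?x = lin (\<lambda>D. \<Theta> (basis_vec (D, std_marks D))) c" by (rule lin_lin[OF c]) (rule std)
  also have "\<dots> = lin basis_vec c" by (rule lin_cong[OF c]) (use \<Theta>_std in blast)
  also have "\<dots> = c" by (rule lin_id[OF c])
  finally have eq: "c = \<Theta> ?x" by (rule sym)
  have "?x \<in> free_space {(D, ms). marked_diagram r r (D, ms) \<and> P D}"
    by (rule lin_in_free_space[OF c], rule std)
  with eq show "c \<in> \<Theta> ` free_space {(D, ms). marked_diagram r r (D, ms) \<and> P D}"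
    by (rule image_eqI)
qed

lemma \<Theta>_carrier: "\<Theta> ` carrier A0 = free_space {D. brauer_diagram r r D}"
  using \<Theta>_image[of "\<lambda>_. True"] by simp

lemma brauer_class_fib: "x \<in> free_space (marked_diagrams r r) \<Longrightarrow> brauer_class r \<epsilon> x = L1.fib (\<Theta> x)"
  using L1.vcoset_fib[of x] by (simp add: vcoset_def brauer_class_def)

lemma brauer_ideal_fib: "brauer_ideal r \<epsilon> k = L1.fib ` free_space (diagrams_le r k)"
proof -
  let ?X = "free_space {(D, ms). marked_diagram r r (D, ms) \<and> int (card (through_strings D)) \<le> k}"
  have "brauer_class r \<epsilon> ` ?X = (\<lambda>x. L1.fib (\<Theta> x)) ` ?X"
    by (rule image_cong[OF refl], rule brauer_class_fib, erule free_space_mono[rotated]) auto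
  then show ?thesis
    unfolding brauer_ideal_def diagrams_le_def \<Theta>_image[symmetric] by (simp add: image_image)
qed

lemma diagrams_le_subset: "free_space (diagrams_le r k) \<subseteq> free_space {D. brauer_diagram r r D}"
  unfolding diagrams_le_def by (rule subsetI, erule free_space_mono[rotated]) blast

lemma fib_inj: "c \<in> free_space {D. brauer_diagram r r D} \<Longrightarrow> d \<in> free_space {D. brauer_diagram r r D} \<Longrightarrow>
    L1.fib c = L1.fib d \<longleftrightarrow> c = d"
  using L1.bij_fib unfolding \<Theta>_carrier by (auto simp: bij_betw_def dest: inj_onD)

lemma BA_ops:
  assumes "c \<in> free_space {D. brauer_diagram r r D}" "d \<in> free_space {D. brauer_diagram r r D}"
  shows "vadd BA (L1.fib c) (L1.fib d) = L1.fib (c + d)" "vscale BA a (L1.fib c) = L1.fib (fun_scale a c)"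
    "vmult BA (L1.fib c) (L1.fib d) = L1.fib (bilin (diagram_mult \<delta> \<epsilon>) c d)"
  using L1.add_fib[of c d] L1.scale_fib[of c a] L1.mult_fib[of c d] assms
  unfolding \<Theta>_carrier marked_brauer_algebra_eq by simp_all

text \<open>Recovers the combination of Brauer diagrams from a class, so that \<open>T2\<close>,
  which is defined on combinations, can be applied to elements of the ideal.\<close>

definition val :: "(mdiagram \<Rightarrow> 'k) set \<Rightarrow> vertex set set \<Rightarrow> 'k" where
  "val X = the_inv_into (free_space {D. brauer_diagram r r D}) L1.fib X"

lemma val_fib: "c \<in> free_space {D. brauer_diagram r r D} \<Longrightarrow> val (L1.fib c) = c"
  unfolding val_def using L1.bij_fib unfolding \<Theta>_carrier by (intro the_inv_into_f_f) (auto simp: bij_betw_def)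

section \<open>The ideal modulo the smaller ideal\<close>

abbreviation "A1 \<equiv> BA\<lparr>carrier := brauer_ideal r \<epsilon> (int t)\<rparr>"
abbreviation "T2 \<equiv> lin (triple_vec t) :: (vertex set set \<Rightarrow> 'k) \<Rightarrow> _"
abbreviation "\<omega> \<equiv> middle_form r t \<delta> \<epsilon>"
abbreviation "C1 \<equiv> inflation E S GA (bilin \<omega>)"

lemma d_diagram:
  assumes "e \<in> E"
  shows "brauer_diagram r r (diagram_of r e e id)" "card (through_strings (diagram_of r e e id)) = t"
    "top_graph (diagram_of r e e id, ms) = e" "bottom_graph (diagram_of r e e id, ms) = e"
    "through_perm t (diagram_of r e e id, ms) = id"
  using diagram_of[OF assms assms permutes_id tr] by simp_all

lemma middle_form_in:
  assumes "f \<in> E" "e \<in> E"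
  shows "\<omega> f e \<in> free_space S"
proof -
  interpret stacked r r r "diagram_of r f f id" "diagram_of r e e id"
    by unfold_locales (use d_diagram assms in auto)
  show ?thesis
    unfolding middle_form_def Let_def
    using through_perm(1)[of r r "(stacked_diagram G, [])" t] brauer_stacked_diagram
    by (auto simp: sym_group_carrier free_space_zero intro!: free_space_scale basis_vec_in_free_space)
qed

lemma triple_vec_in:
  assumes "brauer_diagram r r D"
  shows "triple_vec t D \<in> free_space (E \<times> E \<times> S)"
  using assms graphs_partial_matchings[of r "(D, [])" t] through_perm(1)[of r r "(D, [])" t]
  by (auto simp: triple_vec_def sym_group_carrier free_space_zero intro!: basis_vec_in_free_space)

lemma nonunital_GA: "nonunital_algebra GA"
  by (rule nonunital_group_algebra[OF sym_group_is_group])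

lemma C1_basis_mult:
  assumes "p1 \<in> S" "p2 \<in> S" "f1 \<in> E" "e2 \<in> E"
  shows "vmult C1 (basis_vec (e1, f1, p1)) (basis_vec (e2, f2, p2)) =
    tensor (basis_vec e1) (basis_vec f2) (vmult GA (vmult GA (basis_vec p1) (\<omega> f1 e2)) (basis_vec p2))"
  by (simp add: inflation_def bilin_basis_vec)

text \<open>If a factor has fewer than \<open>t\<close> through strings, so has the composite, and
  both sides vanish. Otherwise the composite loses through strings exactly when the composite of the
  representatives in \<open>middle_form\<close> does, and if none are lost, coefficient and
  permutation agree with theirs up to the permutations of the factors.\<close>

lemma triple_vec_mult:
  assumes D1: "D1 \<in> diagrams_le r (int t)" and D2: "D2 \<in> diagrams_le r (int t)"
  shows "T2 (diagram_mult \<delta> \<epsilon> D1 D2) = vmult C1 (triple_vec t D1) (triple_vec t D2)"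
proof -
  have d: "brauer_diagram r r D1" "brauer_diagram r r D2" using D1 D2 by (auto simp: diagrams_le_def)
  have le: "card (through_strings D1) \<le> t" "card (through_strings D2) \<le> t" using D1 D2 by (auto simp: diagrams_le_def)
  interpret stacked r r r D1 D2 by unfold_locales (use d in auto)
  let ?D = "stacked_diagram G"
  have L: "T2 (diagram_mult \<delta> \<epsilon> D1 D2) = fun_scale (comp_coeff \<delta> \<epsilon> D1 D2) (triple_vec t ?D)"
    by (simp add: diagram_mult_def lin_scale)
  have vm: "vmult C1 = bilin (\<lambda>(x1, y1, b1) (x2, y2, b2).
        tensor (basis_vec x1) (basis_vec y2)
          (vmult GA (vmult GA (basis_vec b1) (bilin \<omega> (basis_vec y1) (basis_vec x2))) (basis_vec b2)))"
    by (simp add: inflation_def)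
  show ?thesis
  proof (cases "card (through_strings D1) = t \<and> card (through_strings D2) = t")
    case False
    then have "triple_vec t D1 = (0 :: _ \<Rightarrow> 'k) \<or> triple_vec t D2 = (0 :: _ \<Rightarrow> 'k)" by (auto simp: triple_vec_def)
    moreover have "card (through_strings ?D) \<noteq> t" using through_le le False by linarith
    ultimately show ?thesis unfolding L vm by (auto simp: triple_vec_def bilin_zero)
  next
    case True
    define e1 f1 p1 e2 f2 p2 where "e1 = top_graph (D1, [])" and "f1 = bottom_graph (D1, [])" and p1_def: "p1 = through_perm t (D1, [])"
      and "e2 = top_graph (D2, [])" and "f2 = bottom_graph (D2, [])" and p2_def: "p2 = through_perm t (D2, [])"
    note defs = this
    have mem: "f1 \<in> E" "e2 \<in> E" "p1 \<in> S" "p2 \<in> S"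
      using graphs_partial_matchings[of r "(D1, [])" t] graphs_partial_matchings[of r "(D2, [])" t]
        through_perm(1)[of r r "(D1, [])" t] through_perm(1)[of r r "(D2, [])" t] d True
      by (simp_all add: defs sym_group_carrier)
    let ?F1 = "diagram_of r f1 f1 id" and ?F2 = "diagram_of r e2 e2 id"
    note F1 = d_diagram[OF mem(1)] and F2 = d_diagram[OF mem(2)]
    \<comment> \<open>Only the bottom graph of the first and the top graph of the second diagram
      matter for the middle row, and the representatives share these.\<close>
    interpret P: stacked_pair r r r D1 D2 r r ?F1 ?F2
    proof unfold_locales
      show "caps ?F1 = caps D1"
        using caps_bottom_graph[OF F1(1), of "[]"] caps_bottom_graph[OF d(1), of "[]"] F1(4) by (simp add: f1_def)
      show "cups ?F2 = cups D2"
        using cups_top_graph[OF F2(1), of "[]"] cups_top_graph[OF d(2), of "[]"] F2(3) by (simp add: e2_def)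
    qed (use F1 F2 in auto)
    let ?D' = "stacked_diagram P.B.G"
    have R: "vmult C1 (triple_vec t D1) (triple_vec t D2) =
      tensor (basis_vec e1) (basis_vec f2) (vmult GA (vmult GA (basis_vec p1) (\<omega> f1 e2)) (basis_vec p2))"
      using True C1_basis_mult[OF mem(3,4,1,2)] by (simp add: triple_vec_def defs)
    have tc: "card (through_strings ?D) = card (through_strings ?D')" by (rule P.through_count)
    show ?thesis
    proof (cases "card (through_strings ?D) = t")
      case False
      then have "\<omega> f1 e2 = 0" using tc by (simp add: middle_form_def Let_def)
      then show ?thesis unfolding L R using False by (simp add: triple_vec_def bilin_zero)
    next
      case t: True
      have full: full_rank P.B.full_rank
        using full_rankI P.B.full_rankI True t tc F1(2) F2(2) by simp_all
      have coeff: "comp_coeff \<delta> \<epsilon> D1 D2 = comp_coeff \<delta> \<epsilon> ?F1 ?F2" by (rule P.comp_coeff_middle[OF full])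
      have id1: "rank (free_top ?F1) i = rank (free_bot ?F1) j" if "{Top i, Bot j} \<in> ?F1" for i j
        using through_perm(2)[of r r "(?F1, [])" t i j] F1(1,2) F1(5)[of "[]"] that by simp
      have id2: "rank (free_top ?F2) i = rank (free_bot ?F2) j" if "{Top i, Bot j} \<in> ?F2" for i j
        using through_perm(2)[of r r "(?F2, [])" t i j] F2(1,2) F2(5)[of "[]"] that by simp
      have perm: "through_perm t (?D, []) = p1 \<circ> through_perm t (?D', []) \<circ> p2"
        unfolding p1_def p2_def by (rule P.through_perm_stacked[OF full _ _ t id1 id2]) (use True in simp_all)
      have "top_graph (?D, []) = e1" "bottom_graph (?D, []) = f2"
        using full(1) unfolding full_rank_def by (simp_all add: top_graph_def bottom_graph_def defs)
      then have "triple_vec t ?D = (basis_vec (e1, f2, p1 \<circ> through_perm t (?D', []) \<circ> p2) :: _ \<Rightarrow> 'k)"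
        using t perm by (simp add: triple_vec_def)
      moreover have "\<omega> f1 e2 = fun_scale (comp_coeff \<delta> \<epsilon> D1 D2) (basis_vec (through_perm t (?D', [])))"
        using t tc coeff by (simp add: middle_form_def Let_def)
      then have "vmult GA (vmult GA (basis_vec p1) (\<omega> f1 e2)) (basis_vec p2) =
          fun_scale (comp_coeff \<delta> \<epsilon> D1 D2) (basis_vec (p1 \<circ> through_perm t (?D', []) \<circ> p2))"
        by (simp add: bilin_scale_left bilin_scale_right bilin_basis_vec sym_group_mult)
      ultimately show ?thesis unfolding L R by (simp add: tensor_scale tensor_basis_vec)
    qed
  qed
qed

lemma diagram_mult_in:
  assumes "D1 \<in> diagrams_le r k" "D2 \<in> diagrams_le r k"
  shows "diagram_mult \<delta> \<epsilon> D1 D2 \<in> free_space (diagrams_le r k)"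
proof -
  interpret stacked r r r D1 D2 by unfold_locales (use assms in \<open>auto simp: diagrams_le_def\<close>)
  have "stacked_diagram G \<in> diagrams_le r k"
    using brauer_stacked_diagram through_le(1) assms(1) by (auto simp: diagrams_le_def)
  then show ?thesis unfolding diagram_mult_def by (intro free_space_scale basis_vec_in_free_space)
qed

lemma T2_in: "c \<in> free_space {D. brauer_diagram r r D} \<Longrightarrow> T2 c \<in> free_space (E \<times> E \<times> S)"
  by (erule lin_in_free_space) (simp add: triple_vec_in)

lemma T2_mult:
  assumes "c \<in> free_space (diagrams_le r (int t))" "d \<in> free_space (diagrams_le r (int t))"
  shows "bilin (diagram_mult \<delta> \<epsilon>) c d \<in> free_space (diagrams_le r (int t))"
    "T2 (bilin (diagram_mult \<delta> \<epsilon>) c d) = vmult C1 (T2 c) (T2 d)"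
proof -
  show "bilin (diagram_mult \<delta> \<epsilon>) c d \<in> free_space (diagrams_le r (int t))"
    by (rule bilin_in_free_space[OF assms diagram_mult_in])
  have tv: "triple_vec t D \<in> free_space (E \<times> E \<times> S)" if "D \<in> diagrams_le r (int t)" for D
    using that triple_vec_in by (auto simp: diagrams_le_def)
  have "T2 (bilin (diagram_mult \<delta> \<epsilon>) c d) = bilin (\<lambda>D1 D2. T2 (diagram_mult \<delta> \<epsilon> D1 D2)) c d"
    by (rule lin_bilin[OF assms diagram_mult_in])
  also have "\<dots> = bilin (\<lambda>D1 D2. vmult C1 (triple_vec t D1) (triple_vec t D2)) c d"
    by (rule bilin_cong[OF assms triple_vec_mult])
  also have "\<dots> = vmult C1 (T2 c) (T2 d)"
    unfolding inflation_def free_algebra_simps by (rule bilin_lin_lin[OF assms tv tv, symmetric])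
  finally show "T2 (bilin (diagram_mult \<delta> \<epsilon>) c d) = vmult C1 (T2 c) (T2 d)" .
qed

text \<open>\<open>diagram_of\<close> reconstructs the part of \<open>c\<close> with exactly
  \<open>t\<close> through strings from \<open>T2 c\<close>, so a vanishing image leaves only
  diagrams with fewer.\<close>

lemma T2_kernel:
  assumes c: "c \<in> free_space (diagrams_le r (int t))"
  shows "T2 c = 0 \<longleftrightarrow> c \<in> free_space (diagrams_le r (int t - 2))"
proof
  assume z: "T2 c = 0"
  let ?inv = "\<lambda>(e, f, p). basis_vec (diagram_of r e f p) :: vertex set set \<Rightarrow> 'k"
  \<comment> \<open>The projection onto diagrams with exactly \<open>t\<close> through
    strings.\<close>
  let ?res = "\<lambda>D. if card (through_strings D) = t then basis_vec D else (0 :: vertex set set \<Rightarrow> 'k)"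
  have tv: "triple_vec t D \<in> free_space (E \<times> E \<times> S)" if "D \<in> diagrams_le r (int t)" for D
    using that triple_vec_in by (auto simp: diagrams_le_def)
  have "lin ?inv (T2 c) = lin (\<lambda>D. lin ?inv (triple_vec t D)) c" by (rule lin_lin[OF c tv])
  also have "\<dots> = lin ?res c"
  proof (rule lin_cong[OF c])
    fix D assume "D \<in> diagrams_le r (int t)"
    then have D: "brauer_diagram r r D" by (simp add: diagrams_le_def)
    show "lin ?inv (triple_vec t D) = ?res D"
      using diagram_of_eq[of r "(D, [])" t] D by (simp add: triple_vec_def)
  qed
  finally have res: "lin ?res c = 0" using z by simp
  have "c D = 0" if "card (through_strings D) = t" for D
  proof (rule ccontr)
    assume "c D \<noteq> 0"
    have fin: "finite {D. c D \<noteq> 0}" using c by (simp add: free_space_iff)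
    have "lin ?res c D = (\<Sum>D' | c D' \<noteq> 0. if D' = D then c D' else 0)"
      unfolding lin_def sum_fun_apply by (rule sum.cong) (auto simp: fun_scale_def basis_vec_def that)
    also have "\<dots> = c D" using fin \<open>c D \<noteq> 0\<close> by simp
    finally show False using res \<open>c D \<noteq> 0\<close> by simp
  qed
  \<comment> \<open>The number of through strings has the parity of \<open>r\<close>, so fewer than
    \<open>t\<close> means at most \<open>t - 2\<close>.\<close>
  moreover have "int (card (through_strings D)) \<le> int t - 2" if "D \<in> diagrams_le r (int t)" "card (through_strings D) \<noteq> t" for D
  proof -
    have D: "brauer_diagram r r D" "card (through_strings D) \<le> t" using that(1) by (auto simp: diagrams_le_def)
    have "t + 2 * u = card (through_strings D) + 2 * card (cups D)" using brauer_diagram_card(1)[OF D(1)] tr by simp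
    then show ?thesis using D(2) that(2) by presburger
  qed
  ultimately show "c \<in> free_space (diagrams_le r (int t - 2))"
    using c unfolding free_space_iff by (auto simp: diagrams_le_def)
next
  assume "c \<in> free_space (diagrams_le r (int t - 2))"
  then have "T2 c = lin (\<lambda>_. 0) c" by (rule lin_cong) (auto simp: diagrams_le_def triple_vec_def)
  then show "T2 c = 0" by (simp add: lin_def)
qed

lemma diagrams_le_mono: "free_space (diagrams_le r (int t - 2)) \<subseteq> free_space (diagrams_le r (int t))"
  unfolding diagrams_le_def by (rule subsetI, erule free_space_mono[rotated]) auto

lemma ideal_cases:
  assumes "X \<in> brauer_ideal r \<epsilon> k"
  obtains c where "c \<in> free_space (diagrams_le r k)" "c \<in> free_space {D. brauer_diagram r r D}" "X = L1.fib c"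
  using assms diagrams_le_subset unfolding brauer_ideal_fib by blast

lemma fib_in_ideal:
  assumes c: "c \<in> free_space {D. brauer_diagram r r D}"
  shows "L1.fib c \<in> brauer_ideal r \<epsilon> k \<longleftrightarrow> c \<in> free_space (diagrams_le r k)"
proof
  assume "L1.fib c \<in> brauer_ideal r \<epsilon> k"
  then obtain d where "d \<in> free_space (diagrams_le r k)" "d \<in> free_space {D. brauer_diagram r r D}" "L1.fib c = L1.fib d"
    by (rule ideal_cases)
  then show "c \<in> free_space (diagrams_le r k)" using fib_inj[OF c, of d] by simp
next
  assume "c \<in> free_space (diagrams_le r k)"
  then show "L1.fib c \<in> brauer_ideal r \<epsilon> k" unfolding brauer_ideal_fib by (rule imageI)
qed

lemma A1_simps: "carrier A1 = brauer_ideal r \<epsilon> (int t)" "vadd A1 = vadd BA" "vscale A1 = vscale BA" "vmult A1 = vmult BA"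
  by simp_all

text \<open>The second quotient: \<open>T2\<close> extracts the part with exactly \<open>t\<close>
  through strings, its kernel in the larger ideal is the smaller one, and it is multiplicative into
  the inflation for \<open>middle_form\<close>.\<close>

sublocale L2: quotient_by_kernel A1 "brauer_ideal r \<epsilon> (int t - 2)" "\<lambda>X. T2 (val X)" C1
proof
  let ?T = "\<lambda>X. T2 (val X)" and ?F = "free_space {D. brauer_diagram r r D} :: (vertex set set \<Rightarrow> 'k) set"
  fix X assume "X \<in> carrier A1"
  then obtain c where c: "c \<in> free_space (diagrams_le r (int t))" "c \<in> ?F" "X = L1.fib c"
    unfolding A1_simps by (rule ideal_cases)
  show "vscale A1 a X \<in> carrier A1 \<and> ?T (vscale A1 a X) = vscale C1 a (?T X)" for a
    unfolding A1_simps c(3) BA_ops(2)[OF c(2,2)] fib_in_ideal[OF free_space_scale[OF c(2)]]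
      val_fib[OF c(2)] val_fib[OF free_space_scale[OF c(2)]] lin_scale inflation_simps
    using free_space_scale[OF c(1)] by simp
  {
    fix Y assume "Y \<in> carrier A1"
    then obtain d where d: "d \<in> free_space (diagrams_le r (int t))" "d \<in> ?F" "Y = L1.fib d"
      unfolding A1_simps by (rule ideal_cases)
    show "vadd A1 X Y \<in> carrier A1 \<and> ?T (vadd A1 X Y) = vadd C1 (?T X) (?T Y)"
      unfolding A1_simps c(3) d(3) BA_ops(1)[OF c(2) d(2)] fib_in_ideal[OF free_space_add[OF c(2) d(2)]]
        val_fib[OF c(2)] val_fib[OF d(2)] val_fib[OF free_space_add[OF c(2) d(2)]] lin_add[OF c(2) d(2)] inflation_simps
      using free_space_add[OF c(1) d(1)] by simp
    have cd: "bilin (diagram_mult \<delta> \<epsilon>) c d \<in> ?F" using T2_mult(1)[OF c(1) d(1)] diagrams_le_subset by blast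
    show "vmult A1 X Y \<in> carrier A1 \<and> ?T (vmult A1 X Y) = vmult C1 (?T X) (?T Y)"
      unfolding A1_simps c(3) d(3) BA_ops(3)[OF c(2) d(2)] fib_in_ideal[OF cd]
        val_fib[OF c(2)] val_fib[OF d(2)] val_fib[OF cd]
      using T2_mult[OF c(1) d(1)] by simp
  }
  show "vcoset A1 (brauer_ideal r \<epsilon> (int t - 2)) X = {Y \<in> carrier A1. ?T Y = ?T X}"
  proof (intro equalityI subsetI)
    fix Y assume "Y \<in> vcoset A1 (brauer_ideal r \<epsilon> (int t - 2)) X"
    then obtain Z where Z: "Z \<in> brauer_ideal r \<epsilon> (int t - 2)" "Y = vadd BA X Z" unfolding vcoset_def A1_simps by blast
    obtain d where d: "d \<in> free_space (diagrams_le r (int t - 2))" "d \<in> ?F" "Z = L1.fib d"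
      using Z(1) by (rule ideal_cases)
    have d': "d \<in> free_space (diagrams_le r (int t))" using d(1) diagrams_le_mono by blast
    have Y: "Y = L1.fib (c + d)" unfolding Z(2) c(3) d(3) BA_ops(1)[OF c(2) d(2)] ..
    have "T2 (c + d) = T2 c" using lin_add[OF c(2) d(2), of "triple_vec t"] T2_kernel[OF d'] d(1) by simp
    then show "Y \<in> {Y \<in> carrier A1. ?T Y = ?T X}"
      unfolding A1_simps Y c(3)
      using fib_in_ideal[OF free_space_add[OF c(2) d(2)]] free_space_add[OF c(1) d'] val_fib[OF c(2)]
        val_fib[OF free_space_add[OF c(2) d(2)]] by simp
  next
    fix Y assume "Y \<in> {Y \<in> carrier A1. ?T Y = ?T X}"
    then have Y: "Y \<in> brauer_ideal r \<epsilon> (int t)" "?T Y = ?T X" unfolding A1_simps by blast+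
    obtain d where d: "d \<in> free_space (diagrams_le r (int t))" "d \<in> ?F" "Y = L1.fib d" using Y(1) by (rule ideal_cases)
    have "T2 (d - c) = 0" using Y(2) unfolding c(3) d(3) val_fib[OF c(2)] val_fib[OF d(2)] lin_diff[OF d(2) c(2)] by simp
    then have dc: "d - c \<in> free_space (diagrams_le r (int t - 2))" using T2_kernel[OF free_space_diff[OF d(1) c(1)]] by simp
    have dcF: "d - c \<in> ?F" by (rule free_space_diff[OF d(2) c(2)])
    have "L1.fib (d - c) \<in> brauer_ideal r \<epsilon> (int t - 2)" using fib_in_ideal[OF dcF] dc by simp
    moreover have "Y = vadd BA X (L1.fib (d - c))" unfolding c(3) d(3) BA_ops(1)[OF c(2) dcF] by simp
    ultimately show "Y \<in> vcoset A1 (brauer_ideal r \<epsilon> (int t - 2)) X" unfolding vcoset_def A1_simps by blast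
  qed
next
  show "brauer_ideal r \<epsilon> (int t - 2) = {Y \<in> carrier A1. T2 (val Y) = vzero C1}"
  proof (intro equalityI subsetI)
    fix Y assume "Y \<in> brauer_ideal r \<epsilon> (int t - 2)"
    then obtain d where d: "d \<in> free_space (diagrams_le r (int t - 2))" "d \<in> free_space {D. brauer_diagram r r D}" "Y = L1.fib d"
      by (rule ideal_cases)
    then have "d \<in> free_space (diagrams_le r (int t))" using diagrams_le_mono by blast
    then show "Y \<in> {Y \<in> carrier A1. T2 (val Y) = vzero C1}"
      unfolding A1_simps d(3) using fib_in_ideal[OF d(2)] val_fib[OF d(2)] T2_kernel d(1) by simp
  next
    fix Y assume "Y \<in> {Y \<in> carrier A1. T2 (val Y) = vzero C1}"
    then have Y: "Y \<in> brauer_ideal r \<epsilon> (int t)" "T2 (val Y) = 0" by simp_all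
    obtain d where d: "d \<in> free_space (diagrams_le r (int t))" "d \<in> free_space {D. brauer_diagram r r D}" "Y = L1.fib d"
      using Y(1) by (rule ideal_cases)
    then show "Y \<in> brauer_ideal r \<epsilon> (int t - 2)" using Y(2) fib_in_ideal[OF d(2)] val_fib[OF d(2)] T2_kernel by simp
  qed
qed

section \<open>Identification of psi, omega and the bilinear form\<close>

abbreviation "Q \<equiv> ideal_quotient r t \<delta> \<epsilon>"

lemma Q_eq: "Q = quotient_algebra A1 (brauer_ideal r \<epsilon> (int t - 2))"
  by (simp add: ideal_quotient_def)

lemma T2_image: "(\<lambda>X. T2 (val X)) ` carrier A1 = free_space (E \<times> E \<times> S)"
proof (intro equalityI subsetI)
  fix z assume "z \<in> (\<lambda>X. T2 (val X)) ` carrier A1"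
  then obtain X where X: "X \<in> brauer_ideal r \<epsilon> (int t)" "z = T2 (val X)" unfolding A1_simps by blast
  obtain c where "c \<in> free_space {D. brauer_diagram r r D}" "X = L1.fib c" using X(1) by (rule ideal_cases)
  then show "z \<in> free_space (E \<times> E \<times> S)" using X(2) val_fib T2_in by simp
next
  fix z :: "_ \<Rightarrow> 'k" assume z: "z \<in> free_space (E \<times> E \<times> S)"
  let ?inv = "\<lambda>(e, f, p). basis_vec (diagram_of r e f p) :: vertex set set \<Rightarrow> 'k"
  have inv: "?inv q \<in> free_space (diagrams_le r (int t)) \<and> T2 (?inv q) = basis_vec q" if "q \<in> E \<times> E \<times> S" for q
  proof -
    obtain e f p where q: "q = (e, f, p)" by (cases q)
    have "e \<in> E" "f \<in> E" "p permutes {1..t}" using that by (auto simp: q sym_group_carrier)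
    note D = diagram_of[OF this tr]
    then show ?thesis by (auto simp: q diagrams_le_def triple_vec_def intro!: basis_vec_in_free_space)
  qed
  let ?c = "lin ?inv z"
  have c: "?c \<in> free_space (diagrams_le r (int t))" by (rule lin_in_free_space[OF z]) (use inv in blast)
  have "T2 ?c = lin (\<lambda>q. T2 (?inv q)) z" by (rule lin_lin[OF z]) (use inv in blast)
  also have "\<dots> = lin basis_vec z" by (rule lin_cong[OF z]) (use inv in blast)
  also have "\<dots> = z" by (rule lin_id[OF z])
  finally have z': "T2 ?c = z" .
  have cF: "?c \<in> free_space {D. brauer_diagram r r D}" by (rule subsetD[OF diagrams_le_subset c])
  show "z \<in> (\<lambda>X. T2 (val X)) ` carrier A1"
  proof (rule image_eqI)
    show "z = T2 (val (L1.fib ?c))" unfolding val_fib[OF cF] z' ..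
    show "L1.fib ?c \<in> carrier A1" unfolding A1_simps fib_in_ideal[OF cF] by (rule c)
  qed
qed

abbreviation "\<Phi> \<equiv> L2.fib"
abbreviation "Z \<equiv> free_space (E \<times> E \<times> S) :: (nat set set \<times> nat set set \<times> (nat \<Rightarrow> nat) \<Rightarrow> 'k) set"

lemma \<Phi>_bij: "bij_betw \<Phi> Z (carrier Q)"
  using L2.bij_fib unfolding T2_image Q_eq .

lemma \<Phi>_ops:
  assumes "x \<in> Z" "y \<in> Z"
  shows "vadd Q (\<Phi> x) (\<Phi> y) = \<Phi> (x + y)" "vscale Q a (\<Phi> x) = \<Phi> (fun_scale a x)"
    "vmult Q (\<Phi> x) (\<Phi> y) = \<Phi> (vmult C1 x y)" "vzero Q = \<Phi> 0"
  using L2.add_fib[of x y] L2.scale_fib[of x a] L2.mult_fib[of x y] L2.zero_fib assms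
  unfolding T2_image Q_eq by simp_all

lemma ideal_quotient_class_standard:
  assumes M: "standard r r M" and t: "card (through_strings (fst M)) = t"
  shows "ideal_quotient_class r t \<delta> \<epsilon> M = \<Phi> (tensor (basis_vec (top_graph M)) (basis_vec (bottom_graph M)) (basis_vec (through_perm t M)))"
proof -
  obtain D ms where Dm: "M = (D, ms)" by (cases M)
  have m: "marked_diagram r r (D, ms)" using M Dm by (simp add: standard_def)
  have D: "brauer_diagram r r D" by (rule marked_diagramD(1)[OF m])
  have bF: "basis_vec D \<in> (free_space {D. brauer_diagram r r D} :: (_ \<Rightarrow> 'k) set)" using D by (intro basis_vec_in_free_space) simp
  have "\<Theta> (basis_vec M) = basis_vec D"
    using marks_sign_standard[OF M, of \<epsilon>] Dm by (simp add: signed_diagram_def)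
  then have cl: "brauer_class r \<epsilon> (basis_vec M) = L1.fib (basis_vec D)"
    using brauer_class_fib[OF basis_vec_in_free_space, of M] m Dm by simp
  have "basis_vec D \<in> (free_space (diagrams_le r (int t)) :: (_ \<Rightarrow> 'k) set)"
    using D t Dm by (intro basis_vec_in_free_space) (simp add: diagrams_le_def)
  then have "L1.fib (basis_vec D) \<in> carrier A1" using fib_in_ideal[OF bF] by simp
  from L2.vcoset_fib[OF this] have "vcoset A1 (brauer_ideal r \<epsilon> (int t - 2)) (L1.fib (basis_vec D)) = \<Phi> (T2 (basis_vec D))"
    unfolding val_fib[OF bF] .
  moreover have "vcoset A1 = vcoset BA" by (simp add: vcoset_def fun_eq_iff)
  moreover have "T2 (basis_vec D) = tensor (basis_vec (top_graph M)) (basis_vec (bottom_graph M)) (basis_vec (through_perm t M))"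
    using t Dm through_perm_fst[of t D "[]" ms] by (simp add: triple_vec_def tensor_basis_vec top_graph_def bottom_graph_def)
  ultimately show ?thesis unfolding ideal_quotient_class_def cl by simp
qed

text \<open>\<open>psi\<close> is a definite description, so its value is available only after
  existence and uniqueness. The inverse of \<open>\<Phi>\<close> has the required properties, and a
  linear map is determined by its values on the classes of standard diagrams.\<close>

lemma psi_\<Phi>:
  shows "x \<in> Z \<Longrightarrow> psi r t \<delta> \<epsilon> (\<Phi> x) = x"
proof -
  have inj: "inj_on \<Phi> Z" and cQ: "carrier Q = \<Phi> ` Z" using \<Phi>_bij by (auto simp: bij_betw_def)
  \<comment> \<open>The restriction makes the inverse \<open>undefined\<close> outside the carrier,
    as \<open>\<rightarrow>\<^sub>E\<close> demands.\<close>
  define g where "g = restrict (the_inv_into Z \<Phi>) (carrier Q)"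
  have g: "g (\<Phi> x) = x" if "x \<in> Z" for x
    using that the_inv_into_f_f[OF inj that] cQ by (simp add: g_def)
  let ?P = "\<lambda>\<psi>. \<psi> \<in> carrier Q \<rightarrow>\<^sub>E Z \<and>
         (\<forall>x\<in>carrier Q. \<forall>y\<in>carrier Q. \<psi> (vadd Q x y) = \<psi> x + \<psi> y) \<and>
         (\<forall>c. \<forall>x\<in>carrier Q. \<psi> (vscale Q c x) = fun_scale c (\<psi> x)) \<and>
         (\<forall>M. standard r r M \<and> card (through_strings (fst M)) = t \<longrightarrow>
            \<psi> (ideal_quotient_class r t \<delta> \<epsilon> M) =
              tensor (basis_vec (top_graph M)) (basis_vec (bottom_graph M)) (basis_vec (through_perm t M)))"
  have tin: "tensor (basis_vec (top_graph M)) (basis_vec (bottom_graph M)) (basis_vec (through_perm t M)) \<in> Z"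
    if M: "standard r r M" "card (through_strings (fst M)) = t" for M
  proof -
    have D: "brauer_diagram r r (fst M)" using M(1) marked_diagramD(1)[of r r "fst M" "snd M"] by (simp add: standard_def)
    show ?thesis unfolding tensor_basis_vec
      using graphs_partial_matchings[OF D M(2)] through_perm(1)[OF D M(2)]
      by (intro basis_vec_in_free_space) (simp add: sym_group_carrier)
  qed
  have "psi r t \<delta> \<epsilon> = g"
    unfolding psi_def Let_def
  proof (rule the_equality)
    show "?P g"
    proof (intro conjI ballI allI impI)
      show "g \<in> carrier Q \<rightarrow>\<^sub>E Z"
        by (rule PiE_I) (use g cQ in \<open>force, simp add: g_def\<close>)
      show "g (vadd Q x y) = g x + g y" if x: "x \<in> carrier Q" and y: "y \<in> carrier Q" for x y
      proof -
        obtain a where "a \<in> Z" "x = \<Phi> a" using x unfolding cQ by (rule imageE)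
        moreover obtain b where "b \<in> Z" "y = \<Phi> b" using y unfolding cQ by (rule imageE)
        ultimately show ?thesis using \<Phi>_ops(1)[of a b] g[OF free_space_add[of a _ b]] g[of a] g[of b] by simp
      qed
      show "g (vscale Q c x) = fun_scale c (g x)" if x: "x \<in> carrier Q" for c x
      proof -
        obtain a where "a \<in> Z" "x = \<Phi> a" using x unfolding cQ by (rule imageE)
        then show ?thesis using \<Phi>_ops(2)[of a a c] g[OF free_space_scale[of a _ c]] g[of a] by simp
      qed
      show "g (ideal_quotient_class r t \<delta> \<epsilon> M) =
              tensor (basis_vec (top_graph M)) (basis_vec (bottom_graph M)) (basis_vec (through_perm t M))"
        if "standard r r M \<and> card (through_strings (fst M)) = t" for M
        using that ideal_quotient_class_standard[of M] g[OF tin[of M]] by simp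
    qed
    fix h assume h: "?P h"
    note h_ext = h[THEN conjunct1] and h_add = h[THEN conjunct2, THEN conjunct1, rule_format]
      and h_scale = h[THEN conjunct2, THEN conjunct2, THEN conjunct1, rule_format]
      and h_std = h[THEN conjunct2, THEN conjunct2, THEN conjunct2, rule_format]
    have \<Phi>_in: "\<Phi> x \<in> carrier Q" if "x \<in> Z" for x unfolding cQ using that by (rule imageI)
    have add: "h (\<Phi> (x + y)) = h (\<Phi> x) + h (\<Phi> y)" if "x \<in> Z" "y \<in> Z" for x y
      using h_add[OF \<Phi>_in[OF that(1)] \<Phi>_in[OF that(2)]] \<Phi>_ops(1)[OF that] by simp
    have scale: "h (\<Phi> (fun_scale c x)) = fun_scale c (h (\<Phi> x))" if "x \<in> Z" for c x
      using h_scale[OF \<Phi>_in[OF that], of c] \<Phi>_ops(2)[OF that that, of c] by simp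
    \<comment> \<open>Every basis triple comes from a standard diagram, namely
      \<open>diagram_of\<close> with its standard markings.\<close>
    have basis: "h (\<Phi> (basis_vec q)) = basis_vec q" if q: "q \<in> E \<times> E \<times> S" for q
    proof -
      obtain e f p where efp: "q = (e, f, p)" by (cases q)
      have "e \<in> E" "f \<in> E" "p permutes {1..t}" using q by (auto simp: efp sym_group_carrier)
      note D = diagram_of[OF this tr]
      let ?M = "(diagram_of r e f p, std_marks (diagram_of r e f p))"
      have M: "standard r r ?M" "card (through_strings (fst ?M)) = t" using D standard_std_marks by simp_all
      have T: "tensor (basis_vec (top_graph ?M)) (basis_vec (bottom_graph ?M)) (basis_vec (through_perm t ?M)) = basis_vec q"
        by (simp add: D efp tensor_basis_vec)
      have "h (ideal_quotient_class r t \<delta> \<epsilon> ?M) =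
          tensor (basis_vec (top_graph ?M)) (basis_vec (bottom_graph ?M)) (basis_vec (through_perm t ?M))"
        by (rule h_std) (intro conjI M)
      then show ?thesis unfolding ideal_quotient_class_standard[OF M] T .
    qed
    show "h = g"
    proof
      fix X
      show "h X = g X"
      proof (cases "X \<in> carrier Q")
        case True
        then obtain x where x: "x \<in> Z" "X = \<Phi> x" unfolding cQ by (elim imageE)
        have "h (\<Phi> x) = lin (\<lambda>q. h (\<Phi> (basis_vec q))) x"
          by (rule lin_unique[OF x(1), of "\<lambda>x. h (\<Phi> x)"]) (use add scale in blast)+
        also have "\<dots> = lin basis_vec x" by (rule lin_cong[OF x(1)]) (rule basis)
        also have "\<dots> = x" by (rule lin_id[OF x(1)])
        finally show ?thesis using g x by simp
      next
        case False
        have "g X = undefined" using False by (simp add: g_def)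
        then show ?thesis using PiE_arb[OF h_ext False] by simp
      qed
    qed
  qed
  then show "x \<in> Z \<Longrightarrow> psi r t \<delta> \<epsilon> (\<Phi> x) = x" using g by simp
qed

lemma psi_inv_\<Phi>: "x \<in> Z \<Longrightarrow> psi_inv r t \<delta> \<epsilon> x = \<Phi> x"
proof -
  assume x: "x \<in> Z"
  have cQ: "carrier Q = \<Phi> ` Z" using \<Phi>_bij by (auto simp: bij_betw_def)
  have "inj_on (psi r t \<delta> \<epsilon>) (carrier Q)" unfolding cQ by (rule inj_onI) (auto simp: psi_\<Phi>)
  then show ?thesis unfolding psi_inv_def
    by (rule the_inv_into_f_eq) (use x cQ psi_\<Phi> in auto)
qed

lemma C1_in: "x \<in> Z \<Longrightarrow> y \<in> Z \<Longrightarrow> vmult C1 x y \<in> Z"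
  using nonunital_algebra.mult_closed[OF nonunital_inflation[OF nonunital_GA, of S E \<omega>], of x y] middle_form_in by simp

text \<open>In the product of the two diagonal elements the identity permutations act trivially, so
  the middle factor is the value of \<open>middle_form\<close>; the tensor with fixed basis vectors
  is injective, which settles the description defining \<open>omega\<close>.\<close>

lemma omega_eq:
  assumes e: "e \<in> E" and f: "f \<in> E"
  shows "omega r t \<delta> \<epsilon> e f = \<omega> e f"
proof -
  have id: "id \<in> S" by (simp add: sym_group_carrier permutes_id)
  have Zg: "basis_vec (g, g, id) \<in> Z" if "g \<in> E" for g using that id by (intro basis_vec_in_free_space) simp
  have one: "vmult GA (vmult GA (basis_vec id) w) (basis_vec id) = w" if "w \<in> free_space S" for w
  proof -
    have "bilin (\<lambda>g h. basis_vec (g \<otimes>\<^bsub>sym_group t\<^esub> h)) (basis_vec id) w = lin basis_vec w"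
      by (simp add: bilin_lin sym_group_mult)
    moreover have "bilin (\<lambda>g h. basis_vec (g \<otimes>\<^bsub>sym_group t\<^esub> h)) w (basis_vec id) = lin basis_vec w"
      by (simp add: bilin_lin sym_group_mult)
    ultimately show ?thesis using lin_id[OF that] by simp
  qed
  have "vmult Q (\<Phi> (basis_vec (e, e, id))) (\<Phi> (basis_vec (f, f, id))) =
      \<Phi> (vmult C1 (basis_vec (e, e, id)) (basis_vec (f, f, id)))"
    by (rule \<Phi>_ops(3)[OF Zg[OF e] Zg[OF f]])
  moreover have "vmult C1 (basis_vec (e, e, id)) (basis_vec (f, f, id)) = tensor (basis_vec e) (basis_vec f) (\<omega> e f)"
    using C1_basis_mult[OF id id e f] one[OF middle_form_in[OF e f]] by simp
  moreover have "psi r t \<delta> \<epsilon> (\<Phi> (tensor (basis_vec e) (basis_vec f) (\<omega> e f))) = tensor (basis_vec e) (basis_vec f) (\<omega> e f)"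
    by (rule psi_\<Phi>, rule tensor_in_free_space) (use e f middle_form_in basis_vec_in_free_space in auto)
  ultimately have "psi r t \<delta> \<epsilon> (vmult Q (psi_inv r t \<delta> \<epsilon> (basis_vec (e, e, id))) (psi_inv r t \<delta> \<epsilon> (basis_vec (f, f, id)))) =
      tensor (basis_vec e) (basis_vec f) (\<omega> e f)"
    using psi_inv_\<Phi> Zg[OF e] Zg[OF f] by simp
  then have eq: "psi r t \<delta> \<epsilon> (vmult Q (psi_inv r t \<delta> \<epsilon> (tensor (basis_vec e) (basis_vec e) (basis_vec \<one>\<^bsub>sym_group t\<^esub>)))
      (psi_inv r t \<delta> \<epsilon> (tensor (basis_vec f) (basis_vec f) (basis_vec \<one>\<^bsub>sym_group t\<^esub>)))) =
      tensor (basis_vec e) (basis_vec f) (\<omega> e f)"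
    by (simp only: tensor_basis_vec sym_group_one)
  show ?thesis unfolding omega_def Let_def eq
    using middle_form_in[OF e f] by (intro the_equality) (simp, metis tensor_basis_vec_inject)
qed

lemma brauer_form_basis:
  assumes e: "e \<in> E" and f: "f \<in> E"
  shows "(if has_second_type_path e f then 0 else omega r t \<delta> \<epsilon> e f) = \<omega> e f"
proof -
  note d = d_diagram[OF e] d_diagram[OF f]
  interpret stacked r r r "diagram_of r e e id" "diagram_of r f f id"
    by unfold_locales (use d in auto)
  have "\<omega> e f = 0" if "has_second_type_path e f"
  proof -
    have "\<not> full_rank" using second_type_not_full_rank[of "[]" "[]"] that d(4) d(8) by simp
    then have "card (through_strings (stacked_diagram G)) \<noteq> t" using full_rankI d(2,7) by auto
    then show ?thesis by (simp add: middle_form_def Let_def)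
  qed
  then show ?thesis using omega_eq[OF e f] by simp
qed

lemma ideal_quotient_isomorphic_inflation:
  "isomorphic_algebras Q (inflation E S GA (brauer_form r t \<delta> \<epsilon>))"
proof -
  let ?h = "\<lambda>e f. if has_second_type_path e f then 0 else omega r t \<delta> \<epsilon> e f"
  let ?I = "inflation E S GA (bilin ?h)"
  \<comment> \<open>The form of the statement and \<open>middle_form\<close> agree on pairs from
    \<open>E\<close> only, which suffices on \<open>Z\<close>.\<close>
  have mult: "vmult ?I x y = vmult C1 x y" if "x \<in> Z" "y \<in> Z" for x y
    unfolding inflation_def free_algebra_simps
    by (rule bilin_cong[OF that]) (auto simp: bilin_basis_vec brauer_form_basis)
  have zero: "0 \<in> Z" by (rule free_space_zero)
  have I: "nonunital_algebra ?I"
    by (rule nonunital_inflation[OF nonunital_GA]) (use middle_form_in brauer_form_basis in auto)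
  have Q: "nonunital_algebra Q"
    by (rule nonunital_algebra_transfer[OF I, of \<Phi>], unfold inflation_simps)
      (simp_all only: \<Phi>_bij \<Phi>_ops \<Phi>_ops(4)[OF zero zero] mult)
  have "algebra_iso Q ?I (the_inv_into (carrier ?I) \<Phi>)"
    by (rule algebra_iso_inverse, unfold inflation_simps)
      (simp_all only: \<Phi>_bij \<Phi>_ops mult C1_in free_space_add free_space_scale simp_thms)
  then show ?thesis using I Q unfolding isomorphic_algebras_def brauer_form_def by (intro conjI exI)
qed

end

theorem theorem4p2p1:
  fixes \<delta> \<epsilon> :: "'k::field" and r t u :: nat
  assumes "CHAR('k) \<noteq> 2"
    and "\<epsilon> \<in> {1, -1}"
    and "\<epsilon> = -1 \<Longrightarrow> \<delta> = 0"
    and "t + 2 * u = r"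
  shows "isomorphic_algebras
    (ideal_quotient r t \<delta> \<epsilon>)
    (inflation (partial_matchings r t) (carrier (sym_group t)) (group_algebra (sym_group t))
      (brauer_form r t \<delta> \<epsilon>))"
proof -
  interpret ideal_setup r t u \<delta> \<epsilon> by unfold_locales (use assms in auto)
  show ?thesis by (rule ideal_quotient_isomorphic_inflation)
qed

end
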